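(* Given a graph $G$ and an obstacle enumeration $\mathcal Q$ in $G$, it is possible to find in linear time either an essential obstacle enumeration of some induced subgraph of $G$ or an induced subgraph of $G$ isomorphic to $C_4^*$, $K_{2,3}$, domino, $G_3$, $\overline{C_6}$, or $\overline{C_5+K_2}$. Moreover, if $G$ is a circular-arc graph, then given a circular-arc model of $G$ and an obstacle enumeration $\mathcal Q$ in $G$, an essential obstacle enumeration of some induced subgraph of $G$ can be found in $O(n)$ time.
   Context: All graphs are finite, undirected, without loops or multiple edges. A circular-arc graph is the intersection graph of a finite set of arcs on a circle (such a set is a circular-arc model of the graph). $n$ and $m$ are the numbers of vertices and edges of $G$; an algorithm taking a graph as input is linear-time if it runs in $O(n+m)$ time. When the input is a circular-arc model, $n$ is the number of arcs, and the $2n$ extremes of the arcs are assumed pairwise different and given in the order in which they occur in some traversal of the circle. $\overline N_G(v)$ denotes the set of vertices of $G$ different from $v$ and nonadjacent to $v$. An obstacle enumeration in a graph $G$ is a circular enumeration $\mathcal Q=v_1,\ldots,v_k$ of $k\ge 3$ pairwise different vertices such that $Q=\{v_1,\ldots,v_k\}$ is a clique of $G$, together with, for each $i\in\{1,\ldots,k\}$, a linear enumeration $\mathcal W_i$ (the witness enumeration of $v_iv_{i+1}$) of one or two vertices of $G$ such that (indices modulo $k$) either $(\mathcal O_1)$ $\mathcal W_i=w_i$ where $\overline N_G(w_i)\cap Q=\{v_i,v_{i+1}\}$; or $(\mathcal O_2)$ $\mathcal W_i=u_i,z_i$ where $\overline N_G(u_i)\cap Q=\{v_i\}$, $\overline N_G(z_i)\cap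 Q=\{v_{i+1}\}$, and $u_iz_i\in E(G)$. Witness enumerations of different edges may share vertices. The vertices occurring in $\mathcal W_1,\ldots,\mathcal W_k$ are the witnesses of $\mathcal Q$. $\mathcal Q$ is an obstacle enumeration of $G$ if every vertex of $G$ belongs to $Q$ or is a witness of $\mathcal Q$. An edge $y_1y_2$ of $G$ joining two witnesses is valid if either one of $\overline N_G(y_1)\cap Q$ and $\overline N_G(y_2)\cap Q$ is a subset of the other, or $y_1$ and $y_2$ occur together in some witness enumeration of $\mathcal Q$. An obstacle enumeration is essential if every edge joining two of its witnesses is valid. $H^*$ denotes the disjoint union $H+K_1$; $+$ is disjoint union; $\overline H$ is the complement of $H$. The domino is the graph on $a_1,a_2,b_1,b_2,c_1,c_2$ with edges exactly $a_1a_2,b_1b_2,c_1c_2,a_1b_1,a_2b_2,b_1c_1,b_2c_2$. $G_3$ is the graph obtained from the domino by adding the edge $a_1c_1$ (equivalently, $\overline{C_6}$ minus one edge of one of its triangles). *)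

theory Defs
  imports Complex_Main
begin

section \<open>Graphs\<close>

type_synonym 'a graph = "'a set \<times> 'a set set"

abbreviation verts :: "'a graph \<Rightarrow> 'a set" where
  "verts G \<equiv> fst G"

abbreviation edges :: "'a graph \<Rightarrow> 'a set set" where
  "edges G \<equiv> snd G"

definition simple_graph :: "'a graph \<Rightarrow> bool" where
  "simple_graph G \<longleftrightarrow> finite (verts G) \<and>
     (\<forall>e\<in>edges G. \<exists>u\<in>verts G. \<exists>v\<in>verts G. u \<noteq> v \<and> e = {u, v})"

definition induced :: "'a graph \<Rightarrow> 'a set \<Rightarrow> 'a graph" where
  "induced G S = (verts G \<inter> S, {e \<in> edges G. e \<subseteq> S})"

definition isomorphic :: "'a graph \<Rightarrow> 'b graph \<Rightarrow> bool" where
  "isomorphic G H \<longleftrightarrow>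
     (\<exists>f. bij_betw f (verts G) (verts H) \<and> edges H = (\<lambda>e. f ` e) ` edges G)"

definition non_nbrs :: "'a graph \<Rightarrow> 'a \<Rightarrow> 'a set" where
  "non_nbrs G v = {u \<in> verts G. u \<noteq> v \<and> {u, v} \<notin> edges G}"

definition clique :: "'a graph \<Rightarrow> 'a set \<Rightarrow> bool" where
  "clique G S \<longleftrightarrow> S \<subseteq> verts G \<and> (\<forall>u\<in>S. \<forall>v\<in>S. u \<noteq> v \<longrightarrow> {u, v} \<in> edges G)"

definition disj_union :: "'a graph \<Rightarrow> 'b graph \<Rightarrow> ('a + 'b) graph" where
  "disj_union G H =
     (verts G <+> verts H, (\<lambda>e. Inl ` e) ` edges G \<union> (\<lambda>e. Inr ` e) ` edges H)"

definition complement :: "'a graph \<Rightarrow> 'a graph" where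
  "complement G =
     (verts G, {{u, v} | u v. u \<in> verts G \<and> v \<in> verts G \<and> u \<noteq> v \<and> {u, v} \<notin> edges G})"

definition cycle_graph :: "nat \<Rightarrow> nat graph" where
  "cycle_graph n = ({0..<n}, {{i, (i + 1) mod n} | i. i < n})"

definition complete_graph :: "nat \<Rightarrow> nat graph" where
  "complete_graph n = ({0..<n}, {{i, j} | i j. i < n \<and> j < n \<and> i \<noteq> j})"

definition complete_bipartite :: "nat \<Rightarrow> nat \<Rightarrow> (nat + nat) graph" where
  "complete_bipartite p q =
     ({0..<p} <+> {0..<q}, {{Inl i, Inr j} | i j. i < p \<and> j < q})"

definition star :: "'a graph \<Rightarrow> ('a + nat) graph" where
  "star H = disj_union H (complete_graph 1)"

datatype domino_vertex = A1 | A2 | B1 | B2 | C1 | C2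

definition domino :: "domino_vertex graph" where
  "domino = (UNIV, {{A1, A2}, {B1, B2}, {C1, C2}, {A1, B1}, {A2, B2}, {B1, C1}, {B2, C2}})"

definition G3 :: "domino_vertex graph" where
  "G3 = (verts domino, insert {A1, C1} (edges domino))"

definition is_listed_graph :: "'a graph \<Rightarrow> bool" where
  "is_listed_graph G \<longleftrightarrow>
     isomorphic G (star (cycle_graph 4)) \<or>
     isomorphic G (complete_bipartite 2 3) \<or>
     isomorphic G domino \<or>
     isomorphic G G3 \<or>
     isomorphic G (complement (cycle_graph 6)) \<or>
     isomorphic G (complement (disj_union (cycle_graph 5) (complete_graph 2)))"


section \<open>Obstacle enumerations\<close>

text \<open>
  An enumeration is a pair \<open>(vs, Ws)\<close>: \<open>vs\<close> is the circular enumeration of the clique,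
  written down from an arbitrary starting vertex, and \<open>Ws ! i\<close> is the witness enumeration
  of the edge joining \<open>vs ! i\<close> to its circular successor.
\<close>

type_synonym 'a enumeration = "'a list \<times> 'a list list"

definition core :: "'a enumeration \<Rightarrow> 'a set" where
  "core Q = set (fst Q)"

definition witnesses :: "'a enumeration \<Rightarrow> 'a set" where
  "witnesses Q = (\<Union>W\<in>set (snd Q). set W)"

definition witness_enum :: "'a graph \<Rightarrow> 'a set \<Rightarrow> 'a \<Rightarrow> 'a \<Rightarrow> 'a list \<Rightarrow> bool" where
  "witness_enum G C v v' W \<longleftrightarrow>
     (\<exists>w\<in>verts G. W = [w] \<and> non_nbrs G w \<inter> C = {v, v'}) \<or>
     (\<exists>u\<in>verts G. \<exists>z\<in>verts G. W = [u, z] \<and>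
        non_nbrs G u \<inter> C = {v} \<and> non_nbrs G z \<inter> C = {v'} \<and> {u, z} \<in> edges G)"

definition obstacle_enum_in :: "'a graph \<Rightarrow> 'a enumeration \<Rightarrow> bool" where
  "obstacle_enum_in G Q \<longleftrightarrow>
     (let vs = fst Q; Ws = snd Q; k = length vs in
        k \<ge> 3 \<and> distinct vs \<and> clique G (set vs) \<and> length Ws = k \<and>
        (\<forall>i<k. witness_enum G (set vs) (vs ! i) (vs ! ((i + 1) mod k)) (Ws ! i)))"

definition obstacle_enum_of :: "'a graph \<Rightarrow> 'a enumeration \<Rightarrow> bool" where
  "obstacle_enum_of G Q \<longleftrightarrow> obstacle_enum_in G Q \<and> verts G = core Q \<union> witnesses Q"

definition valid_edge :: "'a graph \<Rightarrow> 'a enumeration \<Rightarrow> 'a \<Rightarrow> 'a \<Rightarrow> bool" where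
  "valid_edge G Q x y \<longleftrightarrow>
     non_nbrs G x \<inter> core Q \<subseteq> non_nbrs G y \<inter> core Q \<or>
     non_nbrs G y \<inter> core Q \<subseteq> non_nbrs G x \<inter> core Q \<or>
     (\<exists>W\<in>set (snd Q). x \<in> set W \<and> y \<in> set W)"

definition essential :: "'a graph \<Rightarrow> 'a enumeration \<Rightarrow> bool" where
  "essential G Q \<longleftrightarrow>
     (\<forall>x\<in>witnesses Q. \<forall>y\<in>witnesses Q. {x, y} \<in> edges G \<longrightarrow> valid_edge G Q x y)"

definition essential_of_induced :: "'a graph \<Rightarrow> 'a enumeration \<Rightarrow> bool" where
  "essential_of_induced G Q \<longleftrightarrow>
     (\<exists>S\<subseteq>verts G. obstacle_enum_of (induced G S) Q \<and> essential (induced G S) Q)"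


section \<open>Circular-arc models\<close>

definition is_arc :: "complex set \<Rightarrow> bool" where
  "is_arc S \<longleftrightarrow> (\<exists>a l. 0 < l \<and> l < 2 * pi \<and> S = cis ` {a..a + l})"

definition circular_arc_model :: "'a graph \<Rightarrow> ('a \<Rightarrow> complex set) \<Rightarrow> bool" where
  "circular_arc_model G A \<longleftrightarrow>
     (\<forall>v\<in>verts G. is_arc (A v)) \<and>
     (\<forall>u\<in>verts G. \<forall>v\<in>verts G. u \<noteq> v \<longrightarrow> ({u, v} \<in> edges G \<longleftrightarrow> A u \<inter> A v \<noteq> {}))"

text \<open>
  \<open>extremes_in_order V A xs\<close>: the extremes of the arcs \<open>A v\<close>, \<open>v \<in> V\<close>, are pairwise
  different and \<open>xs\<close> lists them in the order in which one traversal of the circle meets them.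
  The traversal starts at \<open>cis \<phi>\<close> and runs counterclockwise (\<open>\<sigma> = 1\<close>) or clockwise
  (\<open>\<sigma> = -1\<close>); \<open>t i\<close> is the time at which it meets the \<open>i\<close>-th extreme. The entry
  \<open>(v, True)\<close> is the extreme at which it enters \<open>A v\<close>, and \<open>(v, False)\<close> the one at which it
  leaves \<open>A v\<close>; the latter comes first in \<open>xs\<close> iff the traversal starts inside \<open>A v\<close>.
\<close>

definition extremes_in_order :: "'a set \<Rightarrow> ('a \<Rightarrow> complex set) \<Rightarrow> ('a \<times> bool) list \<Rightarrow> bool" where
  "extremes_in_order V A xs \<longleftrightarrow>
     distinct xs \<and> set xs = V \<times> UNIV \<and>
     (\<exists>(\<phi>::real) (\<sigma>::real) (t :: nat \<Rightarrow> real).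
        \<sigma> \<in> {1, -1} \<and>
        strict_mono_on {0..<length xs} t \<and>
        (\<forall>i<length xs. 0 \<le> t i \<and> t i < 2 * pi) \<and>
        (\<forall>i<length xs. \<forall>j<length xs. \<forall>v. xs ! i = (v, True) \<and> xs ! j = (v, False) \<longrightarrow>
           A v = (\<lambda>x. cis (\<phi> + \<sigma> * x)) ` {t i..(if i < j then t j else t j + 2 * pi)}))"


section \<open>Machine model\<close>

text \<open>
  Structured programs for a random access machine whose memory consists of finitely many named
  arrays of natural numbers; a scalar \<open>x\<close> is the cell \<open>x[0]\<close>. A program has a fixed set of
  expressions, each evaluated with a bounded number of machine operations, so every assignment
  and every test is charged one unit.

  The only operation that can increase a value is the successor. Hence all values in a run are
  at most the largest input value plus a constant multiple of the running time, and charging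
  unit cost hides no arithmetic on long numbers. Addition below a computed bound \<open>N\<close> is
  available as \<open>N - ((N - a) - b)\<close>, where subtraction is truncated.
\<close>

type_synonym state = "string \<Rightarrow> nat \<Rightarrow> nat"

datatype exp =
    Const nat
  | Read string exp
  | Succ exp
  | Minus exp exp

datatype test =
    Less exp exp
  | Neg test
  | Conj test test

datatype com =
    Skip
  | Write string exp exp
  | Seq com com
  | Branch test com com
  | While test com

fun eval_exp :: "exp \<Rightarrow> state \<Rightarrow> nat" where
  "eval_exp (Const c) s = c"
| "eval_exp (Read a e) s = s a (eval_exp e s)"
| "eval_exp (Succ e) s = Suc (eval_exp e s)"
| "eval_exp (Minus e f) s = eval_exp e s - eval_exp f s"

fun eval_test :: "test \<Rightarrow> state \<Rightarrow> bool" where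
  "eval_test (Less e f) s \<longleftrightarrow> eval_exp e s < eval_exp f s"
| "eval_test (Neg b) s \<longleftrightarrow> \<not> eval_test b s"
| "eval_test (Conj b d) s \<longleftrightarrow> eval_test b s \<and> eval_test d s"

text \<open>\<open>exec p s t s'\<close>: started in \<open>s\<close>, the program \<open>p\<close> halts in \<open>s'\<close> after \<open>t\<close> units of time.\<close>

inductive exec :: "com \<Rightarrow> state \<Rightarrow> nat \<Rightarrow> state \<Rightarrow> bool" where
  exec_Skip: "exec Skip s 1 s"
| exec_Write: "exec (Write a e f) s 1 (s(a := (s a)(eval_exp e s := eval_exp f s)))"
| exec_Seq: "exec p s t s' \<Longrightarrow> exec q s' t' s'' \<Longrightarrow> exec (Seq p q) s (t + t') s''"
| exec_BranchT: "eval_test b s \<Longrightarrow> exec p s t s' \<Longrightarrow> exec (Branch b p q) s (1 + t) s'"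
| exec_BranchF: "\<not> eval_test b s \<Longrightarrow> exec q s t s' \<Longrightarrow> exec (Branch b p q) s (1 + t) s'"
| exec_WhileF: "\<not> eval_test b s \<Longrightarrow> exec (While b p) s 1 s"
| exec_WhileT: "eval_test b s \<Longrightarrow> exec p s t s' \<Longrightarrow> exec (While b p) s' t' s'' \<Longrightarrow>
    exec (While b p) s (1 + t + t') s''"

inductive_cases exec_SkipE: "exec Skip s t s'"
inductive_cases exec_WriteE: "exec (Write a e f) s t s'"
inductive_cases exec_SeqE: "exec (Seq p q) s t s'"
inductive_cases exec_BranchE: "exec (Branch b p q) s t s'"
inductive_cases exec_WhileE: "exec (While b p) s t s'"

lemma exec_deterministic:
  "exec p s t s' \<Longrightarrow> exec p s u s'' \<Longrightarrow> u = t \<and> s'' = s'"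
proof (induction arbitrary: u s'' rule: exec.induct)
  case (exec_Skip s)
  then show ?case by (auto elim: exec_SkipE)
next
  case (exec_Write a e f s)
  then show ?case by (auto elim: exec_WriteE)
next
  case (exec_Seq p s t s' q t' s3)
  from exec_Seq.prems obtain t1 s1 t2
    where run: "exec p s t1 s1" "exec q s1 t2 s''" and u: "u = t1 + t2"
    by (rule exec_SeqE)
  have e: "t1 = t \<and> s1 = s'" using exec_Seq.IH(1)[OF run(1)] .
  then have "exec q s' t2 s''" using run(2) by simp
  from exec_Seq.IH(2)[OF this] e u show ?case by simp
next
  case (exec_BranchT b s p t s' q)
  obtain t1 where run: "exec p s t1 s''" and u: "u = Suc t1"
    using exec_BranchT.prems
    by (rule exec_BranchE) (use exec_BranchT.hyps in simp_all)
  from exec_BranchT.IH[OF run] u show ?case by simp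
next
  case (exec_BranchF b s q t s' p)
  obtain t1 where run: "exec q s t1 s''" and u: "u = Suc t1"
    using exec_BranchF.prems
    by (rule exec_BranchE) (use exec_BranchF.hyps in simp_all)
  from exec_BranchF.IH[OF run] u show ?case by simp
next
  case (exec_WhileF b s p)
  from exec_WhileF.prems show ?case
    by (rule exec_WhileE) (use exec_WhileF.hyps in simp_all)
next
  case (exec_WhileT b s p t s' t' s3)
  obtain t1 s1 t2
    where run: "exec p s t1 s1" "exec (While b p) s1 t2 s''" and u: "u = Suc (t1 + t2)"
    using exec_WhileT.prems
    by (rule exec_WhileE) (use exec_WhileT.hyps in simp_all)
  have e: "t1 = t \<and> s1 = s'" using exec_WhileT.IH(1)[OF run(1)] .
  then have "exec (While b p) s' t2 s''" using run(2) by simp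
  from exec_WhileT.IH(2)[OF this] e u show ?case by simp
qed


section \<open>Input and output\<close>

definition array :: "nat list \<Rightarrow> nat \<Rightarrow> nat" where
  "array xs i = (if i < length xs then xs ! i else 0)"

text \<open>
  \<open>w0\<close> and \<open>w1\<close> hold the first and the second vertex of each witness enumeration; a missing
  second vertex is stored as 0, and \<open>wlen\<close> tells the two cases apart.
\<close>

definition enum_input :: "nat enumeration \<Rightarrow> state \<Rightarrow> state" where
  "enum_input Q s = s(
     ''k'' := array [length (fst Q)],
     ''q'' := array (fst Q),
     ''wlen'' := array (map length (snd Q)),
     ''w0'' := array (map (\<lambda>W. array W 0) (snd Q)),
     ''w1'' := array (map (\<lambda>W. array W 1) (snd Q)))"

definition adjacency_lists :: "nat graph \<Rightarrow> nat list list \<Rightarrow> bool" where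
  "adjacency_lists G adj \<longleftrightarrow> verts G = {0..<length adj} \<and>
     (\<forall>v<length adj. distinct (adj ! v) \<and> set (adj ! v) = {u. {u, v} \<in> edges G})"

text \<open>The neighbours of \<open>v\<close> occupy the cells \<open>adj[i]\<close> with \<open>start[v] \<le> i < start[v + 1]\<close>.\<close>

definition graph_input :: "nat list list \<Rightarrow> nat enumeration \<Rightarrow> state" where
  "graph_input adj Q = enum_input Q ((\<lambda>_ _. 0)(
     ''n'' := array [length adj],
     ''start'' := array (map (\<lambda>v. length (concat (take v adj))) [0..<length adj + 1]),
     ''adj'' := array (concat adj)))"

definition model_input :: "nat \<Rightarrow> (nat \<times> bool) list \<Rightarrow> nat enumeration \<Rightarrow> state" where
  "model_input n xs Q = enum_input Q ((\<lambda>_ _. 0)(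
     ''n'' := array [n],
     ''arc'' := array (map fst xs),
     ''enters'' := array (map (\<lambda>x. if snd x then 1 else 0) xs)))"

definition enum_output :: "state \<Rightarrow> nat enumeration" where
  "enum_output s =
     (map (s ''out_q'') [0..<s ''out_k'' 0],
      map (\<lambda>i. take (s ''out_wlen'' i) [s ''out_w0'' i, s ''out_w1'' i]) [0..<s ''out_k'' 0])"

definition vertices_output :: "state \<Rightarrow> nat set" where
  "vertices_output s = (s ''out_v'') ` {0..<s ''out_n'' 0}"

end

theory Submission
  imports Defs 
begin

text \<open>Write an obstacle enumeration as a circular list of items \<open>(v, a, b)\<close>: a
  core vertex with the witness pair that leads to the next core vertex. Suppose that some edge joins
  two witnesses and is not valid. Dropping suitable core vertices on one side of this edge leaves
  each of its ends with exactly one missed core vertex, so that the edge itself becomes a pair of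
  type O2 closing the remaining side (\<open>obs_cut\<close>, \<open>far_cut\<close>). Usually this
  shortens the enumeration. Between near items the edge may instead replace an existing pair
  (\<open>red2\<close>, \<open>red3\<close>, \<open>red8\<close>); then one more pair begins with
  the witness that ends the preceding pair, and the number \<open>cyc_unjoined\<close> of places
  without such a coincidence drops. With three or four core vertices a cut may leave too few of
  them. A finite case analysis (\<open>special3_111\<close> to \<open>special4_1212\<close>) then
  gives a better enumeration, sometimes with former witnesses as core vertices, or, for three core
  vertices only, one of the six listed graphs. So an enumeration can be improved until it is
  essential or a listed graph shows up (\<open>improvable_if_not_ess\<close>,
  \<open>obs_solution\<close>).

  For linear time, invalid edges between items at circular distance at most two are first removed by
  rewriting windows of three items (\<open>seg\<close>). A rewriting lowers \<open>weight\<close>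
  and spoils only a bounded number of windows already checked, so this phase is linear in the length
  (\<open>ends_clean_up\<close>). Afterwards an invalid edge can only join far items
  (\<open>clean_pair\<close>). One edge between far items is sought, and the shorter side of the
  circle is kept, which leaves at most three quarters of the items (\<open>ends_cut\<close>). The
  costs of these rounds form a geometric series (\<open>ends_shrink\<close>). Once fewer than twelve
  items are left, a decision tree of constant size reads off all equalities and adjacencies and
  prints an answer fixed in advance; \<open>obs_solution\<close> guarantees that there is one
  (\<open>run_brute_answered\<close>).

  The search for an edge between far items depends on the input. For a graph, all pairs of witnesses
  are tried. The core being a clique, its size k satisfies k^2 <= 2m + k
  (\<open>clique_edges\<close>), so quadratic time in k is linear in n + m, and there is also time
  for an adjacency table indexed by compact identifiers (\<open>address_inj\<close>). For a
  circular-arc model, adjacency is read off the positions of the extremes, and the witnesses are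
  taken in the order of their entering extremes. If two arcs meet, one of them meets all arcs that
  enter between the two entering extremes (\<open>sweepable_arcs\<close>). At most ten witnesses,
  itself included, are near a given one, so it suffices to try the next ten witnesses in this order
  (\<open>search_complete\<close>).

  Finally, the listed graphs are not circular-arc graphs, so the answer for a model is always an
  enumeration. The proof (\<open>gap_family.no_listed\<close>) uses only that two disjoint arcs
  leave two gaps, one of which lies in any arc that meets both.\<close>

section \<open>Obstacle enumerations as circular lists of items\<close>

type_synonym 'a item = "'a \<times> 'a \<times> 'a"

definition missed :: "('a \<Rightarrow> 'a \<Rightarrow> bool) \<Rightarrow> 'a set \<Rightarrow> 'a \<Rightarrow> 'a set" where
  "missed adj C y = {c \<in> C. c \<noteq> y \<and> \<not> adj y c}"

text \<open>Type O1 is stored with its witness repeated, \<open>a = b\<close>. For an irreflexive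
  \<open>adj\<close> the two alternatives exclude each other, so no tag is carried along.\<close>

fun link :: "('a \<Rightarrow> 'a \<Rightarrow> bool) \<Rightarrow> 'a set \<Rightarrow> 'a item \<Rightarrow> 'a \<Rightarrow> bool" where
  "link adj C (v, a, b) v' \<longleftrightarrow>
     a = b \<and> missed adj C a = {v, v'} \<or>
     adj a b \<and> missed adj C a = {v} \<and> missed adj C b = {v'}"

definition cores :: "'a item list \<Rightarrow> 'a set" where
  "cores xs = fst ` set xs"

definition wits :: "'a item list \<Rightarrow> 'a set" where
  "wits xs = (\<Union>(v, a, b)\<in>set xs. {a, b})"

definition next_core :: "'a item list \<Rightarrow> 'a \<Rightarrow> 'a" where
  "next_core xs e = (case xs of [] \<Rightarrow> e | x # _ \<Rightarrow> fst x)"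

text \<open>The core vertex \<open>e\<close> that follows the last item is a parameter. This makes
  the predicate split along appends, and closing the circle amounts to choosing \<open>e\<close> as
  the first core vertex.\<close>

fun chain :: "('a \<Rightarrow> 'a \<Rightarrow> bool) \<Rightarrow> 'a set \<Rightarrow> 'a item list \<Rightarrow> 'a \<Rightarrow> bool" where
  "chain adj C [] e \<longleftrightarrow> True"
| "chain adj C (x # xs) e \<longleftrightarrow> link adj C x (next_core xs e) \<and> chain adj C xs e"

definition obs :: "('a \<Rightarrow> 'a \<Rightarrow> bool) \<Rightarrow> 'a item list \<Rightarrow> bool" where
  "obs adj xs \<longleftrightarrow> 3 \<le> length xs \<and> distinct (map fst xs) \<and>
     (\<forall>u\<in>cores xs. \<forall>v\<in>cores xs. u \<noteq> v \<longrightarrow> adj u v) \<and>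
     chain adj (cores xs) xs (fst (hd xs))"

definition ess :: "('a \<Rightarrow> 'a \<Rightarrow> bool) \<Rightarrow> 'a item list \<Rightarrow> bool" where
  "ess adj xs \<longleftrightarrow> (\<forall>x\<in>wits xs. \<forall>y\<in>wits xs. adj x y \<longrightarrow>
     missed adj (cores xs) x \<subseteq> missed adj (cores xs) y \<or>
     missed adj (cores xs) y \<subseteq> missed adj (cores xs) x \<or>
     (\<exists>(v, a, b)\<in>set xs. x \<in> {a, b} \<and> y \<in> {a, b}))"

lemma next_core_simps [simp]: "next_core [] e = e" "next_core (x # xs) e = fst x"
  by (simp_all add: next_core_def)

lemma next_core_append: "next_core (xs @ ys) e = next_core xs (next_core ys e)"
  by (cases xs) auto

lemma chain_append: "chain adj C (xs @ ys) e \<longleftrightarrow> chain adj C xs (next_core ys e) \<and> chain adj C ys e"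
  by (induction xs) (auto simp: next_core_append)

lemma cores_simps [simp]: "cores [] = {}" "cores (x # xs) = insert (fst x) (cores xs)"
  "cores (xs @ ys) = cores xs \<union> cores ys"
  by (auto simp: cores_def)

lemma wits_simps [simp]: "wits [] = {}" "wits ((v, a, b) # xs) = {a, b} \<union> wits xs"
  "wits (xs @ ys) = wits xs \<union> wits ys"
  by (auto simp: wits_def)

lemma next_core_hd: "xs \<noteq> [] \<Longrightarrow> next_core xs e = fst (hd xs)"
  by (cases xs) auto

lemma next_core_in: "next_core xs e \<in> insert e (cores xs)"
  by (cases xs) auto

text \<open>All cuts rest on this: a witness that misses two core vertices misses a single one as
  soon as the other is dropped.\<close>

lemma missed_mono_set: "C' \<subseteq> C \<Longrightarrow> missed adj C' y = missed adj C y \<inter> C'"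
  by (auto simp: missed_def)

lemma obs_rotate:
  assumes "obs adj (xs @ ys)"
  shows "obs adj (ys @ xs)"
proof (cases "xs = [] \<or> ys = []")
  case False
  have c: "cores (ys @ xs) = cores (xs @ ys)" by auto
  have "chain adj (cores (ys @ xs)) (ys @ xs) (fst (hd (ys @ xs)))"
    using assms False unfolding obs_def c chain_append by (simp add: next_core_hd)
  then show ?thesis using assms unfolding obs_def c by (auto simp: add.commute)
qed (use assms in auto)

text \<open>Along a retained part both core vertices of every link survive, and restricting the core
  removes nothing from the missed sets of its witnesses.\<close>

lemma chain_subset:
  assumes "chain adj C xs e" "C' \<subseteq> C" "insert e (cores xs) \<subseteq> C'"
  shows "chain adj C' xs e"
  using assms
proof (induction xs)
  case (Cons x xs)
  obtain v a b where x: "x = (v, a, b)" by (cases x)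
  have "next_core xs e \<in> C'" "v \<in> C'" using Cons.prems(3) next_core_in[of xs e] x by auto
  then have "link adj C' x (next_core xs e)"
    using Cons.prems(1) x by (auto simp: missed_mono_set[OF Cons.prems(2)])
  with Cons show ?case by auto
qed simp

text \<open>The retained part K is closed by a single new witness pair.\<close>

lemma obs_cut:
  assumes o: "obs adj (K @ R)" and R: "R \<noteq> []" and K: "2 \<le> length K" and xy: "adj x y"
    and C': "C' = insert (fst (hd R)) (cores K)"
    and x: "missed adj C' x = {fst (hd R)}" and y: "missed adj C' y = {fst (hd K)}"
  shows "obs adj (K @ [(fst (hd R), x, y)])"
proof -
  obtain r R' where r: "R = r # R'" using R by (cases R) auto
  have sub: "C' \<subseteq> cores (K @ R)" unfolding C' r by auto
  have "chain adj (cores (K @ R)) K (fst r)" using o unfolding obs_def r by (simp add: chain_append)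
  then have "chain adj C' K (fst r)" by (rule chain_subset[OF _ sub]) (auto simp: C' r)
  moreover have "cores (K @ [(fst r, x, y)]) = C'" by (auto simp: C' r)
  ultimately show ?thesis using o K x y xy unfolding obs_def
    by (auto simp: r chain_append hd_append cores_def C')
qed

section \<open>Shortening and exchange by an edge between witnesses\<close>

locale adjacency =
  fixes adj :: "'a \<Rightarrow> 'a \<Rightarrow> bool"
  assumes adj_sym: "adj x y \<Longrightarrow> adj y x" and adj_irrefl [simp]: "\<not> adj x x"
begin

lemma link_cases:
  assumes "link adj C (v, a, b) v'"
  obtains "a = b" "missed adj C a = {v, v'}" | "a \<noteq> b" "adj a b" "missed adj C a = {v}" "missed adj C b = {v'}"
  using assms by auto

text \<open>The edge \<open>a0 b1\<close> bypasses \<open>v1\<close>: once \<open>v1\<close> is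
  gone, \<open>a0\<close> misses only \<open>v0\<close> and \<open>b1\<close> only
  \<open>v2\<close>, whatever the types of the two pairs.\<close>

lemma red1:
  assumes o: "obs adj ((v0,a0,b0) # (v1,a1,b1) # (v2,a2,b2) # K)" and K: "K \<noteq> []" and a: "adj a0 b1"
  shows "obs adj ((v0,a0,b1) # (v2,a2,b2) # K)"
proof -
  let ?C = "cores ((v0,a0,b0) # (v1,a1,b1) # (v2,a2,b2) # K)"
  let ?C' = "insert v0 (insert v2 (cores K))"
  have d: "v1 \<notin> ?C'" and d2: "v0 \<noteq> v1" "v1 \<noteq> v2" using o by (auto simp: obs_def cores_def)
  have l: "link adj ?C (v0,a0,b0) v1" "link adj ?C (v1,a1,b1) v2" using o by (auto simp: obs_def)
  have sub: "?C' \<subseteq> ?C" by auto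
  \<comment> \<open>Rotated so that the part to be kept comes first, as \<open>obs_cut\<close>
    requires; the other shortening reductions do the same.\<close>
  have "obs adj (((v2,a2,b2) # K) @ [(v0,a0,b0),(v1,a1,b1)])"
    using obs_rotate[of adj "[(v0,a0,b0),(v1,a1,b1)]" "(v2,a2,b2) # K"] o by simp
  moreover have "missed adj ?C' a0 = {v0}" "missed adj ?C' b1 = {v2}"
    using l d d2 unfolding missed_mono_set[OF sub] by auto
  ultimately have "obs adj (((v2,a2,b2) # K) @ [(v0,a0,b1)])"
    using obs_cut[of adj "(v2,a2,b2) # K" "[(v0,a0,b0),(v1,a1,b1)]" a0 b1 ?C'] K a
    by (cases K) auto
  then show ?thesis using obs_rotate[of adj "(v2,a2,b2) # K"] by fastforce
qed

text \<open>Bypasses both \<open>v1\<close> and \<open>v2\<close>. Two further items must remain,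
  since together with \<open>v0\<close> they form the new core.\<close>

lemma red5:
  assumes o: "obs adj ((v0,a0,b0) # (v1,a1,b1) # (v2,a2,b2) # K)" and K: "2 \<le> length K" and a: "adj a0 b2"
  shows "obs adj ((v0,a0,b2) # K)"
proof -
  let ?W = "[(v0,a0,b0),(v1,a1,b1),(v2,a2,b2)]"
  let ?C = "cores (?W @ K)"
  let ?C' = "insert v0 (cores K)"
  obtain x K' where K': "K = x # K'" using K by (cases K) auto
  have d: "v1 \<notin> ?C'" "v2 \<notin> ?C'" using o by (auto simp: obs_def cores_def)
  have l: "link adj ?C (v0,a0,b0) v1" "link adj ?C (v2,a2,b2) (fst x)" using o by (auto simp: obs_def K')
  have sub: "?C' \<subseteq> ?C" by auto
  have "obs adj (K @ ?W)"
    using obs_rotate[of adj ?W K] o by simp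
  moreover have "missed adj ?C' a0 = {v0}" "missed adj ?C' b2 = {fst x}"
    using l d unfolding missed_mono_set[OF sub] by (auto simp: K')
  ultimately have "obs adj (K @ [(v0,a0,b2)])"
    using obs_cut[of adj K ?W a0 b2 ?C'] K a by (auto simp: K')
  then show ?thesis using obs_rotate[of adj K "[(v0,a0,b2)]"] by simp
qed

text \<open>A pair of type O2 at \<open>v2\<close> has a first witness missing only
  \<open>v2\<close>. It can therefore end the new pair of \<open>v0\<close> as well, and
  \<open>v1\<close> is bypassed.\<close>

lemma red7:
  assumes o: "obs adj ((v0,a0,b0) # (v1,a1,b1) # (v2,a2,b2) # K)" and K: "K \<noteq> []" and n: "a2 \<noteq> b2" and a: "adj a0 a2"
  shows "obs adj ((v0,a0,a2) # (v2,a2,b2) # K)"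
proof -
  let ?C = "cores ((v0,a0,b0) # (v1,a1,b1) # (v2,a2,b2) # K)"
  let ?C' = "insert v0 (insert v2 (cores K))"
  have d: "v1 \<notin> ?C'" and d2: "v0 \<noteq> v1" "v1 \<noteq> v2" using o by (auto simp: obs_def cores_def)
  have l: "link adj ?C (v0,a0,b0) v1" "link adj ?C (v2,a2,b2) (next_core K v0)" using o by (auto simp: obs_def)
  have sub: "?C' \<subseteq> ?C" by auto
  have "obs adj (((v2,a2,b2) # K) @ [(v0,a0,b0),(v1,a1,b1)])"
    using obs_rotate[of adj "[(v0,a0,b0),(v1,a1,b1)]" "(v2,a2,b2) # K"] o by simp
  moreover have "missed adj ?C' a0 = {v0}" "missed adj ?C' a2 = {v2}"
    using l d d2 n unfolding missed_mono_set[OF sub] by auto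
  ultimately have "obs adj (((v2,a2,b2) # K) @ [(v0,a0,a2)])"
    using obs_cut[of adj "(v2,a2,b2) # K" "[(v0,a0,b0),(v1,a1,b1)]" a0 a2 ?C'] K a
    by (cases K) auto
  then show ?thesis using obs_rotate by fastforce
qed

text \<open>The mirror image of \<open>red7\<close>: \<open>b0\<close> misses only
  \<open>v1\<close>, so it can also begin a pair there, and \<open>v2\<close> is bypassed.\<close>

lemma red6:
  assumes o: "obs adj ((v0,a0,b0) # (v1,a1,b1) # (v2,a2,b2) # K)" and K: "K \<noteq> []" and n: "a0 \<noteq> b0" and a: "adj b0 b2"
  shows "obs adj ((v0,a0,b0) # (v1,b0,b2) # K)"
proof -
  let ?C = "cores ((v0,a0,b0) # (v1,a1,b1) # (v2,a2,b2) # K)"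
  let ?C' = "insert v0 (insert v1 (cores K))"
  obtain x K' where K': "K = x # K'" using K by (cases K) auto
  have d: "v2 \<notin> ?C'" and d2: "v0 \<noteq> v1" "v1 \<noteq> v2" using o by (auto simp: obs_def cores_def)
  have l: "link adj ?C (v0,a0,b0) v1" "link adj ?C (v2,a2,b2) (fst x)" using o by (auto simp: obs_def K')
  have sub: "?C' \<subseteq> ?C" by auto
  have "obs adj ((K @ [(v0,a0,b0)]) @ [(v1,a1,b1),(v2,a2,b2)])"
    using obs_rotate[of adj "[(v0,a0,b0),(v1,a1,b1),(v2,a2,b2)]" K] o
      obs_rotate[of adj "[(v1,a1,b1),(v2,a2,b2)]" "K @ [(v0,a0,b0)]"] obs_rotate[of adj "[(v0,a0,b0)]" "(v1,a1,b1) # (v2,a2,b2) # K"] by simp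
  moreover have "missed adj ?C' b0 = {v1}" "missed adj ?C' b2 = {fst x}"
    using l d d2 n unfolding missed_mono_set[OF sub] by (auto simp: K')
  ultimately have "obs adj ((K @ [(v0,a0,b0)]) @ [(v1,b0,b2)])"
    using obs_cut[of adj "K @ [(v0,a0,b0)]" "[(v1,a1,b1),(v2,a2,b2)]" b0 b2 ?C'] a
    by (auto simp: K' insert_commute)
  then show ?thesis using obs_rotate[of adj K "[(v0,a0,b0),(v1,b0,b2)]"] by simp
qed

text \<open>No core vertex is lost here; only a witness pair is exchanged.\<close>

lemma obs_exchange:
  assumes o: "obs adj (A @ (v, a, b) # B)" and "adj x y"
    and "missed adj (cores (A @ (v, a, b) # B)) x = {v}"
    and "missed adj (cores (A @ (v, a, b) # B)) y = {next_core (B @ A) v}"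
  shows "obs adj (A @ (v, x, y) # B)"
proof -
  have "next_core (A @ (v, x, y) # B) e = next_core (A @ (v, a, b) # B) e" for e
    by (auto simp: next_core_append)
  moreover have "next_core B (fst (hd (A @ (v, a, b) # B))) = next_core (B @ A) v"
    by (cases A) (auto simp: next_core_append)
  moreover have "fst (hd (A @ (v, x, y) # B)) = fst (hd (A @ (v, a, b) # B))" by (cases A) auto
  ultimately show ?thesis using assms
    by (simp add: obs_def chain_append)
qed

text \<open>Both \<open>b0\<close> and \<open>a1\<close> miss only \<open>v1\<close>, so
  \<open>b0\<close> may take the place of \<open>a1\<close>. Afterwards the pairs of
  \<open>v0\<close> and \<open>v1\<close> share \<open>b0\<close>, which lowers
  \<open>cyc_unjoined\<close> if \<open>b0\<close> and \<open>a1\<close> were different.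
  \<open>red3\<close> is the mirror image.\<close>

lemma red2:
  assumes o: "obs adj ((v0,a0,b0) # (v1,a1,b1) # (v2,a2,b2) # K)" and n: "a0 \<noteq> b0" "a1 \<noteq> b1" and a: "adj b0 b1"
  shows "obs adj ((v0,a0,b0) # (v1,b0,b1) # (v2,a2,b2) # K)"
  using obs_exchange[of "[(v0,a0,b0)]" v1 a1 b1 "(v2,a2,b2) # K" b0 b1] o n a
  by (auto simp: obs_def)

lemma red3:
  assumes o: "obs adj ((v0,a0,b0) # (v1,a1,b1) # (v2,a2,b2) # K)" and n: "a0 \<noteq> b0" "a1 \<noteq> b1" and a: "adj a0 a1"
  shows "obs adj ((v0,a0,a1) # (v1,a1,b1) # (v2,a2,b2) # K)"
  using obs_exchange[of "[]" v0 a0 b0 "(v1,a1,b1) # (v2,a2,b2) # K" a0 a1] o n a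
  by (auto simp: obs_def)

text \<open>Here the whole pair of \<open>v1\<close> is replaced by an edge between the end of the
  preceding pair and the start of the following one.\<close>

lemma red8:
  assumes o: "obs adj ((v0,a0,b0) # (v1,a1,b1) # (v2,a2,b2) # K)" and n: "a0 \<noteq> b0" "a2 \<noteq> b2" and a: "adj b0 a2"
  shows "obs adj ((v0,a0,b0) # (v1,b0,a2) # (v2,a2,b2) # K)"
  using obs_exchange[of "[(v0,a0,b0)]" v1 a1 b1 "(v2,a2,b2) # K" b0 a2] o n a
  by (auto simp: obs_def)

text \<open>The part between the two items is kept and closed by the pair \<open>(y, x)\<close>. The
  first core vertex kept must be the only one missed by \<open>x\<close>: if \<open>x = b0\<close>
  this is the successor of \<open>v0\<close>, and dropping \<open>v0\<close> also settles the case
  \<open>a0 = b0\<close>; otherwise \<open>x = a0\<close> and the item of \<open>v0\<close> stays.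
  In the same way \<open>p\<close> is the vertex that \<open>y\<close> is left with.\<close>

lemma far_cut:
  assumes o: "obs adj ((v0,a0,b0) # P @ (v,a,b) # S)" and P: "2 \<le> length P" and S: "S \<noteq> []"
    and x: "x = a0 \<or> x = b0" and y: "y = a \<or> y = b" and xy: "adj x y"
    and K: "K = (if x = b0 then P else (v0,a0,b0) # P) @ (if y = a then [] else [(v,a,b)])"
    and p: "p = (if y = a then v else fst (hd S))"
  shows "obs adj (K @ [(p, y, x)])"
proof -
  let ?L = "(v0,a0,b0) # P @ (v,a,b) # S"
  let ?C = "cores ?L"
  let ?R = "(if y = a then (v,a,b) # S else S) @ (if x = b0 then [(v0,a0,b0)] else [])"
  let ?C' = "insert p (cores K)"
  obtain s S' where S': "S = s # S'" using S by (cases S) auto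
  obtain q P' where P': "P = q # P'" using P by (cases P) auto
  have d: "v0 \<notin> cores P" "v0 \<noteq> v" "v0 \<noteq> fst s" "v \<notin> cores P" "fst s \<notin> cores P" "fst s \<noteq> v" "fst q \<noteq> v0"
    using o unfolding obs_def S' P' by (auto simp: cores_def)
  have l: "link adj ?C (v0,a0,b0) (fst q)" "link adj ?C (v,a,b) (fst s)"
    using o unfolding obs_def S' P' by (auto simp: chain_append)
  have sub: "?C' \<subseteq> ?C" unfolding K p S' by auto
  have "obs adj (P @ (v,a,b) # S @ [(v0,a0,b0)])"
    using o obs_rotate[of adj "[(v0,a0,b0)]" "P @ (v,a,b) # S"] by simp
  then have 1: "obs adj (K @ ?R)"
    using o unfolding K by simp
  have 2: "missed adj ?C' x = {fst (hd K)}"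
    using l(1) x d unfolding missed_mono_set[OF sub] unfolding K p by (auto simp: P' S')
  have "missed adj ?C y \<in> (if y = a then {{v}, {v, fst s}} else {{fst s}})"
    using l(2) y by auto
  moreover have "fst s \<notin> ?C'" if "y = a" using d that unfolding K p by auto
  moreover have "p = (if y = a then v else fst s)" unfolding p S' by simp
  ultimately have 3: "missed adj ?C' y = {p}"
    unfolding missed_mono_set[OF sub] by (auto split: if_splits)
  have 4: "fst (hd ?R) = p" "?R \<noteq> []" unfolding p S' by simp_all
  have 5: "2 \<le> length K" using P unfolding K by simp
  show ?thesis
    by (rule obs_cut[OF 1 4(2) 5 adj_sym[OF xy], of ?C', unfolded 4(1), OF refl 3 2])
qed

end

section \<open>Patterns of the listed graphs\<close>

type_synonym shape = "nat \<times> (nat \<times> nat) list"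

text \<open>A shape is a number of vertices with a list of non-edges, each in either order.
  Distinctness is demanded only for non-adjacent vertices; for adjacent ones it follows from
  irreflexivity.\<close>

definition shape :: "('a \<Rightarrow> 'a \<Rightarrow> bool) \<Rightarrow> shape \<Rightarrow> 'a list \<Rightarrow> bool" where
  "shape adj S vs \<longleftrightarrow> length vs = fst S \<and>
     (\<forall>j<fst S. \<forall>i<j. if (i, j) \<in> set (snd S) \<or> (j, i) \<in> set (snd S)
        then vs ! i \<noteq> vs ! j \<and> \<not> adj (vs ! i) (vs ! j) else adj (vs ! i) (vs ! j))"

text \<open>The edge lists describe the complements, which are sparser, of
  \<open>C\<^sub>4\<^sup>*\<close>, \<open>K\<^sub>2\<^sub>,\<^sub>3\<close>, the domino, \<open>G\<^sub>3\<close>, and the complements of \<open>C\<^sub>6\<close> and \<open>C\<^sub>5 + K\<^sub>2\<close>.\<close>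

definition co_shapes :: "shape list" where
  "co_shapes =
  [(5, [(0, 1), (0, 2), (0, 3), (0, 4), (1, 2), (3, 4)]),
   (5, [(0, 1), (2, 3), (3, 4), (2, 4)]),
   (6, [(0, 1), (1, 2), (0, 2), (3, 4), (4, 5), (3, 5), (0, 3), (1, 4)]),
   (6, [(0, 1), (1, 2), (2, 3), (3, 4), (4, 5), (5, 0), (0, 2)]),
   (6, [(0, 1), (1, 2), (2, 3), (3, 4), (4, 5), (5, 0)]),
   (7, [(0, 1), (1, 2), (2, 3), (3, 4), (4, 0), (5, 6)])]"

definition listed :: "('a \<Rightarrow> 'a \<Rightarrow> bool) \<Rightarrow> 'a set \<Rightarrow> bool" where
  "listed adj U \<longleftrightarrow> (\<exists>S\<in>set co_shapes. \<exists>vs. set vs \<subseteq> U \<and> shape adj S vs)"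

lemma listedI: "S \<in> set co_shapes \<Longrightarrow> set vs \<subseteq> U \<Longrightarrow> shape adj S vs \<Longrightarrow> listed adj U"
  by (auto simp: listed_def)

lemma all_less_numeral:
  "(\<forall>i<(numeral k::nat). P i) \<longleftrightarrow> (\<forall>i<pred_numeral k. P i) \<and> P (pred_numeral k)"
  "(\<forall>i<Suc n. P i) \<longleftrightarrow> (\<forall>i<n. P i) \<and> P n"
  by (auto simp: numeral_eq_Suc less_Suc_eq)

section \<open>The measure of progress\<close>

definition next_wit :: "'a item list \<Rightarrow> 'a \<Rightarrow> 'a" where
  "next_wit xs e = (case xs of [] \<Rightarrow> e | x # _ \<Rightarrow> fst (snd x))"

lemma next_wit_simps [simp]: "next_wit [] e = e" "next_wit (x # xs) e = fst (snd x)"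
  by (simp_all add: next_wit_def)

text \<open>Counts the items whose second witness differs from the first witness of the next item.
  The exchanges keep the length, and each of them, where it is applied, creates such a
  coincidence.\<close>

fun unjoined :: "'a item list \<Rightarrow> 'a \<Rightarrow> nat" where
  "unjoined [] e = 0"
| "unjoined ((v, a, b) # xs) e =
     (if b = next_wit xs e then 0 else 1) + unjoined xs e"

definition cyc_unjoined :: "'a item list \<Rightarrow> nat" where
  "cyc_unjoined xs = unjoined xs (fst (snd (hd xs)))"

abbreviation verts_of :: "'a item list \<Rightarrow> 'a set" where
  "verts_of xs \<equiv> cores xs \<union> wits xs"

text \<open>Progress with respect to the lexicographic order on length and
  \<open>cyc_unjoined\<close>, within the same vertices, unless a listed graph has been
  found.\<close>

definition improvable :: "('a \<Rightarrow> 'a \<Rightarrow> bool) \<Rightarrow> 'a item list \<Rightarrow> bool" where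
  "improvable adj xs \<longleftrightarrow> listed adj (verts_of xs) \<or>
     (\<exists>ys. obs adj ys \<and> verts_of ys \<subseteq> verts_of xs \<and>
        (length ys < length xs \<or> length ys = length xs \<and> cyc_unjoined ys < cyc_unjoined xs))"

lemma improvable_listed: "listed adj (verts_of xs) \<Longrightarrow> improvable adj xs"
  by (simp add: improvable_def)

lemma improvable_obs:
  "obs adj ys \<Longrightarrow> verts_of ys \<subseteq> verts_of xs \<Longrightarrow>
   length ys < length xs \<or> length ys = length xs \<and> cyc_unjoined ys < cyc_unjoined xs \<Longrightarrow>
   improvable adj xs"
  by (auto simp: improvable_def)

section \<open>Enumerations with three or four core vertices\<close>

text \<open>The relation \<open>link\<close> over the core \<open>v\<close>, \<open>v'\<close>,
  \<open>r\<close>, spelled out in single adjacencies. With it \<open>obs\<close> becomes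
  propositional (\<open>obs3_iff\<close>), and the small cases are settled by simplification;
  \<open>link4\<close> does the same for four core vertices.\<close>

definition link3 :: "('a \<Rightarrow> 'a \<Rightarrow> bool) \<Rightarrow> 'a \<Rightarrow> 'a \<Rightarrow> 'a \<Rightarrow> 'a \<Rightarrow> 'a \<Rightarrow> bool" where
  "link3 adj a b v v' r \<longleftrightarrow>
     a = b \<and> v \<noteq> a \<and> \<not> adj v a \<and> v' \<noteq> a \<and> \<not> adj v' a \<and> adj r a \<or>
     adj a b \<and> v \<noteq> a \<and> \<not> adj v a \<and> adj v' a \<and> adj r a \<and> v' \<noteq> b \<and> \<not> adj v' b \<and> adj v b \<and> adj r b"

definition link4 :: "('a \<Rightarrow> 'a \<Rightarrow> bool) \<Rightarrow> 'a \<Rightarrow> 'a \<Rightarrow> 'a \<Rightarrow> 'a \<Rightarrow> 'a \<Rightarrow> 'a \<Rightarrow> bool" where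
  "link4 adj a b v v' r s \<longleftrightarrow>
     a = b \<and> v \<noteq> a \<and> \<not> adj v a \<and> v' \<noteq> a \<and> \<not> adj v' a \<and> adj r a \<and> adj s a \<or>
     adj a b \<and> v \<noteq> a \<and> \<not> adj v a \<and> adj v' a \<and> adj r a \<and> adj s a \<and>
       v' \<noteq> b \<and> \<not> adj v' b \<and> adj v b \<and> adj r b \<and> adj s b"

context adjacency
begin

lemma adj_commute: "adj x y \<longleftrightarrow> adj y x"
  using adj_sym by blast

text \<open>These lemmas are named after complements: the complement of C4 + K1 is the butterfly,
  that of \<open>K\<^sub>2\<^sub>,\<^sub>3\<close> is K2 + K3, and \<open>listed_C6\<close> and
  \<open>listed_C5_K2\<close> produce the complements of C6 and of C5 + K2.\<close>

lemma listed_butterfly: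
  assumes "x0 \<noteq> x1 \<and> \<not> adj x0 x1 \<and>
      x0 \<noteq> x2 \<and> \<not> adj x0 x2 \<and>
      x0 \<noteq> x3 \<and> \<not> adj x0 x3 \<and>
      x0 \<noteq> x4 \<and> \<not> adj x0 x4 \<and>
      x1 \<noteq> x2 \<and> \<not> adj x1 x2 \<and>
      adj x1 x3 \<and>
      adj x1 x4 \<and>
      adj x2 x3 \<and>
      adj x2 x4 \<and>
      x3 \<noteq> x4 \<and> \<not> adj x3 x4"
    and "{x0, x1, x2, x3, x4} \<subseteq> U"
  shows "listed adj U"
  by (rule listedI[of "co_shapes ! 0" "[x0, x1, x2, x3, x4]"])
    (use assms in \<open>simp_all add: co_shapes_def shape_def all_less_numeral\<close>)

lemma listed_K2_K3:
  assumes "x0 \<noteq> x1 \<and> \<not> adj x0 x1 \<and>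
      adj x0 x2 \<and>
      adj x0 x3 \<and>
      adj x0 x4 \<and>
      adj x1 x2 \<and>
      adj x1 x3 \<and>
      adj x1 x4 \<and>
      x2 \<noteq> x3 \<and> \<not> adj x2 x3 \<and>
      x2 \<noteq> x4 \<and> \<not> adj x2 x4 \<and>
      x3 \<noteq> x4 \<and> \<not> adj x3 x4"
    and "{x0, x1, x2, x3, x4} \<subseteq> U"
  shows "listed adj U"
  by (rule listedI[of "co_shapes ! 1" "[x0, x1, x2, x3, x4]"])
    (use assms in \<open>simp_all add: co_shapes_def shape_def all_less_numeral\<close>)

lemma listed_coDomino:
  assumes "x0 \<noteq> x1 \<and> \<not> adj x0 x1 \<and>
      x0 \<noteq> x2 \<and> \<not> adj x0 x2 \<and>
      x0 \<noteq> x3 \<and> \<not> adj x0 x3 \<and>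
      adj x0 x4 \<and>
      adj x0 x5 \<and>
      x1 \<noteq> x2 \<and> \<not> adj x1 x2 \<and>
      adj x1 x3 \<and>
      x1 \<noteq> x4 \<and> \<not> adj x1 x4 \<and>
      adj x1 x5 \<and>
      adj x2 x3 \<and>
      adj x2 x4 \<and>
      adj x2 x5 \<and>
      x3 \<noteq> x4 \<and> \<not> adj x3 x4 \<and>
      x3 \<noteq> x5 \<and> \<not> adj x3 x5 \<and>
      x4 \<noteq> x5 \<and> \<not> adj x4 x5"
    and "{x0, x1, x2, x3, x4, x5} \<subseteq> U"
  shows "listed adj U"
  by (rule listedI[of "co_shapes ! 2" "[x0, x1, x2, x3, x4, x5]"])
    (use assms in \<open>simp_all add: co_shapes_def shape_def all_less_numeral\<close>)

lemma listed_coG3: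
  assumes "x0 \<noteq> x1 \<and> \<not> adj x0 x1 \<and>
      x0 \<noteq> x2 \<and> \<not> adj x0 x2 \<and>
      adj x0 x3 \<and>
      adj x0 x4 \<and>
      x0 \<noteq> x5 \<and> \<not> adj x0 x5 \<and>
      x1 \<noteq> x2 \<and> \<not> adj x1 x2 \<and>
      adj x1 x3 \<and>
      adj x1 x4 \<and>
      adj x1 x5 \<and>
      x2 \<noteq> x3 \<and> \<not> adj x2 x3 \<and>
      adj x2 x4 \<and>
      adj x2 x5 \<and>
      x3 \<noteq> x4 \<and> \<not> adj x3 x4 \<and>
      adj x3 x5 \<and>
      x4 \<noteq> x5 \<and> \<not> adj x4 x5"
    and "{x0, x1, x2, x3, x4, x5} \<subseteq> U"
  shows "listed adj U"
  by (rule listedI[of "co_shapes ! 3" "[x0, x1, x2, x3, x4, x5]"])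
    (use assms in \<open>simp_all add: co_shapes_def shape_def all_less_numeral\<close>)

lemma listed_C6:
  assumes "x0 \<noteq> x1 \<and> \<not> adj x0 x1 \<and>
      adj x0 x2 \<and>
      adj x0 x3 \<and>
      adj x0 x4 \<and>
      x0 \<noteq> x5 \<and> \<not> adj x0 x5 \<and>
      x1 \<noteq> x2 \<and> \<not> adj x1 x2 \<and>
      adj x1 x3 \<and>
      adj x1 x4 \<and>
      adj x1 x5 \<and>
      x2 \<noteq> x3 \<and> \<not> adj x2 x3 \<and>
      adj x2 x4 \<and>
      adj x2 x5 \<and>
      x3 \<noteq> x4 \<and> \<not> adj x3 x4 \<and>
      adj x3 x5 \<and>
      x4 \<noteq> x5 \<and> \<not> adj x4 x5"
    and "{x0, x1, x2, x3, x4, x5} \<subseteq> U"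
  shows "listed adj U"
  by (rule listedI[of "co_shapes ! 4" "[x0, x1, x2, x3, x4, x5]"])
    (use assms in \<open>simp_all add: co_shapes_def shape_def all_less_numeral\<close>)

lemma listed_C5_K2:
  assumes "x0 \<noteq> x1 \<and> \<not> adj x0 x1 \<and>
      adj x0 x2 \<and>
      adj x0 x3 \<and>
      x0 \<noteq> x4 \<and> \<not> adj x0 x4 \<and>
      adj x0 x5 \<and>
      adj x0 x6 \<and>
      x1 \<noteq> x2 \<and> \<not> adj x1 x2 \<and>
      adj x1 x3 \<and>
      adj x1 x4 \<and>
      adj x1 x5 \<and>
      adj x1 x6 \<and>
      x2 \<noteq> x3 \<and> \<not> adj x2 x3 \<and>
      adj x2 x4 \<and>
      adj x2 x5 \<and>
      adj x2 x6 \<and>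
      x3 \<noteq> x4 \<and> \<not> adj x3 x4 \<and>
      adj x3 x5 \<and>
      adj x3 x6 \<and>
      adj x4 x5 \<and>
      adj x4 x6 \<and>
      x5 \<noteq> x6 \<and> \<not> adj x5 x6"
    and "{x0, x1, x2, x3, x4, x5, x6} \<subseteq> U"
  shows "listed adj U"
  by (rule listedI[of "co_shapes ! 5" "[x0, x1, x2, x3, x4, x5, x6]"])
    (use assms in \<open>simp_all add: co_shapes_def shape_def all_less_numeral\<close>)

text \<open>In the case analyses below most distinctness facts come from a third vertex that is
  adjacent to exactly one of the two.\<close>

lemma neq_by_adj: "(\<exists>z\<in>set zs. adj x z \<noteq> adj y z) \<Longrightarrow> x \<noteq> y"
  by auto

lemma missed3:
  assumes "adj u v" "adj u w" "adj v w"
  shows "missed adj {u, v, w} y = {u} \<longleftrightarrow> u \<noteq> y \<and> \<not> adj u y \<and> adj v y \<and> adj w y" (is ?A)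
    "missed adj {u, v, w} y = {u, v} \<longleftrightarrow> u \<noteq> y \<and> \<not> adj u y \<and> v \<noteq> y \<and> \<not> adj v y \<and> adj w y" (is ?B)
proof -
  have ne: "u \<noteq> v" "u \<noteq> w" "v \<noteq> w" using assms by auto
  have m: "u \<in> missed adj {u, v, w} y \<longleftrightarrow> y \<noteq> u \<and> \<not> adj u y"
    "v \<in> missed adj {u, v, w} y \<longleftrightarrow> y \<noteq> v \<and> \<not> adj v y"
    "w \<in> missed adj {u, v, w} y \<longleftrightarrow> y \<noteq> w \<and> \<not> adj w y"
    "missed adj {u, v, w} y \<subseteq> {u, v, w}" using adj_commute by (auto simp: missed_def)
  have "missed adj {u, v, w} y = {u} \<longleftrightarrow> u \<in> missed adj {u, v, w} y \<and> v \<notin> missed adj {u, v, w} y \<and> w \<notin> missed adj {u, v, w} y"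
    using m(4) ne by auto
  then show ?A unfolding m using assms by auto
  have "missed adj {u, v, w} y = {u, v} \<longleftrightarrow> u \<in> missed adj {u, v, w} y \<and> v \<in> missed adj {u, v, w} y \<and> w \<notin> missed adj {u, v, w} y"
    using m(4) ne by auto
  then show ?B unfolding m using assms by auto
qed

lemma subset4_eq:
  assumes "M \<subseteq> {u, v, w, x}" "u \<noteq> v" "u \<noteq> w" "v \<noteq> w" "u \<noteq> x" "v \<noteq> x" "w \<noteq> x"
  shows "M = {u} \<longleftrightarrow> u \<in> M \<and> v \<notin> M \<and> w \<notin> M \<and> x \<notin> M"
    "M = {u, v} \<longleftrightarrow> u \<in> M \<and> v \<in> M \<and> w \<notin> M \<and> x \<notin> M"
  using assms by auto

lemma missed4:
  assumes "adj u v" "adj u w" "adj v w" "adj u x" "adj v x" "adj w x"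
  shows "missed adj {u, v, w, x} y = {u} \<longleftrightarrow> u \<noteq> y \<and> \<not> adj u y \<and> adj v y \<and> adj w y \<and> adj x y" (is ?A)
    "missed adj {u, v, w, x} y = {u, v} \<longleftrightarrow> u \<noteq> y \<and> \<not> adj u y \<and> v \<noteq> y \<and> \<not> adj v y \<and> adj w y \<and> adj x y" (is ?B)
proof -
  let ?M = "missed adj {u, v, w, x} y"
  have ne: "u \<noteq> v" "u \<noteq> w" "v \<noteq> w" "u \<noteq> x" "v \<noteq> x" "w \<noteq> x" using assms by auto
  have m: "u \<in> ?M \<longleftrightarrow> y \<noteq> u \<and> \<not> adj u y" "v \<in> ?M \<longleftrightarrow> y \<noteq> v \<and> \<not> adj v y"
    "w \<in> ?M \<longleftrightarrow> y \<noteq> w \<and> \<not> adj w y" "x \<in> ?M \<longleftrightarrow> y \<noteq> x \<and> \<not> adj x y"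
    "?M \<subseteq> {u, v, w, x}" using adj_commute by (auto simp: missed_def)
  note e = subset4_eq[OF m(5) ne]
  show ?A unfolding e m
    by (cases "y = u"; cases "y = v"; cases "y = w"; cases "y = x")
      (use assms assms[THEN adj_sym] in simp_all)
  show ?B unfolding e m
    by (cases "y = u"; cases "y = v"; cases "y = w"; cases "y = x")
      (use assms assms[THEN adj_sym] in simp_all)
qed

lemma obs3_iff:
  "obs adj [(u, a0, b0), (v, a1, b1), (w, a2, b2)] \<longleftrightarrow>
     adj u v \<and> adj u w \<and> adj v w \<and> u \<noteq> v \<and> u \<noteq> w \<and> v \<noteq> w \<and>
     link3 adj a0 b0 u v w \<and> link3 adj a1 b1 v w u \<and> link3 adj a2 b2 w u v"
proof (cases "adj u v \<and> adj u w \<and> adj v w")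
  case True
  then have a: "adj u v" "adj u w" "adj v w" "adj v u" "adj w u" "adj w v" using adj_sym by auto
  have p: "{v, w, u} = {u, v, w}" "{w, u, v} = {u, v, w}" by auto
  note m = missed3[OF a(1-3)] missed3[OF a(3,4,5)] missed3[OF a(5,6,1)]
  have ne: "u \<noteq> v" "u \<noteq> w" "v \<noteq> w" using a by auto
  show ?thesis by (simp add: obs_def link3_def a ne ne[symmetric] m[unfolded p] conj_ac)
next
  case False
  then show ?thesis unfolding obs_def by auto
qed

lemma obs4_iff:
  "obs adj [(u, a0, b0), (v, a1, b1), (w, a2, b2), (x, a3, b3)] \<longleftrightarrow>
     adj u v \<and> adj u w \<and> adj v w \<and> adj u x \<and> adj v x \<and> adj w x \<and>
     u \<noteq> v \<and> u \<noteq> w \<and> v \<noteq> w \<and> u \<noteq> x \<and> v \<noteq> x \<and> w \<noteq> x \<and>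
     link4 adj a0 b0 u v w x \<and> link4 adj a1 b1 v w x u \<and> link4 adj a2 b2 w x u v \<and> link4 adj a3 b3 x u v w"
proof (cases "adj u v \<and> adj u w \<and> adj v w \<and> adj u x \<and> adj v x \<and> adj w x")
  case True
  then have a: "adj u v" "adj u w" "adj v w" "adj v u" "adj w u" "adj w v"
    "adj u x" "adj v x" "adj w x" "adj x u" "adj x v" "adj x w" using adj_sym by auto
  have p: "{v, w, x, u} = {u, v, w, x}" "{w, x, u, v} = {u, v, w, x}" "{x, u, v, w} = {u, v, w, x}" by auto
  note m = missed4[OF a(1-3,7-9)] missed4[OF a(3,8,9,4,5,10)] missed4[OF a(9,5,10,6,11,1)] missed4[OF a(10,11,1,12,2,3)]
  have ne: "u \<noteq> v" "u \<noteq> w" "v \<noteq> w" "u \<noteq> x" "v \<noteq> x" "w \<noteq> x" using a by auto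
  show ?thesis by (simp add: obs_def link4_def a ne ne[symmetric] m[unfolded p] conj_ac)
next
  case False
  then show ?thesis unfolding obs_def by auto
qed

text \<open>The digits give the numbers of witnesses of the successive pairs, and \<open>e\<close>
  is the edge assumed invalid. In all these lemmas \<open>C\<close> orients the adjacencies,
  \<open>F\<close> lists those that are known, \<open>D\<close> gives distinctness, and each
  \<open>i0\<close>, \<open>i1\<close>, ... treats one pattern of the unknown ones; together the
  patterns are exhaustive.\<close>

lemma special3_111:
  assumes o: "obs adj [(v0, w0, w0), (v1, w1, w1), (v2, w2, w2)]"
    and e: "adj w0 w1"
  shows "improvable adj [(v0, w0, w0), (v1, w1, w1), (v2, w2, w2)]"
proof -
  have C: "adj v1 v0 = adj v0 v1" "adj v2 v0 = adj v0 v2" "adj w0 v0 = adj v0 w0" "adj w1 v0 = adj v0 w1" "adj w2 v0 = adj v0 w2" "adj v2 v1 = adj v1 v2" "adj w0 v1 = adj v1 w0" "adj w1 v1 = adj v1 w1" "adj w2 v1 = adj v1 w2" "adj w0 v2 = adj v2 w0" "adj w1 v2 = adj v2 w1" "adj w2 v2 = adj v2 w2" "adj w1 w0 = adj w0 w1" "adj w2 w0 = adj w0 w2" "adj w2 w1 = adj w1 w2"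
    by (auto intro: adj_sym)
  have F: "adj v0 v1" "adj v0 v2" "\<not> adj v0 w0" "v0 \<noteq> w0" "w0 \<noteq> v0" "adj v0 w1" "\<not> adj v0 w2" "v0 \<noteq> w2" "w2 \<noteq> v0" "adj v1 v2" "\<not> adj v1 w0" "v1 \<noteq> w0" "w0 \<noteq> v1" "\<not> adj v1 w1" "v1 \<noteq> w1" "w1 \<noteq> v1" "adj v1 w2" "adj v2 w0" "\<not> adj v2 w1" "v2 \<noteq> w1" "w1 \<noteq> v2" "\<not> adj v2 w2" "v2 \<noteq> w2" "w2 \<noteq> v2" "adj w0 w1"
    using o e by (auto simp: obs3_iff link3_def C)
  have D: "v0 \<noteq> v1" "v0 \<noteq> v2" "v0 \<noteq> w1" "v1 \<noteq> v2" "v1 \<noteq> w2" "v2 \<noteq> w0" "w0 \<noteq> w1" "w0 \<noteq> w2" "w1 \<noteq> w2"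
    by (rule neq_by_adj[of "[v0, v1, v2, w0, w1, w2]"], simp add: F C)+
  have i0: "\<lbrakk>adj w0 w2; adj w1 w2\<rbrakk> \<Longrightarrow> ?thesis"
    by (rule improvable_listed, rule listed_C6[of v0 w0 v1 w1 v2 w2]) (simp_all add: C F D D[symmetric])
  have i1: "\<lbrakk>adj w0 w2; \<not> adj w1 w2\<rbrakk> \<Longrightarrow> ?thesis"
    by (rule improvable_listed, rule listed_coG3[of w1 v2 w2 v0 w0 v1]) (simp_all add: C F D D[symmetric])
  have i2: "\<lbrakk>\<not> adj w0 w2; adj w1 w2\<rbrakk> \<Longrightarrow> ?thesis"
    by (rule improvable_listed, rule listed_coG3[of w0 v0 w2 v2 w1 v1]) (simp_all add: C F D D[symmetric])
  have i3: "\<lbrakk>\<not> adj w0 w2; \<not> adj w1 w2\<rbrakk> \<Longrightarrow> ?thesis"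
    by (rule improvable_listed, rule listed_butterfly[of w2 v0 w0 v2 w1]) (simp_all add: C F D D[symmetric])
  show ?thesis using i0 i1 i2 i3 by blast
qed

lemma special3_112:
  assumes o: "obs adj [(v0, w0, w0), (v1, w1, w1), (v2, a2, b2)]"
    and e: "adj w0 w1"
    and ne: "a2 \<noteq> b2"
  shows "improvable adj [(v0, w0, w0), (v1, w1, w1), (v2, a2, b2)]"
proof -
  have C: "adj v1 v0 = adj v0 v1" "adj v2 v0 = adj v0 v2" "adj w0 v0 = adj v0 w0" "adj w1 v0 = adj v0 w1" "adj a2 v0 = adj v0 a2" "adj b2 v0 = adj v0 b2" "adj v2 v1 = adj v1 v2" "adj w0 v1 = adj v1 w0" "adj w1 v1 = adj v1 w1" "adj a2 v1 = adj v1 a2" "adj b2 v1 = adj v1 b2" "adj w0 v2 = adj v2 w0" "adj w1 v2 = adj v2 w1" "adj a2 v2 = adj v2 a2" "adj b2 v2 = adj v2 b2" "adj w1 w0 = adj w0 w1" "adj a2 w0 = adj w0 a2" "adj b2 w0 = adj w0 b2" "adj a2 w1 = adj w1 a2" "adj b2 w1 = adj w1 b2" "adj b2 a2 = adj a2 b2"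
    by (auto intro: adj_sym)
  have F: "adj v0 v1" "adj v0 v2" "\<not> adj v0 w0" "v0 \<noteq> w0" "w0 \<noteq> v0" "adj v0 w1" "adj v0 a2" "\<not> adj v0 b2" "v0 \<noteq> b2" "b2 \<noteq> v0" "adj v1 v2" "\<not> adj v1 w0" "v1 \<noteq> w0" "w0 \<noteq> v1" "\<not> adj v1 w1" "v1 \<noteq> w1" "w1 \<noteq> v1" "adj v1 a2" "adj v1 b2" "adj v2 w0" "\<not> adj v2 w1" "v2 \<noteq> w1" "w1 \<noteq> v2" "\<not> adj v2 a2" "v2 \<noteq> a2" "a2 \<noteq> v2" "adj v2 b2" "adj w0 w1" "adj a2 b2" "a2 \<noteq> b2" "b2 \<noteq> a2"
    using o e ne by (auto simp: obs3_iff link3_def C)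
  have D: "v0 \<noteq> v1" "v0 \<noteq> v2" "v0 \<noteq> w1" "v0 \<noteq> a2" "v1 \<noteq> v2" "v1 \<noteq> a2" "v1 \<noteq> b2" "v2 \<noteq> w0" "v2 \<noteq> b2" "w0 \<noteq> w1" "w0 \<noteq> a2" "w0 \<noteq> b2" "w1 \<noteq> a2" "w1 \<noteq> b2"
    by (rule neq_by_adj[of "[v0, v1, v2, w0, w1, a2, b2]"], simp add: F C)+
  have i0: "\<lbrakk>adj w0 a2; \<not> adj w1 a2\<rbrakk> \<Longrightarrow> ?thesis"
    by (rule improvable_listed, rule listed_K2_K3[of v0 w0 v2 w1 a2]) (simp_all add: C F D D[symmetric])
  have i1: "\<lbrakk>\<not> adj w0 b2; adj w1 b2\<rbrakk> \<Longrightarrow> ?thesis"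
    by (rule improvable_listed, rule listed_K2_K3[of v2 w1 v0 w0 b2]) (simp_all add: C F D D[symmetric])
  have i2: "\<lbrakk>\<not> adj w1 a2; adj w1 b2\<rbrakk> \<Longrightarrow> ?thesis"
    by (rule improvable_listed, rule listed_K2_K3[of v0 b2 v2 w1 a2]) (simp_all add: C F D D[symmetric])
  have i3: "\<lbrakk>adj w0 a2; \<not> adj w0 b2\<rbrakk> \<Longrightarrow> ?thesis"
    by (rule improvable_listed, rule listed_K2_K3[of v2 a2 v0 w0 b2]) (simp_all add: C F D D[symmetric])
  \<comment> \<open>Witnesses and core vertices change roles: \<open>a2\<close> and
    \<open>b2\<close> enter the core while \<open>v0\<close> and \<open>v2\<close> become witnesses.
    The length stays three, and \<open>cyc_unjoined\<close> falls from three to one.\<close>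
  have i4: "\<lbrakk>adj w0 a2; adj w0 b2; adj w1 a2; adj w1 b2\<rbrakk> \<Longrightarrow> ?thesis"
    by (rule improvable_obs[of adj "[(v1, w0, v2), (a2, v2, v0), (b2, v0, w1)]"])
      (simp_all add: obs3_iff link3_def C F D D[symmetric] cyc_unjoined_def)
  have i5: "\<lbrakk>adj w0 a2; adj w0 b2; adj w1 a2; \<not> adj w1 b2\<rbrakk> \<Longrightarrow> ?thesis"
    by (rule improvable_obs[of adj "[(v1, w0, v2), (a2, v2, v0), (b2, w1, w1)]"])
      (simp_all add: obs3_iff link3_def C F D D[symmetric] cyc_unjoined_def)
  have i6: "\<lbrakk>\<not> adj w0 a2; adj w0 b2; adj w1 a2; adj w1 b2\<rbrakk> \<Longrightarrow> ?thesis"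
    by (rule improvable_obs[of adj "[(v1, w0, w0), (a2, v2, v0), (b2, v0, w1)]"])
      (simp_all add: obs3_iff link3_def C F D D[symmetric] cyc_unjoined_def)
  have i7: "\<lbrakk>\<not> adj w0 a2; adj w0 b2; adj w1 a2; \<not> adj w1 b2\<rbrakk> \<Longrightarrow> ?thesis"
    by (rule improvable_listed, rule listed_C6[of v0 w0 a2 v2 w1 b2]) (simp_all add: C F D D[symmetric])
  have i8: "\<lbrakk>\<not> adj w0 a2; adj w0 b2; \<not> adj w1 a2; \<not> adj w1 b2\<rbrakk> \<Longrightarrow> ?thesis"
    by (rule improvable_listed, rule listed_coG3[of w1 v2 a2 w0 v0 b2]) (simp_all add: C F D D[symmetric])
  have i9: "\<lbrakk>\<not> adj w0 a2; \<not> adj w0 b2; adj w1 a2; \<not> adj w1 b2\<rbrakk> \<Longrightarrow> ?thesis"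
    by (rule improvable_listed, rule listed_coG3[of w0 v0 b2 w1 v2 a2]) (simp_all add: C F D D[symmetric])
  have i10: "\<lbrakk>\<not> adj w0 a2; \<not> adj w0 b2; \<not> adj w1 a2; \<not> adj w1 b2\<rbrakk> \<Longrightarrow> ?thesis"
    by (rule improvable_listed, rule listed_coDomino[of w0 b2 v0 a2 w1 v2]) (simp_all add: C F D D[symmetric])
  show ?thesis using i0 i1 i2 i3 i4 i5 i6 i7 i8 i9 i10 by blast
qed

lemma special3_121:
  assumes o: "obs adj [(v0, w0, w0), (v1, a1, b1), (v2, w2, w2)]"
    and e: "adj w0 b1"
    and ne: "a1 \<noteq> b1"
  shows "improvable adj [(v0, w0, w0), (v1, a1, b1), (v2, w2, w2)]"
proof -
  have C: "adj v1 v0 = adj v0 v1" "adj v2 v0 = adj v0 v2" "adj w0 v0 = adj v0 w0" "adj a1 v0 = adj v0 a1" "adj b1 v0 = adj v0 b1" "adj w2 v0 = adj v0 w2" "adj v2 v1 = adj v1 v2" "adj w0 v1 = adj v1 w0" "adj a1 v1 = adj v1 a1" "adj b1 v1 = adj v1 b1" "adj w2 v1 = adj v1 w2" "adj w0 v2 = adj v2 w0" "adj a1 v2 = adj v2 a1" "adj b1 v2 = adj v2 b1" "adj w2 v2 = adj v2 w2" "adj a1 w0 = adj w0 a1" "adj b1 w0 = adj w0 b1" "adj w2 w0 = adj w0 w2" "adj b1 a1 = adj a1 b1" "adj w2 a1 = adj a1 w2" "adj w2 b1 = adj b1 w2"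
    by (auto intro: adj_sym)
  have F: "adj v0 v1" "adj v0 v2" "\<not> adj v0 w0" "v0 \<noteq> w0" "w0 \<noteq> v0" "adj v0 a1" "adj v0 b1" "\<not> adj v0 w2" "v0 \<noteq> w2" "w2 \<noteq> v0" "adj v1 v2" "\<not> adj v1 w0" "v1 \<noteq> w0" "w0 \<noteq> v1" "\<not> adj v1 a1" "v1 \<noteq> a1" "a1 \<noteq> v1" "adj v1 b1" "adj v1 w2" "adj v2 w0" "adj v2 a1" "\<not> adj v2 b1" "v2 \<noteq> b1" "b1 \<noteq> v2" "\<not> adj v2 w2" "v2 \<noteq> w2" "w2 \<noteq> v2" "adj w0 b1" "adj a1 b1" "a1 \<noteq> b1" "b1 \<noteq> a1"
    using o e ne by (auto simp: obs3_iff link3_def C)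
  have D: "v0 \<noteq> v1" "v0 \<noteq> v2" "v0 \<noteq> a1" "v0 \<noteq> b1" "v1 \<noteq> v2" "v1 \<noteq> b1" "v1 \<noteq> w2" "v2 \<noteq> w0" "v2 \<noteq> a1" "w0 \<noteq> a1" "w0 \<noteq> b1" "w0 \<noteq> w2" "a1 \<noteq> w2" "b1 \<noteq> w2"
    by (rule neq_by_adj[of "[v0, v1, v2, w0, a1, b1, w2]"], simp add: F C)+
  have i0: "\<lbrakk>\<not> adj w0 a1\<rbrakk> \<Longrightarrow> ?thesis"
    by (rule improvable_listed, rule listed_K2_K3[of v2 b1 v1 w0 a1]) (simp_all add: C F D D[symmetric])
  have i1: "\<lbrakk>adj w0 w2; \<not> adj b1 w2\<rbrakk> \<Longrightarrow> ?thesis"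
    by (rule improvable_listed, rule listed_K2_K3[of v1 w0 v2 b1 w2]) (simp_all add: C F D D[symmetric])
  have i2: "\<lbrakk>\<not> adj w0 w2; \<not> adj b1 w2\<rbrakk> \<Longrightarrow> ?thesis"
    by (rule improvable_listed, rule listed_butterfly[of w2 v0 w0 v2 b1]) (simp_all add: C F D D[symmetric])
  have i3: "\<lbrakk>adj w0 a1; adj a1 w2; adj b1 w2\<rbrakk> \<Longrightarrow> ?thesis"
    by (rule improvable_obs[of adj "[(v0, w2, v1), (a1, v1, v2), (b1, v2, w0)]"])
      (simp_all add: obs3_iff link3_def C F D D[symmetric] cyc_unjoined_def)
  have i4: "\<lbrakk>adj w0 a1; \<not> adj a1 w2; adj b1 w2\<rbrakk> \<Longrightarrow> ?thesis"
    by (rule improvable_obs[of adj "[(v0, w2, w2), (a1, v1, v2), (b1, v2, w0)]"])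
      (simp_all add: obs3_iff link3_def C F D D[symmetric] cyc_unjoined_def)
  show ?thesis using i0 i1 i2 i3 i4 by blast
qed

lemma special3_122:
  assumes o: "obs adj [(v0, w0, w0), (v1, a1, b1), (v2, a2, b2)]"
    and e: "adj w0 b1"
    and ne: "a1 \<noteq> b1" "a2 \<noteq> b2" "b1 \<noteq> a2"
  shows "improvable adj [(v0, w0, w0), (v1, a1, b1), (v2, a2, b2)]"
proof -
  have C: "adj v1 v0 = adj v0 v1" "adj v2 v0 = adj v0 v2" "adj w0 v0 = adj v0 w0" "adj a1 v0 = adj v0 a1" "adj b1 v0 = adj v0 b1" "adj a2 v0 = adj v0 a2" "adj b2 v0 = adj v0 b2" "adj v2 v1 = adj v1 v2" "adj w0 v1 = adj v1 w0" "adj a1 v1 = adj v1 a1" "adj b1 v1 = adj v1 b1" "adj a2 v1 = adj v1 a2" "adj b2 v1 = adj v1 b2" "adj w0 v2 = adj v2 w0" "adj a1 v2 = adj v2 a1" "adj b1 v2 = adj v2 b1" "adj a2 v2 = adj v2 a2" "adj b2 v2 = adj v2 b2" "adj a1 w0 = adj w0 a1" "adj b1 w0 = adj w0 b1" "adj a2 w0 = adj w0 a2" "adj b2 w0 = adj w0 b2" "adj b1 a1 = adj a1 b1" "adj a2 a1 = adj a1 a2" "adj b2 a1 = adj a1 b2" "adj a2 b1 = adj b1 a2" "adj b2 b1 = adj b1 b2" "adj b2 a2 = adj a2 b2"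
    by (auto intro: adj_sym)
  have F: "adj v0 v1" "adj v0 v2" "\<not> adj v0 w0" "v0 \<noteq> w0" "w0 \<noteq> v0" "adj v0 a1" "adj v0 b1" "adj v0 a2" "\<not> adj v0 b2" "v0 \<noteq> b2" "b2 \<noteq> v0" "adj v1 v2" "\<not> adj v1 w0" "v1 \<noteq> w0" "w0 \<noteq> v1" "\<not> adj v1 a1" "v1 \<noteq> a1" "a1 \<noteq> v1" "adj v1 b1" "adj v1 a2" "adj v1 b2" "adj v2 w0" "adj v2 a1" "\<not> adj v2 b1" "v2 \<noteq> b1" "b1 \<noteq> v2" "\<not> adj v2 a2" "v2 \<noteq> a2" "a2 \<noteq> v2" "adj v2 b2" "adj w0 b1" "adj a1 b1" "adj a2 b2" "a1 \<noteq> b1" "b1 \<noteq> a1" "a2 \<noteq> b2" "b2 \<noteq> a2" "b1 \<noteq> a2" "a2 \<noteq> b1"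
    using o e ne by (auto simp: obs3_iff link3_def C)
  have D: "v0 \<noteq> v1" "v0 \<noteq> v2" "v0 \<noteq> a1" "v0 \<noteq> b1" "v0 \<noteq> a2" "v1 \<noteq> v2" "v1 \<noteq> b1" "v1 \<noteq> a2" "v1 \<noteq> b2" "v2 \<noteq> w0" "v2 \<noteq> a1" "v2 \<noteq> b2" "w0 \<noteq> a1" "w0 \<noteq> b1" "w0 \<noteq> a2" "w0 \<noteq> b2" "a1 \<noteq> a2" "a1 \<noteq> b2" "b1 \<noteq> b2"
    by (rule neq_by_adj[of "[v0, v1, v2, w0, a1, b1, a2, b2]"], simp add: F C)+
  have i0: "\<lbrakk>adj b1 b2\<rbrakk> \<Longrightarrow> ?thesis"
    by (rule improvable_obs[of adj "[(v0, w0, w0), (v1, a1, b1), (v2, b1, b2)]"])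
      (simp_all add: obs3_iff link3_def C F D D[symmetric] cyc_unjoined_def)
  have i1: "\<lbrakk>adj a1 a2\<rbrakk> \<Longrightarrow> ?thesis"
    by (rule improvable_obs[of adj "[(v0, w0, w0), (v1, a1, a2), (v2, a2, b2)]"])
      (simp_all add: obs3_iff link3_def C F D D[symmetric] cyc_unjoined_def)
  have i2: "\<lbrakk>adj a1 b2\<rbrakk> \<Longrightarrow> ?thesis"
    by (rule improvable_obs[of adj "[(v0, b2, a1), (v1, a1, b1), (v2, a2, b2)]"])
      (simp_all add: obs3_iff link3_def C F D D[symmetric] cyc_unjoined_def)
  have i3: "\<lbrakk>\<not> adj w0 a1\<rbrakk> \<Longrightarrow> ?thesis"
    by (rule improvable_listed, rule listed_K2_K3[of v2 b1 v1 w0 a1]) (simp_all add: C F D D[symmetric])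
  have i4: "\<lbrakk>adj w0 a1; \<not> adj a1 b2\<rbrakk> \<Longrightarrow> ?thesis"
    by (rule improvable_obs[of adj "[(v0, w0, b1), (v2, b1, v1), (a1, b2, b2)]"])
      (simp_all add: obs3_iff link3_def C F D D[symmetric] cyc_unjoined_def)
  show ?thesis using i0 i1 i2 i3 i4 by blast
qed

text \<open>Here the second and third pairs already share \<open>b1\<close>. This is the case that
  produces the complement of C5 + K2: \<open>v0\<close>, \<open>w0\<close>, \<open>v1\<close>,
  \<open>a1\<close>, \<open>b2\<close> form a cycle of non-adjacencies, beside the non-adjacent
  vertices \<open>v2\<close> and \<open>b1\<close>.\<close>

lemma special3_122_joined:
  assumes o: "obs adj [(v0, w0, w0), (v1, a1, b1), (v2, b1, b2)]"
    and e: "adj w0 b1"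
    and ne: "a1 \<noteq> b1" "b1 \<noteq> b2"
  shows "improvable adj [(v0, w0, w0), (v1, a1, b1), (v2, b1, b2)]"
proof -
  have C: "adj v1 v0 = adj v0 v1" "adj v2 v0 = adj v0 v2" "adj w0 v0 = adj v0 w0" "adj a1 v0 = adj v0 a1" "adj b1 v0 = adj v0 b1" "adj b2 v0 = adj v0 b2" "adj v2 v1 = adj v1 v2" "adj w0 v1 = adj v1 w0" "adj a1 v1 = adj v1 a1" "adj b1 v1 = adj v1 b1" "adj b2 v1 = adj v1 b2" "adj w0 v2 = adj v2 w0" "adj a1 v2 = adj v2 a1" "adj b1 v2 = adj v2 b1" "adj b2 v2 = adj v2 b2" "adj a1 w0 = adj w0 a1" "adj b1 w0 = adj w0 b1" "adj b2 w0 = adj w0 b2" "adj b1 a1 = adj a1 b1" "adj b2 a1 = adj a1 b2" "adj b2 b1 = adj b1 b2"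
    by (auto intro: adj_sym)
  have F: "adj v0 v1" "adj v0 v2" "\<not> adj v0 w0" "v0 \<noteq> w0" "w0 \<noteq> v0" "adj v0 a1" "adj v0 b1" "\<not> adj v0 b2" "v0 \<noteq> b2" "b2 \<noteq> v0" "adj v1 v2" "\<not> adj v1 w0" "v1 \<noteq> w0" "w0 \<noteq> v1" "\<not> adj v1 a1" "v1 \<noteq> a1" "a1 \<noteq> v1" "adj v1 b1" "adj v1 b2" "adj v2 w0" "adj v2 a1" "\<not> adj v2 b1" "v2 \<noteq> b1" "b1 \<noteq> v2" "adj v2 b2" "adj w0 b1" "adj a1 b1" "adj b1 b2" "a1 \<noteq> b1" "b1 \<noteq> a1" "b1 \<noteq> b2" "b2 \<noteq> b1"
    using o e ne by (auto simp: obs3_iff link3_def C)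
  have D: "v0 \<noteq> v1" "v0 \<noteq> v2" "v0 \<noteq> a1" "v0 \<noteq> b1" "v1 \<noteq> v2" "v1 \<noteq> b1" "v1 \<noteq> b2" "v2 \<noteq> w0" "v2 \<noteq> a1" "v2 \<noteq> b2" "w0 \<noteq> a1" "w0 \<noteq> b1" "w0 \<noteq> b2" "a1 \<noteq> b2"
    by (rule neq_by_adj[of "[v0, v1, v2, w0, a1, b1, b2]"], simp add: F C)+
  have i0: "\<lbrakk>adj a1 b2\<rbrakk> \<Longrightarrow> ?thesis"
    by (rule improvable_obs[of adj "[(v0, b2, a1), (v1, a1, b1), (v2, b1, b2)]"])
      (simp_all add: obs3_iff link3_def C F D D[symmetric] cyc_unjoined_def)
  have i1: "\<lbrakk>\<not> adj w0 b2\<rbrakk> \<Longrightarrow> ?thesis"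
    by (rule improvable_listed, rule listed_K2_K3[of v2 b1 v0 w0 b2]) (simp_all add: C F D D[symmetric])
  have i2: "\<lbrakk>\<not> adj w0 a1\<rbrakk> \<Longrightarrow> ?thesis"
    by (rule improvable_listed, rule listed_K2_K3[of v2 b1 v1 w0 a1]) (simp_all add: C F D D[symmetric])
  have i3: "\<lbrakk>adj w0 a1; adj w0 b2; \<not> adj a1 b2\<rbrakk> \<Longrightarrow> ?thesis"
    by (rule improvable_listed, rule listed_C5_K2[of v0 w0 v1 a1 b2 v2 b1]) (simp_all add: C F D D[symmetric])
  show ?thesis using i0 i1 i2 i3 by blast
qed

text \<open>Bypassing two core vertices would leave only two. If \<open>w2\<close> is adjacent to
  \<open>w1\<close> or to \<open>w3\<close>, one core vertex can be bypassed as usual. Otherwise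
  \<open>w2\<close> itself replaces \<open>v2\<close> and \<open>v3\<close> in the core: it is
  adjacent to \<open>v0\<close> and \<open>v1\<close>, it is missed by \<open>w1\<close> and
  \<open>w3\<close>, and the edge \<open>w0 w2\<close> makes \<open>w0\<close> fit.
  \<open>special4_1112\<close> is analogous.\<close>

lemma special4_1111:
  assumes o: "obs adj [(v0, w0, w0), (v1, w1, w1), (v2, w2, w2), (v3, w3, w3)]"
    and e: "adj w0 w2"
  shows "improvable adj [(v0, w0, w0), (v1, w1, w1), (v2, w2, w2), (v3, w3, w3)]"
proof -
  have C: "adj v1 v0 = adj v0 v1" "adj v2 v0 = adj v0 v2" "adj v3 v0 = adj v0 v3" "adj w0 v0 = adj v0 w0" "adj w1 v0 = adj v0 w1" "adj w2 v0 = adj v0 w2" "adj w3 v0 = adj v0 w3" "adj v2 v1 = adj v1 v2" "adj v3 v1 = adj v1 v3" "adj w0 v1 = adj v1 w0" "adj w1 v1 = adj v1 w1" "adj w2 v1 = adj v1 w2" "adj w3 v1 = adj v1 w3" "adj v3 v2 = adj v2 v3" "adj w0 v2 = adj v2 w0" "adj w1 v2 = adj v2 w1" "adj w2 v2 = adj v2 w2" "adj w3 v2 = adj v2 w3" "adj w0 v3 = adj v3 w0" "adj w1 v3 = adj v3 w1" "adj w2 v3 = adj v3 w2" "adj w3 v3 = adj v3 w3" "adj w1 w0 = adj w0 w1" "adj w2 w0 = adj w0 w2" "adj w3 w0 = adj w0 w3" "adj w2 w1 = adj w1 w2" "adj w3 w1 = adj w1 w3" "adj w3 w2 = adj w2 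w3"
    by (auto intro: adj_sym)
  have F: "adj v0 v1" "adj v0 v2" "adj v0 v3" "\<not> adj v0 w0" "v0 \<noteq> w0" "w0 \<noteq> v0" "adj v0 w1" "adj v0 w2" "\<not> adj v0 w3" "v0 \<noteq> w3" "w3 \<noteq> v0" "adj v1 v2" "adj v1 v3" "\<not> adj v1 w0" "v1 \<noteq> w0" "w0 \<noteq> v1" "\<not> adj v1 w1" "v1 \<noteq> w1" "w1 \<noteq> v1" "adj v1 w2" "adj v1 w3" "adj v2 v3" "adj v2 w0" "\<not> adj v2 w1" "v2 \<noteq> w1" "w1 \<noteq> v2" "\<not> adj v2 w2" "v2 \<noteq> w2" "w2 \<noteq> v2" "adj v2 w3" "adj v3 w0" "adj v3 w1" "\<not> adj v3 w2" "v3 \<noteq> w2" "w2 \<noteq> v3" "\<not> adj v3 w3" "v3 \<noteq> w3" "w3 \<noteq> v3" "adj w0 w2"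
    using o e by (auto simp: obs4_iff link4_def C)
  have D: "v0 \<noteq> v1" "v0 \<noteq> v2" "v0 \<noteq> v3" "v0 \<noteq> w1" "v0 \<noteq> w2" "v1 \<noteq> v2" "v1 \<noteq> v3" "v1 \<noteq> w2" "v1 \<noteq> w3" "v2 \<noteq> v3" "v2 \<noteq> w0" "v2 \<noteq> w3" "v3 \<noteq> w0" "v3 \<noteq> w1" "w0 \<noteq> w1" "w0 \<noteq> w2" "w0 \<noteq> w3" "w1 \<noteq> w2" "w1 \<noteq> w3" "w2 \<noteq> w3"
    by (rule neq_by_adj[of "[v0, v1, v2, v3, w0, w1, w2, w3]"], simp add: F C)+
  have i0: "\<lbrakk>adj w2 w3\<rbrakk> \<Longrightarrow> ?thesis"
    by (rule improvable_obs[of adj "[(v0, w0, w0), (v1, w1, w1), (v2, w2, w3)]"])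
      (simp_all add: obs3_iff link3_def C F D D[symmetric] cyc_unjoined_def)
  have i1: "\<lbrakk>adj w1 w2\<rbrakk> \<Longrightarrow> ?thesis"
    by (rule improvable_obs[of adj "[(v0, w0, w0), (v1, w1, w2), (v3, w3, w3)]"])
      (simp_all add: obs3_iff link3_def C F D D[symmetric] cyc_unjoined_def)
  have i2: "\<lbrakk>\<not> adj w1 w2; \<not> adj w2 w3\<rbrakk> \<Longrightarrow> ?thesis"
    by (rule improvable_obs[of adj "[(v0, w0, w0), (v1, w1, w1), (w2, w3, w3)]"])
      (simp_all add: obs3_iff link3_def C F D D[symmetric] cyc_unjoined_def)
  show ?thesis using i0 i1 i2 by blast
qed

lemma special4_1112:
  assumes o: "obs adj [(v0, w0, w0), (v1, w1, w1), (v2, w2, w2), (v3, a3, b3)]"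
    and e: "adj w0 w2"
    and ne: "a3 \<noteq> b3"
  shows "improvable adj [(v0, w0, w0), (v1, w1, w1), (v2, w2, w2), (v3, a3, b3)]"
proof -
  have C: "adj v1 v0 = adj v0 v1" "adj v2 v0 = adj v0 v2" "adj v3 v0 = adj v0 v3" "adj w0 v0 = adj v0 w0" "adj w1 v0 = adj v0 w1" "adj w2 v0 = adj v0 w2" "adj a3 v0 = adj v0 a3" "adj b3 v0 = adj v0 b3" "adj v2 v1 = adj v1 v2" "adj v3 v1 = adj v1 v3" "adj w0 v1 = adj v1 w0" "adj w1 v1 = adj v1 w1" "adj w2 v1 = adj v1 w2" "adj a3 v1 = adj v1 a3" "adj b3 v1 = adj v1 b3" "adj v3 v2 = adj v2 v3" "adj w0 v2 = adj v2 w0" "adj w1 v2 = adj v2 w1" "adj w2 v2 = adj v2 w2" "adj a3 v2 = adj v2 a3" "adj b3 v2 = adj v2 b3" "adj w0 v3 = adj v3 w0" "adj w1 v3 = adj v3 w1" "adj w2 v3 = adj v3 w2" "adj a3 v3 = adj v3 a3" "adj b3 v3 = adj v3 b3" "adj w1 w0 = adj w0 w1" "adj w2 w0 = adj w0 w2" "adj a3 w0 = adj w0 a3" "adj b3 w0 = adj w0 b3" "adj w2 w1 = adj w1 w2" "adj a3 w1 = adj w1 a3" "adj b3 w1 = adj w1 b3" "adj a3 w2 = adj w2 a3" "adj b3 w2 = adj w2 b3" "adj b3 a3 = adj a3 b3"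
    by (auto intro: adj_sym)
  have F: "adj v0 v1" "adj v0 v2" "adj v0 v3" "\<not> adj v0 w0" "v0 \<noteq> w0" "w0 \<noteq> v0" "adj v0 w1" "adj v0 w2" "adj v0 a3" "\<not> adj v0 b3" "v0 \<noteq> b3" "b3 \<noteq> v0" "adj v1 v2" "adj v1 v3" "\<not> adj v1 w0" "v1 \<noteq> w0" "w0 \<noteq> v1" "\<not> adj v1 w1" "v1 \<noteq> w1" "w1 \<noteq> v1" "adj v1 w2" "adj v1 a3" "adj v1 b3" "adj v2 v3" "adj v2 w0" "\<not> adj v2 w1" "v2 \<noteq> w1" "w1 \<noteq> v2" "\<not> adj v2 w2" "v2 \<noteq> w2" "w2 \<noteq> v2" "adj v2 a3" "adj v2 b3" "adj v3 w0" "adj v3 w1" "\<not> adj v3 w2" "v3 \<noteq> w2" "w2 \<noteq> v3" "\<not> adj v3 a3" "v3 \<noteq> a3" "a3 \<noteq> v3" "adj v3 b3" "adj w0 w2" "adj a3 b3" "a3 \<noteq> b3" "b3 \<noteq> a3"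
    using o e ne by (auto simp: obs4_iff link4_def C)
  have D: "v0 \<noteq> v1" "v0 \<noteq> v2" "v0 \<noteq> v3" "v0 \<noteq> w1" "v0 \<noteq> w2" "v0 \<noteq> a3" "v1 \<noteq> v2" "v1 \<noteq> v3" "v1 \<noteq> w2" "v1 \<noteq> a3" "v1 \<noteq> b3" "v2 \<noteq> v3" "v2 \<noteq> w0" "v2 \<noteq> a3" "v2 \<noteq> b3" "v3 \<noteq> w0" "v3 \<noteq> w1" "v3 \<noteq> b3" "w0 \<noteq> w1" "w0 \<noteq> w2" "w0 \<noteq> a3" "w0 \<noteq> b3" "w1 \<noteq> w2" "w1 \<noteq> a3" "w1 \<noteq> b3" "w2 \<noteq> a3" "w2 \<noteq> b3"
    by (rule neq_by_adj[of "[v0, v1, v2, v3, w0, w1, w2, a3, b3]"], simp add: F C)+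
  have i0: "\<lbrakk>adj w2 b3\<rbrakk> \<Longrightarrow> ?thesis"
    by (rule improvable_obs[of adj "[(v0, w0, w0), (v1, w1, w1), (v2, w2, b3)]"])
      (simp_all add: obs3_iff link3_def C F D D[symmetric] cyc_unjoined_def)
  have i1: "\<lbrakk>adj w1 w2\<rbrakk> \<Longrightarrow> ?thesis"
    by (rule improvable_obs[of adj "[(v0, w0, w0), (v1, w1, w2), (v3, a3, b3)]"])
      (simp_all add: obs3_iff link3_def C F D D[symmetric] cyc_unjoined_def)
  have i2: "\<lbrakk>\<not> adj w1 w2; \<not> adj w2 b3\<rbrakk> \<Longrightarrow> ?thesis"
    by (rule improvable_obs[of adj "[(v0, w0, w0), (v1, w1, w1), (w2, b3, b3)]"])
      (simp_all add: obs3_iff link3_def C F D D[symmetric] cyc_unjoined_def)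
  show ?thesis using i0 i1 i2 by blast
qed

lemma special4_1212:
  assumes o: "obs adj [(v0, w0, w0), (v1, a1, b1), (v2, w2, w2), (v3, a3, b3)]"
    and e: "adj w0 w2"
    and ne: "a1 \<noteq> b1" "a3 \<noteq> b3"
  shows "improvable adj [(v0, w0, w0), (v1, a1, b1), (v2, w2, w2), (v3, a3, b3)]"
proof -
  have C: "adj v1 v0 = adj v0 v1" "adj v2 v0 = adj v0 v2" "adj v3 v0 = adj v0 v3" "adj w0 v0 = adj v0 w0" "adj a1 v0 = adj v0 a1" "adj b1 v0 = adj v0 b1" "adj w2 v0 = adj v0 w2" "adj a3 v0 = adj v0 a3" "adj b3 v0 = adj v0 b3" "adj v2 v1 = adj v1 v2" "adj v3 v1 = adj v1 v3" "adj w0 v1 = adj v1 w0" "adj a1 v1 = adj v1 a1" "adj b1 v1 = adj v1 b1" "adj w2 v1 = adj v1 w2" "adj a3 v1 = adj v1 a3" "adj b3 v1 = adj v1 b3" "adj v3 v2 = adj v2 v3" "adj w0 v2 = adj v2 w0" "adj a1 v2 = adj v2 a1" "adj b1 v2 = adj v2 b1" "adj w2 v2 = adj v2 w2" "adj a3 v2 = adj v2 a3" "adj b3 v2 = adj v2 b3" "adj w0 v3 = adj v3 w0" "adj a1 v3 = adj v3 a1" "adj b1 v3 = adj v3 b1" "adj w2 v3 = adj v3 w2" "adj a3 v3 = adj v3 a3" "adj b3 v3 = adj v3 b3" "adj a1 w0 = adj w0 a1" "adj b1 w0 = adj w0 b1" "adj w2 w0 = adj w0 w2" "adj a3 w0 =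 adj w0 a3" "adj b3 w0 = adj w0 b3" "adj b1 a1 = adj a1 b1" "adj w2 a1 = adj a1 w2" "adj a3 a1 = adj a1 a3" "adj b3 a1 = adj a1 b3" "adj w2 b1 = adj b1 w2" "adj a3 b1 = adj b1 a3" "adj b3 b1 = adj b1 b3" "adj a3 w2 = adj w2 a3" "adj b3 w2 = adj w2 b3" "adj b3 a3 = adj a3 b3"
    by (auto intro: adj_sym)
  have F: "adj v0 v1" "adj v0 v2" "adj v0 v3" "\<not> adj v0 w0" "v0 \<noteq> w0" "w0 \<noteq> v0" "adj v0 a1" "adj v0 b1" "adj v0 w2" "adj v0 a3" "\<not> adj v0 b3" "v0 \<noteq> b3" "b3 \<noteq> v0" "adj v1 v2" "adj v1 v3" "\<not> adj v1 w0" "v1 \<noteq> w0" "w0 \<noteq> v1" "\<not> adj v1 a1" "v1 \<noteq> a1" "a1 \<noteq> v1" "adj v1 b1" "adj v1 w2" "adj v1 a3" "adj v1 b3" "adj v2 v3" "adj v2 w0" "adj v2 a1" "\<not> adj v2 b1" "v2 \<noteq> b1" "b1 \<noteq> v2" "\<not> adj v2 w2" "v2 \<noteq> w2" "w2 \<noteq> v2" "adj v2 a3" "adj v2 b3" "adj v3 w0" "adj v3 a1" "adj v3 b1" "\<not> adj v3 w2" "v3 \<noteq> w2" "w2 \<noteq> v3" "\<not> adj v3 a3" "v3 \<noteq> a3" "a3 \<noteq> v3" "adj v3 b3" "adj w0 w2" "adj a1 b1" "adj a3 b3" "a1 \<noteq> b1" "b1 \<noteq> a1" "a3 \<noteq>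 b3" "b3 \<noteq> a3"
    using o e ne by (auto simp: obs4_iff link4_def C)
  have D: "v0 \<noteq> v1" "v0 \<noteq> v2" "v0 \<noteq> v3" "v0 \<noteq> a1" "v0 \<noteq> b1" "v0 \<noteq> w2" "v0 \<noteq> a3" "v1 \<noteq> v2" "v1 \<noteq> v3" "v1 \<noteq> b1" "v1 \<noteq> w2" "v1 \<noteq> a3" "v1 \<noteq> b3" "v2 \<noteq> v3" "v2 \<noteq> w0" "v2 \<noteq> a1" "v2 \<noteq> a3" "v2 \<noteq> b3" "v3 \<noteq> w0" "v3 \<noteq> a1" "v3 \<noteq> b1" "v3 \<noteq> b3" "w0 \<noteq> a1" "w0 \<noteq> b1" "w0 \<noteq> w2" "w0 \<noteq> a3" "w0 \<noteq> b3" "a1 \<noteq> w2" "a1 \<noteq> a3" "a1 \<noteq> b3" "b1 \<noteq> w2" "b1 \<noteq> a3" "b1 \<noteq> b3" "w2 \<noteq> a3" "w2 \<noteq> b3"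
    by (rule neq_by_adj[of "[v0, v1, v2, v3, w0, a1, b1, w2, a3, b3]"], simp add: F C)+
  have i0: "\<lbrakk>adj b1 b3\<rbrakk> \<Longrightarrow> ?thesis"
    by (rule improvable_obs[of adj "[(v0, w0, w0), (v1, a1, b1), (v2, b1, b3)]"])
      (simp_all add: obs3_iff link3_def C F D D[symmetric] cyc_unjoined_def)
  have i1: "\<lbrakk>adj w2 b3\<rbrakk> \<Longrightarrow> ?thesis"
    by (rule improvable_obs[of adj "[(v0, w0, w0), (v1, a1, b1), (v2, w2, b3)]"])
      (simp_all add: obs3_iff link3_def C F D D[symmetric] cyc_unjoined_def)
  have i2: "\<lbrakk>adj a1 w2\<rbrakk> \<Longrightarrow> ?thesis"
    by (rule improvable_obs[of adj "[(v0, w0, w0), (v1, a1, w2), (v3, a3, b3)]"])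
      (simp_all add: obs3_iff link3_def C F D D[symmetric] cyc_unjoined_def)
  \<comment> \<open>Again \<open>w2\<close> joins the core. Now \<open>a1\<close> misses
    \<open>v1\<close> and \<open>w2\<close>, and \<open>b3\<close> misses \<open>w2\<close> and
    \<open>v0\<close>, so each of them serves alone as a pair of type O1.\<close>
  have i3: "\<lbrakk>\<not> adj a1 w2; \<not> adj w2 b3\<rbrakk> \<Longrightarrow> ?thesis"
    by (rule improvable_obs[of adj "[(v0, w0, w0), (v1, a1, a1), (w2, b3, b3)]"])
      (simp_all add: obs3_iff link3_def C F D D[symmetric] cyc_unjoined_def)
  show ?thesis using i0 i1 i2 i3 by blast
qed

end

section \<open>Rewriting of windows, and the edges it leaves\<close>

text \<open>The reductions as a partial function on three consecutive items, the shortening ones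
  first. The inequalities between witnesses of different items exclude exchanges that would not
  lower \<open>cyc_unjoined\<close>. The result \<open>None\<close> means that no invalid edge leads
  from the first item to the other two (\<open>seg_None_near\<close>).\<close>

fun seg :: "('a \<Rightarrow> 'a \<Rightarrow> bool) \<Rightarrow> 'a item \<Rightarrow> 'a item \<Rightarrow> 'a item \<Rightarrow> 'a item list option" where
  "seg adj (v0, a0, b0) (v1, a1, b1) (v2, a2, b2) =
     (if adj a0 b2 then Some [(v0, a0, b2)]
      else if adj a0 b1 then Some [(v0, a0, b1), (v2, a2, b2)]
      else if a2 \<noteq> b2 \<and> adj a0 a2 then Some [(v0, a0, a2), (v2, a2, b2)]
      else if a0 \<noteq> b0 \<and> adj b0 b2 then Some [(v0, a0, b0), (v1, b0, b2)]
      else if a0 \<noteq> b0 \<and> a1 \<noteq> b1 \<and> b0 \<noteq> a1 \<and> adj b0 b1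
        then Some [(v0, a0, b0), (v1, b0, b1), (v2, a2, b2)]
      else if a0 \<noteq> b0 \<and> a1 \<noteq> b1 \<and> b0 \<noteq> a1 \<and> adj a0 a1
        then Some [(v0, a0, a1), (v1, a1, b1), (v2, a2, b2)]
      else if a0 \<noteq> b0 \<and> a2 \<noteq> b2 \<and> (b0 \<noteq> a1 \<or> b1 \<noteq> a2) \<and> adj b0 a2
        then Some [(v0, a0, b0), (v1, b0, a2), (v2, a2, b2)]
      else None)"

declare seg.simps [simp del]

definition pair_ok :: "('a \<Rightarrow> 'a \<Rightarrow> bool) \<Rightarrow> 'a item list \<Rightarrow> 'a \<Rightarrow> 'a \<Rightarrow> bool" where
  "pair_ok adj xs x y \<longleftrightarrow>
     missed adj (cores xs) x \<subseteq> missed adj (cores xs) y \<or>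
     missed adj (cores xs) y \<subseteq> missed adj (cores xs) x \<or>
     (\<exists>(v, a, b)\<in>set xs. x \<in> {a, b} \<and> y \<in> {a, b})"

lemma ess_iff: "ess adj xs \<longleftrightarrow> (\<forall>x\<in>wits xs. \<forall>y\<in>wits xs. adj x y \<longrightarrow> pair_ok adj xs x y)"
  by (simp add: ess_def pair_ok_def)

lemma pair_ok_commute: "pair_ok adj xs x y \<longleftrightarrow> pair_ok adj xs y x"
  unfolding pair_ok_def by blast

lemma pair_ok_cong: "set xs = set ys \<Longrightarrow> pair_ok adj xs x y \<longleftrightarrow> pair_ok adj ys x y"
  by (simp add: pair_ok_def cores_def)

lemma unjoined_append:
  "unjoined (xs @ ys) e = unjoined xs (next_wit ys e) + unjoined ys e"
proof (induction xs)
  case (Cons x xs)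
  have "next_wit (xs @ ys) e = next_wit xs (next_wit ys e)" by (cases xs) auto
  with Cons show ?case by (cases x) simp
qed simp

lemma cyc_unjoined_rotate: "cyc_unjoined (xs @ ys) = cyc_unjoined (ys @ xs)"
  by (cases xs; cases ys) (simp_all add: cyc_unjoined_def unjoined_append del: append.simps unjoined.simps, simp_all)

lemma unjoined_le: "unjoined xs e \<le> length xs"
  by (induction xs) auto

text \<open>Every replacement keeps the first and the last witness of the segment, so that the
  joins with the rest of the enumeration are not affected.\<close>

lemma cyc_unjoined_segment:
  assumes "seg adj i0 i1 i2 = Some ys"
  shows "length ys < 3 \<and> cyc_unjoined (ys @ K) \<le> cyc_unjoined (i0 # i1 # i2 # K) + 2 \<or>
    length ys = 3 \<and> cyc_unjoined (ys @ K) < cyc_unjoined (i0 # i1 # i2 # K)"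
proof -
  obtain v0 a0 b0 v1 a1 b1 v2 a2 b2 where i: "i0 = (v0,a0,b0)" "i1 = (v1,a1,b1)" "i2 = (v2,a2,b2)"
    by (metis prod.exhaust)
  from assms[unfolded i seg.simps] show ?thesis
    by (auto simp: i cyc_unjoined_def split: if_split_asm)
qed

definition wit_at :: "'a item list \<Rightarrow> nat \<Rightarrow> 'a set" where
  "wit_at xs i = {fst (snd (xs ! i)), snd (snd (xs ! i))}"

lemma wits_nth: "x \<in> wits xs \<longleftrightarrow> (\<exists>i<length xs. x \<in> wit_at xs i)"
proof -
  have "x \<in> wits xs \<longleftrightarrow> (\<exists>i\<in>set xs. x \<in> {fst (snd i), snd (snd i)})" by (force simp: wits_def)
  then show ?thesis unfolding wit_at_def by (metis in_set_conv_nth)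
qed

text \<open>Circular distance greater than two on a circle of \<open>k\<close> items. Subtraction is
  truncated, so only the alternative with the larger index first can hold.\<close>

definition far :: "nat \<Rightarrow> nat \<Rightarrow> nat \<Rightarrow> bool" where
  "far k i j \<longleftrightarrow> 2 < j - i \<and> j - i + 2 < k \<or> 2 < i - j \<and> i - j + 2 < k"

context adjacency
begin

text \<open>Both \<open>b0\<close> and \<open>a1\<close> miss \<open>v1\<close>, and a witness of
  type O2 misses nothing else. The other edges between the two items therefore join witnesses with
  comparable missed sets, or lie inside one pair because \<open>b0 = a1\<close>.\<close>

lemma near1:
  assumes o: "obs adj ((v0,a0,b0) # (v1,a1,b1) # K)"
    and x: "x = a0 \<or> x = b0" and y: "y = a1 \<or> y = b1" and xy: "adj x y" and n: "\<not> pair_ok adj ((v0,a0,b0) # (v1,a1,b1) # K) x y"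
  shows "x = a0 \<and> y = b1 \<or> a0 \<noteq> b0 \<and> a1 \<noteq> b1 \<and> b0 \<noteq> a1 \<and> (x = b0 \<and> y = b1 \<or> x = a0 \<and> y = a1)"
proof -
  have l: "link adj (cores ((v0,a0,b0) # (v1,a1,b1) # K)) (v0,a0,b0) v1" "link adj (cores ((v0,a0,b0) # (v1,a1,b1) # K)) (v1,a1,b1) (next_core K v0)"
    using o by (auto simp: obs_def)
  have t: "\<not> (x \<in> {a0, b0} \<and> y \<in> {a0, b0})" "\<not> (x \<in> {a1, b1} \<and> y \<in> {a1, b1})"
    "\<not> missed adj (cores ((v0,a0,b0) # (v1,a1,b1) # K)) x \<subseteq> missed adj (cores ((v0,a0,b0) # (v1,a1,b1) # K)) y"
    "\<not> missed adj (cores ((v0,a0,b0) # (v1,a1,b1) # K)) y \<subseteq> missed adj (cores ((v0,a0,b0) # (v1,a1,b1) # K)) x"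
    using n by (auto simp: pair_ok_def)
  show ?thesis using l t x y
    by (elim link_cases disjE) auto
qed

text \<open>An edge \<open>b0 a2\<close> with \<open>b0 = a1\<close> and \<open>b1 = a2\<close> is
  itself the pair of \<open>v1\<close>, hence valid; this explains the last side condition.\<close>

lemma near2:
  assumes n: "\<not> pair_ok adj ((v0,a0,b0) # (v1,a1,b1) # (v2,a2,b2) # K) x y"
    and x: "x = a0 \<or> x = b0" and y: "y = a2 \<or> y = b2"
  shows "x = a0 \<and> y = b2 \<or> a2 \<noteq> b2 \<and> x = a0 \<and> y = a2 \<or> a0 \<noteq> b0 \<and> x = b0 \<and> y = b2 \<or>
    a0 \<noteq> b0 \<and> a2 \<noteq> b2 \<and> (b0 \<noteq> a1 \<or> b1 \<noteq> a2) \<and> x = b0 \<and> y = a2"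
  using assms by (auto simp: pair_ok_def)

lemma seg_obs:
  assumes "obs adj (i0 # i1 # i2 # K)" "2 \<le> length K" "seg adj i0 i1 i2 = Some ys"
  shows "obs adj (ys @ K)"
proof -
  obtain v0 a0 b0 v1 a1 b1 v2 a2 b2 where i: "i0 = (v0,a0,b0)" "i1 = (v1,a1,b1)" "i2 = (v2,a2,b2)"
    by (metis prod.exhaust)
  have K: "K \<noteq> []" using assms(2) by auto
  note o = assms(1)[unfolded i]
  show ?thesis
    using assms(3) red1[OF o K] red2[OF o] red3[OF o] red5[OF o assms(2)] red6[OF o K] red7[OF o K] red8[OF o]
    unfolding i by (auto simp: seg.simps split: if_splits)
qed

lemma seg_verts:
  assumes "seg adj i0 i1 i2 = Some ys"
  shows "verts_of (ys @ K) \<subseteq> verts_of (i0 # i1 # i2 # K)"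
  using assms by (cases i0; cases i1; cases i2) (auto simp: seg.simps split: if_splits)

lemma seg_None_near:
  assumes o: "obs adj ((v0,a0,b0) # (v1,a1,b1) # (v2,a2,b2) # K)"
    and s: "seg adj (v0,a0,b0) (v1,a1,b1) (v2,a2,b2) = None"
    and x: "x = a0 \<or> x = b0" and y: "y \<in> {a1, b1, a2, b2}" and xy: "adj x y"
  shows "pair_ok adj ((v0,a0,b0) # (v1,a1,b1) # (v2,a2,b2) # K) x y"
proof (rule ccontr)
  assume n: "\<not> ?thesis"
  show False
  proof (cases "y = a1 \<or> y = b1")
    case True
    from near1[OF o x True xy n] s xy show False by (auto simp: seg.simps split: if_splits)
  next
    case False
    then have "y = a2 \<or> y = b2" using y by auto
    from near2[OF n x this] s xy show False by (auto simp: seg.simps split: if_splits)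
  qed
qed

definition clean :: "'a item list \<Rightarrow> bool" where
  "clean xs \<longleftrightarrow> (\<forall>i<length xs.
     seg adj (xs ! i) (xs ! (Suc i mod length xs)) (xs ! ((i + 2) mod length xs)) = None)"

lemma obs_rotate_list: "obs adj xs \<Longrightarrow> obs adj (rotate i xs)"
proof (induction i)
  case (Suc i)
  then show ?case
    using obs_rotate[of adj "[hd (rotate i xs)]" "tl (rotate i xs)"]
    by (cases "rotate i xs") (auto simp: rotate1_hd_tl)
qed simp

lemma rotate_split:
  assumes "i < length xs" "t < length xs" "0 < t"
  shows "\<exists>P S. rotate i xs = xs ! i # P @ xs ! ((i + t) mod length xs) # S \<and> length P = t - 1 \<and>
    length S = length xs - t - 1"
proof -
  let ?r = "rotate i xs"
  have "?r = ?r ! 0 # tl ?r" using assms by (metis hd_conv_nth length_greater_0_conv length_rotate less_nat_zero_code list.collapse list.size(3))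
  moreover have "tl ?r = take (t - 1) (tl ?r) @ tl ?r ! (t - 1) # drop t (tl ?r)"
    using assms id_take_nth_drop[of "t - 1" "tl ?r"] by simp
  moreover have "tl ?r ! (t - 1) = ?r ! t" using assms by (simp add: nth_tl)
  moreover have "?r ! t = xs ! ((i + t) mod length xs)" "?r ! 0 = xs ! i"
    using assms nth_rotate[of t xs i] nth_rotate[of 0 xs i] by (fastforce simp: add.commute)+
  ultimately show ?thesis using assms
    by (intro exI[of _ "take (t - 1) (tl ?r)"] exI[of _ "drop t (tl ?r)"]) (auto simp: min_def)
qed

lemma rotate_split3:
  assumes "i < length xs" "3 \<le> length xs"
  shows "\<exists>K. rotate i xs = xs ! i # xs ! (Suc i mod length xs) # xs ! ((i + 2) mod length xs) # K"
proof -
  obtain P S where 1: "rotate i xs = xs ! i # P @ xs ! ((i + 1) mod length xs) # S" "length P = 0" "length S = length xs - 2"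
    using rotate_split[of i xs 1] assms by auto
  then obtain s S' where S: "S = s # S'" using assms by (cases S) auto
  have "rotate i xs ! 2 = s" using 1 S by simp
  then have "s = xs ! ((i + 2) mod length xs)" using nth_rotate[of 2 xs i] assms by (simp add: add.commute)
  then show ?thesis using 1 S by auto
qed

lemma clean_near:
  assumes o: "obs adj xs" and c: "clean xs" and i: "i < length xs" and t: "t \<in> {1, 2}"
    and x: "x \<in> wit_at xs i" and y: "y \<in> wit_at xs ((i + t) mod length xs)" and xy: "adj x y"
  shows "pair_ok adj xs x y"
proof -
  obtain K where K: "rotate i xs = xs ! i # xs ! (Suc i mod length xs) # xs ! ((i + 2) mod length xs) # K"
    using rotate_split3[OF i] o by (auto simp: obs_def)
  obtain v0 a0 b0 v1 a1 b1 v2 a2 b2 where e: "xs ! i = (v0,a0,b0)" "xs ! (Suc i mod length xs) = (v1,a1,b1)"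
     "xs ! ((i + 2) mod length xs) = (v2,a2,b2)" by (metis prod.exhaust)
  have "obs adj (rotate i xs)" using o by (rule obs_rotate_list)
  moreover have "seg adj (xs ! i) (xs ! (Suc i mod length xs)) (xs ! ((i + 2) mod length xs)) = None"
    using c i unfolding clean_def by auto
  moreover have "x = a0 \<or> x = b0" using x by (simp add: wit_at_def e)
  moreover have "y \<in> {a1, b1, a2, b2}"
  proof (cases "t = 1")
    case True
    then show ?thesis using y by (auto simp: wit_at_def e)
  next
    case False
    then have "t = 2" using t by simp
    then show ?thesis using y unfolding wit_at_def \<open>t = 2\<close> e(3) by auto
  qed
  ultimately have "pair_ok adj (rotate i xs) x y"
    using seg_None_near[of v0 a0 b0 v1 a1 b1 v2 a2 b2 K x y] xy unfolding K e by blast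
  then show ?thesis using pair_ok_cong[of "rotate i xs" xs] by simp
qed

text \<open>This is what confines the search for invalid edges to far items. Of two near items one
  comes first along the shorter way round, and \<open>clean_near\<close> applies to the window that
  starts there.\<close>

lemma clean_pair:
  assumes o: "obs adj xs" and c: "clean xs" and ij: "i < length xs" "j < length xs"
    and xy: "x \<in> wit_at xs i" "y \<in> wit_at xs j" "adj x y" and f: "\<not> far (length xs) i j"
  shows "pair_ok adj xs x y"
proof -
  have main: "pair_ok adj xs x y" if "i \<le> j" "j < length xs" "x \<in> wit_at xs i" "y \<in> wit_at xs j" "adj x y" "\<not> far (length xs) i j" for i j x y
  proof -
    have "i = j \<or> j - i = 1 \<or> j - i = 2 \<or> length xs - (j - i) = 1 \<or> length xs - (j - i) = 2 \<or> far (length xs) i j"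
      using that(1,2) unfolding far_def by linarith
    then consider "i = j" | "j - i \<in> {1,2}" "i \<noteq> j" | "length xs - (j - i) \<in> {1,2}" "i \<noteq> j" | "far (length xs) i j"
      by (cases "i = j") auto
    then show ?thesis
    proof cases
      case 1
      obtain v a b where e: "xs ! i = (v, a, b)" by (cases "xs ! i")
      then have "(v, a, b) \<in> set xs" using that by (metis nth_mem order.strict_trans1)
      moreover have "x \<in> {a, b}" "y \<in> {a, b}" using that 1 e by (auto simp: wit_at_def)
      ultimately show ?thesis unfolding pair_ok_def by blast
    next
      case 2
      have "(i + (j - i)) mod length xs = j" using that by simp
      then show ?thesis using clean_near[OF o c, of i "j - i" x y] 2 that by auto
    next
      case 3
      have "(j + (length xs - (j - i))) mod length xs = i"
      proof -
        have "j + (length xs - (j - i)) = length xs + i" using that by auto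
        then show ?thesis using that by simp
      qed
      then have "pair_ok adj xs y x"
        using clean_near[OF o c, of j "length xs - (j - i)" y x] 3 that adj_sym by auto
      then show ?thesis using pair_ok_commute by metis
    next
      case 4
      then show ?thesis using that by auto
    qed
  qed
  show ?thesis
    using main[of i j x y] main[of j i y x] ij xy f adj_sym pair_ok_commute[of adj xs x y]
    by (cases "i \<le> j") (auto simp: far_def)
qed

section \<open>Every invalid edge gives an improvement\<close>

lemma improvable_rotate: "improvable adj (rotate i xs) \<Longrightarrow> improvable adj xs"
proof -
  have "cyc_unjoined (rotate i xs) = cyc_unjoined xs" for i
    using cyc_unjoined_rotate[of "drop (i mod length xs) xs" "take (i mod length xs) xs"]
    by (simp add: rotate_drop_take)
  moreover have "cores (rotate i xs) = cores xs" "wits (rotate i xs) = wits xs"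
    by (auto simp: cores_def wits_def)
  ultimately show "improvable adj (rotate i xs) \<Longrightarrow> improvable adj xs" by (simp add: improvable_def)
qed

lemma improvable_exchange:
  assumes o: "obs adj (i0 # ys @ K)" and v: "verts_of (i0 # ys @ K) \<subseteq> verts_of xs"
    and "length (i0 # ys @ K) \<le> length xs" and "length (i0 # ys @ K) = length xs \<Longrightarrow> cyc_unjoined (i0 # ys @ K) < cyc_unjoined xs"
  shows "improvable adj xs"
  using assms improvable_obs[OF o v] by linarith

text \<open>Reversing the circle swaps the two ends of every pair. It reduces the case of a pair of
  type O2 followed by one of type O1 to the opposite order.\<close>

lemma mirror3:
  "obs adj [(v0,a0,b0),(v1,a1,b1),(v2,a2,b2)] \<Longrightarrow> obs adj [(v2,b1,a1),(v1,b0,a0),(v0,b2,a2)]"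
  unfolding obs3_iff link3_def using adj_commute by blast

lemma special3_12:
  assumes "obs adj [(v0,a0,b0),(v1,a1,b1),(v2,a2,b2)]" "adj a0 b1" "a0 = b0" "a1 \<noteq> b1"
  shows "improvable adj [(v0,a0,b0),(v1,a1,b1),(v2,a2,b2)]"
  using assms special3_121[of v0 a0 v1 a1 b1 v2 a2] special3_122[of v0 a0 v1 a1 b1 v2 a2 b2]
    special3_122_joined[of v0 a0 v1 a1 b1 v2 b2]
  by (cases "a2 = b2"; cases "b1 = a2") auto

lemma improvable3:
  assumes o: "obs adj [(v0,a0,b0),(v1,a1,b1),(v2,a2,b2)]"
    and x: "x = a0 \<or> x = b0" and y: "y = a1 \<or> y = b1" and xy: "adj x y" and n: "\<not> pair_ok adj [(v0,a0,b0),(v1,a1,b1),(v2,a2,b2)] x y"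
  shows "improvable adj [(v0,a0,b0),(v1,a1,b1),(v2,a2,b2)]"
proof -
  from near1[OF o x y xy n] consider "x = a0" "y = b1"
    | "a0 \<noteq> b0" "a1 \<noteq> b1" "b0 \<noteq> a1" "x = b0" "y = b1" | "a0 \<noteq> b0" "a1 \<noteq> b1" "b0 \<noteq> a1" "x = a0" "y = a1" by auto
  then show ?thesis
  proof cases
    case 1
    then have e: "adj a0 b1" using xy by simp
    consider "a0 = b0" "a1 = b1" | "a0 = b0" "a1 \<noteq> b1" | "a0 \<noteq> b0" "a1 = b1" | "a0 \<noteq> b0" "a1 \<noteq> b1" by auto
    then show ?thesis
    proof cases
      case 1
      then show ?thesis using o e special3_111[of v0 a0 v1 a1 v2 a2] special3_112[of v0 a0 v1 a1 v2 a2 b2]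
        by (cases "a2 = b2") auto
    next
      case 2
      then show ?thesis using special3_12 o e by blast
    next
      case 3
      have "improvable adj [(v2,b1,a1),(v1,b0,a0),(v0,b2,a2)]"
        by (rule special3_12[OF mirror3[OF o] adj_sym[OF e]]) (use 3 in auto)
      moreover have "verts_of [(v2,b1,a1),(v1,b0,a0),(v0,b2,a2)] = verts_of [(v0,a0,b0),(v1,a1,b1),(v2,a2,b2)]" by auto
      moreover have "cyc_unjoined [(v2,b1,a1),(v1,b0,a0),(v0,b2,a2)] = cyc_unjoined [(v0,a0,b0),(v1,a1,b1),(v2,a2,b2)]"
        by (auto simp: cyc_unjoined_def)
      ultimately show ?thesis by (simp add: improvable_def)
    next
      case 4
      have r: "rotate 1 [(v0,a0,b0),(v1,a1,b1),(v2,a2,b2)] = [(v1,a1,b1),(v2,a2,b2),(v0,a0,b0)]" by simp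
      \<comment> \<open>Starting from \<open>v1\<close>, the edge \<open>a0 b1\<close> joins the end
        of the first pair to the start of the third one, so \<open>red8\<close> can exchange the
        pair of \<open>v2\<close>.\<close>
      have o': "obs adj [(v1,a1,b1),(v2,a2,b2),(v0,a0,b0)]" using obs_rotate_list[OF o, of 1] by simp
      have "\<not> (b1 = a2 \<and> b2 = a0)" using n 1 unfolding pair_ok_def by auto
      then have "improvable adj [(v1,a1,b1),(v2,a2,b2),(v0,a0,b0)]"
        using 4 red8[OF o'] adj_sym[OF e]
        by (intro improvable_obs[of adj "[(v1,a1,b1),(v2,b1,a0),(v0,a0,b0)]"]) (auto simp: cyc_unjoined_def)
      then show ?thesis using improvable_rotate[of 1 "[(v0,a0,b0),(v1,a1,b1),(v2,a2,b2)]"] by simp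
    qed
  next
    case 2
    then show ?thesis using red2[of v0 a0 b0 v1 a1 b1 v2 a2 b2 "[]"] o xy
      by (intro improvable_obs[of adj "[(v0,a0,b0),(v1,b0,b1),(v2,a2,b2)]"]) (auto simp: cyc_unjoined_def)
  next
    case 3
    then show ?thesis using red3[of v0 a0 b0 v1 a1 b1 v2 a2 b2 "[]"] o xy
      by (intro improvable_obs[of adj "[(v0,a0,a1),(v1,a1,b1),(v2,a2,b2)]"]) (auto simp: cyc_unjoined_def)
  qed
qed

lemma improvable_near1:
  assumes o: "obs adj ((v0,a0,b0) # (v1,a1,b1) # (v2,a2,b2) # K)" and K: "K \<noteq> []"
    and x: "x = a0 \<or> x = b0" and y: "y = a1 \<or> y = b1" and xy: "adj x y" and n: "\<not> pair_ok adj ((v0,a0,b0) # (v1,a1,b1) # (v2,a2,b2) # K) x y"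
  shows "improvable adj ((v0,a0,b0) # (v1,a1,b1) # (v2,a2,b2) # K)"
proof -
  from near1[OF o x y xy n] consider "x = a0" "y = b1"
    | "a0 \<noteq> b0" "a1 \<noteq> b1" "b0 \<noteq> a1" "x = b0" "y = b1" | "a0 \<noteq> b0" "a1 \<noteq> b1" "b0 \<noteq> a1" "x = a0" "y = a1" by auto
  then show ?thesis
  proof cases
    case 1
    then show ?thesis using red1[OF o K] xy
      by (intro improvable_obs[of adj "(v0,a0,b1) # (v2,a2,b2) # K"]) auto
  next
    case 2
    then show ?thesis using red2[OF o] xy
      by (intro improvable_obs[of adj "(v0,a0,b0) # (v1,b0,b1) # (v2,a2,b2) # K"]) (auto simp: cyc_unjoined_def)
  next
    case 3
    then show ?thesis using red3[OF o] xy
      by (intro improvable_obs[of adj "(v0,a0,a1) # (v1,a1,b1) # (v2,a2,b2) # K"]) (auto simp: cyc_unjoined_def)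
  qed
qed

lemma improvable_near2:
  assumes o: "obs adj ((v0,a0,b0) # (v1,a1,b1) # (v2,a2,b2) # K)" and K: "K \<noteq> []"
    and x: "x = a0 \<or> x = b0" and y: "y = a2 \<or> y = b2" and xy: "adj x y" and n: "\<not> pair_ok adj ((v0,a0,b0) # (v1,a1,b1) # (v2,a2,b2) # K) x y"
  shows "improvable adj ((v0,a0,b0) # (v1,a1,b1) # (v2,a2,b2) # K) \<or> x = a0 \<and> y = b2"
proof -
  from near2[OF n x y] consider "x = a0" "y = b2" | "a2 \<noteq> b2" "x = a0" "y = a2" | "a0 \<noteq> b0" "x = b0" "y = b2"
    | "a0 \<noteq> b0" "a2 \<noteq> b2" "b0 \<noteq> a1 \<or> b1 \<noteq> a2" "x = b0" "y = a2" by auto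
  then show ?thesis
  proof cases
    case 2
    then show ?thesis using red7[OF o K] xy
      by (intro disjI1 improvable_obs[of adj "(v0,a0,a2) # (v2,a2,b2) # K"]) auto
  next
    case 3
    then show ?thesis using red6[OF o K] xy
      by (intro disjI1 improvable_obs[of adj "(v0,a0,b0) # (v1,b0,b2) # K"]) auto
  next
    case 4
    then show ?thesis using red8[OF o] xy
      by (intro disjI1[of "improvable _ _"] improvable_obs[of adj "(v0,a0,b0) # (v1,b0,a2) # (v2,a2,b2) # K"]) (auto simp: cyc_unjoined_def)
  qed simp
qed

text \<open>On a circle of four items, distance two is distance two both ways. What
  \<open>near2\<close> leaves open from one side is \<open>x = a0\<close>, \<open>y = b2\<close>,
  from the other \<open>x = b0\<close>, \<open>y = a2\<close>; so both pairs are of type O1, which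
  is the situation of the four-vertex cases.\<close>

lemma improvable4:
  assumes o: "obs adj [(v0,a0,b0),(v1,a1,b1),(v2,a2,b2),(v3,a3,b3)]"
    and x: "x = a0 \<or> x = b0" and y: "y = a2 \<or> y = b2" and xy: "adj x y" and n: "\<not> pair_ok adj [(v0,a0,b0),(v1,a1,b1),(v2,a2,b2),(v3,a3,b3)] x y"
  shows "improvable adj [(v0,a0,b0),(v1,a1,b1),(v2,a2,b2),(v3,a3,b3)]"
proof -
  let ?ys = "[(v2,a2,b2),(v3,a3,b3),(v0,a0,b0),(v1,a1,b1)]"
  have r: "rotate 2 [(v0,a0,b0),(v1,a1,b1),(v2,a2,b2),(v3,a3,b3)] = ?ys" by (simp add: numeral_eq_Suc)
  have o': "obs adj ?ys" using obs_rotate_list[OF o, of 2] unfolding r .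
  have n': "\<not> pair_ok adj ?ys y x"
    using n pair_ok_commute[of adj "[(v0,a0,b0),(v1,a1,b1),(v2,a2,b2),(v3,a3,b3)]"] pair_ok_cong[of "[(v0,a0,b0),(v1,a1,b1),(v2,a2,b2),(v3,a3,b3)]" ?ys adj] by auto
  have A: "improvable adj [(v0,a0,b0),(v1,a1,b1),(v2,a2,b2),(v3,a3,b3)] \<or> x = a0 \<and> y = b2" using improvable_near2[OF o _ x y xy n] by simp
  have B: "improvable adj [(v0,a0,b0),(v1,a1,b1),(v2,a2,b2),(v3,a3,b3)] \<or> y = a2 \<and> x = b0"
    using improvable_near2[OF o' _ y x adj_sym[OF xy] n'] improvable_rotate[of 2 "[(v0,a0,b0),(v1,a1,b1),(v2,a2,b2),(v3,a3,b3)]", unfolded r] by auto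
  show ?thesis
  proof (rule ccontr)
    assume c: "\<not> ?thesis"
    with A B have e: "a0 = b0" "a2 = b2" "adj a0 a2" using xy by auto
    show False
    proof (cases "a1 = b1")
      case True
      then show False using c o e special4_1111[of v0 a0 v1 a1 v2 a2 v3 a3] special4_1112[of v0 a0 v1 a1 v2 a2 v3 a3 b3]
        by (cases "a3 = b3") auto
    next
      case n1: False
      show False
      proof (cases "a3 = b3")
        case True
        then have "improvable adj ?ys"
          using o' e n1 special4_1112[of v2 a2 v3 a3 v0 a0 v1 a1 b1] adj_commute[of a0 a2] by auto
        then show False using improvable_rotate[of 2 "[(v0,a0,b0),(v1,a1,b1),(v2,a2,b2),(v3,a3,b3)]", unfolded r] c by auto
      next
        case False
        then show False using c o e n1 special4_1212[of v0 a0 v1 a1 b1 v2 a2 v3 a3 b3] by auto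
      qed
    qed
  qed
qed

lemma improvable_far:
  assumes o: "obs adj ((v0,a0,b0) # P @ (v,a,b) # S)" and P: "2 \<le> length P" and S: "2 \<le> length S"
    and x: "x = a0 \<or> x = b0" and y: "y = a \<or> y = b" and xy: "adj x y"
  shows "improvable adj ((v0,a0,b0) # P @ (v,a,b) # S)"
proof -
  let ?K = "(if x = b0 then P else (v0,a0,b0) # P) @ (if y = a then [] else [(v,a,b)])"
  let ?p = "if y = a then v else fst (hd S)"
  have S': "S \<noteq> []" using S by auto
  then have "fst (hd S) \<in> cores S" by (cases S) auto
  then show ?thesis
    using far_cut[OF o P S' x y xy refl refl] x y S
    by (intro improvable_obs[of adj "?K @ [(?p, y, x)]"]) auto
qed

lemma improvable_distance:
  assumes o: "obs adj xs" and i: "i < length xs" and t: "0 < t" "t \<le> length xs - t"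
    and x: "x \<in> wit_at xs i" and y: "y \<in> wit_at xs ((i + t) mod length xs)" and xy: "adj x y"
    and n: "\<not> pair_ok adj xs x y"
  shows "improvable adj xs"
proof -
  have k: "3 \<le> length xs" using o by (simp add: obs_def)
  have t': "t < length xs" using t by linarith
  obtain P S where r: "rotate i xs = xs ! i # P @ xs ! ((i + t) mod length xs) # S"
    and P: "length P = t - 1" and S: "length S = length xs - t - 1"
    using rotate_split[OF i t' t(1)] by blast
  obtain v0 a0 b0 where e0: "xs ! i = (v0,a0,b0)" by (metis prod.exhaust)
  obtain v a b where e: "xs ! ((i + t) mod length xs) = (v,a,b)" by (metis prod.exhaust)
  have o': "obs adj ((v0,a0,b0) # P @ (v,a,b) # S)"
    using obs_rotate_list[OF o, of i] unfolding r e0 e .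
  have n': "\<not> pair_ok adj ((v0,a0,b0) # P @ (v,a,b) # S) x y"
    using n pair_ok_cong[OF set_rotate[of i xs], of adj x y] unfolding r e0 e by blast
  have x': "x = a0 \<or> x = b0" and y': "y = a \<or> y = b" using x y by (simp_all add: wit_at_def e0 e)
  \<comment> \<open>Bypassing one core vertex takes at least four of them, bypassing two takes five;
    this separates the small lengths.\<close>
  consider "t = 1" "length xs = 3" | "t = 1" "length xs \<ge> 4" | "t = 2" "length xs = 4" | "t = 2" "length xs \<ge> 5" | "t \<ge> 3"
    using t k by linarith
  then have "improvable adj ((v0,a0,b0) # P @ (v,a,b) # S)"
  proof cases
    case 1
    then obtain s where s: "P = []" "S = [s]" using P S by (cases S) auto
    obtain v2 a2 b2 where "s = (v2,a2,b2)" by (metis prod.exhaust)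
    then show ?thesis using improvable3[of v0 a0 b0 v a b v2 a2 b2 x y] o' n' x' y' xy s by simp
  next
    case 2
    then obtain s S' where s: "P = []" "S = s # S'" "S' \<noteq> []" using P S by (cases S; cases "tl S") auto
    obtain v2 a2 b2 where "s = (v2,a2,b2)" by (metis prod.exhaust)
    then show ?thesis using improvable_near1[of v0 a0 b0 v a b v2 a2 b2 S' x y] o' n' x' y' xy s by simp
  next
    case 3
    then obtain p s where s: "P = [p]" "S = [s]" using P S by (cases P; cases S) auto
    obtain v1 a1 b1 v2 a2 b2 where "p = (v1,a1,b1)" "s = (v2,a2,b2)" by (metis prod.exhaust)
    then show ?thesis using improvable4[of v0 a0 b0 v1 a1 b1 v a b v2 a2 b2 x y] o' n' x' y' xy s by simp
  next
    case 4
    then obtain p where p: "P = [p]" using P by (cases P) auto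
    have S2: "2 \<le> length S" "S \<noteq> []" using S 4 by auto
    obtain v1 a1 b1 where p': "p = (v1,a1,b1)" by (metis prod.exhaust)
    have "improvable adj ((v0,a0,b0) # P @ (v,a,b) # S)" if "x = a0" "y = b"
      using red5[of v0 a0 b0 v1 a1 b1 v a b S] o' S2 xy that p p'
      by (intro improvable_obs[of adj "(v0,a0,b) # S"]) auto
    then show ?thesis using improvable_near2[of v0 a0 b0 v1 a1 b1 v a b S x y] o' n' x' y' xy p p' S2 by auto
  next
    case 5
    then show ?thesis using improvable_far[OF o' _ _ x' y' xy] P S t by simp
  qed
  then have "improvable adj (rotate i xs)" unfolding r e0 e .
  then show ?thesis by (rule improvable_rotate)
qed

lemma improvable_if_not_ess:
  assumes o: "obs adj xs" and n: "\<not> ess adj xs"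
  shows "improvable adj xs"
proof -
  obtain x y where w: "x \<in> wits xs" "y \<in> wits xs" and xy: "adj x y" and n: "\<not> pair_ok adj xs x y"
    using n unfolding ess_iff by blast
  obtain i j where ij: "i < length xs" "j < length xs" "x \<in> wit_at xs i" "y \<in> wit_at xs j"
    using w unfolding wits_nth by blast
  have n': "\<not> pair_ok adj xs y x" using n pair_ok_commute by metis
  have main: "improvable adj xs" if "i < j" "j < length xs" "x \<in> wit_at xs i" "y \<in> wit_at xs j" "adj x y"
    "\<not> pair_ok adj xs x y" "\<not> pair_ok adj xs y x" for i j x y
  proof (cases "j - i \<le> length xs - (j - i)")
    case True
    have "(i + (j - i)) mod length xs = j" using that by simp
    then show ?thesis using improvable_distance[OF o, of i "j - i" x y] True that by auto
  next
    case False
    have "j + (length xs - (j - i)) = length xs + i" using that by auto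
    then have "(j + (length xs - (j - i))) mod length xs = i" using that by simp
    then show ?thesis
      using improvable_distance[OF o, of j "length xs - (j - i)" y x] False that adj_sym[of x y] by auto
  qed
  have "i \<noteq> j"
  proof
    assume e: "i = j"
    obtain v a b where v: "xs ! i = (v, a, b)" by (cases "xs ! i")
    then have "(v, a, b) \<in> set xs" using ij by (metis nth_mem)
    then show False using n ij e v unfolding pair_ok_def wit_at_def by auto
  qed
  then show ?thesis
    using main[of i j x y] main[of j i y x] ij xy n n' adj_sym[of x y] by (cases "i < j") auto
qed

theorem obs_solution:
  assumes "obs adj xs"
  shows "listed adj (verts_of xs) \<or> (\<exists>ys. obs adj ys \<and> ess adj ys \<and> verts_of ys \<subseteq> verts_of xs)"
  using assms
\<comment> \<open>Since \<open>cyc_unjoined\<close> is at most the length, the quadratic term makes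
  this number decrease along the lexicographic order.\<close>
proof (induction xs rule: measure_induct_rule[where f = "\<lambda>xs. (length xs) * (length xs + 1) + cyc_unjoined xs"])
  case (less xs)
  show ?case
  proof (cases "ess adj xs")
    case False
    from improvable_if_not_ess[OF less.prems this]
    consider "listed adj (verts_of xs)" | ys where "obs adj ys" "verts_of ys \<subseteq> verts_of xs"
      "length ys < length xs \<or> length ys = length xs \<and> cyc_unjoined ys < cyc_unjoined xs"
      unfolding improvable_def by blast
    then show ?thesis
    proof cases
      case (2 ys)
      note ys = 2(1,2) and l = 2(3)
      have "length ys * (length ys + 1) + cyc_unjoined ys < length xs * (length xs + 1) + cyc_unjoined xs"
        using l
      proof
        assume lt: "length ys < length xs"
        have "cyc_unjoined ys \<le> length ys" by (simp add: cyc_unjoined_def unjoined_le)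
        moreover have "length ys * (length ys + 1) + length ys < (length ys + 1) * (length ys + 1 + 1)" by simp
        moreover have "(length ys + 1) * (length ys + 1 + 1) \<le> length xs * (length xs + 1)"
          using lt by (intro mult_mono) auto
        ultimately show ?thesis by linarith
      qed simp
      from less.IH[OF this ys(1)] ys(2) show ?thesis unfolding listed_def by (meson subset_trans)
    qed auto
  qed (use less.prems in blast)
qed

end

section \<open>Translation from and to enumerations of a graph\<close>

abbreviation gadj :: "'a graph \<Rightarrow> 'a \<Rightarrow> 'a \<Rightarrow> bool" where
  "gadj G u v \<equiv> {u, v} \<in> edges G"

lemma adjacency_gadj: "simple_graph G \<Longrightarrow> adjacency (gadj G)"
  unfolding simple_graph_def by standard (auto simp: insert_commute doubleton_eq_iff)

text \<open>On a single witness \<open>hd\<close> and \<open>last\<close> agree, which gives the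
  encoding of type O1.\<close>

definition items_of :: "'a enumeration \<Rightarrow> 'a item list" where
  "items_of Q = map2 (\<lambda>v W. (v, hd W, last W)) (fst Q) (snd Q)"

definition enum_of :: "'a item list \<Rightarrow> 'a enumeration" where
  "enum_of xs = (map fst xs, map (\<lambda>(v, a, b). if a = b then [a] else [a, b]) xs)"

lemma core_enum_of: "core (enum_of xs) = cores xs"
  by (simp add: core_def enum_of_def cores_def)

lemma witnesses_enum_of: "witnesses (enum_of xs) = wits xs"
proof -
  have "set (case x of (v, a, b) \<Rightarrow> if a = b then [a] else [a, b]) = (case x of (v, a, b) \<Rightarrow> {a, b})" for x :: "'a item"
    by (cases x) auto
  then show ?thesis by (simp add: witnesses_def enum_of_def wits_def)
qed

lemma non_nbrs_missed: "C \<subseteq> verts G \<Longrightarrow> non_nbrs G y \<inter> C = missed (gadj G) C y"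
  by (auto simp: non_nbrs_def missed_def insert_commute)

lemma chain_nth:
  "chain adj C xs e \<longleftrightarrow> (\<forall>i<length xs. link adj C (xs ! i) (if Suc i < length xs then fst (xs ! Suc i) else e))"
proof (induction xs)
  case (Cons x xs)
  have "next_core xs e = (if Suc 0 < length (x # xs) then fst ((x # xs) ! Suc 0) else e)"
    by (cases xs) auto
  then show ?case unfolding chain.simps Cons.IH by (auto simp: All_less_Suc2)
qed simp

lemma mod_Suc_nth:
  assumes "i < length xs"
  shows "(if Suc i < length xs then f (xs ! Suc i) else f (hd xs)) = f (xs ! (Suc i mod length xs))"
proof (cases "Suc i < length xs")
  case False
  then have "Suc i = length xs" "xs \<noteq> []" using assms by auto
  then show ?thesis by (simp add: hd_conv_nth)
qed simp

lemma obs_nth: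
  "obs adj xs \<longleftrightarrow> 3 \<le> length xs \<and> distinct (map fst xs) \<and>
     (\<forall>u\<in>cores xs. \<forall>v\<in>cores xs. u \<noteq> v \<longrightarrow> adj u v) \<and>
     (\<forall>i<length xs. link adj (cores xs) (xs ! i) (fst (xs ! (Suc i mod length xs))))"
  unfolding obs_def chain_nth using mod_Suc_nth[of _ xs fst] by auto

lemma obstacle_enum_items:
  assumes G: "simple_graph G" and Q: "obstacle_enum_in G Q"
  shows "obs (gadj G) (items_of Q)" "verts_of (items_of Q) \<subseteq> verts G" "length (items_of Q) = length (fst Q)"
proof -
  interpret adjacency "gadj G" by (rule adjacency_gadj[OF G])
  let ?vs = "fst Q" and ?Ws = "snd Q" and ?xs = "items_of Q"
  have q: "3 \<le> length ?vs" "distinct ?vs" "clique G (set ?vs)" "length ?Ws = length ?vs"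
    "\<And>i. i < length ?vs \<Longrightarrow> witness_enum G (set ?vs) (?vs ! i) (?vs ! (Suc i mod length ?vs)) (?Ws ! i)"
    using Q by (auto simp: obstacle_enum_in_def Let_def)
  have len: "length ?xs = length ?vs" and fsts: "map fst ?xs = ?vs"
    using q(4) by (simp_all add: items_of_def map_fst_zip comp_def case_prod_beta)
  then show "length (items_of Q) = length (fst Q)" by simp
  have cs: "cores ?xs = set ?vs" unfolding cores_def fsts[symmetric] by simp
  have sub: "set ?vs \<subseteq> verts G" using q(3) by (simp add: clique_def)
  have nth: "?xs ! i = (?vs ! i, hd (?Ws ! i), last (?Ws ! i))" if "i < length ?vs" for i
    using that q(4) by (simp add: items_of_def)
  have link: "link (gadj G) (set ?vs) (?xs ! i) (?vs ! (Suc i mod length ?vs)) \<and>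
     hd (?Ws ! i) \<in> verts G \<and> last (?Ws ! i) \<in> verts G" if "i < length ?vs" for i
    using q(5)[OF that] unfolding witness_enum_def non_nbrs_missed[OF sub] nth[OF that]
    by (elim disjE bexE conjE) simp_all
  have "Suc i mod length ?vs < length ?vs" for i using q(1) by (intro mod_less_divisor) auto
  then show "obs (gadj G) ?xs"
    unfolding obs_nth len cs fsts using q link nth by (auto simp: clique_def)
  have "a \<in> verts G \<and> b \<in> verts G" if "(v, a, b) \<in> set ?xs" for v a b
    using that link nth unfolding in_set_conv_nth len by (metis fst_conv snd_conv)
  then show "verts_of ?xs \<subseteq> verts G" using cs sub by (auto simp: wits_def)
qed

lemma induced_gadj:
  "u \<in> S \<Longrightarrow> v \<in> S \<Longrightarrow> gadj (induced G S) u v \<longleftrightarrow> gadj G u v"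
  by (simp add: induced_def)

text \<open>The induced subgraph is taken on exactly the vertices that occur in the list. For these
  vertices adjacency and the missed sets are the same as in \<open>G\<close>, so all conditions
  carry over.\<close>

lemma essential_enum_of:
  assumes G: "simple_graph G" and o: "obs (gadj G) xs" and e: "ess (gadj G) xs" and v: "verts_of xs \<subseteq> verts G"
  shows "essential_of_induced G (enum_of xs)"
proof -
  interpret adjacency "gadj G" by (rule adjacency_gadj[OF G])
  let ?S = "verts_of xs" and ?Q = "enum_of xs" and ?H = "induced G (verts_of xs)"
  have vH: "verts ?H = ?S" using v by (auto simp: induced_def)
  have n: "non_nbrs ?H y \<inter> cores xs = missed (gadj G) (cores xs) y" if "y \<in> ?S" for y
    using that by (auto simp: non_nbrs_def missed_def vH induced_gadj insert_commute)
  have fQ: "fst ?Q = map fst xs" "snd ?Q = map (\<lambda>(v, a, b). if a = b then [a] else [a, b]) xs"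
    by (simp_all add: enum_of_def)
  have we: "witness_enum ?H (cores xs) (fst (xs ! i)) (fst (xs ! (Suc i mod length xs))) (snd ?Q ! i)"
    if i: "i < length xs" for i
  proof -
    obtain c a b where x: "xs ! i = (c, a, b)" by (cases "xs ! i")
    have "(c, a, b) \<in> set xs" using i x by (metis nth_mem)
    then have ab: "a \<in> ?S" "b \<in> ?S" by (auto simp: wits_def)
    have "link (gadj G) (cores xs) (c, a, b) (fst (xs ! (Suc i mod length xs)))"
      using o i unfolding obs_nth x[symmetric] by blast
    then show ?thesis using ab i
      by (elim link_cases) (auto simp: fQ x witness_enum_def n vH induced_gadj)
  qed
  have cl: "clique ?H (cores xs)"
    using o v by (auto simp: clique_def vH induced_gadj obs_def)
  have "obstacle_enum_in ?H ?Q"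
    unfolding obstacle_enum_in_def Let_def fQ(1)
  proof (intro conjI allI impI)
    fix i assume "i < length (map fst xs)"
    moreover from this have "(i + 1) mod length xs < length xs" by (intro mod_less_divisor) auto
    ultimately show "witness_enum ?H (set (map fst xs)) (map fst xs ! i) (map fst xs ! ((i + 1) mod length (map fst xs))) (snd ?Q ! i)"
      using we[of i] by (simp add: cores_def)
  qed (use o cl in \<open>simp_all add: obs_def cores_def fQ(2)\<close>)
  then have "obstacle_enum_of ?H ?Q"
    by (simp add: obstacle_enum_of_def vH core_enum_of witnesses_enum_of)
  moreover have "essential ?H ?Q"
    unfolding essential_def valid_edge_def core_enum_of witnesses_enum_of
  proof (intro ballI impI)
    fix x y assume xy: "x \<in> wits xs" "y \<in> wits xs" "gadj ?H x y"
    then have "x \<in> ?S" "y \<in> ?S" "gadj G x y" by (auto simp: induced_gadj)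
    then have "pair_ok (gadj G) xs x y" using e xy unfolding ess_iff by blast
    moreover have "\<exists>W\<in>set (snd ?Q). x \<in> set W \<and> y \<in> set W"
      if "(v, a, b) \<in> set xs" "x \<in> {a, b}" "y \<in> {a, b}" for v a b
      using that unfolding fQ by (intro bexI[of _ "if a = b then [a] else [a, b]"]) force+
    ultimately show "non_nbrs ?H x \<inter> cores xs \<subseteq> non_nbrs ?H y \<inter> cores xs \<or>
         non_nbrs ?H y \<inter> cores xs \<subseteq> non_nbrs ?H x \<inter> cores xs \<or>
         (\<exists>W\<in>set (snd ?Q). x \<in> set W \<and> y \<in> set W)"
      unfolding n[OF \<open>x \<in> ?S\<close>] n[OF \<open>y \<in> ?S\<close>] pair_ok_def by blast
  qed
  ultimately show ?thesis unfolding essential_of_induced_def using v by blast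
qed

section \<open>From patterns to the listed graphs\<close>

text \<open>\<open>ts\<close> arranges the vertices of \<open>H\<close> so that its non-adjacent
  positions are those of the shape; the isomorphism matches equal positions of \<open>vs\<close> and
  \<open>ts\<close>.\<close>

lemma isomorphic_shape:
  assumes G: "simple_graph G" and vs: "set vs \<subseteq> verts G" and s: "shape (gadj G) S vs"
    and ts: "verts H = set ts" "distinct ts" "length ts = fst S"
    and H1: "\<forall>e\<in>edges H. e \<subseteq> verts H \<and> card e = 2"
    and H2: "\<forall>j<fst S. \<forall>i<j. {ts ! i, ts ! j} \<in> edges H \<longleftrightarrow> (i, j) \<notin> set (snd S) \<and> (j, i) \<notin> set (snd S)"
  shows "isomorphic (induced G (set vs)) H"
proof -
  interpret adjacency "gadj G" by (rule adjacency_gadj[OF G])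
  let ?n = "fst S"
  have len: "length vs = ?n" using s by (simp add: shape_def)
  have adj: "gadj G (vs ! i) (vs ! j) \<longleftrightarrow> {ts ! i, ts ! j} \<in> edges H" if "i < j" "j < ?n" for i j
    using s H2 that unfolding shape_def by (smt (verit))
  have adj': "gadj G (vs ! i) (vs ! j) \<longleftrightarrow> {ts ! i, ts ! j} \<in> edges H" if "i < ?n" "j < ?n" "i \<noteq> j" for i j
    using adj[of i j] adj[of j i] that by (cases "i < j") (auto simp: insert_commute)
  have "vs ! i \<noteq> vs ! j" if "i < j" "j < ?n" for i j
    using s that adj_irrefl unfolding shape_def by (metis (no_types, lifting))
  then have dv: "distinct vs" unfolding distinct_conv_nth len by (metis linorder_neqE_nat)
  define f where "f x = ts ! (THE i. i < ?n \<and> vs ! i = x)" for x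
  have f: "f (vs ! i) = ts ! i" if "i < ?n" for i
  proof -
    have "(THE j. j < ?n \<and> vs ! j = vs ! i) = i"
      using that dv len by (intro the_equality) (auto simp: nth_eq_iff_index_eq)
    then show ?thesis by (simp add: f_def)
  qed
  have vG: "verts (induced G (set vs)) = set vs" using vs by (auto simp: induced_def)
  have bij: "bij_betw f (set vs) (set ts)"
  proof (rule bij_betwI')
    fix x y assume "x \<in> set vs" "y \<in> set vs"
    then obtain i j where "i < ?n" "j < ?n" "x = vs ! i" "y = vs ! j" by (metis in_set_conv_nth len)
    then show "f x = f y \<longleftrightarrow> x = y" using f dv ts len by (simp add: nth_eq_iff_index_eq)
  next
    fix x assume "x \<in> set vs" then show "f x \<in> set ts" using f ts len by (metis in_set_conv_nth)
  next
    fix y assume "y \<in> set ts" then show "\<exists>x\<in>set vs. y = f x" using f ts len by (metis in_set_conv_nth)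
  qed
  have "edges H = (\<lambda>e. f ` e) ` edges (induced G (set vs))"
  proof (intro subset_antisym subsetI)
    fix e assume e: "e \<in> edges H"
    then obtain x y where xy: "x \<in> set ts" "y \<in> set ts" "x \<noteq> y" "e = {x, y}"
      using H1 ts(1) by (metis card_2_iff insert_subset)
    then obtain i j where ij: "i < ?n" "j < ?n" "x = ts ! i" "y = ts ! j" by (metis in_set_conv_nth ts(3))
    then have "gadj G (vs ! i) (vs ! j)" using adj'[of i j] e xy by auto
    then have "{vs ! i, vs ! j} \<in> edges (induced G (set vs))" using ij len by (simp add: induced_def)
    moreover have "f ` {vs ! i, vs ! j} = e" using f ij xy by simp
    ultimately show "e \<in> (\<lambda>e. f ` e) ` edges (induced G (set vs))" by blast
  next
    fix e assume "e \<in> (\<lambda>e. f ` e) ` edges (induced G (set vs))"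
    then obtain d where d: "d \<in> edges G" "d \<subseteq> set vs" "e = f ` d" by (auto simp: induced_def)
    then obtain x y where xy: "x \<noteq> y" "d = {x, y}" using G unfolding simple_graph_def by blast
    then obtain i j where ij: "i < ?n" "j < ?n" "x = vs ! i" "y = vs ! j" using d(2) by (metis in_set_conv_nth insert_subset len)
    then show "e \<in> edges H" using adj'[of i j] xy d f by auto
  qed
  then show ?thesis unfolding isomorphic_def vG ts(1) using bij by blast
qed

lemma atLeastLessThan_numeral:
  "{0..<numeral k} = insert (pred_numeral k) {0..<pred_numeral k :: nat}" "{0..<Suc 0} = {0::nat}" "{0..<1} = {0::nat}"
  by (auto simp: numeral_eq_Suc atLeast0_lessThan_Suc)

lemma edges_cycle_graph: "edges (cycle_graph n) = (\<lambda>i. {i, (i + 1) mod n}) ` {0..<n}"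
  by (auto simp: cycle_graph_def)

lemma edge_complement:
  "{u, v} \<in> edges (complement H) \<longleftrightarrow> u \<in> verts H \<and> v \<in> verts H \<and> u \<noteq> v \<and> {u, v} \<notin> edges H"
  by (auto simp: complement_def doubleton_eq_iff insert_commute)

lemma edges_complement: "\<forall>e\<in>edges (complement H). e \<subseteq> verts (complement H) \<and> card e = 2"
  by (auto simp: complement_def)

lemma listed_is_listed_graph:
  assumes G: "simple_graph G" and l: "S \<in> set co_shapes" "shape (gadj G) S vs" "set vs \<subseteq> verts G"
  shows "is_listed_graph (induced G (set vs))"
proof -
  note iso = isomorphic_shape[OF G l(3,2)]
  note expand = all_less_numeral doubleton_eq_iff co_shapes_def atLeastLessThan_numeral
  have V: "verts (cycle_graph n) = {0..<n}" "verts (complete_graph n) = {0..<n}"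
    "verts (disj_union H K) = Inl ` verts H \<union> Inr ` verts K" "verts (complement H) = verts H" for n H K
    by (auto simp: cycle_graph_def complete_graph_def disj_union_def complement_def)
  have C: "edges (cycle_graph 4) = {{3, 0}, {2, 3}, {1, 2}, {0, 1}}"
    "edges (cycle_graph 5) = {{4, 0}, {3, 4}, {2, 3}, {1, 2}, {0, 1}}"
    "edges (cycle_graph 6) = {{5, 0}, {4, 5}, {3, 4}, {2, 3}, {1, 2}, {0, 1}}"
    by (simp_all add: edges_cycle_graph atLeastLessThan_numeral flip: numeral_2_eq_2)
  have K: "edges (complete_graph (Suc 0)) = {}" "edges (complete_graph 2) = {{0, 1}}"
    by (auto simp: complete_graph_def less_2_cases_iff)
  have U: "edges (disj_union H K) = (\<lambda>e. Inl ` e) ` edges H \<union> (\<lambda>e. Inr ` e) ` edges K" for H K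
    by (simp add: disj_union_def)
  consider "S = co_shapes ! 0" | "S = co_shapes ! 1" | "S = co_shapes ! 2" | "S = co_shapes ! 3"
    | "S = co_shapes ! 4" | "S = co_shapes ! 5"
    using l(1) by (auto simp: co_shapes_def)
  then show ?thesis
  proof cases
    case 1
    \<comment> \<open>The isolated vertex comes first, followed by the two diagonals of the 4-cycle.
      The arrangements in the other cases are found in the same way, from the complement.\<close>
    have "isomorphic (induced G (set vs)) (star (cycle_graph 4))"
      by (rule iso[of _ "[Inr 0, Inl 0, Inl 2, Inl 1, Inl 3]"])
        (simp_all add: 1 star_def U C K V expand insert_commute)
    then show ?thesis by (simp add: is_listed_graph_def)
  next
    case 2
    let ?H = "complete_bipartite 2 3"
    have E: "{Inl i, Inr j} \<in> edges ?H \<longleftrightarrow> i < 2 \<and> j < 3"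
      "{Inr j, Inl i} \<in> edges ?H \<longleftrightarrow> i < 2 \<and> j < 3" "{Inl i, Inl i'} \<notin> edges ?H" "{Inr j, Inr j'} \<notin> edges ?H" for i i' j j'
      by (auto simp: complete_bipartite_def doubleton_eq_iff)
    have "verts ?H = Inl ` {0..<2} \<union> Inr ` {0..<3}" by (auto simp: complete_bipartite_def)
    moreover have "\<forall>e\<in>edges ?H. e \<subseteq> verts ?H \<and> card e = 2" by (auto simp: complete_bipartite_def)
    ultimately have "isomorphic (induced G (set vs)) ?H"
      by (intro iso[of _ "[Inl 0, Inl 1, Inr 0, Inr 1, Inr 2]"])
        (simp_all add: 2 E expand insert_commute)
    then show ?thesis by (simp add: is_listed_graph_def)
  next
    case 3
    have "verts domino = set [C2, A2, B1, A1, C1, B2]"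
      using domino_vertex.exhaust by (auto simp: domino_def)
    then have "isomorphic (induced G (set vs)) domino"
      by (rule iso) (simp_all add: 3 domino_def expand)
    then show ?thesis by (simp add: is_listed_graph_def)
  next
    case 4
    have "verts G3 = set [A2, B1, C2, A1, B2, C1]"
      using domino_vertex.exhaust by (auto simp: G3_def domino_def)
    then have "isomorphic (induced G (set vs)) G3"
      by (rule iso) (simp_all add: 4 G3_def domino_def expand)
    then show ?thesis by (simp add: is_listed_graph_def)
  next
    case 5
    have "isomorphic (induced G (set vs)) (complement (cycle_graph 6))"
      by (rule iso[of _ "[0, 1, 2, 3, 4, 5]", OF _ _ _ edges_complement])
        (simp_all add: 5 edge_complement V C expand insert_commute)
    then show ?thesis by (simp add: is_listed_graph_def)
  next
    case 6
    have "isomorphic (induced G (set vs)) (complement (disj_union (cycle_graph 5) (complete_graph 2)))"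
      by (rule iso[of _ "[Inl 0, Inl 1, Inl 2, Inl 3, Inl 4, Inr 0, Inr 1]", OF _ _ _ edges_complement])
        (simp_all add: 6 edge_complement V U C K expand insert_commute)
    then show ?thesis by (simp add: is_listed_graph_def)
  qed
qed

section \<open>Circular-arc graphs contain no listed graph\<close>

text \<open>What the argument uses of arcs on a circle \<open>C\<close>: two disjoint arcs leave two
  gaps \<open>X\<close> and \<open>Y\<close>, and an arc that meets both must run through one of the
  gaps. No angles and no order are involved.\<close>

locale gap_family =
  fixes S :: "'a \<Rightarrow> 'b set" and C :: "'b set"
  assumes sub: "S r \<subseteq> C" and nonempty: "S r \<noteq> {}"
    and gaps: "S p \<inter> S q = {} \<Longrightarrow> \<exists>X Y. X \<noteq> {} \<and> Y \<noteq> {} \<and> C \<subseteq> S p \<union> S q \<union> X \<union> Y \<and>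
      (\<forall>r. S r \<inter> S p \<noteq> {} \<longrightarrow> S r \<inter> S q \<noteq> {} \<longrightarrow> X \<subseteq> S r \<or> Y \<subseteq> S r)"
begin

definition meet :: "'a \<Rightarrow> 'a \<Rightarrow> bool" where "meet u v \<longleftrightarrow> S u \<inter> S v \<noteq> {}"

lemma meet_sym: "meet u v \<longleftrightarrow> meet v u" by (auto simp: meet_def)

definition links :: "'a \<Rightarrow> 'a \<Rightarrow> 'a \<Rightarrow> bool" where "links p q r \<longleftrightarrow> meet r p \<and> meet r q"

text \<open>The two kinds are told apart by whether the gap \<open>X\<close> is contained. Sets of
  one kind share a nonempty gap, hence meet; two sets of different kinds fill both gaps and, with
  \<open>p\<close> and \<open>q\<close>, the whole circle.\<close>

lemma connecting:
  assumes "\<not> meet p q"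
  shows "\<exists>f :: 'a \<Rightarrow> bool. (\<forall>r s. links p q r \<longrightarrow> links p q s \<longrightarrow> \<not> meet r s \<longrightarrow> f r \<noteq> f s) \<and>
    (\<forall>r s. links p q r \<longrightarrow> links p q s \<longrightarrow> f r \<noteq> f s \<longrightarrow> C \<subseteq> S p \<union> S q \<union> S r \<union> S s)"
proof -
  have "S p \<inter> S q = {}" using assms by (simp add: meet_def)
  from gaps[OF this] obtain X Y where XY: "X \<noteq> {}" "Y \<noteq> {}" "C \<subseteq> S p \<union> S q \<union> X \<union> Y"
    "\<forall>r. S r \<inter> S p \<noteq> {} \<longrightarrow> S r \<inter> S q \<noteq> {} \<longrightarrow> X \<subseteq> S r \<or> Y \<subseteq> S r"
    by (elim exE conjE)
  show ?thesis
  proof (intro exI[of _ "\<lambda>r. X \<subseteq> S r"] conjI allI impI)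
    fix r s assume a: "links p q r" "links p q s"
    then have b: "X \<subseteq> S r \<or> Y \<subseteq> S r" "X \<subseteq> S s \<or> Y \<subseteq> S s" using XY(4) by (simp_all add: links_def meet_def)
    show "(X \<subseteq> S r) \<noteq> (X \<subseteq> S s)" if "\<not> meet r s" using b that XY(1,2) unfolding meet_def by blast
    show "C \<subseteq> S p \<union> S q \<union> S r \<union> S s" if "(X \<subseteq> S r) \<noteq> (X \<subseteq> S s)"
      using that XY(3) b by blast
  qed
qed

text \<open>The disjoint sets \<open>b\<close> and \<open>d\<close> both link \<open>a\<close> and
  \<open>c\<close>, so they run through different gaps.\<close>

lemma cycle4_covers:
  assumes "\<not> meet a c" "\<not> meet b d" "meet a b" "meet b c" "meet c d" "meet d a"
  shows "C \<subseteq> S a \<union> S b \<union> S c \<union> S d"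
proof -
  from connecting[OF assms(1)] obtain f :: "'a \<Rightarrow> bool"
    where f: "\<forall>r s. links a c r \<longrightarrow> links a c s \<longrightarrow> \<not> meet r s \<longrightarrow> f r \<noteq> f s"
    "\<forall>r s. links a c r \<longrightarrow> links a c s \<longrightarrow> f r \<noteq> f s \<longrightarrow> C \<subseteq> S a \<union> S c \<union> S r \<union> S s"
    by (elim exE conjE)
  have m: "links a c b" "links a c d" using assms(3-6) meet_sym[of a b] meet_sym[of c d] by (simp_all add: links_def)
  have "C \<subseteq> S a \<union> S c \<union> S b \<union> S d" using f m assms(2) by simp
  then show ?thesis by blast
qed

lemma cycle4_neighbour:
  assumes "\<not> meet a c" "\<not> meet b d" "meet a b" "meet b c" "meet c d" "meet d a"
    and "\<not> meet x a" "\<not> meet x c" "\<not> meet x d"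
  shows "S x \<subseteq> S b"
  using cycle4_covers[OF assms(1-6)] sub[of x] assms(7-9) unfolding meet_def by blast

text \<open>In C4 + K1, the domino and G3, the 4-cycle covers the circle, so a vertex that avoids
  three of its arcs lies inside the fourth; this contradicts that it is isolated, or that it has a
  neighbour avoiding the fourth. In \<open>K\<^sub>2\<^sub>,\<^sub>3\<close> and in the complement
  of C5 + K2, \<open>connecting\<close> would properly 2-colour a triangle or a 5-cycle of pairwise
  disjointness. In the complement of C6, a common point of two arcs escapes a covering
  4-cycle.\<close>

lemma no_listed:
  assumes adj: "\<And>u v. u \<in> U \<Longrightarrow> v \<in> U \<Longrightarrow> u \<noteq> v \<Longrightarrow> adj u v \<longleftrightarrow> meet u v"
    and irr: "\<And>u. \<not> adj u u"
  shows "\<not> listed adj U"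
proof
  assume "listed adj U"
  then obtain T vs where T: "T \<in> set co_shapes" and vs: "set vs \<subseteq> U" and s: "shape adj T vs"
    by (auto simp: listed_def)
  have m: "meet (vs ! i) (vs ! j) \<longleftrightarrow> (i, j) \<notin> set (snd T) \<and> (j, i) \<notin> set (snd T)"
    if "i < j" "j < fst T" for i j
  proof -
    have "vs ! i \<in> U" "vs ! j \<in> U" using that s vs by (auto simp: shape_def subset_iff)
    moreover have "vs ! i \<noteq> vs ! j"
      using s that irr[of "vs ! j"] unfolding shape_def by (metis (no_types, lifting))
    moreover have "adj (vs ! i) (vs ! j) \<longleftrightarrow> (i, j) \<notin> set (snd T) \<and> (j, i) \<notin> set (snd T)"
      using s that unfolding shape_def by (smt (verit))
    ultimately show ?thesis using adj by blast
  qed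
  then have m: "\<forall>j<fst T. \<forall>i<j. meet (vs ! i) (vs ! j) \<longleftrightarrow> (i, j) \<notin> set (snd T) \<and> (j, i) \<notin> set (snd T)"
    by blast
  define x where "x i = vs ! i" for i
  note m = m[folded x_def]
  consider "T = co_shapes ! 0" | "T = co_shapes ! 1" | "T = co_shapes ! 2" | "T = co_shapes ! 3"
    | "T = co_shapes ! 4" | "T = co_shapes ! 5"
    using T by (auto simp: co_shapes_def)
  then show False
  proof cases
    case 1
    then have "\<not> meet (x 1) (x 2)" "\<not> meet (x 3) (x 4)" "meet (x 1) (x 3)" "meet (x 2) (x 3)"
      "meet (x 2) (x 4)" "meet (x 1) (x 4)" "\<not> meet (x 0) (x 1)" "\<not> meet (x 0) (x 2)"
      "\<not> meet (x 0) (x 3)" "\<not> meet (x 0) (x 4)"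
      using m by (simp_all add: co_shapes_def all_less_numeral)
    note y = this
    have "S (x 0) \<subseteq> S (x 3)"
      using cycle4_neighbour[of "x 1" "x 2" "x 3" "x 4" "x 0"] y by (metis meet_sym)
    moreover have "S (x 0) \<inter> S (x 3) = {}" using y by (simp add: meet_def)
    ultimately show False using nonempty[of "x 0"] by blast
  next
    case 2
    then have n: "\<not> meet (x 0) (x 1)" "\<not> meet (x 2) (x 3)" "\<not> meet (x 2) (x 4)" "\<not> meet (x 3) (x 4)"
      and "meet (x 0) (x 2)" "meet (x 1) (x 2)" "meet (x 0) (x 3)" "meet (x 1) (x 3)" "meet (x 0) (x 4)" "meet (x 1) (x 4)"
      using m by (simp_all add: co_shapes_def all_less_numeral)
    then have y: "links (x 0) (x 1) (x 2)" "links (x 0) (x 1) (x 3)" "links (x 0) (x 1) (x 4)"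
      unfolding links_def by (simp_all add: meet_def Int_commute)
    from connecting[OF n(1)] obtain f :: "'a \<Rightarrow> bool"
      where f: "\<forall>r s. links (x 0) (x 1) r \<longrightarrow> links (x 0) (x 1) s \<longrightarrow> \<not> meet r s \<longrightarrow> f r \<noteq> f s"
      by (elim exE conjE)
    show False using f n y by metis
  next
    case 3
    then have y: "\<not> meet (x 0) (x 1)" "\<not> meet (x 0) (x 2)" "\<not> meet (x 1) (x 2)" "\<not> meet (x 3) (x 4)"
      "\<not> meet (x 3) (x 5)" "\<not> meet (x 4) (x 5)" "\<not> meet (x 0) (x 3)" "\<not> meet (x 1) (x 4)"
      "meet (x 0) (x 4)" "meet (x 0) (x 5)" "meet (x 1) (x 3)" "meet (x 1) (x 5)" "meet (x 2) (x 3)"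
      "meet (x 2) (x 4)" "meet (x 2) (x 5)"
      using m by (simp_all add: co_shapes_def all_less_numeral)
    have "S (x 1) \<subseteq> S (x 5)"
      using cycle4_neighbour[of "x 0" "x 2" "x 5" "x 4" "x 1"] y by (metis meet_sym)
    moreover have "S (x 3) \<inter> S (x 5) = {}" "S (x 1) \<inter> S (x 3) \<noteq> {}" using y by (simp_all add: meet_def)
    ultimately show False by blast
  next
    case 4
    then have y: "\<not> meet (x 0) (x 1)" "\<not> meet (x 1) (x 2)" "\<not> meet (x 2) (x 3)" "\<not> meet (x 3) (x 4)"
      "\<not> meet (x 4) (x 5)" "\<not> meet (x 0) (x 5)" "\<not> meet (x 0) (x 2)"
      "meet (x 0) (x 3)" "meet (x 0) (x 4)" "meet (x 1) (x 3)" "meet (x 1) (x 4)" "meet (x 1) (x 5)"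
      "meet (x 2) (x 4)" "meet (x 2) (x 5)" "meet (x 3) (x 5)"
      using m by (simp_all add: co_shapes_def all_less_numeral)
    have "S (x 0) \<subseteq> S (x 4)"
      using cycle4_neighbour[of "x 1" "x 2" "x 4" "x 5" "x 0"] y by (metis meet_sym)
    moreover have "S (x 3) \<inter> S (x 4) = {}" "S (x 0) \<inter> S (x 3) \<noteq> {}" using y by (simp_all add: meet_def)
    ultimately show False by blast
  next
    case 5
    then have y: "\<not> meet (x 0) (x 1)" "\<not> meet (x 1) (x 2)" "\<not> meet (x 2) (x 3)" "\<not> meet (x 3) (x 4)"
      "\<not> meet (x 4) (x 5)" "\<not> meet (x 0) (x 5)" "meet (x 0) (x 2)"
      "meet (x 0) (x 3)" "meet (x 0) (x 4)" "meet (x 1) (x 3)" "meet (x 1) (x 4)" "meet (x 1) (x 5)"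
      "meet (x 2) (x 4)" "meet (x 2) (x 5)" "meet (x 3) (x 5)"
      using m by (simp_all add: co_shapes_def all_less_numeral)
    have "C \<subseteq> S (x 0) \<union> S (x 2) \<union> S (x 5) \<union> S (x 3)"
      using cycle4_covers[of "x 0" "x 5" "x 2" "x 3"] y by (metis meet_sym)
    moreover obtain p where p: "p \<in> S (x 1)" "p \<in> S (x 4)" using y(11) unfolding meet_def by blast
    moreover have "p \<in> C" using p sub[of "x 1"] by blast
    ultimately have o: "p \<in> S (x 0) \<or> p \<in> S (x 2) \<or> p \<in> S (x 5) \<or> p \<in> S (x 3)" by blast
    have "S (x 0) \<inter> S (x 1) = {}" "S (x 1) \<inter> S (x 2) = {}" "S (x 3) \<inter> S (x 4) = {}" "S (x 4) \<inter> S (x 5) = {}"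
      using y unfolding meet_def by simp_all
    then show False using p o by blast
  next
    case 6
    then have n: "\<not> meet (x 5) (x 6)" "\<not> meet (x 0) (x 1)" "\<not> meet (x 1) (x 2)" "\<not> meet (x 2) (x 3)"
       "\<not> meet (x 3) (x 4)" "\<not> meet (x 0) (x 4)"
      and y: "links (x 5) (x 6) (x 0)" "links (x 5) (x 6) (x 1)" "links (x 5) (x 6) (x 2)"
       "links (x 5) (x 6) (x 3)" "links (x 5) (x 6) (x 4)"
      using m by (simp_all add: co_shapes_def all_less_numeral links_def)
    from connecting[OF n(1)] obtain f :: "'a \<Rightarrow> bool"
      where f: "\<forall>r s. links (x 5) (x 6) r \<longrightarrow> links (x 5) (x 6) s \<longrightarrow> \<not> meet r s \<longrightarrow> f r \<noteq> f s"
      by (elim exE conjE)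
    show False using f n y by metis
  qed
qed

end

section \<open>Arcs as cyclic intervals of indices\<close>

definition cyc_ivl :: "nat \<Rightarrow> nat \<Rightarrow> nat \<Rightarrow> nat set" where
  "cyc_ivl N i j = {p. p < N \<and> (if i \<le> j then i \<le> p \<and> p \<le> j else i \<le> p \<or> p \<le> j)}"

text \<open>The two gaps between disjoint intervals are taken with the bounding endpoints, which makes
  them nonempty even if no integer lies strictly between the intervals.\<close>

lemma cyc_ivl_gaps:
  assumes "i1 < N" "j1 < N" "i2 < N" "j2 < N" "cyc_ivl N i1 j1 \<inter> cyc_ivl N i2 j2 = {}"
  shows "{..<N} \<subseteq> cyc_ivl N i1 j1 \<union> cyc_ivl N i2 j2 \<union> cyc_ivl N j1 i2 \<union> cyc_ivl N j2 i1"
    and "\<lbrakk>i < N; j < N; cyc_ivl N i j \<inter> cyc_ivl N i1 j1 \<noteq> {}; cyc_ivl N i j \<inter> cyc_ivl N i2 j2 \<noteq> {}\<rbrakk> \<Longrightarrow>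
      cyc_ivl N j1 i2 \<subseteq> cyc_ivl N i j \<or> cyc_ivl N j2 i1 \<subseteq> cyc_ivl N i j"
proof -
  have "i2 \<notin> cyc_ivl N i1 j1" "j2 \<notin> cyc_ivl N i1 j1" "i1 \<notin> cyc_ivl N i2 j2" "j1 \<notin> cyc_ivl N i2 j2"
    using assms unfolding cyc_ivl_def disjoint_iff by (metis (mono_tags, lifting) le_refl linorder_le_cases mem_Collect_eq)+
  then have d: "\<not> (if i1 \<le> j1 then i1 \<le> i2 \<and> i2 \<le> j1 else i1 \<le> i2 \<or> i2 \<le> j1)"
    "\<not> (if i1 \<le> j1 then i1 \<le> j2 \<and> j2 \<le> j1 else i1 \<le> j2 \<or> j2 \<le> j1)"
    "\<not> (if i2 \<le> j2 then i2 \<le> i1 \<and> i1 \<le> j2 else i2 \<le> i1 \<or> i1 \<le> j2)"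
    "\<not> (if i2 \<le> j2 then i2 \<le> j1 \<and> j1 \<le> j2 else i2 \<le> j1 \<or> j1 \<le> j2)"
    using assms by (auto simp: cyc_ivl_def)
  show "{..<N} \<subseteq> cyc_ivl N i1 j1 \<union> cyc_ivl N i2 j2 \<union> cyc_ivl N j1 i2 \<union> cyc_ivl N j2 i1"
  proof
    fix p assume "p \<in> {..<N}"
    then show "p \<in> cyc_ivl N i1 j1 \<union> cyc_ivl N i2 j2 \<union> cyc_ivl N j1 i2 \<union> cyc_ivl N j2 i1"
      using d unfolding cyc_ivl_def
      by (cases "i1 \<le> j1"; cases "i2 \<le> j2"; cases "j1 \<le> i2"; cases "j2 \<le> i1") (simp_all, (linarith+)?)
  qed
  show "cyc_ivl N j1 i2 \<subseteq> cyc_ivl N i j \<or> cyc_ivl N j2 i1 \<subseteq> cyc_ivl N i j"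
    if ij: "i < N" "j < N" "cyc_ivl N i j \<inter> cyc_ivl N i1 j1 \<noteq> {}" "cyc_ivl N i j \<inter> cyc_ivl N i2 j2 \<noteq> {}"
  proof (rule ccontr)
    assume "\<not> ?thesis"
    then obtain p q where "p \<in> cyc_ivl N j1 i2 - cyc_ivl N i j" "q \<in> cyc_ivl N j2 i1 - cyc_ivl N i j" by blast
    moreover obtain r s where "r \<in> cyc_ivl N i j \<inter> cyc_ivl N i1 j1" "s \<in> cyc_ivl N i j \<inter> cyc_ivl N i2 j2"
      using ij by blast
    ultimately show False using d
      unfolding cyc_ivl_def by (simp split: if_splits)
  qed
qed

text \<open>Going backwards from a common point, the left endpoint reached first lies in the other
  interval. This provides a constant-time adjacency test.\<close>

lemma cyc_ivl_meet_iff: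
  assumes "i1 < N" "j1 < N" "i2 < N" "j2 < N"
  shows "cyc_ivl N i1 j1 \<inter> cyc_ivl N i2 j2 \<noteq> {} \<longleftrightarrow> i2 \<in> cyc_ivl N i1 j1 \<or> i1 \<in> cyc_ivl N i2 j2"
proof
  assume "cyc_ivl N i1 j1 \<inter> cyc_ivl N i2 j2 \<noteq> {}"
  then obtain p where "p \<in> cyc_ivl N i1 j1" "p \<in> cyc_ivl N i2 j2" by blast
  then show "i2 \<in> cyc_ivl N i1 j1 \<or> i1 \<in> cyc_ivl N i2 j2"
    using assms by (auto simp: cyc_ivl_def split: if_splits)
next
  have "i1 \<in> cyc_ivl N i1 j1" "i2 \<in> cyc_ivl N i2 j2" using assms by (auto simp: cyc_ivl_def)
  then show "i2 \<in> cyc_ivl N i1 j1 \<or> i1 \<in> cyc_ivl N i2 j2 \<Longrightarrow> cyc_ivl N i1 j1 \<inter> cyc_ivl N i2 j2 \<noteq> {}" by blast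
qed

lemma cyc_ivl_gap_family:
  assumes "\<And>v. f v < N" "\<And>v. g v < N"
  shows "gap_family (\<lambda>v. cyc_ivl N (f v) (g v)) {..<N}"
proof
  fix p q :: 'a
  show "cyc_ivl N (f p) (g p) \<subseteq> {..<N}" by (auto simp: cyc_ivl_def)
  have self: "i \<in> cyc_ivl N i j" if "i < N" for i j using that by (auto simp: cyc_ivl_def)
  then show "cyc_ivl N (f p) (g p) \<noteq> {}" using assms by blast
  assume d: "cyc_ivl N (f p) (g p) \<inter> cyc_ivl N (f q) (g q) = {}"
  show "\<exists>X Y. X \<noteq> {} \<and> Y \<noteq> {} \<and> {..<N} \<subseteq> cyc_ivl N (f p) (g p) \<union> cyc_ivl N (f q) (g q) \<union> X \<union> Y \<and>
     (\<forall>r. cyc_ivl N (f r) (g r) \<inter> cyc_ivl N (f p) (g p) \<noteq> {} \<longrightarrow>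
       cyc_ivl N (f r) (g r) \<inter> cyc_ivl N (f q) (g q) \<noteq> {} \<longrightarrow>
       X \<subseteq> cyc_ivl N (f r) (g r) \<or> Y \<subseteq> cyc_ivl N (f r) (g r))"
  proof (rule exI[of _ "cyc_ivl N (g p) (f q)"], rule exI[of _ "cyc_ivl N (g q) (f p)"], intro conjI allI impI)
    show "cyc_ivl N (g p) (f q) \<noteq> {}" "cyc_ivl N (g q) (f p) \<noteq> {}" using self[OF assms(2)] by auto
    show "{..<N} \<subseteq> cyc_ivl N (f p) (g p) \<union> cyc_ivl N (f q) (g q) \<union> cyc_ivl N (g p) (f q) \<union> cyc_ivl N (g q) (f p)"
      by (rule cyc_ivl_gaps(1)[OF assms(1,2) assms(1,2) d])
    fix r
    assume "cyc_ivl N (f r) (g r) \<inter> cyc_ivl N (f p) (g p) \<noteq> {}" "cyc_ivl N (f r) (g r) \<inter> cyc_ivl N (f q) (g q) \<noteq> {}"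
    then show "cyc_ivl N (g p) (f q) \<subseteq> cyc_ivl N (f r) (g r) \<or> cyc_ivl N (g q) (f p) \<subseteq> cyc_ivl N (f r) (g r)"
      by (rule cyc_ivl_gaps(2)[OF assms(1,2) assms(1,2) d assms(1,2)])
  qed
qed

definition arc_start :: "('a \<times> bool) list \<Rightarrow> 'a \<Rightarrow> nat" where
  "arc_start xs v = (THE i. i < length xs \<and> xs ! i = (v, True))"

definition arc_end :: "('a \<times> bool) list \<Rightarrow> 'a \<Rightarrow> nat" where
  "arc_end xs v = (THE i. i < length xs \<and> xs ! i = (v, False))"

definition arc_ivl :: "('a \<times> bool) list \<Rightarrow> 'a \<Rightarrow> nat set" where
  "arc_ivl xs v = cyc_ivl (length xs) (arc_start xs v) (arc_end xs v)"

lemma the_index: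
  assumes "distinct xs" "x \<in> set xs"
  shows "(THE i. i < length xs \<and> xs ! i = x) < length xs" "xs ! (THE i. i < length xs \<and> xs ! i = x) = x"
proof -
  obtain i where i: "i < length xs" "xs ! i = x" using assms(2) by (auto simp: in_set_conv_nth)
  have "(THE j. j < length xs \<and> xs ! j = x) = i"
    using i assms(1) by (intro the_equality) (auto simp: nth_eq_iff_index_eq)
  then show "(THE i. i < length xs \<and> xs ! i = x) < length xs" "xs ! (THE i. i < length xs \<and> xs ! i = x) = x"
    using i by simp_all
qed

lemma cis_shift_inj:
  assumes "cis (\<phi> + \<sigma> * x) = cis (\<phi> + \<sigma> * y)" "\<sigma> \<in> {1, -1}" "0 \<le> x" "x < 2 * pi" "0 \<le> y" "y < 2 * pi"
  shows "x = y"
proof -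
  have "\<exists>n::int. \<phi> + \<sigma> * x = \<phi> + \<sigma> * y + 2 * pi * of_int n"
    using assms(1) sin_cos_eq_iff[of "\<phi> + \<sigma> * x" "\<phi> + \<sigma> * y"] by (auto simp: cis.ctr)
  then obtain n :: int where "\<sigma> * x = \<sigma> * y + 2 * pi * of_int n" by auto
  then obtain m :: int where m: "x = y + 2 * pi * of_int m"
    using assms(2) by (cases "\<sigma> = 1") (auto intro!: that[of n] that[of "-n"])
  have "2 * pi * of_int m < 2 * pi * 1" "2 * pi * - 1 < 2 * pi * of_int m" using m assms(3-6) by linarith+
  then have "(of_int m :: real) < 1" "- 1 < (of_int m :: real)"
    using pi_gt_zero by (simp_all only: mult_less_cancel_left_pos mult_pos_pos zero_less_numeral)
  then have "m = 0" by linarith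
  then show ?thesis using m by simp
qed

text \<open>Only the order of the extremes matters. Both for arcs of real times and for intervals of
  indices, two of them meet exactly if one contains the starting point of the other, and
  \<open>t\<close> is strictly increasing.\<close>

lemma arcs_meet_iff:
  assumes e: "extremes_in_order V A xs" and u: "u \<in> V" and v: "v \<in> V"
  shows "A u \<inter> A v \<noteq> {} \<longleftrightarrow> arc_ivl xs u \<inter> arc_ivl xs v \<noteq> {}"
proof -
  let ?N = "length xs"
  obtain \<phi> \<sigma> :: real and t :: "nat \<Rightarrow> real" where d: "distinct xs" "set xs = V \<times> UNIV"
    and \<sigma>: "\<sigma> \<in> {1, -1}" and mono: "strict_mono_on {0..<?N} t" and t: "\<And>i. i < ?N \<Longrightarrow> 0 \<le> t i \<and> t i < 2 * pi"
    and A: "\<And>i j v. i < ?N \<Longrightarrow> j < ?N \<Longrightarrow> xs ! i = (v, True) \<Longrightarrow> xs ! j = (v, False) \<Longrightarrow>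
           A v = (\<lambda>x. cis (\<phi> + \<sigma> * x)) ` {t i..(if i < j then t j else t j + 2 * pi)}"
    using e unfolding extremes_in_order_def by metis
  let ?F = "\<lambda>x. cis (\<phi> + \<sigma> * x)"
  \<comment> \<open>The arc pulled back to times within one turn; an arc that contains the start of
    the traversal splits into two pieces.\<close>
  define T where "T i j = {x. 0 \<le> x \<and> x < 2 * pi \<and> (if i \<le> j then t i \<le> x \<and> x \<le> t j else t i \<le> x \<or> x \<le> t j)}" for i j
  have per: "?F (x + 2 * pi) = ?F x" for x
  proof -
    have "?F (x + 2 * pi) = ?F x * cis (\<sigma> * (2 * pi))" by (simp add: cis_mult algebra_simps)
    moreover have "cis (\<sigma> * (2 * pi)) = 1" using \<sigma> by (auto simp: complex_eq_iff)
    ultimately show ?thesis by simp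
  qed
  have le: "t i \<le> t j \<longleftrightarrow> i \<le> j" if "i < ?N" "j < ?N" for i j
    using mono that strict_mono_on_less_eq[OF mono, of i j] by simp
  have AT: "A w = ?F ` T (arc_start xs w) (arc_end xs w) \<and> arc_start xs w < ?N \<and> arc_end xs w < ?N \<and>
    arc_start xs w \<noteq> arc_end xs w" if w: "w \<in> V" for w
  proof -
    let ?i = "arc_start xs w" and ?j = "arc_end xs w"
    have i: "?i < ?N" "xs ! ?i = (w, True)" and j: "?j < ?N" "xs ! ?j = (w, False)"
      unfolding arc_start_def arc_end_def by (rule the_index, use d w in auto)+
    have ne: "?i \<noteq> ?j" using i j by auto
    have "?F ` {t ?i..(if ?i < ?j then t ?j else t ?j + 2 * pi)} = ?F ` T ?i ?j"
    proof (cases "?i < ?j")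
      case True
      then have "{t ?i..t ?j} = T ?i ?j" using t[OF i(1)] t[OF j(1)] by (auto simp: T_def)
      then show ?thesis using True by simp
    next
      case False
      show ?thesis
      proof (intro subset_antisym subsetI)
        fix z assume "z \<in> ?F ` {t ?i..(if ?i < ?j then t ?j else t ?j + 2 * pi)}"
        then obtain x where x: "z = ?F x" "t ?i \<le> x" "x \<le> t ?j + 2 * pi" using False by auto
        show "z \<in> ?F ` T ?i ?j"
        proof (cases "x < 2 * pi")
          case True
          then have "x \<in> T ?i ?j" using False ne x t[OF i(1)] by (auto simp: T_def)
          then show ?thesis using x by blast
        next
          case n: False
          then have "x - 2 * pi \<in> T ?i ?j" using False ne x t[OF j(1)] by (auto simp: T_def)
          moreover have "z = ?F (x - 2 * pi)" using per[of "x - 2 * pi"] x by simp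
          ultimately show ?thesis by blast
        qed
      next
        fix z assume "z \<in> ?F ` T ?i ?j"
        then obtain x where x: "z = ?F x" "x \<in> T ?i ?j" by blast
        show "z \<in> ?F ` {t ?i..(if ?i < ?j then t ?j else t ?j + 2 * pi)}"
        proof (cases "t ?i \<le> x")
          case True
          then have "x \<in> {t ?i..(if ?i < ?j then t ?j else t ?j + 2 * pi)}"
            using x False t[OF j(1)] by (auto simp: T_def)
          then show ?thesis using x by blast
        next
          case n: False
          then have "x + 2 * pi \<in> {t ?i..(if ?i < ?j then t ?j else t ?j + 2 * pi)}"
            using x False ne t[OF i(1)] t[OF j(1)] by (auto simp: T_def split: if_splits)
          then show ?thesis using x per[of x] by (metis image_eqI)
        qed
      qed
    qed
    then show ?thesis using A[OF i(1) j(1) i(2) j(2)] i j ne by simp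
  qed
  let ?i = "arc_start xs u" and ?j = "arc_end xs u" and ?k = "arc_start xs v" and ?l = "arc_end xs v"
  have b: "?i < ?N" "?j < ?N" "?k < ?N" "?l < ?N" using AT u v by blast+
  have inT: "t p \<in> T i j \<longleftrightarrow> p \<in> cyc_ivl ?N i j" if "p < ?N" "i < ?N" "j < ?N" for p i j
    using that t[of p] by (simp add: T_def cyc_ivl_def le)
  have "A u \<inter> A v \<noteq> {} \<longleftrightarrow> T ?i ?j \<inter> T ?k ?l \<noteq> {}"
  proof
    assume "A u \<inter> A v \<noteq> {}"
    then obtain x y where xy: "x \<in> T ?i ?j" "y \<in> T ?k ?l" "?F x = ?F y" using AT u v by fastforce
    then have "x = y" using cis_shift_inj[of \<phi> \<sigma> x y] \<sigma> by (auto simp: T_def)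
    then show "T ?i ?j \<inter> T ?k ?l \<noteq> {}" using xy by blast
  next
    assume "T ?i ?j \<inter> T ?k ?l \<noteq> {}"
    then show "A u \<inter> A v \<noteq> {}" using AT[OF u] AT[OF v] by blast
  qed
  also have "\<dots> \<longleftrightarrow> t ?k \<in> T ?i ?j \<or> t ?i \<in> T ?k ?l"
  proof
    assume "T ?i ?j \<inter> T ?k ?l \<noteq> {}"
    then obtain x where "x \<in> T ?i ?j" "x \<in> T ?k ?l" by blast
    then show "t ?k \<in> T ?i ?j \<or> t ?i \<in> T ?k ?l"
      using t[OF b(1)] t[OF b(2)] t[OF b(3)] t[OF b(4)] le[OF b(1,2)] le[OF b(3,4)]
      by (auto simp: T_def split: if_splits)
  next
    have "t ?i \<in> T ?i ?j" "t ?k \<in> T ?k ?l" using inT b by (auto simp: cyc_ivl_def)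
    then show "t ?k \<in> T ?i ?j \<or> t ?i \<in> T ?k ?l \<Longrightarrow> T ?i ?j \<inter> T ?k ?l \<noteq> {}" by blast
  qed
  also have "\<dots> \<longleftrightarrow> arc_ivl xs u \<inter> arc_ivl xs v \<noteq> {}"
    unfolding arc_ivl_def cyc_ivl_meet_iff[OF b] using inT b by simp
  finally show ?thesis .
qed

section \<open>Total correctness with running times\<close>

fun loopfree :: "com \<Rightarrow> bool" where
  "loopfree (Seq p q) \<longleftrightarrow> loopfree p \<and> loopfree q"
| "loopfree (Branch b p q) \<longleftrightarrow> loopfree p \<and> loopfree q"
| "loopfree (While b p) \<longleftrightarrow> False"
| "loopfree _ \<longleftrightarrow> True"

text \<open>A functional semantics for loop-free programs; the clause for \<open>While\<close> is a
  default value.\<close>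

fun run :: "com \<Rightarrow> state \<Rightarrow> state" where
  "run Skip s = s"
| "run (Write a e f) s = s(a := (s a)(eval_exp e s := eval_exp f s))"
| "run (Seq p q) s = run q (run p s)"
| "run (Branch b p q) s = (if eval_test b s then run p s else run q s)"
| "run (While b p) s = s"

fun cost :: "com \<Rightarrow> nat" where
  "cost (Seq p q) = cost p + cost q"
| "cost (Branch b p q) = 1 + cost p + cost q"
| "cost _ = 1"

lemma exec_run: "loopfree p \<Longrightarrow> \<exists>t\<le>cost p. exec p s t (run p s)"
proof (induction p arbitrary: s)
  case (Seq p q)
  then obtain t where t: "t \<le> cost p" "exec p s t (run p s)" by fastforce
  from Seq obtain u where u: "u \<le> cost q" "exec q (run p s) u (run q (run p s))" by fastforce
  from t u exec_Seq[OF t(2) u(2)] show ?case by (intro exI[of _ "t + u"]) auto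
next
  case (Branch b p q)
  show ?case
  proof (cases "eval_test b s")
    case True
    obtain t where "t \<le> cost p" "exec p s t (run p s)" using Branch by fastforce
    with exec_BranchT[OF True] True show ?thesis by (intro exI[of _ "1 + t"]) auto
  next
    case False
    obtain t where "t \<le> cost q" "exec q s t (run q s)" using Branch by fastforce
    with exec_BranchF[OF False] False show ?thesis by (intro exI[of _ "1 + t"]) auto
  qed
next
  case Skip
  show ?case using exec_Skip[of s] by auto
next
  case (Write a e f)
  show ?case by (intro exI[of _ 1] conjI) (simp_all only: run.simps cost.simps le_refl exec_Write)
qed simp

fun writes :: "com \<Rightarrow> string set" where
  "writes Skip = {}"
| "writes (Write a e f) = {a}"
| "writes (Seq p q) = writes p \<union> writes q"
| "writes (Branch b p q) = writes p \<union> writes q"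
| "writes (While b p) = writes p"

lemma exec_frame: "exec p s t s' \<Longrightarrow> a \<notin> writes p \<Longrightarrow> s' a = s a"
  by (induction rule: exec.induct) auto

text \<open>The frame condition is part of the specification, so that loop invariants need to mention only
  the arrays that are written.\<close>

definition ends :: "com \<Rightarrow> state \<Rightarrow> nat \<Rightarrow> (state \<Rightarrow> bool) \<Rightarrow> bool" where
  "ends p s T Q \<longleftrightarrow> (\<exists>t s'. exec p s t s' \<and> t \<le> T \<and> Q s' \<and> (\<forall>a. a \<notin> writes p \<longrightarrow> s' a = s a))"

lemma endsI: "exec p s t s' \<Longrightarrow> t \<le> T \<Longrightarrow> Q s' \<Longrightarrow> ends p s T Q"
  unfolding ends_def using exec_frame by metis

lemma ends_run: "loopfree p \<Longrightarrow> Q (run p s) \<Longrightarrow> cost p \<le> T \<Longrightarrow> ends p s T Q"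
  using exec_run[of p s] by (auto intro: endsI)

lemma ends_weaken:
  assumes "ends p s T Q" "T \<le> T'" "\<And>s'. Q s' \<Longrightarrow> (\<And>a. a \<notin> writes p \<Longrightarrow> s' a = s a) \<Longrightarrow> Q' s'"
  shows "ends p s T' Q'"
proof -
  obtain t s' where "exec p s t s'" "t \<le> T" "Q s'" "\<forall>a. a \<notin> writes p \<longrightarrow> s' a = s a"
    using assms(1) unfolding ends_def by blast
  then show ?thesis using assms(2,3) by (intro endsI[of p s t s']) auto
qed

lemma ends_Seq:
  assumes "ends p s T1 R" "\<And>s'. R s' \<Longrightarrow> (\<And>a. a \<notin> writes p \<Longrightarrow> s' a = s a) \<Longrightarrow> ends q s' T2 Q" "T1 + T2 \<le> T"
  shows "ends (Seq p q) s T Q"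
proof -
  obtain t s' where 1: "exec p s t s'" "t \<le> T1" "R s'" "\<forall>a. a \<notin> writes p \<longrightarrow> s' a = s a"
    using assms(1) unfolding ends_def by blast
  then obtain u s'' where 2: "exec q s' u s''" "u \<le> T2" "Q s''"
    using assms(2)[of s'] unfolding ends_def by blast
  show ?thesis using endsI[where Q = Q, OF exec_Seq[OF 1(1) 2(1)], of T] 1 2 assms(3) by auto
qed

lemma ends_Branch:
  assumes "eval_test b s \<Longrightarrow> ends p s T Q" "\<not> eval_test b s \<Longrightarrow> ends q s T Q" "1 + T \<le> T'"
  shows "ends (Branch b p q) s T' Q"
proof (cases "eval_test b s")
  case True
  then obtain t s' where "exec p s t s'" "t \<le> T" "Q s'" using assms(1) unfolding ends_def by blast
  then show ?thesis using endsI[where Q = Q, OF exec_BranchT[OF True], of p t s' T' q] assms(3) by auto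
next
  case False
  then obtain t s' where "exec q s t s'" "t \<le> T" "Q s'" using assms(2) unfolding ends_def by blast
  then show ?thesis using endsI[where Q = Q, OF exec_BranchF[OF False], of q t s' T' p] assms(3) by auto
qed

text \<open>The potential method: an iteration that costs \<open>T\<close> must lower
  \<open>\<Phi>\<close> by \<open>T\<close> and one more unit for its test. The remaining unit pays
  for the last test. Amortised bounds can be stated because \<open>T\<close> may depend on the
  state.\<close>

lemma ends_While:
  fixes \<Phi> :: "state \<Rightarrow> nat"
  assumes step: "\<And>s'. I s' \<Longrightarrow> eval_test b s' \<Longrightarrow> (\<And>a. a \<notin> writes p \<Longrightarrow> s' a = s a) \<Longrightarrow>
      \<exists>T. ends p s' T (\<lambda>s''. I s'' \<and> T + 1 + \<Phi> s'' \<le> \<Phi> s')"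
    and I: "I s" and T: "\<Phi> s + 1 \<le> T"
    and Q: "\<And>s'. I s' \<Longrightarrow> \<not> eval_test b s' \<Longrightarrow> (\<And>a. a \<notin> writes p \<Longrightarrow> s' a = s a) \<Longrightarrow> Q s'"
  shows "ends (While b p) s T Q"
proof -
  have "\<exists>t s''. exec (While b p) s' t s'' \<and> t \<le> \<Phi> s' + 1 \<and> I s'' \<and> \<not> eval_test b s''"
    if "I s'" "\<forall>a. a \<notin> writes p \<longrightarrow> s' a = s a" for s'
    using that
  proof (induction s' rule: measure_induct_rule[of \<Phi>])
    case (less s')
    show ?case
    proof (cases "eval_test b s'")
      case False
      then show ?thesis using exec_WhileF[OF False] less.prems by (intro exI[of _ 1] exI[of _ s']) auto
    next
      case True
      obtain T where "ends p s' T (\<lambda>s''. I s'' \<and> T + 1 + \<Phi> s'' \<le> \<Phi> s')" using step less.prems True by blast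
      then obtain t s1 where 1: "exec p s' t s1" "t \<le> T" "I s1" "T + 1 + \<Phi> s1 \<le> \<Phi> s'"
        "\<forall>a. a \<notin> writes p \<longrightarrow> s1 a = s' a" unfolding ends_def by blast
      then obtain u s2 where 2: "exec (While b p) s1 u s2" "u \<le> \<Phi> s1 + 1" "I s2" "\<not> eval_test b s2"
        using less.IH[of s1] less.prems by auto
      show ?thesis using exec_WhileT[OF True 1(1) 2(1)] 1 2 by (intro exI[of _ "1 + t + u"] exI[of _ s2]) auto
    qed
  qed
  from this[of s] I obtain t s'' where 1: "exec (While b p) s t s''" "t \<le> \<Phi> s + 1" "I s''" "\<not> eval_test b s''" by auto
  then show ?thesis using Q[of s''] exec_frame[OF 1(1)] T by (intro endsI[OF 1(1)]) auto
qed

section \<open>The cleaning phase\<close>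

abbreviation Var :: "string \<Rightarrow> exp" where "Var x \<equiv> Read x (Const 0)"
abbreviation Set :: "string \<Rightarrow> exp \<Rightarrow> com" where "Set x e \<equiv> Write x (Const 0) e"
abbreviation Le :: "exp \<Rightarrow> exp \<Rightarrow> test" where "Le e f \<equiv> Neg (Less f e)"
definition Eq :: "exp \<Rightarrow> exp \<Rightarrow> test" where "Eq e f = Conj (Le e f) (Le f e)"
definition Or :: "test \<Rightarrow> test \<Rightarrow> test" where "Or b c = Neg (Conj (Neg b) (Neg c))"

lemma eval_Eq_Or [simp]:
  "eval_test (Eq e f) s \<longleftrightarrow> eval_exp e s = eval_exp f s"
  "eval_test (Or b c) s \<longleftrightarrow> eval_test b s \<or> eval_test c s"
  by (auto simp: Eq_def Or_def)

abbreviation Inc :: "string \<Rightarrow> com" where "Inc x \<equiv> Set x (Succ (Var x))"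
abbreviation Dec :: "string \<Rightarrow> com" where "Dec x \<equiv> Set x (Minus (Var x) (Const 1))"

fun seqs :: "com list \<Rightarrow> com" where
  "seqs [] = Skip" | "seqs [p] = p" | "seqs (p # ps) = Seq p (seqs ps)"

text \<open>The current enumeration occupies the cells from \<open>hd\<close> to \<open>tl - 1\<close> of the three arrays; the
  second witness of a pair of type \<open>\<O>\<^sub>1\<close> is stored as a copy of the first.\<close>

definition block :: "state \<Rightarrow> nat \<Rightarrow> nat \<Rightarrow> nat item list" where
  "block s i j = map (\<lambda>p. (s ''q'' p, s ''w0'' p, s ''w1'' p)) [i..<j]"

abbreviation items :: "state \<Rightarrow> nat item list" where
  "items s \<equiv> block s (s ''hd'' 0) (s ''tl'' 0)"

definition move :: "exp \<Rightarrow> exp \<Rightarrow> com" where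
  "move e f = seqs [Write ''q'' f (Read ''q'' e), Write ''w0'' f (Read ''w0'' e), Write ''w1'' f (Read ''w1'' e)]"

abbreviation Hd :: exp where "Hd \<equiv> Var ''hd''"
abbreviation Tl :: exp where "Tl \<equiv> Var ''tl''"
abbreviation Len :: exp where "Len \<equiv> Minus Tl Hd"

abbreviation At :: "string \<Rightarrow> nat \<Rightarrow> exp" where
  "At a i \<equiv> Read a ((Succ ^^ i) Hd)"

text \<open>The second witness of the target slot stays in place: it is the second witness of the
  new item.\<close>

definition drop_to :: "nat \<Rightarrow> nat \<Rightarrow> com" where
  "drop_to i j = seqs [Write ''q'' ((Succ ^^ j) Hd) (At ''q'' i), Write ''w0'' ((Succ ^^ j) Hd) (At ''w0'' i)]"

text \<open>The seven actions realise the branches of \<open>seg\<close> in order. A shortened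
  segment is aligned to the right, so that only \<open>hd\<close> moves and the rest of the list
  stays where it is.\<close>

definition act1 :: com where
  "act1 = seqs [drop_to 0 2, Set ''hd'' (Succ (Succ Hd)), Set ''red'' (Const 1)]"
definition act2 :: com where
  "act2 = seqs [drop_to 0 1, Set ''hd'' (Succ Hd), Set ''red'' (Const 1)]"
definition act3 :: com where
  "act3 = seqs [drop_to 0 1, Write ''w1'' (Succ Hd) (At ''w0'' 2), Set ''hd'' (Succ Hd), Set ''red'' (Const 1)]"
definition act4 :: com where
  "act4 = seqs [Write ''q'' (Succ (Succ Hd)) (At ''q'' 1), Write ''w0'' (Succ (Succ Hd)) (At ''w1'' 0),
     move Hd (Succ Hd), Set ''hd'' (Succ Hd), Set ''red'' (Const 1)]"
definition act5 :: com where
  "act5 = seqs [Write ''w0'' (Succ Hd) (At ''w1'' 0), Set ''red'' (Const 1)]"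
definition act6 :: com where
  "act6 = seqs [Write ''w1'' Hd (At ''w0'' 1), Set ''red'' (Const 1)]"
definition act7 :: com where
  "act7 = seqs [Write ''w0'' (Succ Hd) (At ''w1'' 0), Write ''w1'' (Succ Hd) (At ''w0'' 2), Set ''red'' (Const 1)]"

definition reduce :: "(exp \<Rightarrow> exp \<Rightarrow> test) \<Rightarrow> com" where
  "reduce adjt = (let a0 = At ''w0'' 0; b0 = At ''w1'' 0; a1 = At ''w0'' 1; b1 = At ''w1'' 1;
     a2 = At ''w0'' 2; b2 = At ''w1'' 2
   in Seq (Set ''red'' (Const 0))
     (Branch (adjt a0 b2) act1
     (Branch (adjt a0 b1) act2
     (Branch (Conj (Neg (Eq a2 b2)) (adjt a0 a2)) act3
     (Branch (Conj (Neg (Eq a0 b0)) (adjt b0 b2)) act4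
     (Branch (Conj (Neg (Eq a0 b0)) (Conj (Neg (Eq a1 b1)) (Conj (Neg (Eq b0 a1)) (adjt b0 b1)))) act5
     (Branch (Conj (Neg (Eq a0 b0)) (Conj (Neg (Eq a1 b1)) (Conj (Neg (Eq b0 a1)) (adjt a0 a1)))) act6
     (Branch (Conj (Neg (Eq a0 b0)) (Conj (Neg (Eq a2 b2)) (Conj (Neg (Conj (Eq b0 a1) (Eq b1 a2))) (adjt b0 a2)))) act7
     Skip))))))))"

lemmas act_defs = act1_def act2_def act3_def act4_def act5_def act6_def act7_def drop_to_def

definition step_back :: com where
  "step_back = seqs [Dec ''tl'', Dec ''hd'', move Tl Hd]"

text \<open>A rewriting also affects the windows that start one or two items earlier, so the list is
  rotated back by two. \<open>gd\<close> counts the windows at the end of the list known to be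
  clean; the bound \<open>Len - 5\<close> forgets those that start inside the rewritten segment,
  which matters when nearly the whole circle had been checked.\<close>

definition retreat :: com where
  "retreat = seqs [
     Branch (Less (Const 1) (Var ''gd''))
       (seqs [step_back, step_back, Set ''gd'' (Minus (Var ''gd'') (Const 2))]) (Set ''gd'' (Const 0)),
     Branch (Less (Minus Len (Const 5)) (Var ''gd'')) (Set ''gd'' (Minus Len (Const 5))) Skip]"

definition advance :: com where
  "advance = seqs [move Hd Tl, Inc ''hd'', Inc ''tl'', Inc ''gd'']"

definition clean_step :: "(exp \<Rightarrow> exp \<Rightarrow> test) \<Rightarrow> com" where
  "clean_step adjt = Seq (reduce adjt) (Branch (Less (Const 0) (Var ''red'')) retreat advance)"

definition clean_up :: "(exp \<Rightarrow> exp \<Rightarrow> test) \<Rightarrow> com" where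
  "clean_up adjt = Seq (Set ''gd'' (Const 0))
     (While (Conj (Less (Var ''gd'') Len) (Less (Const 11) Len)) (clean_step adjt))"

lemma block_append: "i \<le> m \<Longrightarrow> m \<le> j \<Longrightarrow> block s i j = block s i m @ block s m j"
  using upt_add_eq_append[of i m "j - m"] by (simp add: block_def flip: map_append)

lemma block_Cons: "i < j \<Longrightarrow> block s i j = (s ''q'' i, s ''w0'' i, s ''w1'' i) # block s (Suc i) j"
  unfolding block_def by (simp add: upt_conv_Cons)

lemma block_self [simp]: "block s i i = []"
  by (simp add: block_def)

lemma block_snoc: "i \<le> j \<Longrightarrow> block s i (Suc j) = block s i j @ [(s ''q'' j, s ''w0'' j, s ''w1'' j)]"
  unfolding block_def by simp

lemma length_block [simp]: "length (block s i j) = j - i"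
  by (simp add: block_def)

lemma nth_block: "p < j - i \<Longrightarrow> block s i j ! p = (s ''q'' (i + p), s ''w0'' (i + p), s ''w1'' (i + p))"
  by (simp add: block_def)

lemma block_cong:
  "(\<And>p. i \<le> p \<Longrightarrow> p < j \<Longrightarrow> s ''q'' p = s' ''q'' p \<and> s ''w0'' p = s' ''w0'' p \<and> s ''w1'' p = s' ''w1'' p) \<Longrightarrow>
   block s i j = block s' i j"
  by (auto simp: block_def)

definition window_clean :: "(nat \<Rightarrow> nat \<Rightarrow> bool) \<Rightarrow> nat item list \<Rightarrow> nat \<Rightarrow> bool" where
  "window_clean adj xs i \<longleftrightarrow>
     seg adj (xs ! i) (xs ! (Suc i mod length xs)) (xs ! ((i + 2) mod length xs)) = None"

text \<open>A shortening removes at least one item and raises \<open>cyc_unjoined\<close> by at most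
  two, so with the factor three every rewriting lowers the weight.\<close>

definition weight :: "'a item list \<Rightarrow> nat" where
  "weight xs = 3 * length xs + cyc_unjoined xs"

lemma weight_rotate: "weight (xs @ ys) = weight (ys @ xs)"
  by (simp add: weight_def cyc_unjoined_rotate[of xs ys])

lemma weight_le: "weight xs \<le> 4 * length xs"
  by (simp add: weight_def cyc_unjoined_def unjoined_le)

lemma weight_seg: "seg adj i0 i1 i2 = Some ys \<Longrightarrow> weight (ys @ K) < weight (i0 # i1 # i2 # K)"
  using cyc_unjoined_segment[of adj i0 i1 i2 ys K] by (auto simp: weight_def)

lemma seg_wits: "seg adj i0 i1 i2 = Some ys \<Longrightarrow> wits (ys @ K) \<subseteq> wits (i0 # i1 # i2 # K)"
  by (cases i0; cases i1; cases i2) (auto simp: seg.simps split: if_splits)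

lemma seg_length: "seg adj i0 i1 i2 = Some ys \<Longrightarrow> 1 \<le> length ys \<and> length ys \<le> 3"
  by (cases i0; cases i1; cases i2) (auto simp: seg.simps split: if_splits)

text \<open>The arrays on which an adjacency test may depend. Once they are prepared, nothing writes
  to them.\<close>

definition adj_arrays :: "string set" where
  "adj_arrays = {''mat'', ''row'', ''lid'', ''top'', ''pin'', ''pout''}"

text \<open>Abstracts from the input: \<open>adjt\<close> is any test that decides adjacency for
  values in \<open>U\<close> in the states satisfying \<open>ok\<close>. One correctness proof then
  serves graphs and models.\<close>

locale ram = adjacency adj for adj :: "nat \<Rightarrow> nat \<Rightarrow> bool" +
  fixes adjt :: "exp \<Rightarrow> exp \<Rightarrow> test" and ok :: "state \<Rightarrow> bool" and U :: "nat set"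
  assumes adjt: "ok s \<Longrightarrow> eval_exp e s \<in> U \<Longrightarrow> eval_exp f s \<in> U \<Longrightarrow>
      eval_test (adjt e f) s \<longleftrightarrow> adj (eval_exp e s) (eval_exp f s)"
    and ok_frame: "ok s \<Longrightarrow> (\<And>a. a \<in> adj_arrays \<Longrightarrow> s' a = s a) \<Longrightarrow> ok s'"
begin

lemma loopfree_clean_step: "loopfree (clean_step adjt)"
  by (simp add: act_defs clean_step_def reduce_def Let_def retreat_def step_back_def advance_def move_def)

lemma writes_clean_step: "writes (clean_step adjt) \<inter> adj_arrays = {}"
  by (simp add: adj_arrays_def act_defs clean_step_def reduce_def Let_def retreat_def step_back_def advance_def move_def)

lemma run_ok:
  assumes "loopfree p" "writes p \<inter> adj_arrays = {}" "ok s"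
  shows "ok (run p s)"
proof -
  obtain t where "exec p s t (run p s)" using exec_run[OF assms(1)] by blast
  then show ?thesis using exec_frame assms(2) by (intro ok_frame[OF assms(3)]) blast
qed

lemma ok_upd: "ok s \<Longrightarrow> a \<notin> adj_arrays \<Longrightarrow> ok (s(a := f))"
  by (rule ok_frame[of s]) auto

lemma run_reduce:
  fixes s :: state
  defines "h \<equiv> s ''hd'' 0" and "s1 \<equiv> run (reduce adjt) s"
  assumes ok: "ok s" and U: "wits (items s) \<subseteq> U" and len: "3 \<le> length (items s)"
  shows "s1 ''tl'' 0 = s ''tl'' 0 \<and> s1 ''gd'' 0 = s ''gd'' 0 \<and> h \<le> s1 ''hd'' 0 \<and>
    (case seg adj (items s ! 0) (items s ! 1) (items s ! 2) of
       None \<Rightarrow> s1 ''red'' 0 = 0 \<and> items s1 = items s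
     | Some ys \<Rightarrow> s1 ''red'' 0 = 1 \<and> items s1 = ys @ drop 3 (items s))"
proof -
  let ?t = "s ''tl'' 0"
  have ht: "h + 3 \<le> ?t" using len by (simp add: h_def)
  define s0 where "s0 = s(''red'' := (s ''red'')(0 := 0))"
  have ok0: "ok s0" unfolding s0_def by (rule ok_upd[OF ok]) (simp add: adj_arrays_def)
  have rd: "s0 ''hd'' 0 = h" "s0 ''w0'' = s ''w0''" "s0 ''w1'' = s ''w1''" "s0 ''q'' = s ''q''"
    "s0 ''tl'' 0 = ?t" "s0 ''gd'' 0 = s ''gd'' 0" "s0 ''red'' 0 = 0"
    by (simp_all add: s0_def h_def)
  let ?v = "\<lambda>i. s ''q'' (h + i)" and ?a = "\<lambda>i. s ''w0'' (h + i)" and ?b = "\<lambda>i. s ''w1'' (h + i)"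
  have xs: "items s = (?v 0, ?a 0, ?b 0) # (?v 1, ?a 1, ?b 1) # (?v 2, ?a 2, ?b 2) # block s (h + 3) ?t"
    using ht by (simp add: block_Cons h_def[symmetric] eval_nat_numeral)
  have inU: "?a 0 \<in> U" "?b 0 \<in> U" "?a 1 \<in> U" "?b 1 \<in> U" "?a 2 \<in> U" "?b 2 \<in> U"
    using U unfolding xs by auto
  have tail: "block s1 (h + 3) ?t = block s (h + 3) ?t"
    if "\<And>p. h + 3 \<le> p \<Longrightarrow> s1 ''q'' p = s ''q'' p \<and> s1 ''w0'' p = s ''w0'' p \<and> s1 ''w1'' p = s ''w1'' p"
    using that by (intro block_cong) auto
  have split: "block s1 h' ?t = block s1 h' (h + 3) @ block s1 (h + 3) ?t" if "h' \<le> h + 3" for h'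
    using that ht by (intro block_append) auto
  have ev: "eval_exp (At ''w0'' i) s0 = ?a i" "eval_exp (At ''w1'' i) s0 = ?b i" if "i \<in> {0, 1, 2}" for i
    using that by (auto simp: rd numeral_2_eq_2)
  have t: "eval_test (adjt (At x i) (At y j)) s0 = adj (eval_exp (At x i) s0) (eval_exp (At y j) s0)"
    if "i \<in> {0, 1, 2}" "j \<in> {0, 1, 2}" "x \<in> {''w0'', ''w1''}" "y \<in> {''w0'', ''w1''}" for i j x y
  proof -
    have "eval_exp (At z n) s0 \<in> U" if "n \<in> {0, 1, 2}" "z \<in> {''w0'', ''w1''}" for n z
      using that(2) ev[OF that(1)] inU that(1) by (auto simp del: eval_exp.simps)
    then show ?thesis using that by (intro adjt[OF ok0])
  qed
  have R0: "run (Set ''red'' (Const 0)) s = s0" by (simp add: s0_def)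
  have s1: "s1 = (if adj (?a 0) (?b 2) then run act1 s0
    else if adj (?a 0) (?b 1) then run act2 s0
    else if ?a 2 \<noteq> ?b 2 \<and> adj (?a 0) (?a 2) then run act3 s0
    else if ?a 0 \<noteq> ?b 0 \<and> adj (?b 0) (?b 2) then run act4 s0
    else if ?a 0 \<noteq> ?b 0 \<and> ?a 1 \<noteq> ?b 1 \<and> ?b 0 \<noteq> ?a 1 \<and> adj (?b 0) (?b 1) then run act5 s0
    else if ?a 0 \<noteq> ?b 0 \<and> ?a 1 \<noteq> ?b 1 \<and> ?b 0 \<noteq> ?a 1 \<and> adj (?a 0) (?a 1) then run act6 s0
    else if ?a 0 \<noteq> ?b 0 \<and> ?a 2 \<noteq> ?b 2 \<and> (?b 0 \<noteq> ?a 1 \<or> ?b 1 \<noteq> ?a 2) \<and> adj (?b 0) (?a 2) then run act7 s0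
    else s0)"
    unfolding s1_def reduce_def Let_def run.simps(4)[of _ _ _ s0] run.simps(3)[of "Set ''red'' (Const 0)"] R0
      run.simps(1,4) eval_Eq_Or eval_test.simps(2,3)
    by (simp only: t ev insert_iff simp_thms de_Morgan_conj)
  have eval: "(Succ ^^ 0) Hd = Hd" "(Succ ^^ 1) Hd = Succ Hd" "(Succ ^^ 2) Hd = Succ (Succ Hd)"
    by (simp_all add: eval_nat_numeral)
  have up: "[h..<h + 3] = [h, Suc h, Suc (Suc h)]" "[Suc h..<h + 3] = [Suc h, Suc (Suc h)]" "[Suc (Suc h)..<h + 3] = [Suc (Suc h)]"
    by (simp_all add: upt_rec eval_nat_numeral)
  have drop3: "drop 3 (items s) = block s (h + 3) ?t" unfolding xs by simp
  have Seg: "seg adj (items s ! 0) (items s ! 1) (items s ! 2) =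
    seg adj (?v 0, ?a 0, ?b 0) (?v 1, ?a 1, ?b 1) (?v 2, ?a 2, ?b 2)" unfolding xs by (simp add: numeral_2_eq_2)
  define W where "W s1 r \<longleftrightarrow> s1 ''tl'' 0 = ?t \<and> s1 ''gd'' 0 = s ''gd'' 0 \<and> h \<le> s1 ''hd'' 0 \<and> s1 ''hd'' 0 \<le> h + 3 \<and>
    (\<forall>p\<ge>h+3. s1 ''q'' p = s ''q'' p \<and> s1 ''w0'' p = s ''w0'' p \<and> s1 ''w1'' p = s ''w1'' p) \<and>
    (case r of
       None \<Rightarrow> s1 ''red'' 0 = 0 \<and> s1 ''hd'' 0 = h \<and> (\<forall>p. s1 ''q'' p = s ''q'' p \<and> s1 ''w0'' p = s ''w0'' p \<and> s1 ''w1'' p = s ''w1'' p)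
     | Some ys \<Rightarrow> s1 ''red'' 0 = 1 \<and> block s1 (s1 ''hd'' 0) (h + 3) = ys)" for s1 :: state and r
  have acts: "W (run act1 s0) (Some [(?v 0, ?a 0, ?b 2)])"
    "W (run act2 s0) (Some [(?v 0, ?a 0, ?b 1), (?v 2, ?a 2, ?b 2)])"
    "W (run act3 s0) (Some [(?v 0, ?a 0, ?a 2), (?v 2, ?a 2, ?b 2)])"
    "W (run act4 s0) (Some [(?v 0, ?a 0, ?b 0), (?v 1, ?b 0, ?b 2)])"
    "W (run act5 s0) (Some [(?v 0, ?a 0, ?b 0), (?v 1, ?b 0, ?b 1), (?v 2, ?a 2, ?b 2)])"
    "W (run act6 s0) (Some [(?v 0, ?a 0, ?a 1), (?v 1, ?a 1, ?b 1), (?v 2, ?a 2, ?b 2)])"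
    "W (run act7 s0) (Some [(?v 0, ?a 0, ?b 0), (?v 1, ?b 0, ?a 2), (?v 2, ?a 2, ?b 2)])"
    "W s0 None"
    unfolding W_def by (simp_all add: act_defs move_def eval rd block_def up)
  \<comment> \<open>The program and \<open>seg\<close> are the same cascade of conditionals, so it
    suffices to compare them branch by branch.\<close>
  have main: "W s1 (seg adj (?v 0, ?a 0, ?b 0) (?v 1, ?a 1, ?b 1) (?v 2, ?a 2, ?b 2))"
  proof -
    have "W (if c then x else y) (if c then x' else y')" if "W x x'" "W y y'" for c x y x' y'
      using that by simp
    note if_rule = this
    show ?thesis unfolding seg.simps s1 by (intro if_rule acts)
  qed
  show ?thesis
  proof (cases "seg adj (items s ! 0) (items s ! 1) (items s ! 2)")
    case None
    then have "items s1 = items s" using main unfolding Seg W_def by (auto intro!: block_cong simp: h_def)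
    then show ?thesis using main None unfolding Seg W_def by auto
  next
    case (Some ys)
    then have "items s1 = ys @ drop 3 (items s)"
      using main unfolding Seg drop3 W_def using split[of "s1 ''hd'' 0"] tail by auto
    then show ?thesis using main Some unfolding Seg W_def by auto
  qed
qed

lemma run_step_back:
  assumes "1 \<le> s ''hd'' 0" "s ''hd'' 0 < s ''tl'' 0"
  shows "run step_back s ''hd'' 0 = s ''hd'' 0 - 1" "run step_back s ''tl'' 0 = s ''tl'' 0 - 1"
    "run step_back s ''gd'' 0 = s ''gd'' 0" "items (run step_back s) = last (items s) # butlast (items s)"
proof -
  let ?s = "run step_back s" and ?h = "s ''hd'' 0" and ?t = "s ''tl'' 0"
  show h: "?s ''hd'' 0 = ?h - 1" and t: "?s ''tl'' 0 = ?t - 1" and "?s ''gd'' 0 = s ''gd'' 0"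
    by (simp_all add: step_back_def move_def)
  have "block s ?h ?t = block s ?h (?t - 1) @ [(s ''q'' (?t - 1), s ''w0'' (?t - 1), s ''w1'' (?t - 1))]"
    using assms block_snoc[of ?h "?t - 1" s] by simp
  moreover have "block ?s (?h - 1) (?t - 1) = (s ''q'' (?t - 1), s ''w0'' (?t - 1), s ''w1'' (?t - 1)) # block s ?h (?t - 1)"
  proof -
    have "block ?s ?h (?t - 1) = block s ?h (?t - 1)"
      using assms by (intro block_cong) (auto simp: step_back_def move_def)
    then show ?thesis using assms block_Cons[of "?h - 1" "?t - 1" ?s]
      by (simp add: step_back_def move_def)
  qed
  ultimately show "items ?s = last (items s) # butlast (items s)" unfolding h t by simp
qed

lemma rotate_back2:
  assumes "2 \<le> length xs"
  shows "last (last xs # butlast xs) # butlast (last xs # butlast xs) = rotate (length xs - 2) xs"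
proof -
  obtain ys b where 1: "xs = ys @ [b]" using assms by (cases xs rule: rev_cases) auto
  obtain zs a where 2: "ys = zs @ [a]" using assms 1 by (cases ys rule: rev_cases) auto
  show ?thesis unfolding 1 2 by (simp add: rotate_append butlast_append)
qed

lemma run_retreat:
  assumes "2 \<le> s ''gd'' 0" "s ''gd'' 0 \<le> s ''hd'' 0" "5 \<le> length (items s)"
  shows "items (run retreat s) = rotate (length (items s) - 2) (items s)"
    "run retreat s ''gd'' 0 = min (s ''gd'' 0 - 2) (length (items s) - 5)"
    "run retreat s ''hd'' 0 = s ''hd'' 0 - 2"
proof -
  let ?xs = "items s" and ?k = "length (items s)"
  let ?s1 = "run step_back s"
  let ?s2 = "run step_back ?s1"
  let ?s3 = "?s2(''gd'' := (?s2 ''gd'')(0 := s ''gd'' 0 - 2))"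
  note 1 = run_step_back[of s]
  have a: "1 \<le> s ''hd'' 0" "s ''hd'' 0 < s ''tl'' 0" using assms by auto
  have b: "1 \<le> ?s1 ''hd'' 0" "?s1 ''hd'' 0 < ?s1 ''tl'' 0" using assms 1[OF a] by auto
  note 2 = run_step_back[of ?s1, OF b]
  have r: "items ?s2 = rotate (?k - 2) ?xs"
    unfolding 2(4) unfolding 1(4)[OF a] by (rule rotate_back2) (use assms(3) in linarith)
  have gd: "?s2 ''gd'' 0 = s ''gd'' 0" using 1(3)[OF a] 2(3) by simp
  have tl: "?s2 ''tl'' 0 - ?s2 ''hd'' 0 = ?k" using 1[OF a] 2 assms by simp
  have run: "run retreat s = (if ?k - 5 < s ''gd'' 0 - 2 then ?s3(''gd'' := (?s3 ''gd'')(0 := ?k - 5)) else ?s3)"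
    using assms(1) gd tl unfolding retreat_def by simp
  show "run retreat s ''gd'' 0 = min (s ''gd'' 0 - 2) (?k - 5)" unfolding run by simp
  show "run retreat s ''hd'' 0 = s ''hd'' 0 - 2" unfolding run using 1[OF a] 2 by simp
  show "items (run retreat s) = rotate (?k - 2) ?xs" unfolding run r[symmetric] by (auto simp: block_def)
qed

lemma run_retreat_small:
  assumes "s ''gd'' 0 < 2"
  shows "items (run retreat s) = items s" "run retreat s ''gd'' 0 = 0"
  using assms by (auto simp: retreat_def block_def)

lemma run_advance:
  assumes "s ''hd'' 0 < s ''tl'' 0"
  shows "items (run advance s) = rotate 1 (items s)" "run advance s ''gd'' 0 = Suc (s ''gd'' 0)"
    "run advance s ''hd'' 0 = Suc (s ''hd'' 0)"
proof -
  let ?s = "run advance s" and ?h = "s ''hd'' 0" and ?t = "s ''tl'' 0"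
  show h: "?s ''hd'' 0 = Suc ?h" and "?s ''gd'' 0 = Suc (s ''gd'' 0)"
    by (simp_all add: advance_def move_def)
  have t: "?s ''tl'' 0 = Suc ?t" by (simp add: advance_def move_def)
  have "block ?s (Suc ?h) ?t = block s (Suc ?h) ?t"
    by (intro block_cong) (auto simp: advance_def move_def)
  then have "items ?s = block s (Suc ?h) ?t @ [(s ''q'' ?h, s ''w0'' ?h, s ''w1'' ?h)]"
    unfolding h t using assms by (simp add: block_snoc) (simp add: advance_def move_def)
  then show "items ?s = rotate 1 (items s)" using assms by (simp add: block_Cons)
qed

lemma window_clean_rotate:
  assumes "i < length xs"
  shows "window_clean adj (rotate n xs) i \<longleftrightarrow> window_clean adj xs ((i + n) mod length xs)"
proof -
  have l: "0 < length xs" using assms by auto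
  have m: "(n + i mod length xs) mod length xs = (i + n) mod length xs" for i by (simp add: mod_simps add.commute)
  show ?thesis using assms l
    by (simp add: window_clean_def nth_rotate m mod_Suc_eq mod_simps add.commute[of n])
qed

lemma window_clean_suffix:
  assumes "3 \<le> j" "j \<le> length R"
  shows "window_clean adj (P @ R) (length (P @ R) - j) \<longleftrightarrow>
    seg adj (R ! (length R - j)) (R ! (length R - j + 1)) (R ! (length R - j + 2)) = None"
proof -
  define i where "i = length R - j"
  have e: "length (P @ R) - j = length P + i" using assms by (simp add: i_def)
  have "Suc (length P + i) mod length (P @ R) = length P + (i + 1)" "(length P + i + 2) mod length (P @ R) = length P + (i + 2)"
    using assms by (simp_all add: i_def)
  then show ?thesis unfolding window_clean_def e i_def[symmetric] by (simp only: nth_append_length_plus)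
qed

text \<open>The windows are counted from the end of the list, the last two of them wrapping around.
  The bound \<open>gd <= hd\<close> keeps free cells to the left of \<open>hd\<close> for the steps
  back.\<close>

definition cinv :: "nat \<Rightarrow> nat set \<Rightarrow> state \<Rightarrow> bool" where
  "cinv k X s \<longleftrightarrow> wits (items s) \<subseteq> X \<and> ok s \<and> obs adj (items s) \<and> verts_of (items s) \<subseteq> U \<and> length (items s) \<le> k \<and>
     s ''gd'' 0 \<le> length (items s) \<and> s ''gd'' 0 \<le> s ''hd'' 0 \<and>
     (\<forall>m. 1 \<le> m \<and> m \<le> s ''gd'' 0 \<longrightarrow> window_clean adj (items s) (length (items s) - m))"

lemma obs_rotate_eq: "obs adj (rotate n xs) = obs adj xs"
proof
  assume "obs adj (rotate n xs)"
  then have "obs adj (rotate (length xs - n mod length xs) (rotate n xs))" by (rule obs_rotate_list)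
  moreover have "rotate (length xs - n mod length xs) (rotate n xs) = xs"
  proof (cases "xs = []")
    case False
    then have "(length xs - n mod length xs + n) mod length xs = 0"
      by (metis add.commute le_add_diff_inverse2 length_greater_0_conv less_imp_le_nat mod_add_right_eq mod_less_divisor mod_self)
    then show ?thesis by (simp add: rotate_rotate rotate_conv_mod[of "length xs - n mod length xs + n"])
  qed simp
  ultimately show "obs adj xs" by simp
qed (rule obs_rotate_list)

lemma verts_of_rotate: "cores (rotate n xs) = cores xs" "wits (rotate n xs) = wits xs"
  by (simp_all add: cores_def wits_def)

lemma weight_rotate_list: "weight (rotate n xs) = weight xs"
  using weight_rotate[of "drop (n mod length xs) xs" "take (n mod length xs) xs"] by (simp add: rotate_drop_take)

text \<open>An advance raises \<open>gd\<close> by one. A rewriting lowers the weight by at least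
  one and \<open>gd\<close> by at most seven. So eight times the weight minus \<open>gd\<close>
  always falls.\<close>

lemma clean_step_correct:
  assumes I: "cinv k X s" and g: "s ''gd'' 0 < length (items s)" and k: "11 < length (items s)"
  defines "s' \<equiv> run (clean_step adjt) s"
  shows "cinv k X s' \<and> 8 * weight (items s') + s ''gd'' 0 < 8 * weight (items s) + s' ''gd'' 0"
proof -
  let ?xs = "items s" and ?g = "s ''gd'' 0"
  let ?s1 = "run (reduce adjt) s"
  have ok: "ok s" and o: "obs adj ?xs" and U: "verts_of ?xs \<subseteq> U" and X: "wits ?xs \<subseteq> X" and lk: "length ?xs \<le> k" and gh: "?g \<le> s ''hd'' 0"
    and W: "\<And>m. 1 \<le> m \<Longrightarrow> m \<le> ?g \<Longrightarrow> window_clean adj ?xs (length ?xs - m)"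
    using I by (auto simp: cinv_def)
  have U': "wits ?xs \<subseteq> U" using U by auto
  note R = run_reduce[OF ok U'] 
  have ok': "ok s'" unfolding s'_def by (rule run_ok[OF loopfree_clean_step writes_clean_step ok])
  have len: "length (rotate n xs) = length xs" for n and xs :: "nat item list" by simp
  have s': "s' = (if 0 < ?s1 ''red'' 0 then run retreat ?s1 else run advance ?s1)"
    by (simp add: s'_def clean_step_def)
  obtain i0 i1 i2 K where xs: "?xs = i0 # i1 # i2 # K"
    using k by (cases ?xs; cases "tl ?xs"; cases "tl (tl ?xs)") auto
  have K: "9 \<le> length K" using k unfolding xs by simp
  show ?thesis
  proof (cases "seg adj i0 i1 i2")
    case None
    then have r: "?s1 ''red'' 0 = 0" "items ?s1 = ?xs" "?s1 ''gd'' 0 = ?g" "?s1 ''tl'' 0 = s ''tl'' 0" "s ''hd'' 0 \<le> ?s1 ''hd'' 0"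
      using R k by (auto simp: xs numeral_2_eq_2)
    have s'': "s' = run advance ?s1" using s' r by simp
    have ht: "?s1 ''hd'' 0 < ?s1 ''tl'' 0" using r(2) k by (metis length_block zero_less_diff gr_implies_not_zero not_gr_zero)
    note A = run_advance[of ?s1, OF ht, folded s'', unfolded r(2,3)]
    have "window_clean adj (rotate 1 ?xs) (length ?xs - m)" if m: "1 \<le> m" "m \<le> Suc ?g" for m
    proof (cases "m = 1")
      case True
      have "window_clean adj ?xs 0" unfolding window_clean_def using None K by (simp add: xs numeral_2_eq_2)
      moreover have "(length ?xs - m + 1) mod length ?xs = 0"
      proof -
        have "length ?xs - m + 1 = length ?xs" using True k by linarith
        then show ?thesis by (simp only: mod_self)
      qed
      ultimately show ?thesis using window_clean_rotate[of "length ?xs - m" ?xs 1] k m by simp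
    next
      case False
      then have "length ?xs - m + 1 = length ?xs - (m - 1)" "length ?xs - m + 1 < length ?xs" using m g by auto
      then show ?thesis using W[of "m - 1"] window_clean_rotate[of "length ?xs - m" ?xs 1] k m False by simp
    qed
    then have "cinv k X s'" unfolding cinv_def A(1) len obs_rotate_eq verts_of_rotate
      using o U X lk g gh r(5) ok' A(2,3) by simp
    then show ?thesis unfolding A(1) weight_rotate_list using A(2) by simp
  next
    case (Some ys)
    let ?zs = "ys @ K"
    have r: "?s1 ''red'' 0 = 1" "items ?s1 = ?zs" "?s1 ''gd'' 0 = ?g" "s ''hd'' 0 \<le> ?s1 ''hd'' 0"
      using R k Some by (auto simp: xs numeral_2_eq_2 numeral_3_eq_3)
    have s'': "s' = run retreat ?s1" using s' r by simp
    have oz: "obs adj ?zs" using seg_obs[OF _ _ Some] o K unfolding xs by auto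
    have Uz: "verts_of ?zs \<subseteq> U" using seg_verts[OF Some, of K] U unfolding xs by blast
    have Xz: "wits ?zs \<subseteq> X" using seg_wits[OF Some, of K] X unfolding xs by blast
    have wz: "weight ?zs < weight ?xs" using weight_seg[OF Some] unfolding xs .
    have ly: "1 \<le> length ys" "length ys \<le> 3" using seg_length[OF Some] by auto
    show ?thesis
    proof (cases "2 \<le> ?g")
      case True
      then have A: "items s' = rotate (length ?zs - 2) ?zs" "s' ''gd'' 0 = min (?g - 2) (length ?zs - 5)" "s' ''hd'' 0 = ?s1 ''hd'' 0 - 2"
        using run_retreat[of ?s1] r gh K unfolding s'' by auto
      have "window_clean adj (rotate (length ?zs - 2) ?zs) (length ?zs - m)"
        if m: "1 \<le> m" "m \<le> min (?g - 2) (length ?zs - 5)" for m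
      proof -
        \<comment> \<open>Counted in the list before the rotation, the window starts
          \<open>m + 2\<close> places before the end; it lies inside \<open>K\<close>, which the
          rewriting left untouched.\<close>
        have j: "3 \<le> m + 2" "m + 2 \<le> length K" using m ly by auto
        have "(length ?zs - m + (length ?zs - 2)) mod length ?zs = length ?zs - (m + 2)"
        proof -
          have "length ?zs - m + (length ?zs - 2) = length ?zs + (length ?zs - (m + 2))" using j by simp
          moreover have "length ?zs - (m + 2) < length ?zs" using j by simp
          ultimately show ?thesis by (simp only: mod_add_self1 mod_less)
        qed
        then have "window_clean adj (rotate (length ?zs - 2) ?zs) (length ?zs - m) \<longleftrightarrow> window_clean adj ?zs (length ?zs - (m + 2))"
          using window_clean_rotate[of "length ?zs - m" ?zs] m K by simp
        also have "\<dots> \<longleftrightarrow> window_clean adj ([i0, i1, i2] @ K) (length ([i0, i1, i2] @ K) - (m + 2))"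
          unfolding window_clean_suffix[OF j] ..
        also have "\<dots>"
        proof -
          have "m + 2 \<le> ?g" using m True by auto
          then show ?thesis using W[of "m + 2"] unfolding xs by simp
        qed
        finally show ?thesis .
      qed
      then have "cinv k X s'" unfolding cinv_def A(1) len obs_rotate_eq verts_of_rotate A(2)
        using oz Uz Xz lk gh r(4) ok' A(3) ly unfolding xs by auto
      moreover have "?g \<le> s' ''gd'' 0 + 7" using A(2) g ly unfolding xs by simp
      ultimately show ?thesis using wz unfolding A(1) weight_rotate_list by linarith
    next
      case False
      then have A: "items s' = ?zs" "s' ''gd'' 0 = 0" using run_retreat_small[of ?s1] r unfolding s'' by auto
      then have "cinv k X s'" unfolding cinv_def using oz Uz Xz lk ok' ly unfolding xs by auto
      then show ?thesis using wz A False by simp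
    qed
  qed
qed

lemma ends_clean_up:
  assumes ok: "ok s" and o: "obs adj (items s)" and U: "verts_of (items s) \<subseteq> U"
  shows "ends (clean_up adjt) s (32 * (cost (clean_step adjt) + 1) * length (items s) + 2)
    (\<lambda>s'. ok s' \<and> obs adj (items s') \<and> verts_of (items s') \<subseteq> U \<and> length (items s') \<le> length (items s) \<and>
       (12 \<le> length (items s') \<longrightarrow> clean (items s')) \<and> wits (items s') \<subseteq> wits (items s))"
  unfolding clean_up_def
proof (rule ends_Seq)
  let ?k = "length (items s)" and ?C = "cost (clean_step adjt) + 1" and ?X = "wits (items s)"
  let ?s0 = "s(''gd'' := (s ''gd'')(0 := 0))"
  have i0: "items ?s0 = items s" by (simp add: block_def)
  have "ok ?s0" by (rule ok_upd[OF ok]) (simp add: adj_arrays_def)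
  then have "cinv ?k ?X ?s0" using o U by (simp add: cinv_def block_def)
  then show "ends (Set ''gd'' (Const 0)) s 1 (\<lambda>s'. cinv ?k ?X s' \<and> weight (items s') \<le> 4 * ?k)"
    using weight_le[of "items s"] i0 by (intro ends_run) auto
  show "1 + (8 * (4 * ?k) * ?C + 1) \<le> 32 * ?C * ?k + 2" by (simp add: algebra_simps)
  fix s1 assume s1: "cinv ?k ?X s1 \<and> weight (items s1) \<le> 4 * ?k"
  have gw: "s' ''gd'' 0 \<le> 8 * weight (items s')" if "cinv ?k ?X s'" for s'
    using that by (auto simp: cinv_def weight_def)
  show "ends (While (Conj (Less (Var ''gd'') Len) (Less (Const 11) Len)) (clean_step adjt)) s1 (8 * (4 * ?k) * ?C + 1)
    (\<lambda>s'. ok s' \<and> obs adj (items s') \<and> verts_of (items s') \<subseteq> U \<and> length (items s') \<le> length (items s) \<and>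
       (12 \<le> length (items s') \<longrightarrow> clean (items s')) \<and> wits (items s') \<subseteq> wits (items s))"
  proof (rule ends_While[where I = "cinv ?k ?X" and \<Phi> = "\<lambda>s. (8 * weight (items s) - s ''gd'' 0) * ?C"])
    fix s' assume I: "cinv ?k ?X s'" and b: "eval_test (Conj (Less (Var ''gd'') Len) (Less (Const 11) Len)) s'"
    let ?r = "run (clean_step adjt) s'"
    have c: "cinv ?k ?X ?r \<and> 8 * weight (items ?r) + s' ''gd'' 0 < 8 * weight (items s') + ?r ''gd'' 0"
      using clean_step_correct[OF I] b by simp
    then have "Suc (8 * weight (items ?r) - ?r ''gd'' 0) \<le> 8 * weight (items s') - s' ''gd'' 0"
      using gw[OF I] gw[of ?r] by linarith
    from mult_le_mono1[OF this, of ?C]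
    show "\<exists>T. ends (clean_step adjt) s' T (\<lambda>s''. cinv ?k ?X s'' \<and>
        T + 1 + (8 * weight (items s'') - s'' ''gd'' 0) * ?C \<le> (8 * weight (items s') - s' ''gd'' 0) * ?C)"
      using c by (intro exI[of _ "cost (clean_step adjt)"] ends_run[OF loopfree_clean_step]) auto
  next
    show "cinv ?k ?X s1" using s1 by simp
    have "(8 * weight (items s1) - s1 ''gd'' 0) \<le> 8 * (4 * ?k)" using s1 by linarith
    from mult_le_mono1[OF this, of ?C]
    show "(8 * weight (items s1) - s1 ''gd'' 0) * ?C + 1 \<le> 8 * (4 * ?k) * ?C + 1" by simp
  next
    fix s' assume I: "cinv ?k ?X s'" and b: "\<not> eval_test (Conj (Less (Var ''gd'') Len) (Less (Const 11) Len)) s'"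
    have "clean (items s')" if "12 \<le> length (items s')"
    proof -
      have g: "s' ''gd'' 0 = length (items s')" using b that I by (auto simp: cinv_def)
      have "window_clean adj (items s') i" if "i < length (items s')" for i
      proof -
        have "window_clean adj (items s') (length (items s') - (length (items s') - i))"
          using I that unfolding cinv_def g by (metis One_nat_def Suc_leI diff_le_self zero_less_diff)
        moreover have "length (items s') - (length (items s') - i) = i" using that by linarith
        ultimately show ?thesis by (simp only:)
      qed
      then show ?thesis unfolding clean_def window_clean_def by blast
    qed
    then show "ok s' \<and> obs adj (items s') \<and> verts_of (items s') \<subseteq> U \<and> length (items s') \<le> length (items s) \<and>
       (12 \<le> length (items s') \<longrightarrow> clean (items s')) \<and> wits (items s') \<subseteq> wits (items s)"
      using I unfolding cinv_def by blast
  qed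
qed

end

section \<open>Far neighbours in a cyclic order\<close>

definition cyclic_between :: "('a \<Rightarrow> nat) \<Rightarrow> 'a \<Rightarrow> 'a \<Rightarrow> 'a \<Rightarrow> bool" where
  "cyclic_between key x z y \<longleftrightarrow>
     key x < key z \<and> key z < key y \<or> key y < key x \<and> key x < key z \<or> key z < key y \<and> key y < key x"

text \<open>Modelled on circular arcs with their entering extremes as keys: one of two adjacent
  vertices is adjacent to everything met on the way to the other.\<close>

definition sweepable :: "('a \<Rightarrow> 'a \<Rightarrow> bool) \<Rightarrow> ('a \<Rightarrow> nat) \<Rightarrow> 'a set \<Rightarrow> bool" where
  "sweepable adj key U \<longleftrightarrow> (\<forall>x\<in>U. \<forall>y\<in>U. adj x y \<longrightarrow>
     (\<forall>z\<in>U. cyclic_between key x z y \<longrightarrow> adj x z) \<or> (\<forall>z\<in>U. cyclic_between key y z x \<longrightarrow> adj y z))"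

definition offset :: "nat \<Rightarrow> nat \<Rightarrow> nat \<Rightarrow> nat" where
  "offset n i j = (if i < j then j - i else n + j - i)"

lemma offset:
  assumes "i < n" "j < n" "i \<noteq> j"
  shows "0 < offset n i j" "offset n i j < n" "(i + offset n i j) mod n = j"
  using assms by (auto simp: offset_def)

lemma cyclic_between_nth:
  assumes s: "sorted_wrt (\<lambda>u v. key u < key v) E" and i: "i < length E" and j: "j < length E"
    and e: "0 < e" "e < offset (length E) i j" "i \<noteq> j"
  shows "cyclic_between key (E ! i) (E ! ((i + e) mod length E)) (E ! j)"
proof -
  have k: "p < q \<Longrightarrow> q < length E \<Longrightarrow> key (E ! p) < key (E ! q)" for p q
    using s by (simp add: sorted_wrt_iff_nth_less)
  show ?thesis
  proof (cases "i + e < length E")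
    case True
    then show ?thesis using e i j k[of i "i + e"] k[of "i + e" j] k[of j i]
      unfolding offset_def cyclic_between_def by (auto split: if_splits)
  next
    case False
    then have m: "(i + e) mod length E = i + e - length E" using e i j
      by (subst le_mod_geq) (auto simp: offset_def split: if_splits)
    have "i + e - length E < j" "j < i" using False e i j by (auto simp: offset_def split: if_splits)
    then show ?thesis using k[of "i + e - length E" j] k[of j i] i j
      unfolding m cyclic_between_def by auto
  qed
qed

text \<open>Five items are at circular distance at most two, the item itself included, and each has
  at most two witnesses.\<close>

lemma not_far_card:
  assumes "5 \<le> k" "p < k" "length xs = k"
  shows "card (\<Union>q\<in>{q. q < k \<and> \<not> far k p q}. wit_at xs q) \<le> 10"
    "finite (\<Union>q\<in>{q. q < k \<and> \<not> far k p q}. wit_at xs q)"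
proof -
  let ?D = "(\<lambda>d. (p + d) mod k) ` {0, 1, 2, k - 1, k - 2}"
  have "{q. q < k \<and> \<not> far k p q} \<subseteq> ?D"
  proof
    fix q assume "q \<in> {q. q < k \<and> \<not> far k p q}"
    then have q: "q < k" "\<not> far k p q" by auto
    have "(p + (if p \<le> q then q - p else k + q - p)) mod k = q" using q assms by auto
    moreover have "(if p \<le> q then q - p else k + q - p) \<in> {0, 1, 2, k - 1, k - 2}"
    proof (cases "p \<le> q")
      case True
      then have "q - p = 0 \<or> q - p = 1 \<or> q - p = 2 \<or> q - p = k - 1 \<or> q - p = k - 2"
        using q assms unfolding far_def by linarith
      then show ?thesis using True by simp
    next
      case False
      then have "p - q \<le> 2 \<or> k \<le> p - q + 2" using q unfolding far_def by linarith
      then have "p - q = 1 \<or> p - q = 2 \<or> p - q = k - 1 \<or> p - q = k - 2" using False assms by linarith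
      moreover have "k + q - p = k - (p - q)" using False by linarith
      ultimately show ?thesis using False assms(1) by auto
    qed
    ultimately show "q \<in> ?D" by (intro image_eqI[where x = "if p \<le> q then q - p else k + q - p"]) (simp_all only:)
  qed
  moreover have "card ?D \<le> 5" by (rule order_trans[OF card_image_le]) (auto simp: card_insert_if)
  ultimately have c: "card {q. q < k \<and> \<not> far k p q} \<le> 5" by (meson card_mono finite.emptyI finite_imageI finite_insert order_trans)
  have "card (\<Union>q\<in>{q. q < k \<and> \<not> far k p q}. wit_at xs q) \<le> (\<Sum>q\<in>{q. q < k \<and> \<not> far k p q}. card (wit_at xs q))"
    by (rule card_UN_le) auto
  also have "\<dots> \<le> (\<Sum>q\<in>{q. q < k \<and> \<not> far k p q}. 2)"
    by (rule sum_mono) (auto simp: wit_at_def card_insert_if)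
  also have "\<dots> \<le> 10" using c by simp
  finally show "card (\<Union>q\<in>{q. q < k \<and> \<not> far k p q}. wit_at xs q) \<le> 10" .
  show "finite (\<Union>q\<in>{q. q < k \<and> \<not> far k p q}. wit_at xs q)" by (auto simp: wit_at_def)
qed

context adjacency
begin

text \<open>If the first ten successors of x in the order of E are adjacent to x, then one of them is far
  from x, since at most ten witnesses, x among them, are near x.\<close>

lemma search_complete:
  assumes o: "obs adj xs" and c: "clean xs" and k: "5 \<le> length xs"
    and s: "sorted_wrt (\<lambda>u v. key u < key v) E" and E: "set E = wits xs" "wits xs \<subseteq> U"
    and pos: "\<And>y. y \<in> wits xs \<Longrightarrow> pos y < length xs \<and> y \<in> wit_at xs (pos y)"
    and S: "length E \<le> S \<or> 10 \<le> S \<and> sweepable adj key U"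
    and n: "\<And>i c. i < length E \<Longrightarrow> 0 < c \<Longrightarrow> c \<le> S \<Longrightarrow> c \<le> length E \<Longrightarrow>
      \<not> (adj (E ! i) (E ! ((i + c) mod length E)) \<and> far (length xs) (pos (E ! i)) (pos (E ! ((i + c) mod length E))))"
  shows "ess adj xs"
  unfolding ess_iff
proof (intro ballI impI, rule ccontr)
  fix x y assume xy: "x \<in> wits xs" "y \<in> wits xs" "adj x y" and "\<not> pair_ok adj xs x y"
  then have f: "far (length xs) (pos x) (pos y)"
    using clean_pair[OF o c, of "pos x" "pos y" x y] pos by blast
  have main: False if xy: "x \<in> wits xs" "y \<in> wits xs" "adj x y" and f: "far (length xs) (pos x) (pos y)"
    and adj: "length E \<le> S \<or> 10 \<le> S \<and> (\<forall>z\<in>U. cyclic_between key x z y \<longrightarrow> adj x z)" for x y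
  proof -
    obtain i j where ij: "i < length E" "j < length E" "x = E ! i" "y = E ! j"
      using xy E(1) by (metis in_set_conv_nth)
    have ne: "i \<noteq> j" using xy ij by auto
    let ?c = "offset (length E) i j"
    have c: "0 < ?c" "?c < length E" "(i + ?c) mod length E = j" using offset[OF ij(1,2) ne] by auto
    show False
    proof (cases "?c \<le> S")
      case True
      then show False using n[OF ij(1) c(1) True] c xy f ij by auto
    next
      case False
      then have S: "10 \<le> S" "\<And>z. z \<in> U \<Longrightarrow> cyclic_between key x z y \<Longrightarrow> adj x z" using adj c by auto
      let ?z = "\<lambda>e. E ! ((i + e) mod length E)"
      let ?N = "\<Union>q\<in>{q. q < length xs \<and> \<not> far (length xs) (pos x) q}. wit_at xs q"
      have l: "0 < length E" using ij by auto
      have "?z e \<in> ?N" if e: "e \<le> 10" for e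
      proof -
        have z: "?z e \<in> wits xs" using l E(1) by (metis mod_less_divisor nth_mem)
        have "\<not> far (length xs) (pos x) (pos (?z e))"
        proof (cases "e = 0")
          case True
          then show ?thesis using ij by (simp add: far_def)
        next
          case e0: False
          have "cyclic_between key x (?z e) y"
            using cyclic_between_nth[OF s ij(1,2), of e] e0 e S(1) False ne unfolding ij by auto
          then have "adj x (?z e)" using S(2) z E(2) by blast
          then show ?thesis using n[OF ij(1), of e] e0 e S(1) False c ij by auto
        qed
        then show ?thesis using pos[OF z] by blast
      qed
      then have "?z ` {..10} \<subseteq> ?N" by auto
      moreover have "inj_on ?z {..10}"
      proof (rule inj_onI)
        fix d e :: nat assume de: "d \<in> {..10}" "e \<in> {..10}" "?z d = ?z e"
        have "distinct E" using s by (metis (mono_tags, lifting) less_irrefl linorder_neqE_nat nth_eq_iff_index_eq sorted_wrt_iff_nth_less distinct_conv_nth)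
        then have "(i + d) mod length E = (i + e) mod length E" using de(3) l by (simp add: nth_eq_iff_index_eq)
        moreover have "d < length E" "e < length E" using de(1,2) S(1) False c by auto
        ultimately show "d = e" using ij(1)
          by (auto simp: mod_if[of "i + d"] mod_if[of "i + e"] split: if_splits)
      qed
      ultimately have "card {..10::nat} \<le> card ?N"
        using card_inj_on_le not_far_card(2)[OF k, of "pos x" xs] pos[OF xy(1)] by blast
      then show False using not_far_card(1)[OF k, of "pos x" xs] pos[OF xy(1)] by simp
    qed
  qed
  have f': "far (length xs) (pos y) (pos x)" using f by (auto simp: far_def)
  have U: "x \<in> U" "y \<in> U" using xy E by auto
  show False
    using main[OF xy f] main[OF xy(2,1) adj_sym[OF xy(3)] f'] S U xy(3) unfolding sweepable_def by blast
qed

end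

section \<open>The search for an edge between far items\<close>

text \<open>An entry of \<open>ix\<close> is trusted only if the item it points to lies in the
  current list and contains the vertex. Outdated entries are thus recognised, and the array is never
  cleared between rounds.\<close>

definition is_current :: "exp \<Rightarrow> test" where
  "is_current e = (let p = Read ''ix'' e in
     Conj (Le Hd p) (Conj (Less p Tl) (Or (Eq (Read ''w0'' p) e) (Eq (Read ''w1'' p) e))))"

definition current :: "state \<Rightarrow> nat \<Rightarrow> bool" where
  "current s v \<longleftrightarrow> s ''hd'' 0 \<le> s ''ix'' v \<and> s ''ix'' v < s ''tl'' 0 \<and>
     (s ''w0'' (s ''ix'' v) = v \<or> s ''w1'' (s ''ix'' v) = v)"

lemma eval_is_current [simp]: "eval_test (is_current e) s \<longleftrightarrow> current s (eval_exp e s)"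
  by (auto simp: is_current_def current_def Let_def)

text \<open>A witness of several items keeps the last of its positions. Any one is good enough,
  because \<open>clean_pair\<close> holds for every position at which the witnesses occur.\<close>

definition mark :: com where
  "mark = Seq (Set ''i'' Hd) (While (Less (Var ''i'') Tl)
     (seqs [Write ''ix'' (Read ''w0'' (Var ''i'')) (Var ''i''),
            Write ''ix'' (Read ''w1'' (Var ''i'')) (Var ''i''), Inc ''i'']))"

definition filter_step :: com where
  "filter_step = Seq (Branch (is_current (Read ''ord'' (Var ''i'')))
     (seqs [Write ''ord'' (Var ''j'') (Read ''ord'' (Var ''i'')), Inc ''j'']) Skip) (Inc ''i'')"

definition filter_order :: com where
  "filter_order = seqs [Set ''i'' (Const 0), Set ''j'' (Const 0),
     While (Less (Var ''i'') (Var ''el'')) filter_step, Set ''el'' (Var ''j'')]"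

definition far_test :: "exp \<Rightarrow> exp \<Rightarrow> test" where
  "far_test p q = Or (Conj (Less (Const 2) (Minus q p)) (Less (Succ (Succ (Minus q p))) Len))
                     (Conj (Less (Const 2) (Minus p q)) (Less (Succ (Succ (Minus p q))) Len))"

lemma eval_far_test [simp]:
  "eval_test (far_test p q) s \<longleftrightarrow> far (s ''tl'' 0 - s ''hd'' 0) (eval_exp p s) (eval_exp q s)"
  by (auto simp: far_test_def far_def)

definition search_step :: "(exp \<Rightarrow> exp \<Rightarrow> test) \<Rightarrow> com" where
  "search_step adjt = (let x = Read ''ord'' (Var ''i''); y = Read ''ord'' (Var ''j'') in
     seqs [Branch (Less (Succ (Var ''j'')) (Var ''el'')) (Inc ''j'') (Set ''j'' (Const 0)), Inc ''c'',
       Branch (Conj (adjt x y) (far_test (Read ''ix'' x) (Read ''ix'' y)))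
         (seqs [Set ''fd'' (Const 1), Set ''fx'' x, Set ''fy'' y]) Skip])"

text \<open>\<open>mx\<close> limits how many successors of each vertex are tried: it is set to the
  number of vertices for a graph and to ten for a model.\<close>

definition search :: "(exp \<Rightarrow> exp \<Rightarrow> test) \<Rightarrow> com" where
  "search adjt = seqs [Set ''fd'' (Const 0), Set ''i'' (Const 0),
     While (Conj (Less (Var ''i'') (Var ''el'')) (Eq (Var ''fd'') (Const 0)))
       (seqs [Set ''j'' (Var ''i''), Set ''c'' (Const 0),
         While (Conj (Less (Var ''c'') (Var ''mx'')) (Conj (Less (Var ''c'') (Var ''el'')) (Eq (Var ''fd'') (Const 0))))
           (search_step adjt), Inc ''i''])]"

definition order :: "state \<Rightarrow> nat list" where
  "order s = map (s ''ord'') [0..<s ''el'' 0]"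

lemma ends_mark:
  "ends mark s (4 * (s ''tl'' 0 - s ''hd'' 0) + 2)
     (\<lambda>s'. \<forall>y\<in>wits (items s). current s' y)"
  unfolding mark_def
proof (rule ends_Seq)
  let ?I = "\<lambda>s'. s ''hd'' 0 \<le> s' ''i'' 0 \<and> (s ''hd'' 0 \<le> s ''tl'' 0 \<longrightarrow> s' ''i'' 0 \<le> s ''tl'' 0) \<and>
    (\<forall>p. s ''hd'' 0 \<le> p \<longrightarrow> p < s' ''i'' 0 \<longrightarrow> (\<forall>y\<in>{s ''w0'' p, s ''w1'' p}.
      s ''hd'' 0 \<le> s' ''ix'' y \<and> s' ''ix'' y < s' ''i'' 0 \<and> (s ''w0'' (s' ''ix'' y) = y \<or> s ''w1'' (s' ''ix'' y) = y)))"
  show "ends (Set ''i'' Hd) s 1 (\<lambda>s'. ?I s' \<and> s' ''i'' 0 = s ''hd'' 0)"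
    by (rule ends_run) auto
  fix s1 assume s1: "?I s1 \<and> s1 ''i'' 0 = s ''hd'' 0" and fr: "\<And>a. a \<notin> writes (Set ''i'' Hd) \<Longrightarrow> s1 a = s a"
  show "ends (While (Less (Var ''i'') Tl)
     (seqs [Write ''ix'' (Read ''w0'' (Var ''i'')) (Var ''i''),
            Write ''ix'' (Read ''w1'' (Var ''i'')) (Var ''i''), Inc ''i''])) s1 (4 * (s ''tl'' 0 - s ''hd'' 0) + 1)
     (\<lambda>s'. \<forall>y\<in>wits (items s). current s' y)"
  proof (rule ends_While[where I = ?I and \<Phi> = "\<lambda>s'. 4 * (s ''tl'' 0 - s' ''i'' 0)"])
    fix s' assume I: "?I s'" and b: "eval_test (Less (Var ''i'') Tl) s'"
      and f: "\<And>a. a \<notin> writes (seqs [Write ''ix'' (Read ''w0'' (Var ''i'')) (Var ''i''),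
            Write ''ix'' (Read ''w1'' (Var ''i'')) (Var ''i''), Inc ''i'']) \<Longrightarrow> s' a = s1 a"
    have e: "s' ''w0'' = s ''w0''" "s' ''w1'' = s ''w1''" "s' ''tl'' = s ''tl''" "s' ''hd'' = s ''hd''"
      using f fr by auto
    show "\<exists>T. ends (seqs [Write ''ix'' (Read ''w0'' (Var ''i'')) (Var ''i''),
            Write ''ix'' (Read ''w1'' (Var ''i'')) (Var ''i''), Inc ''i'']) s' T (\<lambda>s''. ?I s'' \<and>
          T + 1 + 4 * (s ''tl'' 0 - s'' ''i'' 0) \<le> 4 * (s ''tl'' 0 - s' ''i'' 0))"
      using I b e by (intro exI[of _ 3] ends_run) (auto simp: less_Suc_eq)
  next
    show "?I s1" using s1 by simp
    show "4 * (s ''tl'' 0 - s1 ''i'' 0) + 1 \<le> 4 * (s ''tl'' 0 - s ''hd'' 0) + 1" using s1 by simp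
  next
    fix s' assume I: "?I s'" and b: "\<not> eval_test (Less (Var ''i'') Tl) s'"
      and f: "\<And>a. a \<notin> writes (seqs [Write ''ix'' (Read ''w0'' (Var ''i'')) (Var ''i''),
            Write ''ix'' (Read ''w1'' (Var ''i'')) (Var ''i''), Inc ''i'']) \<Longrightarrow> s' a = s1 a"
    have e: "s' ''w0'' = s ''w0''" "s' ''w1'' = s ''w1''" "s' ''tl'' = s ''tl''" "s' ''hd'' = s ''hd''"
      using f fr by auto
    show "\<forall>y\<in>wits (items s). current s' y"
    proof
      fix y assume "y \<in> wits (items s)"
      then obtain p where p: "s ''hd'' 0 \<le> p" "p < s ''tl'' 0" "y \<in> {s ''w0'' p, s ''w1'' p}"
        by (auto simp: wits_def block_def)
      then have "p < s' ''i'' 0" "s' ''i'' 0 \<le> s ''tl'' 0" using I b e by auto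
      then show "current s' y" using I p unfolding current_def e by (meson order_less_le_trans)
    qed
  qed
qed simp

lemma ends_filter_order:
  "ends filter_order s (6 * s ''el'' 0 + 5) (\<lambda>s'. order s' = filter (current s) (order s))"
proof -
  let ?n = "s ''el'' 0" and ?L = "order s"
  let ?I = "\<lambda>s'. s' ''i'' 0 \<le> ?n \<and> s' ''j'' 0 \<le> s' ''i'' 0 \<and>
    map (s' ''ord'') [0..<s' ''j'' 0] = filter (current s) (take (s' ''i'' 0) ?L) \<and>
    (\<forall>p. s' ''i'' 0 \<le> p \<longrightarrow> s' ''ord'' p = s ''ord'' p)"
  let ?B = filter_step
  have wB: "writes ?B = {''ord'', ''j'', ''i''}" by (auto simp: filter_step_def)
  have len: "length ?L = ?n" by (simp add: order_def)
  let ?P = "seqs [Set ''i'' (Const 0), Set ''j'' (Const 0)]"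
  have 1: "ends (Set ''i'' (Const 0)) s 1 (\<lambda>s'. s' ''i'' 0 = 0)" by (rule ends_run) auto
  have 2: "ends (While (Less (Var ''i'') (Var ''el'')) ?B) s1 (6 * ?n + 1)
     (\<lambda>s'. map (s' ''ord'') [0..<s' ''j'' 0] = filter (current s) ?L)"
    if s1: "s1 ''i'' 0 = 0" "s1 ''j'' 0 = 0" and fr: "\<And>a. a \<notin> {''i'', ''j''} \<Longrightarrow> s1 a = s a" for s1
  proof (rule ends_While[where I = ?I and \<Phi> = "\<lambda>s'. 6 * (?n - s' ''i'' 0)"])
    fix s' assume I: "?I s'" and b: "eval_test (Less (Var ''i'') (Var ''el'')) s'"
      and f: "\<And>a. a \<notin> writes ?B \<Longrightarrow> s' a = s1 a"
    have e: "s' ''w0'' = s ''w0''" "s' ''w1'' = s ''w1''" "s' ''tl'' = s ''tl''" "s' ''hd'' = s ''hd''"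
      "s' ''ix'' = s ''ix''" "s' ''el'' = s ''el''" using f fr by (auto simp: wB)
    have cur: "current s' v = current s v" for v by (simp add: current_def e)
    have i: "s' ''i'' 0 < ?n" using b e by simp
    then have tk: "take (Suc (s' ''i'' 0)) ?L = take (s' ''i'' 0) ?L @ [s ''ord'' (s' ''i'' 0)]"
      using take_Suc_conv_app_nth[of "s' ''i'' 0" ?L] len by (simp add: order_def)
    have up: "map ((s' ''ord'')(s' ''j'' 0 := v)) [0..<s' ''j'' 0] = map (s' ''ord'') [0..<s' ''j'' 0]" for v
      by auto
    show "\<exists>T. ends ?B s' T (\<lambda>s''. ?I s'' \<and> T + 1 + 6 * (?n - s'' ''i'' 0) \<le> 6 * (?n - s' ''i'' 0))"
      using I i by (intro exI[of _ 5] ends_run) (auto simp: cur tk up filter_step_def)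
  next
    show "?I s1" using s1 fr by simp
    show "6 * (?n - s1 ''i'' 0) + 1 \<le> 6 * ?n + 1" by simp
  next
    fix s' assume I: "?I s'" and b: "\<not> eval_test (Less (Var ''i'') (Var ''el'')) s'"
      and f: "\<And>a. a \<notin> writes ?B \<Longrightarrow> s' a = s1 a"
    have "s' ''el'' = s ''el''" using f fr by (auto simp: wB)
    then have "s' ''i'' 0 = ?n" using I b by simp
    then show "map (s' ''ord'') [0..<s' ''j'' 0] = filter (current s) ?L" using I len by simp
  qed
  show ?thesis unfolding filter_order_def seqs.simps
  proof (rule ends_Seq[OF 1])
    fix s0 assume s0: "s0 ''i'' 0 = 0" and f0: "\<And>a. a \<notin> writes (Set ''i'' (Const 0)) \<Longrightarrow> s0 a = s a"
    show "ends (Seq (Set ''j'' (Const 0)) (Seq (While (Less (Var ''i'') (Var ''el'')) ?B) (Set ''el'' (Var ''j'')))) s0 (6 * ?n + 4)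
      (\<lambda>s'. order s' = filter (current s) ?L)"
    proof (rule ends_Seq)
      show "ends (Set ''j'' (Const 0)) s0 1 (\<lambda>s1. s1 ''i'' 0 = 0 \<and> s1 ''j'' 0 = 0 \<and> (\<forall>a. a \<notin> {''i'', ''j''} \<longrightarrow> s1 a = s a))"
        using s0 f0 by (intro ends_run) auto
      fix s1 assume s1: "s1 ''i'' 0 = 0 \<and> s1 ''j'' 0 = 0 \<and> (\<forall>a. a \<notin> {''i'', ''j''} \<longrightarrow> s1 a = s a)"
      show "ends (Seq (While (Less (Var ''i'') (Var ''el'')) ?B) (Set ''el'' (Var ''j''))) s1 (6 * ?n + 2)
        (\<lambda>s'. order s' = filter (current s) ?L)"
      proof (rule ends_Seq)
        show "ends (While (Less (Var ''i'') (Var ''el'')) ?B) s1 (6 * ?n + 1)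
           (\<lambda>s'. map (s' ''ord'') [0..<s' ''j'' 0] = filter (current s) ?L)" using s1 by (intro 2) auto
        show "ends (Set ''el'' (Var ''j'')) s2 1 (\<lambda>s'. order s' = filter (current s) ?L)"
          if "map (s2 ''ord'') [0..<s2 ''j'' 0] = filter (current s) ?L" for s2
          using that by (intro ends_run) (auto simp: order_def)
        show "6 * ?n + 1 + 1 \<le> 6 * ?n + 2" by simp
      qed
    qed simp
  qed simp
qed

context ram
begin

lemma ends_search:
  assumes ok: "ok s" and U: "set (order s) \<subseteq> U"
  defines "E \<equiv> order s" and "k \<equiv> s ''tl'' 0 - s ''hd'' 0"
  defines "hit \<equiv> \<lambda>x y. adj x y \<and> far k (s ''ix'' x) (s ''ix'' y)"
  shows "ends (search adjt) s (s ''el'' 0 * ((cost (search_step adjt) + 1) * min (s ''mx'' 0) (s ''el'' 0) + 5) + 3)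
    (\<lambda>s'. if s' ''fd'' 0 = 0
       then \<forall>i<length E. \<forall>c. 0 < c \<longrightarrow> c \<le> s ''mx'' 0 \<longrightarrow> c \<le> length E \<longrightarrow>
         \<not> hit (E ! i) (E ! ((i + c) mod length E))
       else s' ''fx'' 0 \<in> set E \<and> s' ''fy'' 0 \<in> set E \<and> hit (s' ''fx'' 0) (s' ''fy'' 0))"
    (is "ends _ _ _ ?Q")
proof -
  let ?n = "s ''el'' 0" and ?m = "s ''mx'' 0" and ?C = "cost (search_step adjt) + 1"
  define X where "X = {''fd'', ''fx'', ''fy'', ''i'', ''j'', ''c''}"
  define same where "same s' \<longleftrightarrow> (\<forall>a. a \<notin> X \<longrightarrow> s' a = s a)" for s' :: state
  have n: "length E = ?n" by (simp add: E_def order_def)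
  have nth: "E ! i = s ''ord'' i" if "i < ?n" for i using that by (simp add: E_def order_def)
  have sm: "ok s' \<and> s' ''ord'' = s ''ord'' \<and> s' ''el'' = s ''el'' \<and> s' ''mx'' = s ''mx'' \<and> s' ''tl'' = s ''tl'' \<and>
     s' ''hd'' = s ''hd'' \<and> s' ''ix'' = s ''ix''" if "same s'" for s'
  proof -
    have "adj_arrays \<inter> X = {}" by (simp add: adj_arrays_def X_def)
    then have "ok s'" using that unfolding same_def by (intro ok_frame[OF ok]) blast
    then show ?thesis using that by (simp add: same_def X_def)
  qed
  have lf: "loopfree (search_step adjt)" by (simp add: search_step_def Let_def)
  define found where "found s' \<longleftrightarrow> s' ''fx'' 0 \<in> set E \<and> s' ''fy'' 0 \<in> set E \<and> hit (s' ''fx'' 0) (s' ''fy'' 0)" for s' :: state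
  define none where "none i m \<longleftrightarrow> (\<forall>c. 0 < c \<longrightarrow> c \<le> m \<longrightarrow> \<not> hit (E ! i) (E ! ((i + c) mod ?n)))" for i m
  let ?J = "\<lambda>i s'. same s' \<and> s' ''i'' 0 = i \<and> s' ''c'' 0 \<le> min ?m ?n \<and> s' ''j'' 0 = (i + s' ''c'' 0) mod ?n \<and>
    (if s' ''fd'' 0 = 0 then none i (s' ''c'' 0) else found s')"
  have step: "?J i (run (search_step adjt) s') \<and> run (search_step adjt) s' ''c'' 0 = Suc (s' ''c'' 0)"
    if J: "?J i s'" and i: "i < ?n" and c: "s' ''c'' 0 < ?m" "s' ''c'' 0 < ?n" and fd: "s' ''fd'' 0 = 0" for s' i
  proof -
    let ?r = "run (search_step adjt) s'"
    let ?s1 = "run (Branch (Less (Succ (Var ''j'')) (Var ''el'')) (Inc ''j'') (Set ''j'' (Const 0))) s'"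
    let ?s2 = "run (Inc ''c'') ?s1"
    let ?j = "(i + Suc (s' ''c'' 0)) mod ?n"
    have S: "same s'" using J by simp
    note e = sm[OF S]
    have j: "?s2 ''j'' 0 = ?j"
    proof -
      have "?s2 ''j'' 0 = (if Suc (s' ''j'' 0) < ?n then Suc (s' ''j'' 0) else 0)" using e by auto
      also have "\<dots> = Suc (s' ''j'' 0) mod ?n"
      proof -
        have "s' ''j'' 0 < ?n" using J i by auto
        then show ?thesis by (auto simp: mod_Suc)
      qed
      also have "\<dots> = ?j" using J by (simp add: mod_Suc_eq)
      finally show ?thesis .
    qed
    have jn: "?j < ?n" using i by (intro mod_less_divisor) simp
    have S2: "same ?s2" using S by (auto simp: same_def X_def)
    have i2: "?s2 ''i'' 0 = i" "?s2 ''fd'' 0 = 0" "?s2 ''c'' 0 = Suc (s' ''c'' 0)" using J fd by auto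
    define s2 where "s2 = ?s2"
    note S2 = S2[folded s2_def] and i2 = i2[folded s2_def] and j = j[folded s2_def]
    note e2 = sm[OF S2]
    have x: "eval_exp (Read ''ord'' (Var ''i'')) s2 = E ! i" "eval_exp (Read ''ord'' (Var ''j'')) s2 = E ! ?j"
      using e2 i2(1) j nth[OF i] nth[OF jn] by simp_all
    have inE: "E ! i \<in> set E" "E ! ?j \<in> set E" using i jn n by simp_all
    then have xU: "E ! i \<in> U" "E ! ?j \<in> U" using U unfolding E_def by auto
    have ok2: "ok s2" using e2 by blast
    have t: "eval_test (Conj (adjt (Read ''ord'' (Var ''i'')) (Read ''ord'' (Var ''j'')))
        (far_test (Read ''ix'' (Read ''ord'' (Var ''i''))) (Read ''ix'' (Read ''ord'' (Var ''j''))))) s2 \<longleftrightarrow> hit (E ! i) (E ! ?j)"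
    proof -
      have "eval_test (adjt (Read ''ord'' (Var ''i'')) (Read ''ord'' (Var ''j''))) s2 = adj (E ! i) (E ! ?j)"
        using adjt[OF ok2, of "Read ''ord'' (Var ''i'')" "Read ''ord'' (Var ''j'')"] xU unfolding x by blast
      moreover have "eval_exp (Read ''ix'' (Read ''ord'' (Var v))) s2 = s ''ix'' (eval_exp (Read ''ord'' (Var v)) s2)" for v
        using e2 by simp
      ultimately show ?thesis unfolding eval_test.simps(3) eval_far_test hit_def k_def using e2 by (simp only: x)
    qed
    have r: "?r = (if hit (E ! i) (E ! ?j) then run (seqs [Set ''fd'' (Const 1), Set ''fx'' (Read ''ord'' (Var ''i'')), Set ''fy'' (Read ''ord'' (Var ''j''))]) s2 else s2)"
      unfolding search_step_def Let_def seqs.simps run.simps(3) s2_def[symmetric] run.simps(4)[of _ _ _ s2] t by (simp only: run.simps(1))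
    have nn: "none i (Suc (s' ''c'' 0)) \<longleftrightarrow> none i (s' ''c'' 0) \<and> \<not> hit (E ! i) (E ! ?j)"
      unfolding none_def by (auto simp: le_Suc_eq)
    show ?thesis
    proof (cases "hit (E ! i) (E ! ?j)")
      case False
      then have "?r = s2" using r by simp
      then show ?thesis using S2 i2 j nn J c fd False by (simp del: run.simps)
    next
      case True
      let ?s3 = "run (seqs [Set ''fd'' (Const 1), Set ''fx'' (Read ''ord'' (Var ''i'')), Set ''fy'' (Read ''ord'' (Var ''j''))]) s2"
      have rr: "?r = ?s3" using r True by simp
      have "?s3 = s2(''fd'' := (s2 ''fd'')(0 := 1), ''fx'' := (s2 ''fx'')(0 := E ! i), ''fy'' := (s2 ''fy'')(0 := E ! ?j))"
        using x by (simp add: fun_upd_def del: fun_upd_apply)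
      then have "?s3 ''fd'' 0 = 1" "?s3 ''fx'' 0 = E ! i" "?s3 ''fy'' 0 = E ! ?j" "?s3 ''i'' = s2 ''i''" "?s3 ''c'' = s2 ''c''"
        "?s3 ''j'' = s2 ''j''" "same ?s3" using S2 by (auto simp: same_def X_def)
      then show ?thesis unfolding rr using i2 j c True inE by (simp add: found_def del: run.simps)
    qed
  qed
  let ?inner = "While (Conj (Less (Var ''c'') (Var ''mx'')) (Conj (Less (Var ''c'') (Var ''el'')) (Eq (Var ''fd'') (Const 0)))) (search_step adjt)"
  have inner: "ends ?inner s1 (?C * min ?m ?n + 1)
    (\<lambda>s'. same s' \<and> s' ''i'' 0 = i \<and> (if s' ''fd'' 0 = 0 then none i (min ?m ?n) else found s'))"
    if s1: "?J i s1" "s1 ''c'' 0 = 0" and i: "i < ?n" for s1 i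
  proof (rule ends_While[where I = "?J i" and \<Phi> = "\<lambda>s'. ?C * (min ?m ?n - s' ''c'' 0)"])
    fix s' assume J: "?J i s'" and b: "eval_test (Conj (Less (Var ''c'') (Var ''mx'')) (Conj (Less (Var ''c'') (Var ''el'')) (Eq (Var ''fd'') (Const 0)))) s'"
    have c: "s' ''c'' 0 < ?m" "s' ''c'' 0 < ?n" "s' ''fd'' 0 = 0" using b sm J by auto
    note r = step[OF J i c]
    have "?C * (min ?m ?n - s' ''c'' 0) = ?C * Suc (min ?m ?n - Suc (s' ''c'' 0))" using c by (simp add: Suc_diff_Suc)
    then have "cost (search_step adjt) + 1 + ?C * (min ?m ?n - Suc (s' ''c'' 0)) \<le> ?C * (min ?m ?n - s' ''c'' 0)" by simp
    then show "\<exists>T. ends (search_step adjt) s' T (\<lambda>s''. ?J i s'' \<and>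
       T + 1 + ?C * (min ?m ?n - s'' ''c'' 0) \<le> ?C * (min ?m ?n - s' ''c'' 0))"
      using r by (intro exI[of _ "cost (search_step adjt)"] ends_run[OF lf]) auto
  next
    show "?J i s1" by (rule s1(1))
    show "?C * (min ?m ?n - s1 ''c'' 0) + 1 \<le> ?C * min ?m ?n + 1" using s1 by simp
  next
    fix s' assume J: "?J i s'" and b: "\<not> eval_test (Conj (Less (Var ''c'') (Var ''mx'')) (Conj (Less (Var ''c'') (Var ''el'')) (Eq (Var ''fd'') (Const 0)))) s'"
    have "s' ''c'' 0 = min ?m ?n" if "s' ''fd'' 0 = 0" using b that J sm[of s'] by auto
    then show "same s' \<and> s' ''i'' 0 = i \<and> (if s' ''fd'' 0 = 0 then none i (min ?m ?n) else found s')"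
      using J by auto
  qed
  let ?body = "seqs [Set ''j'' (Var ''i''), Set ''c'' (Const 0), ?inner, Inc ''i'']"
  let ?I = "\<lambda>s'. same s' \<and> s' ''i'' 0 \<le> ?n \<and> (if s' ''fd'' 0 = 0 then \<forall>i<s' ''i'' 0. none i (min ?m ?n) else found s')"
  let ?D = "?C * min ?m ?n + 5"
  have body: "ends ?body s' (?D - 1) (\<lambda>s''. ?I s'' \<and> s'' ''i'' 0 = Suc (s' ''i'' 0))"
    if I: "?I s'" and b: "s' ''i'' 0 < ?n" "s' ''fd'' 0 = 0" for s'
    unfolding seqs.simps
  proof (rule ends_Seq[where ?T1.0 = 1])
    let ?i = "s' ''i'' 0"
    show "ends (Set ''j'' (Var ''i'')) s' 1 (\<lambda>s1. ?I s1 \<and> s1 ''i'' 0 = ?i \<and> s1 ''j'' 0 = ?i \<and> s1 ''fd'' 0 = 0)"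
      using I b by (intro ends_run) (auto simp: same_def X_def)
    fix s1 assume s1: "?I s1 \<and> s1 ''i'' 0 = ?i \<and> s1 ''j'' 0 = ?i \<and> s1 ''fd'' 0 = 0"
    show "ends (Seq (Set ''c'' (Const 0)) (Seq ?inner (Inc ''i''))) s1 (?C * min ?m ?n + 3)
      (\<lambda>s''. ?I s'' \<and> s'' ''i'' 0 = Suc ?i)"
    proof (rule ends_Seq[where ?T1.0 = 1])
      show "ends (Set ''c'' (Const 0)) s1 1 (\<lambda>s2. ?I s2 \<and> ?J ?i s2 \<and> s2 ''c'' 0 = 0)"
      proof -
        let ?r = "run (Set ''c'' (Const 0)) s1"
        have "same s1" using s1 by blast
        then have 1: "same ?r" by (simp add: same_def X_def)
        have 2: "?r ''i'' = s1 ''i''" "?r ''fd'' = s1 ''fd''" "?r ''j'' = s1 ''j''" "?r ''c'' 0 = 0" by simp_all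
        have 3: "none ?i 0" by (simp add: none_def)
        have 4: "(?i + 0) mod ?n = ?i" using b by simp
        have 5: "?I r \<and> ?J ?i r \<and> r ''c'' 0 = 0"
          if "same r" "r ''i'' = s1 ''i''" "r ''fd'' = s1 ''fd''" "r ''j'' = s1 ''j''" "r ''c'' 0 = 0" for r :: state
          using s1 that 3 4 by simp
        show ?thesis by (rule ends_run, simp, rule 5[OF 1 2], simp)
      qed
      fix s2 assume s2: "?I s2 \<and> ?J ?i s2 \<and> s2 ''c'' 0 = 0"
      have fd2: "s2 ''fd'' 0 = 0 \<longrightarrow> (\<forall>i<?i. none i (min ?m ?n))" using s2 by auto
      show "ends (Seq ?inner (Inc ''i'')) s2 (?C * min ?m ?n + 2) (\<lambda>s''. ?I s'' \<and> s'' ''i'' 0 = Suc ?i)"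
      proof (rule ends_Seq)
        show "ends ?inner s2 (?C * min ?m ?n + 1) (\<lambda>s'. same s' \<and> s' ''i'' 0 = ?i \<and> (if s' ''fd'' 0 = 0 then none ?i (min ?m ?n) else found s'))"
          by (rule inner) (use s2 b in blast)+
        show "ends (Inc ''i'') s3 1 (\<lambda>s''. ?I s'' \<and> s'' ''i'' 0 = Suc ?i)"
          if "same s3 \<and> s3 ''i'' 0 = ?i \<and> (if s3 ''fd'' 0 = 0 then none ?i (min ?m ?n) else found s3)" for s3
        proof -
          let ?r = "run (Inc ''i'') s3"
          have 1: "same ?r" using that by (simp add: same_def X_def)
          have 2: "?r ''i'' 0 = Suc (s3 ''i'' 0)" "?r ''fd'' = s3 ''fd''" "?r ''fx'' = s3 ''fx''" "?r ''fy'' = s3 ''fy''" by simp_all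
          have 3: "\<forall>i<?i. none i (min ?m ?n)" using I b(2) by simp
          have 4: "?I r \<and> r ''i'' 0 = Suc ?i"
            if r: "same r" "r ''i'' 0 = Suc (s3 ''i'' 0)" "r ''fd'' = s3 ''fd''" "r ''fx'' = s3 ''fx''" "r ''fy'' = s3 ''fy''" for r :: state
            using r that(1) \<open>same s3 \<and> s3 ''i'' 0 = ?i \<and> _\<close> 3 b(1) by (auto simp: found_def less_Suc_eq)
          show ?thesis by (rule ends_run, simp, rule 4[OF 1 2], simp)
        qed
        show "?C * min ?m ?n + 1 + 1 \<le> ?C * min ?m ?n + 2" by simp
      qed
    qed simp
  qed simp
  let ?outer = "While (Conj (Less (Var ''i'') (Var ''el'')) (Eq (Var ''fd'') (Const 0))) ?body"
  have outer: "ends ?outer s1 (?n * ?D + 1) ?Q" if s1: "?I s1" "s1 ''i'' 0 = 0" for s1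
  proof (rule ends_While[where I = ?I and \<Phi> = "\<lambda>s'. (?n - s' ''i'' 0) * ?D"])
    fix s' assume I: "?I s'" and b: "eval_test (Conj (Less (Var ''i'') (Var ''el'')) (Eq (Var ''fd'') (Const 0))) s'"
    have b': "s' ''i'' 0 < ?n" "s' ''fd'' 0 = 0" using b I sm[of s'] by auto
    have "(?n - s' ''i'' 0) * ?D = Suc (?n - Suc (s' ''i'' 0)) * ?D" using b' by (simp add: Suc_diff_Suc)
    then have "(?D - 1) + 1 + (?n - Suc (s' ''i'' 0)) * ?D \<le> (?n - s' ''i'' 0) * ?D" by simp
    then show "\<exists>T. ends ?body s' T (\<lambda>s''. ?I s'' \<and> T + 1 + (?n - s'' ''i'' 0) * ?D \<le> (?n - s' ''i'' 0) * ?D)"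
      by (intro exI[of _ "?D - 1"] ends_weaken[OF body[OF I b']]) auto
  next
    show "?I s1" using s1 by simp
    show "(?n - s1 ''i'' 0) * ?D + 1 \<le> ?n * ?D + 1" using s1 by simp
  next
    fix s' assume I: "?I s'" and b: "\<not> eval_test (Conj (Less (Var ''i'') (Var ''el'')) (Eq (Var ''fd'') (Const 0))) s'"
    show "?Q s'"
    proof (cases "s' ''fd'' 0 = 0")
      case True
      then have "s' ''i'' 0 = ?n" using b I sm[of s'] by auto
      then show ?thesis using I True unfolding n none_def by auto
    next
      case False
      then show ?thesis using I unfolding found_def by simp
    qed
  qed
  show ?thesis unfolding search_def seqs.simps(3)[of "Set ''fd'' (Const 0)"] seqs.simps(3)[of "Set ''i'' (Const 0)"]
      seqs.simps(2)[of ?outer]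
  proof (rule ends_Seq[where ?T1.0 = 1])
    show "ends (Set ''fd'' (Const 0)) s 1 (\<lambda>s1. same s1 \<and> s1 ''fd'' 0 = 0)"
      by (intro ends_run) (auto simp: same_def X_def)
    fix s1 assume s1: "same s1 \<and> s1 ''fd'' 0 = 0"
    show "ends (Seq (Set ''i'' (Const 0)) ?outer) s1 (?n * ?D + 2) ?Q"
    proof (rule ends_Seq[where ?T1.0 = 1])
      show "ends (Set ''i'' (Const 0)) s1 1 (\<lambda>s2. ?I s2 \<and> s2 ''i'' 0 = 0)"
        using s1 by (intro ends_run) (auto simp: same_def X_def)
      show "ends ?outer s2 (?n * ?D + 1) ?Q" if "?I s2 \<and> s2 ''i'' 0 = 0" for s2 using that outer by blast
    qed simp
  qed simp
qed

end

section \<open>Cutting the circle at an edge between far items\<close>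

abbreviation copy_step :: com where
  "copy_step \<equiv> Seq (move (Var ''i'') Tl) (Seq (Inc ''tl'') (Inc ''i''))"

text \<open>Appends the items up to the one after \<open>fi\<close>, so that the side of the circle
  running from \<open>fj\<close> over the end back to \<open>fi\<close> becomes contiguous. The
  extra item supplies the core vertex that follows \<open>fi\<close>.\<close>

definition copy_front :: com where
  "copy_front = Seq (Set ''i'' Hd) (While (Le (Var ''i'') (Succ (Var ''fi''))) copy_step)"

definition swap :: "string \<Rightarrow> string \<Rightarrow> com" where
  "swap x y = seqs [Set ''tmp'' (Var x), Set x (Var y), Set y (Var ''tmp'')]"

text \<open>Carries out \<open>far_cut\<close> in place. The core vertex already stored in the final
  cell is the vertex \<open>p\<close> of that lemma, so only the two witnesses are written.\<close>

definition finish :: com where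
  "finish = seqs [Branch (Eq (Read ''w1'' (Var ''fi'')) (Var ''fx'')) (Set ''hd'' (Succ (Var ''fi''))) (Set ''hd'' (Var ''fi'')),
     Branch (Eq (Read ''w0'' (Var ''fj'')) (Var ''fy'')) Skip (Inc ''fj''),
     Write ''w0'' (Var ''fj'') (Var ''fy''), Write ''w1'' (Var ''fj'') (Var ''fx''), Set ''tl'' (Succ (Var ''fj''))]"

definition locate :: com where
  "locate = seqs [Set ''fi'' (Read ''ix'' (Var ''fx'')), Set ''fj'' (Read ''ix'' (Var ''fy'')),
     Branch (Less (Var ''fj'') (Var ''fi'')) (Seq (swap ''fx'' ''fy'') (swap ''fi'' ''fj'')) Skip]"

text \<open>After copying, the last cell holds the item after \<open>fi\<close> and the one before
  it the copy of \<open>fi\<close> itself, hence the two subtracted from \<open>tl\<close>.\<close>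

definition turn :: com where
  "turn = seqs [swap ''fx'' ''fy'', Set ''fi'' (Var ''fj''), Set ''fj'' (Minus Tl (Const 2))]"

text \<open>The shorter side is kept. If it does not cross the end of the list, a copy of the first
  item is appended, so that the core vertex after \<open>fj\<close> can be read even if
  \<open>fj\<close> is the last item.\<close>

definition cut :: com where
  "cut = Seq locate (Seq
     (Branch (Less (Minus Len (Minus (Var ''fj'') (Var ''fi''))) (Minus (Var ''fj'') (Var ''fi'')))
       (Seq copy_front turn) (move Hd Tl)) finish)"

lemma ends_copy_front:
  assumes h: "s ''hd'' 0 \<le> s ''fi'' 0" and t: "Suc (s ''fi'' 0) < s ''tl'' 0"
  shows "ends copy_front s (6 * (s ''tl'' 0 - s ''hd'' 0) + 2)
    (\<lambda>s'. s' ''tl'' 0 = s ''tl'' 0 + (s ''fi'' 0 + 2 - s ''hd'' 0) \<and>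
       (\<forall>a\<in>{''q'', ''w0'', ''w1''}. (\<forall>p<s ''tl'' 0. s' a p = s a p) \<and>
          (\<forall>m<s ''fi'' 0 + 2 - s ''hd'' 0. s' a (s ''tl'' 0 + m) = s a (s ''hd'' 0 + m))))"
  unfolding copy_front_def
proof (rule ends_Seq[where ?T1.0 = 1])
  let ?h = "s ''hd'' 0" and ?t = "s ''tl'' 0" and ?f = "s ''fi'' 0"
  let ?I = "\<lambda>s'. ?h \<le> s' ''i'' 0 \<and> s' ''i'' 0 \<le> ?f + 2 \<and> s' ''tl'' 0 = ?t + (s' ''i'' 0 - ?h) \<and>
    (\<forall>a\<in>{''q'', ''w0'', ''w1''}. (\<forall>p<?t. s' a p = s a p) \<and> (\<forall>m<s' ''i'' 0 - ?h. s' a (?t + m) = s a (?h + m)))"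
  show "ends (Set ''i'' Hd) s 1 (\<lambda>s1. ?I s1 \<and> s1 ''i'' 0 = ?h)" using h by (intro ends_run) auto
  fix s1 assume s1: "?I s1 \<and> s1 ''i'' 0 = ?h" and fr: "\<And>a. a \<notin> writes (Set ''i'' Hd) \<Longrightarrow> s1 a = s a"
  show "ends (While (Le (Var ''i'') (Succ (Var ''fi''))) copy_step) s1 (6 * (?t - ?h) + 1)
    (\<lambda>s'. s' ''tl'' 0 = ?t + (?f + 2 - ?h) \<and>
       (\<forall>a\<in>{''q'', ''w0'', ''w1''}. (\<forall>p<?t. s' a p = s a p) \<and> (\<forall>m<?f + 2 - ?h. s' a (?t + m) = s a (?h + m))))"
  proof (rule ends_While[where I = ?I and \<Phi> = "\<lambda>s'. 6 * (?f + 2 - s' ''i'' 0)"])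
    fix s' assume I: "?I s'" and b: "eval_test (Le (Var ''i'') (Succ (Var ''fi''))) s'"
      and f: "\<And>a. a \<notin> writes copy_step \<Longrightarrow> s' a = s1 a"
    have fi: "s' ''fi'' = s ''fi''" using f[of "''fi''"] fr[of "''fi''"] by (simp add: move_def)
    let ?i = "s' ''i'' 0"
    have i: "?i \<le> Suc ?f" using b fi by simp
    obtain m where m: "?i = ?h + m" using I le_Suc_ex by blast
    have rd: "s' a ?i = s a ?i" if "a \<in> {''q'', ''w0'', ''w1''}" for a
      using I that i t by auto
    have r: "run copy_step s' = s'(''q'' := (s' ''q'')(?t + m := s ''q'' ?i), ''w0'' := (s' ''w0'')(?t + m := s ''w0'' ?i),
       ''w1'' := (s' ''w1'')(?t + m := s ''w1'' ?i), ''tl'' := (s' ''tl'')(0 := Suc (?t + m)), ''i'' := (s' ''i'')(0 := Suc ?i))"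
      using I rd m by (simp add: move_def fun_upd_twist)
    have "?I (run copy_step s')" unfolding r using I i m by (auto simp: less_Suc_eq)
    moreover have "run copy_step s' ''i'' 0 = Suc ?i" unfolding r by simp
    ultimately have J: "?I (run copy_step s')" "run copy_step s' ''i'' 0 = Suc ?i" by blast+
    show "\<exists>T. ends copy_step s' T (\<lambda>s''. ?I s'' \<and> T + 1 + 6 * (?f + 2 - s'' ''i'' 0) \<le> 6 * (?f + 2 - s' ''i'' 0))"
    proof (intro exI[of _ 5], rule ends_run)
      have 6: "5 + 1 + 6 * (?f + 2 - Suc ?i) \<le> 6 * (?f + 2 - ?i)" using i by (simp add: Suc_diff_le)
      show "?I (run copy_step s') \<and> 5 + 1 + 6 * (?f + 2 - run copy_step s' ''i'' 0) \<le> 6 * (?f + 2 - ?i)"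
        using J(1) 6 unfolding J(2) by blast
    qed (simp_all add: move_def)
  next
    show "?I s1" using s1 by blast
    show "6 * (?f + 2 - s1 ''i'' 0) + 1 \<le> 6 * (?t - ?h) + 1" using s1 t by simp
  next
    fix s' assume I: "?I s'" and b: "\<not> eval_test (Le (Var ''i'') (Succ (Var ''fi''))) s'"
      and f: "\<And>a. a \<notin> writes copy_step \<Longrightarrow> s' a = s1 a"
    have fi: "s' ''fi'' = s ''fi''" using f[of "''fi''"] fr[of "''fi''"] by (simp add: move_def)
    then have "s' ''i'' 0 = ?f + 2" using I b by simp
    then show "s' ''tl'' 0 = ?t + (?f + 2 - ?h) \<and>
       (\<forall>a\<in>{''q'', ''w0'', ''w1''}. (\<forall>p<?t. s' a p = s a p) \<and> (\<forall>m<?f + 2 - ?h. s' a (?t + m) = s a (?h + m)))"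
      using I by simp
  qed
qed simp

lemma upt_shift: "[n..<n + m] = map ((+) n) [0..<m]"
  by (induction m) auto

lemma in_wits: "(v, a, b) \<in> set xs \<Longrightarrow> a \<in> wits xs \<and> b \<in> wits xs"
  by (force simp: wits_def)

definition item :: "state \<Rightarrow> nat \<Rightarrow> nat item" where
  "item s p = (s ''q'' p, s ''w0'' p, s ''w1'' p)"

lemma block_item: "block s i j = map (item s) [i..<j]"
  by (simp add: block_def item_def)

lemma run_finish:
  fixes s :: state
  defines "i \<equiv> s ''fi'' 0" and "j \<equiv> s ''fj'' 0" and "x \<equiv> s ''fx'' 0" and "y \<equiv> s ''fy'' 0"
  assumes "i < j"
  shows "items (run finish s) = (if x = s ''w1'' i then [] else [item s i]) @ block s (Suc i) j @
     (if y = s ''w0'' j then [] else [item s j]) @ [(s ''q'' (if y = s ''w0'' j then j else Suc j), y, x)]"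
proof -
  let ?r = "run finish s"
  let ?h = "if x = s ''w1'' i then Suc i else i" and ?p = "if y = s ''w0'' j then j else Suc j"
  have h: "?r ''hd'' 0 = ?h" "?r ''tl'' 0 = Suc ?p" "item ?r ?p = (s ''q'' ?p, y, x)"
    unfolding i_def j_def x_def y_def item_def by (auto simp: finish_def)
  have "?h \<le> ?p" using assms(5) by auto
  then have "items ?r = block ?r ?h ?p @ [item ?r ?p]" unfolding h(1,2) by (simp add: block_snoc item_def)
  moreover have "block ?r ?h ?p = block s ?h ?p"
    by (intro block_cong) (auto simp: finish_def i_def j_def x_def y_def)
  moreover have "block s ?h ?p = (if x = s ''w1'' i then [] else [item s i]) @ block s (Suc i) j @ (if y = s ''w0'' j then [] else [item s j])"
    using assms(5) by (auto simp: block_item upt_rec[of i] )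
  ultimately show ?thesis unfolding h(3) by simp
qed

section \<open>Rounds of cleaning, searching and cutting\<close>

definition search_round :: "(exp \<Rightarrow> exp \<Rightarrow> test) \<Rightarrow> com" where
  "search_round adjt = Seq mark (Seq filter_order (Seq (search adjt)
     (Branch (Eq (Var ''fd'') (Const 0)) (Set ''go'' (Const 0)) cut)))"

definition round :: "(exp \<Rightarrow> exp \<Rightarrow> test) \<Rightarrow> com" where
  "round adjt = Seq (clean_up adjt)
     (Branch (Less Len (Const 12)) (Set ''go'' (Const 0)) (search_round adjt))"

definition shrink :: "(exp \<Rightarrow> exp \<Rightarrow> test) \<Rightarrow> com" where
  "shrink adjt = Seq (Set ''go'' (Const 1)) (While (Less (Const 0) (Var ''go'')) (round adjt))"

lemma writes_clean_up: "writes (clean_up adjt) \<subseteq> {''q'', ''w0'', ''w1'', ''hd'', ''tl'', ''gd'', ''red''}"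
  by (simp add: clean_up_def act_defs clean_step_def reduce_def Let_def retreat_def step_back_def advance_def move_def)

lemma writes_cut: "writes cut \<subseteq> {''q'', ''w0'', ''w1'', ''hd'', ''tl'', ''i'', ''fi'', ''fj'', ''fx'', ''fy'', ''tmp''}"
  by (simp add: cut_def locate_def swap_def copy_front_def turn_def move_def finish_def)

lemma writes_search: "writes (search adjt) \<subseteq> {''fd'', ''i'', ''j'', ''c'', ''fx'', ''fy''}"
  by (simp add: search_def search_step_def Let_def)

context ram
begin

text \<open>The side to be kept is stored contiguously from \<open>fi\<close> to \<open>fj\<close>.
  The rest \<open>S\<close> of the circle is no longer needed in memory, apart from its first core
  vertex, which stands in the next cell.\<close>

definition ready :: "nat \<Rightarrow> nat set \<Rightarrow> state \<Rightarrow> bool" where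
  "ready k W s \<longleftrightarrow> s ''fi'' 0 < s ''fj'' 0 \<and> 2 * (s ''fj'' 0 - s ''fi'' 0) \<le> k \<and>
     (\<exists>S. S \<noteq> [] \<and> obs adj (item s (s ''fi'' 0) # block s (Suc (s ''fi'' 0)) (s ''fj'' 0) @ item s (s ''fj'' 0) # S) \<and>
        verts_of (item s (s ''fi'' 0) # block s (Suc (s ''fi'' 0)) (s ''fj'' 0) @ item s (s ''fj'' 0) # S) \<subseteq> U \<and>
        wits (item s (s ''fi'' 0) # block s (Suc (s ''fi'' 0)) (s ''fj'' 0) @ item s (s ''fj'' 0) # S) \<subseteq> W \<and>
        s ''q'' (Suc (s ''fj'' 0)) = fst (hd S)) \<and>
     2 < s ''fj'' 0 - s ''fi'' 0 \<and>
     s ''fx'' 0 \<in> {s ''w0'' (s ''fi'' 0), s ''w1'' (s ''fi'' 0)} \<and>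
     s ''fy'' 0 \<in> {s ''w0'' (s ''fj'' 0), s ''w1'' (s ''fj'' 0)} \<and> adj (s ''fx'' 0) (s ''fy'' 0)"

lemma finish_ready:
  assumes r: "ready k W s" and k: "8 \<le> k"
  shows "obs adj (items (run finish s)) \<and> verts_of (items (run finish s)) \<subseteq> U \<and>
    wits (items (run finish s)) \<subseteq> W \<and> 4 * length (items (run finish s)) \<le> 3 * k"
proof -
  let ?i = "s ''fi'' 0" and ?j = "s ''fj'' 0" and ?x = "s ''fx'' 0" and ?y = "s ''fy'' 0"
  let ?P = "block s (Suc ?i) ?j"
  obtain S where S: "S \<noteq> []" "obs adj (item s ?i # ?P @ item s ?j # S)"
    "verts_of (item s ?i # ?P @ item s ?j # S) \<subseteq> U" "wits (item s ?i # ?P @ item s ?j # S) \<subseteq> W" "s ''q'' (Suc ?j) = fst (hd S)"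
    using r unfolding ready_def by blast
  have ij: "?i < ?j" "2 < ?j - ?i" "2 * (?j - ?i) \<le> k" and x: "?x = s ''w0'' ?i \<or> ?x = s ''w1'' ?i"
    and y: "?y = s ''w0'' ?j \<or> ?y = s ''w1'' ?j" and xy: "adj ?x ?y"
    using r unfolding ready_def by auto
  let ?K = "(if ?x = s ''w1'' ?i then ?P else item s ?i # ?P) @ (if ?y = s ''w0'' ?j then [] else [item s ?j])"
  let ?p = "if ?y = s ''w0'' ?j then s ''q'' ?j else fst (hd S)"
  have it: "items (run finish s) = ?K @ [(?p, ?y, ?x)]"
    unfolding run_finish[of s, OF ij(1)] using S(5) by auto
  have P: "2 \<le> length ?P" using ij by simp
  have "obs adj (?K @ [(?p, ?y, ?x)])"
    using far_cut[OF S(2)[unfolded item_def] P S(1) x y xy refl refl] unfolding item_def .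
  moreover have "fst (hd S) \<in> cores S" using S(1) by (cases S) auto
  then have "verts_of (?K @ [(?p, ?y, ?x)]) \<subseteq> U"
    using S(3) x y by (auto simp: item_def)
  moreover have "wits (?K @ [(?p, ?y, ?x)]) \<subseteq> W"
    using S(4) x y by (auto simp: item_def)
  \<comment> \<open>At most \<open>fj - fi + 2\<close> items remain, that is at most k/2 + 2, which
    is at most 3k/4 because k is at least eight.\<close>
  moreover have "4 * length (?K @ [(?p, ?y, ?x)]) \<le> 3 * k" using ij k by auto
  ultimately show ?thesis unfolding it by blast
qed

lemma ends_cut:
  assumes o: "obs adj (items s)" and U: "verts_of (items s) \<subseteq> U"
    and c: "current s (s ''fx'' 0)" "current s (s ''fy'' 0)" and xy: "adj (s ''fx'' 0) (s ''fy'' 0)"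
    and f: "far (length (items s)) (s ''ix'' (s ''fx'' 0)) (s ''ix'' (s ''fy'' 0))" and k: "8 \<le> length (items s)"
  shows "ends cut s (6 * length (items s) + 40)
     (\<lambda>s'. obs adj (items s') \<and> verts_of (items s') \<subseteq> U \<and> wits (items s') \<subseteq> wits (items s) \<and> 4 * length (items s') \<le> 3 * length (items s))"
  unfolding cut_def
proof (rule ends_Seq[where ?T1.0 = 15])
  let ?k = "length (items s)" and ?h = "s ''hd'' 0" and ?t = "s ''tl'' 0"
  let ?s1 = "run locate s"
  define L where "L s1 \<longleftrightarrow> (\<forall>a\<in>{''q'', ''w0'', ''w1'', ''hd'', ''tl''}. s1 a = s a) \<and>
     ?h \<le> s1 ''fi'' 0 \<and> s1 ''fj'' 0 < ?t \<and> s1 ''fi'' 0 < s1 ''fj'' 0 \<and>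
     s1 ''fx'' 0 \<in> {s ''w0'' (s1 ''fi'' 0), s ''w1'' (s1 ''fi'' 0)} \<and>
     s1 ''fy'' 0 \<in> {s ''w0'' (s1 ''fj'' 0), s ''w1'' (s1 ''fj'' 0)} \<and> adj (s1 ''fx'' 0) (s1 ''fy'' 0) \<and>
     2 < s1 ''fj'' 0 - s1 ''fi'' 0 \<and> s1 ''fj'' 0 - s1 ''fi'' 0 + 2 < ?k" for s1 :: state
  have "L ?s1"
  proof (cases "s ''ix'' (s ''fy'' 0) < s ''ix'' (s ''fx'' 0)")
    case True
    have r: "?s1 ''fi'' 0 = s ''ix'' (s ''fy'' 0)" "?s1 ''fj'' 0 = s ''ix'' (s ''fx'' 0)" "?s1 ''fx'' 0 = s ''fy'' 0"
      "?s1 ''fy'' 0 = s ''fx'' 0" "\<forall>a\<in>{''q'', ''w0'', ''w1'', ''hd'', ''tl''}. ?s1 a = s a"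
      using True by (simp_all add: locate_def swap_def)
    show ?thesis unfolding L_def r(1-4) using r(5) c f True adj_sym[OF xy] by (auto simp: current_def far_def)
  next
    case False
    have r: "?s1 ''fi'' 0 = s ''ix'' (s ''fx'' 0)" "?s1 ''fj'' 0 = s ''ix'' (s ''fy'' 0)" "?s1 ''fx'' 0 = s ''fx'' 0"
      "?s1 ''fy'' 0 = s ''fy'' 0" "\<forall>a\<in>{''q'', ''w0'', ''w1'', ''hd'', ''tl''}. ?s1 a = s a"
      using False by (simp_all add: locate_def swap_def)
    show ?thesis unfolding L_def r(1-4) using r(5) c f False xy by (auto simp: current_def far_def)
  qed
  then show "ends locate s 15 L" by (intro ends_run) (simp_all add: locate_def swap_def)
  fix s1 assume L: "L s1"
  let ?i = "s1 ''fi'' 0" and ?j = "s1 ''fj'' 0"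
  have e: "s1 ''q'' = s ''q''" "s1 ''w0'' = s ''w0''" "s1 ''w1'' = s ''w1''" "s1 ''hd'' = s ''hd''" "s1 ''tl'' = s ''tl''"
    using L by (auto simp: L_def)
  have ij: "?h \<le> ?i" "?j < ?t" "?i < ?j" "2 < ?j - ?i" "?j - ?i + 2 < ?k" using L by (auto simp: L_def)
  let ?A = "block s ?h ?i" and ?P = "block s (Suc ?i) ?j" and ?B = "block s (Suc ?j) ?t"
  have up: "[?h..<?t] = [?h..<?i] @ ?i # [Suc ?i..<?j] @ ?j # [Suc ?j..<?t]"
    using ij upt_add_eq_append[of ?h ?i "?t - ?i"] upt_add_eq_append[of "Suc ?i" ?j "?t - ?j"]
    by (simp add: upt_conv_Cons)
  have xs: "items s = ?A @ item s ?i # ?P @ item s ?j # ?B" unfolding block_item up by simp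
  have V: "verts_of (item s ?i # ?P @ item s ?j # ?B @ ?A) = verts_of (items s)"
    "verts_of (item s ?j # (?B @ ?A) @ item s ?i # ?P) = verts_of (items s)"
    "wits (item s ?i # ?P @ item s ?j # ?B @ ?A) = wits (items s)"
    "wits (item s ?j # (?B @ ?A) @ item s ?i # ?P) = wits (items s)"
    unfolding xs by (auto simp: item_def)
  have o1: "obs adj (item s ?i # ?P @ item s ?j # ?B @ ?A)"
    using obs_rotate[of adj ?A "item s ?i # ?P @ item s ?j # ?B"] o unfolding xs by simp
  then have o2: "obs adj (item s ?j # (?B @ ?A) @ item s ?i # ?P)"
    using obs_rotate[of adj "item s ?i # ?P" "item s ?j # ?B @ ?A"] by simp
  have BA: "length (?B @ ?A) = ?k - (?j - ?i) - 1" using ij by simp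
  have "ends (Branch (Less (Minus Len (Minus (Var ''fj'') (Var ''fi''))) (Minus (Var ''fj'') (Var ''fi''))) (Seq copy_front turn) (move Hd Tl))
     s1 (6 * ?k + 14) (ready ?k (wits (items s)))"
  proof (rule ends_Branch)
    assume "eval_test (Less (Minus Len (Minus (Var ''fj'') (Var ''fi''))) (Minus (Var ''fj'') (Var ''fi''))) s1"
    then have d: "?k - (?j - ?i) < ?j - ?i" using e by simp
    let ?n = "?i + 2 - ?h"
    show "ends (Seq copy_front turn) s1 (6 * ?k + 13) (ready ?k (wits (items s)))"
    proof (rule ends_Seq)
      show "ends copy_front s1 (6 * ?k + 2) (\<lambda>s'. s' ''tl'' 0 = ?t + ?n \<and>
         (\<forall>a\<in>{''q'', ''w0'', ''w1''}. (\<forall>p<?t. s' a p = s a p) \<and> (\<forall>m<?n. s' a (?t + m) = s a (?h + m))))"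
        using ends_copy_front[of s1] ij e by (simp add: e)
      fix s2 assume s2: "s2 ''tl'' 0 = ?t + ?n \<and>
         (\<forall>a\<in>{''q'', ''w0'', ''w1''}. (\<forall>p<?t. s2 a p = s a p) \<and> (\<forall>m<?n. s2 a (?t + m) = s a (?h + m)))"
        and f2: "\<And>a. a \<notin> writes copy_front \<Longrightarrow> s2 a = s1 a"
      have k2: "s2 ''fi'' 0 = ?i" "s2 ''fj'' 0 = ?j" "s2 ''fx'' 0 = s1 ''fx'' 0" "s2 ''fy'' 0 = s1 ''fy'' 0"
        using f2 by (simp_all add: copy_front_def move_def)
      let ?s3 = "run turn s2"
      have i': "?t + ?n - 2 = ?t + (?i - ?h)" using ij by simp
      have t: "?s3 ''fi'' 0 = ?j" "?s3 ''fj'' 0 = ?t + (?i - ?h)" "?s3 ''fx'' 0 = s1 ''fy'' 0" "?s3 ''fy'' 0 = s1 ''fx'' 0"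
        "?s3 ''q'' = s2 ''q''" "?s3 ''w0'' = s2 ''w0''" "?s3 ''w1'' = s2 ''w1''"
        using s2 k2 i' by (simp_all add: turn_def swap_def)
      have old: "item ?s3 p = item s p" if "p < ?t" for p using s2 that by (simp add: item_def t)
      have new: "item ?s3 (?t + m) = item s (?h + m)" if "m < ?n" for m using s2 that by (simp add: item_def t)
      have im: "?i - ?h < ?n" "Suc (?i - ?h) < ?n" "?h + (?i - ?h) = ?i" "?h + Suc (?i - ?h) = Suc ?i" using ij by auto
      have u: "[Suc ?j..<?t + (?i - ?h)] = [Suc ?j..<?t] @ map ((+) ?t) [0..<?i - ?h]"
        unfolding upt_shift[symmetric] using ij by (intro upt_add_eq_append) simp
      have u2: "[?h..<?i] = map ((+) ?h) [0..<?i - ?h]" using ij upt_shift[of ?h "?i - ?h"] by simp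
      \<comment> \<open>Read across the old end of the list, the cells between \<open>fj\<close> and
        the copy of \<open>fi\<close> spell out the other side of the circle.\<close>
      have b: "block ?s3 (Suc ?j) (?t + (?i - ?h)) = ?B @ ?A"
        unfolding block_item u u2 map_append map_map by (auto simp: old new)
      have its: "item ?s3 ?j = item s ?j" "item ?s3 (?t + (?i - ?h)) = item s ?i" using old ij new[OF im(1)] im by auto
      have q: "?s3 ''q'' (Suc (?t + (?i - ?h))) = fst (hd ?P)"
      proof -
        have "Suc ?i < ?j" using ij by linarith
        then show ?thesis using new[OF im(2)] im(4) by (simp add: block_item upt_rec[of "Suc ?i"] item_def)
      qed
      have w: "?s3 ''w0'' ?j = s ''w0'' ?j" "?s3 ''w1'' ?j = s ''w1'' ?j"
        "?s3 ''w0'' (?t + (?i - ?h)) = s ''w0'' ?i" "?s3 ''w1'' (?t + (?i - ?h)) = s ''w1'' ?i"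
        using its by (simp_all add: item_def)
      have Pne: "?P \<noteq> []" using ij by (simp add: block_item)
      have dd: "?t + (?i - ?h) - ?j = ?k - (?j - ?i)" using ij by auto
      have "ready ?k (wits (items s)) ?s3"
        unfolding ready_def t(1-4) b its q w dd
      proof (intro conjI exI[of _ ?P])
        show "?P \<noteq> []" by (rule Pne)
        show "obs adj (item s ?j # (?B @ ?A) @ item s ?i # ?P)" by (rule o2)
        show "verts_of (item s ?j # (?B @ ?A) @ item s ?i # ?P) \<subseteq> U" unfolding V(2) by (rule U)
        show "wits (item s ?j # (?B @ ?A) @ item s ?i # ?P) \<subseteq> wits (items s)" unfolding V(3,4) by (rule order_refl)
        show "adj (s1 ''fy'' 0) (s1 ''fx'' 0)" using L adj_sym by (auto simp: L_def)
      qed (use L ij d in \<open>auto simp: L_def\<close>)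
      then show "ends turn s2 11 (ready ?k (wits (items s)))" by (intro ends_run) (simp_all add: turn_def swap_def)
    qed simp
  next
    assume "\<not> eval_test (Less (Minus Len (Minus (Var ''fj'') (Var ''fi''))) (Minus (Var ''fj'') (Var ''fi''))) s1"
    then have d: "?j - ?i \<le> ?k - (?j - ?i)" using e by simp
    let ?s3 = "run (move Hd Tl) s1"
    have t: "?s3 ''fi'' = s1 ''fi''" "?s3 ''fj'' = s1 ''fj''" "?s3 ''fx'' = s1 ''fx''" "?s3 ''fy'' = s1 ''fy''"
      by (simp_all add: move_def)
    have old: "item ?s3 p = item s p" if "p < ?t" for p using that by (simp add: item_def move_def e)
    have w: "?s3 ''w0'' ?i = s ''w0'' ?i" "?s3 ''w1'' ?i = s ''w1'' ?i" "?s3 ''w0'' ?j = s ''w0'' ?j" "?s3 ''w1'' ?j = s ''w1'' ?j"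
      using old[of ?i] old[of ?j] ij by (simp_all add: item_def)
    have b: "block ?s3 (Suc ?i) ?j = ?P" using old ij by (auto simp: block_item)
    have its: "item ?s3 ?j = item s ?j" "item ?s3 ?i = item s ?i" using old ij by auto
    have ne: "?B @ ?A \<noteq> []" 
    proof -
      have "0 < length (?B @ ?A)" unfolding BA using ij by linarith
      then show ?thesis by (rule length_greater_0_conv[THEN iffD1])
    qed
    have q: "?s3 ''q'' (Suc ?j) = fst (hd (?B @ ?A))"
    proof (cases "Suc ?j = ?t")
      case True
      have "?h < ?i" using ne True by (auto simp: block_item)
      then show ?thesis using True by (simp add: move_def e block_Cons)
    next
      case False
      then show ?thesis using ij by (simp add: move_def e block_Cons)
    qed
    have "ready ?k (wits (items s)) ?s3"
      unfolding ready_def t b its q w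
    proof (intro conjI exI[of _ "?B @ ?A"])
      show "?B @ ?A \<noteq> []" by (rule ne)
      show "obs adj (item s ?i # ?P @ item s ?j # ?B @ ?A)" by (rule o1)
      show "verts_of (item s ?i # ?P @ item s ?j # ?B @ ?A) \<subseteq> U" unfolding V(1) by (rule U)
      show "wits (item s ?i # ?P @ item s ?j # ?B @ ?A) \<subseteq> wits (items s)" unfolding V(3,4) by (rule order_refl)
    qed (use L ij d in \<open>auto simp: L_def\<close>)
    then show "ends (move Hd Tl) s1 (6 * ?k + 13) (ready ?k (wits (items s)))" by (intro ends_run) (simp_all add: move_def)
  qed simp
  then show "ends (Seq (Branch (Less (Minus Len (Minus (Var ''fj'') (Var ''fi''))) (Minus (Var ''fj'') (Var ''fi''))) (Seq copy_front turn) (move Hd Tl)) finish)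
     s1 (6 * ?k + 25) (\<lambda>s'. obs adj (items s') \<and> verts_of (items s') \<subseteq> U \<and> wits (items s') \<subseteq> wits (items s) \<and> 4 * length (items s') \<le> 3 * ?k)"
  proof (rule ends_Seq)
    show "ends finish s2 10 (\<lambda>s'. obs adj (items s') \<and> verts_of (items s') \<subseteq> U \<and> wits (items s') \<subseteq> wits (items s) \<and> 4 * length (items s') \<le> 3 * ?k)"
      if "ready ?k (wits (items s)) s2" for s2
      by (rule ends_run, simp add: finish_def, rule finish_ready[OF that k], simp add: finish_def)
  qed simp
qed simp

lemma current_iff:
  assumes "\<forall>y\<in>wits (items s). current s y"
  shows "current s v \<longleftrightarrow> v \<in> wits (items s)"
proof
  assume c: "current s v"
  let ?p = "s ''ix'' v"
  have "item s ?p \<in> set (items s)" using c by (auto simp: current_def block_item)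
  then show "v \<in> wits (items s)" using c in_wits unfolding current_def item_def by metis
qed (use assms in blast)

lemma current_pos:
  assumes "current s v"
  shows "s ''ix'' v - s ''hd'' 0 < length (items s) \<and> v \<in> wit_at (items s) (s ''ix'' v - s ''hd'' 0)"
  using assms by (auto simp: current_def wit_at_def nth_block)

lemma card_wits: "card (wits xs) \<le> 2 * length xs"
proof (induction xs)
  case (Cons x xs)
  obtain v a b where x: "x = (v, a, b)" by (cases x)
  have "card (wits (x # xs)) \<le> card {a, b} + card (wits xs)" unfolding x wits_simps by (rule card_Un_le)
  also have "card {a, b} \<le> 2" by (simp add: card_insert_if)
  finally show ?case using Cons by simp
qed simp

end

text \<open>The two ways in which trying \<open>S\<close> successors is conclusive: all of
  \<open>U\<close> is reached, or the order is sweepable and \<open>S\<close> is at least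
  ten.\<close>

locale ram_search = ram adj adjt ok U for adj :: "nat \<Rightarrow> nat \<Rightarrow> bool" and adjt ok U +
  fixes key :: "nat \<Rightarrow> nat" and S :: nat
  assumes S: "finite U \<and> card U \<le> S \<or> 10 \<le> S \<and> sweepable adj key U"
begin

text \<open>The order may contain vertices that are no longer witnesses. It is filtered at the start
  of the next search, which keeps it sorted.\<close>

definition rinv :: "state \<Rightarrow> bool" where
  "rinv s \<longleftrightarrow> ok s \<and> obs adj (items s) \<and> verts_of (items s) \<subseteq> U \<and> wits (items s) \<subseteq> set (order s) \<and>
     sorted_wrt (\<lambda>u v. key u < key v) (order s) \<and> s ''mx'' 0 = S"

definition solved :: "state \<Rightarrow> bool" where
  "solved s \<longleftrightarrow> ok s \<and> obs adj (items s) \<and> verts_of (items s) \<subseteq> U \<and> (12 \<le> length (items s) \<longrightarrow> ess adj (items s))"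

definition bound :: nat where
  "bound = cost (search_step adjt) + 40"

lemma sorted_key_distinct: "sorted_wrt (\<lambda>u v. key u < key v) xs \<Longrightarrow> distinct xs"
  by (induction xs) auto

text \<open>Filtering reduces the order to the distinct witnesses, at most two per item. The
  filtering of the next round is thereby bounded by the length in this one.\<close>

lemma ends_search_round:
  assumes I: "rinv s" and c: "clean (items s)" and k: "12 \<le> length (items s)" and go: "s ''go'' 0 = 1"
    and m: "m = min S (2 * length (items s))"
  shows "ends (search_round adjt) s (6 * s ''el'' 0 + 4 * bound * length (items s) * (m + 1))
    (\<lambda>s'. s' ''go'' 0 = 0 \<and> solved s' \<or> s' ''go'' 0 = 1 \<and> rinv s' \<and> s' ''el'' 0 \<le> 2 * length (items s) \<and>
       4 * length (items s') \<le> 3 * length (items s))" (is "ends _ _ _ ?Q")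
proof -
  let ?k = "length (items s)" and ?C = "cost (search_step adjt) + 1"
  define X where "X = {''q'', ''w0'', ''w1'', ''hd'', ''tl'', ''mx'', ''go''} \<union> adj_arrays"
  define Y where "Y = X \<union> {''ix''}"
  have it: "items s' = items s" if "\<forall>a\<in>X. s' a = s a" for s'
    using that by (simp add: X_def block_def)
  have okX: "ok s'" if "\<forall>a\<in>X. s' a = s a" for s'
  proof -
    have sub: "adj_arrays \<subseteq> X" unfolding X_def by (rule Un_upper2)
    have "ok s" using I by (simp add: rinv_def)
    then show ?thesis by (rule ok_frame) (rule that[THEN bspec], rule subsetD[OF sub])
  qed
  have T3: "2 * ?k * (?C * m + 5) + (6 * ?k + 60) + (4 * ?k + 2) + 6 \<le> 4 * bound * ?k * (m + 1)"
  proof -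
    have "2 * ?k * (?C * m + 5) + (6 * ?k + 60) + (4 * ?k + 2) + 6 \<le> 2 * ?k * (?C * m) + 26 * ?k" using k by (simp add: algebra_simps del: length_block)
    also have "\<dots> \<le> 4 * bound * ?k * m + 4 * bound * ?k"
      by (intro add_mono) (simp_all add: bound_def algebra_simps del: length_block)
    finally show ?thesis by (simp add: algebra_simps del: length_block)
  qed
  show ?thesis unfolding search_round_def
  proof (rule ends_Seq)
    show "ends mark s (4 * ?k + 2) (\<lambda>s1. \<forall>y\<in>wits (items s). current s1 y)"
      using ends_mark[of s] by simp
    fix s1 assume c1: "\<forall>y\<in>wits (items s). current s1 y" and f1: "\<And>a. a \<notin> writes mark \<Longrightarrow> s1 a = s a"
    have X1: "\<forall>a\<in>X. s1 a = s a" using f1 by (simp add: mark_def X_def adj_arrays_def)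
    have o1: "order s1 = order s" "s1 ''el'' = s ''el''" using f1 by (simp_all add: order_def mark_def)
    have cur: "current s1 v \<longleftrightarrow> v \<in> wits (items s)" for v
      using current_iff[of s1 v] c1 it[OF X1] by simp
    show "ends (Seq filter_order (Seq (search adjt) (Branch (Eq (Var ''fd'') (Const 0)) (Set ''go'' (Const 0)) cut))) s1
       (6 * s ''el'' 0 + 5 + (2 * ?k * (?C * m + 5) + 3 + (6 * ?k + 50))) ?Q"
    proof (rule ends_Seq)
      show "ends filter_order s1 (6 * s ''el'' 0 + 5) (\<lambda>s2. order s2 = filter (\<lambda>v. v \<in> wits (items s)) (order s))"
        using ends_filter_order[of s1] unfolding o1 cur by simp
      fix s2 assume o2: "order s2 = filter (\<lambda>v. v \<in> wits (items s)) (order s)"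
        and f2: "\<And>a. a \<notin> writes filter_order \<Longrightarrow> s2 a = s1 a"
      have Y2: "\<forall>a\<in>Y. s2 a = s1 a" using f2 by (simp add: filter_order_def filter_step_def Y_def X_def adj_arrays_def)
      then have X2: "\<forall>a\<in>X. s2 a = s a" using X1 unfolding Y_def by simp
      have cur2: "current s2 v \<longleftrightarrow> v \<in> wits (items s)" for v
        using Y2 cur[of v] by (simp add: current_def Y_def X_def)
      have E: "set (order s2) = wits (items s)" using o2 I by (auto simp: rinv_def)
      have sE: "sorted_wrt (\<lambda>u v. key u < key v) (order s2)"
        unfolding o2 using I by (auto simp: rinv_def intro: sorted_wrt_filter)
      have dE: "distinct (order s2)" using sE by (rule sorted_key_distinct)
      have WU: "wits (items s) \<subseteq> U" using I by (auto simp: rinv_def)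
      have el: "length (order s2) = s2 ''el'' 0" by (simp add: order_def)
      have cE: "length (order s2) = card (wits (items s))" using distinct_card[OF dE] E by simp
      then have el2: "s2 ''el'' 0 \<le> 2 * ?k" using card_wits[of "items s"] el by simp
      have mx: "s2 ''mx'' 0 = S" using X2 I by (simp add: X_def rinv_def)
      have okS2: "ok s2" by (rule okX[OF X2])
      let ?hit = "\<lambda>x y. adj x y \<and> far (s2 ''tl'' 0 - s2 ''hd'' 0) (s2 ''ix'' x) (s2 ''ix'' y)"
      have tm: "s2 ''el'' 0 * (?C * min (s2 ''mx'' 0) (s2 ''el'' 0) + 5) + 3 \<le> 2 * ?k * (?C * m + 5) + 3"
        using el2 unfolding mx m by (intro add_mono mult_mono order_refl min.mono) auto
      show "ends (Seq (search adjt) (Branch (Eq (Var ''fd'') (Const 0)) (Set ''go'' (Const 0)) cut)) s2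
        (2 * ?k * (?C * m + 5) + 3 + (6 * ?k + 50)) ?Q"
      proof (rule ends_Seq)
        show "ends (search adjt) s2 (2 * ?k * (?C * m + 5) + 3) (\<lambda>s3. if s3 ''fd'' 0 = 0
             then \<forall>i<length (order s2). \<forall>c. 0 < c \<longrightarrow> c \<le> s2 ''mx'' 0 \<longrightarrow> c \<le> length (order s2) \<longrightarrow>
               \<not> ?hit (order s2 ! i) (order s2 ! ((i + c) mod length (order s2)))
             else s3 ''fx'' 0 \<in> set (order s2) \<and> s3 ''fy'' 0 \<in> set (order s2) \<and> ?hit (s3 ''fx'' 0) (s3 ''fy'' 0))"
          using E WU by (intro ends_weaken[OF ends_search[OF okS2] tm]) auto
        fix s3 assume s3: "if s3 ''fd'' 0 = 0
             then \<forall>i<length (order s2). \<forall>c. 0 < c \<longrightarrow> c \<le> s2 ''mx'' 0 \<longrightarrow> c \<le> length (order s2) \<longrightarrow>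
               \<not> ?hit (order s2 ! i) (order s2 ! ((i + c) mod length (order s2)))
             else s3 ''fx'' 0 \<in> set (order s2) \<and> s3 ''fy'' 0 \<in> set (order s2) \<and> ?hit (s3 ''fx'' 0) (s3 ''fy'' 0)"
          and f3: "\<And>a. a \<notin> writes (search adjt) \<Longrightarrow> s3 a = s2 a"
        have f3': "s3 a = s2 a" if "a \<notin> {''fd'', ''i'', ''j'', ''c'', ''fx'', ''fy''}" for a
          by (rule f3, rule contra_subsetD[OF writes_search], rule that)
        have Y3: "\<forall>a\<in>Y. s3 a = s2 a" using f3' by (simp add: Y_def X_def adj_arrays_def)
        then have X3: "\<forall>a\<in>X. s3 a = s a" using X2 unfolding Y_def by simp
        have o3: "order s3 = order s2" "s3 ''el'' = s2 ''el''" "s3 ''ix'' = s2 ''ix''" using f3' by (simp_all add: order_def)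
        have ht: "s2 ''tl'' 0 - s2 ''hd'' 0 = ?k" using X2 by (simp add: X_def)
        have i3: "items s3 = items s" by (rule it[OF X3])
        have ok3: "ok s3" by (rule okX[OF X3])
        have cur3: "current s3 v \<longleftrightarrow> v \<in> wits (items s)" for v
          using Y3 cur2[of v] by (simp add: current_def Y_def X_def)
        show "ends (Branch (Eq (Var ''fd'') (Const 0)) (Set ''go'' (Const 0)) cut) s3 (6 * ?k + 50) ?Q"
        proof (rule ends_Branch)
          assume "eval_test (Eq (Var ''fd'') (Const 0)) s3"
          then have fd: "s3 ''fd'' 0 = 0" by simp
          have hd0: "s3 ''hd'' 0 = s ''hd'' 0" using X3 by (simp add: X_def)
          have "ess adj (items s)"
          proof (rule search_complete[where E = "order s2" and key = key and U = U and S = S and pos = "\<lambda>v. s3 ''ix'' v - s ''hd'' 0"])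
            show "obs adj (items s)" using I by (simp add: rinv_def)
            show "clean (items s)" by (rule c)
            show "5 \<le> length (items s)" using k by simp
            show "sorted_wrt (\<lambda>u v. key u < key v) (order s2)" by (rule sE)
            show "set (order s2) = wits (items s)" by (rule E)
            show "wits (items s) \<subseteq> U" by (rule WU)
            show "s3 ''ix'' y - s ''hd'' 0 < length (items s) \<and> y \<in> wit_at (items s) (s3 ''ix'' y - s ''hd'' 0)"
              if "y \<in> wits (items s)" for y
              using current_pos[of s3 y, unfolded i3] cur3[of y] that unfolding hd0 by blast
            show "length (order s2) \<le> S \<or> 10 \<le> S \<and> sweepable adj key U"
              using S card_mono[of U "wits (items s)"] WU cE by fastforce
            fix i c assume ic: "i < length (order s2)" "0 < c" "c \<le> S" "c \<le> length (order s2)"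
            let ?x = "order s2 ! i" and ?y = "order s2 ! ((i + c) mod length (order s2))"
            have "(i + c) mod length (order s2) < length (order s2)" by (intro mod_less_divisor) (use ic in linarith)
            then have "?x \<in> wits (items s)" "?y \<in> wits (items s)" using E ic(1) nth_mem by blast+
            then have "s ''hd'' 0 \<le> s3 ''ix'' ?x" "s ''hd'' 0 \<le> s3 ''ix'' ?y" using cur3 unfolding current_def hd0 by blast+
            then have "far ?k (s3 ''ix'' ?x - s ''hd'' 0) (s3 ''ix'' ?y - s ''hd'' 0) \<longleftrightarrow> far ?k (s3 ''ix'' ?x) (s3 ''ix'' ?y)"
              unfolding far_def by auto
            moreover have "\<not> (adj ?x ?y \<and> far ?k (s3 ''ix'' ?x) (s3 ''ix'' ?y))"
              using s3 fd ic unfolding mx ht o3(3) by simp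
            ultimately show "\<not> (adj ?x ?y \<and> far (length (items s)) (s3 ''ix'' ?x - s ''hd'' 0) (s3 ''ix'' ?y - s ''hd'' 0))"
              by blast
          qed
          let ?r = "run (Set ''go'' (Const 0)) s3"
          have "items ?r = items s" unfolding i3[symmetric] by (simp add: block_def)
          moreover have "ok ?r" by (rule run_ok) (simp_all add: adj_arrays_def ok3)
          ultimately have "solved ?r" using \<open>ess adj (items s)\<close> I by (simp add: solved_def rinv_def)
          moreover have "?r ''go'' 0 = 0" by simp
          ultimately show "ends (Set ''go'' (Const 0)) s3 (6 * ?k + 40) ?Q"
            by (intro ends_run) (simp_all del: run.simps)
        next
          assume "\<not> eval_test (Eq (Var ''fd'') (Const 0)) s3"
          then have h: "s3 ''fx'' 0 \<in> wits (items s)" "s3 ''fy'' 0 \<in> wits (items s)" "adj (s3 ''fx'' 0) (s3 ''fy'' 0)"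
             "far ?k (s3 ''ix'' (s3 ''fx'' 0)) (s3 ''ix'' (s3 ''fy'' 0))"
            using s3 E unfolding ht o3(3) by auto
          have "ends cut s3 (6 * ?k + 40)
             (\<lambda>s'. obs adj (items s') \<and> verts_of (items s') \<subseteq> U \<and> wits (items s') \<subseteq> wits (items s) \<and> 4 * length (items s') \<le> 3 * ?k)"
            using ends_cut[of s3] I h cur3 k unfolding i3 by (auto simp: rinv_def)
          then show "ends cut s3 (6 * ?k + 40) ?Q"
          proof (rule ends_weaken)
            fix s4 assume s4: "obs adj (items s4) \<and> verts_of (items s4) \<subseteq> U \<and> wits (items s4) \<subseteq> wits (items s) \<and> 4 * length (items s4) \<le> 3 * ?k"
              and f4: "\<And>a. a \<notin> writes cut \<Longrightarrow> s4 a = s3 a"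
            have f4': "s4 a = s3 a" if "a \<notin> {''q'', ''w0'', ''w1'', ''hd'', ''tl'', ''i'', ''fi'', ''fj'', ''fx'', ''fy'', ''tmp''}" for a
              by (rule f4, rule contra_subsetD[OF writes_cut], rule that)
            have "ok s4" using f4' by (rule ok_frame[OF ok3]) (auto simp: adj_arrays_def)
            moreover have "order s4 = order s2" "s4 ''el'' 0 = s2 ''el'' 0" "s4 ''mx'' = s3 ''mx''" "s4 ''go'' = s3 ''go''"
              using f4' o3 by (simp_all add: order_def)
            moreover have "s3 ''mx'' 0 = S" "s3 ''go'' 0 = 1" using X3 I go by (simp_all add: X_def rinv_def)
            ultimately show "?Q s4" using s4 E sE el2 unfolding rinv_def by simp
          qed simp
        qed simp
      qed simp
    qed simp
  next
    show "4 * ?k + 2 + (6 * s ''el'' 0 + 5 + (2 * ?k * (?C * m + 5) + 3 + (6 * ?k + 50))) \<le>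
       6 * s ''el'' 0 + 4 * bound * ?k * (m + 1)" using T3 by linarith
  qed
qed

lemma ends_round:
  assumes I: "rinv s" and go: "s ''go'' 0 = 1" and k0: "length (items s) \<le> k0"
  shows "ends (round adjt) s ((32 * cost (clean_step adjt) + 4 * bound + 50) * length (items s) * (min S (2 * k0) + 1) + 6 * s ''el'' 0)
    (\<lambda>s'. s' ''go'' 0 = 0 \<and> solved s' \<or> s' ''go'' 0 = 1 \<and> rinv s' \<and> s' ''el'' 0 \<le> 2 * length (items s) \<and>
       4 * length (items s') \<le> 3 * length (items s))" (is "ends _ _ _ ?Q")
proof -
  let ?k = "length (items s)" and ?m = "min S (2 * k0)"
  have ok: "ok s" and o: "obs adj (items s)" and U: "verts_of (items s) \<subseteq> U" using I by (auto simp: rinv_def)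
  have k3: "3 \<le> ?k" using o by (simp add: obs_def)
  show ?thesis unfolding round_def
  proof (rule ends_Seq)
    show "ends (clean_up adjt) s (32 * (cost (clean_step adjt) + 1) * ?k + 2)
      (\<lambda>s'. ok s' \<and> obs adj (items s') \<and> verts_of (items s') \<subseteq> U \<and> length (items s') \<le> length (items s) \<and>
       (12 \<le> length (items s') \<longrightarrow> clean (items s')) \<and> wits (items s') \<subseteq> wits (items s))"
      by (rule ends_clean_up[OF ok o U])
    fix s1 assume s1: "ok s1 \<and> obs adj (items s1) \<and> verts_of (items s1) \<subseteq> U \<and> length (items s1) \<le> length (items s) \<and>
       (12 \<le> length (items s1) \<longrightarrow> clean (items s1)) \<and> wits (items s1) \<subseteq> wits (items s)"
      and f1: "\<And>a. a \<notin> writes (clean_up adjt) \<Longrightarrow> s1 a = s a"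
    have f1': "s1 a = s a" if "a \<notin> {''q'', ''w0'', ''w1'', ''hd'', ''tl'', ''gd'', ''red''}" for a
      by (rule f1, rule contra_subsetD[OF writes_clean_up], rule that)
    have e: "order s1 = order s" "s1 ''mx'' = s ''mx''" "s1 ''go'' = s ''go''" "s1 ''el'' = s ''el''"
      using f1' by (simp_all add: order_def)
    let ?k1 = "length (items s1)"
    let ?m1 = "min S (2 * ?k1)"
    show "ends (Branch (Less Len (Const 12)) (Set ''go'' (Const 0)) (search_round adjt)) s1
      (6 * s ''el'' 0 + 4 * bound * ?k * (?m + 1) + 2) ?Q"
    proof (rule ends_Branch)
      assume "eval_test (Less Len (Const 12)) s1"
      then have k1: "?k1 < 12" by simp
      let ?r = "run (Set ''go'' (Const 0)) s1"
      have "items ?r = items s1" by (simp add: block_def)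
      moreover have "ok ?r" by (rule run_ok) (use s1 in \<open>simp_all add: adj_arrays_def\<close>)
      ultimately have "solved ?r" using s1 k1 unfolding solved_def by simp
      moreover have "?r ''go'' 0 = 0" by simp
      ultimately show "ends (Set ''go'' (Const 0)) s1 (6 * s ''el'' 0 + 4 * bound * ?k * (?m + 1) + 1) ?Q"
        by (intro ends_run) (simp_all del: run.simps)
    next
      assume "\<not> eval_test (Less Len (Const 12)) s1"
      then have k1: "12 \<le> ?k1" by simp
      have R: "rinv s1" using s1 I unfolding rinv_def e by blast
      have "4 * bound * ?k1 * (?m1 + 1) \<le> 4 * bound * ?k * (?m + 1)"
        using s1 k0 by (intro mult_mono add_mono order_refl min.mono) auto
      then have "6 * s1 ''el'' 0 + 4 * bound * ?k1 * (?m1 + 1) \<le> 6 * s ''el'' 0 + 4 * bound * ?k * (?m + 1) + 1"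
        unfolding e by linarith
      then show "ends (search_round adjt) s1 (6 * s ''el'' 0 + 4 * bound * ?k * (?m + 1) + 1) ?Q"
        using s1 k1 go e by (intro ends_weaken[OF ends_search_round[OF R _ k1 _ refl]]) auto
    qed simp
  next
    have "(32 * cost (clean_step adjt) + 4 * bound + 50) * ?k * (?m + 1) =
      (32 * cost (clean_step adjt) + 50) * ?k * (?m + 1) + 4 * bound * ?k * (?m + 1)" by (simp add: algebra_simps del: length_block)
    moreover have "32 * (cost (clean_step adjt) + 1) * ?k + 4 \<le> (32 * cost (clean_step adjt) + 50) * ?k * 1"
      using k3 by (simp add: algebra_simps del: length_block)
    moreover have "(32 * cost (clean_step adjt) + 50) * ?k * 1 \<le> (32 * cost (clean_step adjt) + 50) * ?k * (?m + 1)"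
      by (intro mult_left_mono) simp_all
    ultimately show "32 * (cost (clean_step adjt) + 1) * ?k + 2 + (6 * s ''el'' 0 + 4 * bound * ?k * (?m + 1) + 2)
      \<le> (32 * cost (clean_step adjt) + 4 * bound + 50) * ?k * (?m + 1) + 6 * s ''el'' 0" by linarith
  qed
qed

text \<open>The factor four is the sum of the geometric series with ratio 3/4. The summand 63
  consists of the 50 in the bound for a round, twelve for filtering the order in the next round, and
  one for the test of the loop.\<close>

definition shrink_cost :: nat where
  "shrink_cost = 4 * (32 * cost (clean_step adjt) + 4 * bound + 63)"

lemma ends_shrink:
  assumes ok: "ok s" and o: "obs adj (items s)" and U: "verts_of (items s) \<subseteq> U"
    and w: "wits (items s) \<subseteq> set (order s)" and sorted: "sorted_wrt (\<lambda>u v. key u < key v) (order s)" and mx: "s ''mx'' 0 = S"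
  shows "ends (shrink adjt) s (shrink_cost * length (items s) * (min S (2 * length (items s)) + 1) + 6 * s ''el'' 0 + 2) solved"
proof -
  let ?k0 = "length (items s)" and ?R = "32 * cost (clean_step adjt) + 4 * bound + 50"
  \<comment> \<open>Fixed by the initial length, so that the potential is linear in the current
    length.\<close>
  let ?M = "min S (2 * ?k0) + 1"
  let ?I = "\<lambda>s. s ''go'' 0 = 0 \<and> solved s \<or> s ''go'' 0 = 1 \<and> rinv s \<and> length (items s) \<le> ?k0"
  let ?\<Phi> = "\<lambda>s. if s ''go'' 0 = 0 then 0 else shrink_cost * length (items s) * ?M + 6 * s ''el'' 0"
  show ?thesis unfolding shrink_def
  proof (rule ends_Seq[where ?T1.0 = 1])
    let ?r = "run (Set ''go'' (Const 1)) s"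
    have e: "items ?r = items s" "order ?r = order s" "?r ''el'' = s ''el''" "?r ''mx'' = s ''mx''"
      by (simp_all add: block_def order_def)
    have "ok ?r" by (rule run_ok) (simp_all add: adj_arrays_def ok)
    then have "rinv ?r" unfolding rinv_def e using o U w sorted mx by blast
    moreover have "?r ''go'' 0 = 1" by simp
    ultimately show "ends (Set ''go'' (Const 1)) s 1 (\<lambda>s1. s1 ''go'' 0 = 1 \<and> rinv s1 \<and> items s1 = items s \<and> s1 ''el'' = s ''el'')"
      using e by (intro ends_run) (simp_all del: run.simps)
    fix s1 assume s1: "s1 ''go'' 0 = 1 \<and> rinv s1 \<and> items s1 = items s \<and> s1 ''el'' = s ''el''"
    show "ends (While (Less (Const 0) (Var ''go'')) (round adjt)) s1 (shrink_cost * ?k0 * ?M + 6 * s ''el'' 0 + 1) solved"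
    proof (rule ends_While[where I = ?I and \<Phi> = ?\<Phi>])
      fix s' assume I: "?I s'" and b: "eval_test (Less (Const 0) (Var ''go'')) s'"
      then have R: "rinv s'" and go: "s' ''go'' 0 = 1" and lk: "length (items s') \<le> ?k0" by auto
      let ?k = "length (items s')"
      have k3: "3 \<le> ?k" using R by (simp add: rinv_def obs_def)
      have "?I s'' \<and> (?R * ?k * ?M + 6 * s' ''el'' 0) + 1 + ?\<Phi> s'' \<le> ?\<Phi> s'"
        if s'': "s'' ''go'' 0 = 0 \<and> solved s'' \<or> s'' ''go'' 0 = 1 \<and> rinv s'' \<and> s'' ''el'' 0 \<le> 2 * ?k \<and> 4 * length (items s'') \<le> 3 * ?k"
        for s''
      proof -
        have kM: "1 \<le> ?k * ?M" "?k \<le> ?k * ?M" using k3 by auto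
        have sc: "shrink_cost * ?k * ?M = 4 * (?R + 13) * (?k * ?M)" by (simp add: shrink_cost_def algebra_simps del: length_block)
        have R1: "?R * ?k * ?M = ?R * (?k * ?M)" by (simp add: algebra_simps del: length_block)
        show ?thesis
        proof (cases "s'' ''go'' 0 = 0")
          case True
          have "?R * (?k * ?M) + 1 \<le> 4 * (?R + 13) * (?k * ?M)" using kM(1) by (simp add: algebra_simps del: length_block)
          then show ?thesis using True s'' go unfolding sc R1 by simp
        next
          case False
          then have g: "s'' ''go'' 0 = 1" "rinv s''" "s'' ''el'' 0 \<le> 2 * ?k" "4 * length (items s'') \<le> 3 * ?k" using s'' by auto
          have "shrink_cost * length (items s'') * ?M = (?R + 13) * (4 * length (items s'')) * ?M"
            by (simp add: shrink_cost_def algebra_simps del: length_block)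
          also have "\<dots> \<le> (?R + 13) * (3 * ?k) * ?M" using g(4) by (intro mult_right_mono mult_left_mono) auto
          also have "\<dots> = 3 * ((?R + 13) * (?k * ?M))" by (simp add: algebra_simps del: length_block)
          finally have 1: "shrink_cost * length (items s'') * ?M \<le> 3 * ((?R + 13) * (?k * ?M))" .
          have 2: "shrink_cost * ?k * ?M = 4 * ((?R + 13) * (?k * ?M))" unfolding sc by (simp add: algebra_simps del: length_block)
          have 3: "(?R + 13) * (?k * ?M) = ?R * (?k * ?M) + 13 * (?k * ?M)" by (simp add: algebra_simps del: length_block)
          have "?R * ?k * ?M + 6 * s' ''el'' 0 + 1 + (shrink_cost * length (items s'') * ?M + 6 * s'' ''el'' 0)
             \<le> shrink_cost * ?k * ?M + 6 * s' ''el'' 0"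
            using 1 2 3 R1 g(3) kM by linarith
          then show ?thesis using g lk go by simp
        qed
      qed
      then show "\<exists>T. ends (round adjt) s' T (\<lambda>s''. ?I s'' \<and> T + 1 + ?\<Phi> s'' \<le> ?\<Phi> s')"
        by (intro exI[of _ "?R * ?k * ?M + 6 * s' ''el'' 0"] ends_weaken[OF ends_round[OF R go lk]]) auto
    next
      show "?I s1" using s1 by simp
      show "?\<Phi> s1 + 1 \<le> shrink_cost * ?k0 * ?M + 6 * s ''el'' 0 + 1" using s1 by simp
    next
      fix s' assume "?I s'" "\<not> eval_test (Less (Const 0) (Var ''go'')) s'"
      then show "solved s'" by auto
    qed
  qed simp
qed

end

section \<open>Invariance under isomorphism of small instances\<close>

definition map3 :: "('a \<Rightarrow> 'b) \<Rightarrow> 'a item \<Rightarrow> 'b item" where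
  "map3 h = (\<lambda>(v, a, b). (h v, h a, h b))"

lemma map3_simp [simp]: "map3 h (v, a, b) = (h v, h a, h b)"
  by (simp add: map3_def)

lemma fst_map3: "fst (map3 h x) = h (fst x)"
  by (cases x) simp

lemma cores_map3 [simp]: "cores (map (map3 h) xs) = h ` cores xs"
  by (simp add: cores_def image_image fst_map3)

lemma wits_map3 [simp]: "wits (map (map3 h) xs) = h ` wits xs"
  by (force simp: wits_def)

definition iso_on :: "('a \<Rightarrow> 'b) \<Rightarrow> 'a set \<Rightarrow> ('a \<Rightarrow> 'a \<Rightarrow> bool) \<Rightarrow> ('b \<Rightarrow> 'b \<Rightarrow> bool) \<Rightarrow> bool" where
  "iso_on h A adj adj' \<longleftrightarrow> inj_on h A \<and> (\<forall>x\<in>A. \<forall>y\<in>A. adj' (h x) (h y) \<longleftrightarrow> adj x y)"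

lemma iso_onD:
  assumes "iso_on h A adj adj'" "x \<in> A" "y \<in> A"
  shows "adj' (h x) (h y) \<longleftrightarrow> adj x y" "h x = h y \<longleftrightarrow> x = y"
  using assms by (auto simp: iso_on_def inj_on_def)

lemma missed_image:
  assumes h: "iso_on h A adj adj'" and C: "C \<subseteq> A" "y \<in> A"
  shows "missed adj' (h ` C) (h y) = h ` missed adj C y"
proof -
  have "x \<in> C \<Longrightarrow> adj' (h x) (h y) \<longleftrightarrow> adj x y" "x \<in> C \<Longrightarrow> adj' (h y) (h x) \<longleftrightarrow> adj y x" "x \<in> C \<Longrightarrow> h x = h y \<longleftrightarrow> x = y" for x
    using iso_onD[OF h] C by (metis subsetD)+
  then show ?thesis unfolding missed_def by auto
qed

lemma image_eq_pair:
  assumes "inj_on h A" "B \<subseteq> A" "C \<subseteq> A"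
  shows "h ` B = h ` C \<longleftrightarrow> B = C"
  using assms by (rule inj_on_image_eq_iff)

lemma link_map3:
  assumes h: "iso_on h A adj adj'" and C: "C \<subseteq> A" and x: "v \<in> A" "v' \<in> A" "a \<in> A" "b \<in> A"
    and l: "link adj C (v, a, b) v'"
  shows "link adj' (h ` C) (h v, h a, h b) (h v')"
  using l x iso_onD[OF h] missed_image[OF h C x(3)] missed_image[OF h C x(4)] by auto

lemma obs_map3:
  assumes h: "iso_on h A adj adj'" and A: "verts_of xs \<subseteq> A" and o: "obs adj xs"
  shows "obs adj' (map (map3 h) xs)"
proof -
  have C: "cores xs \<subseteq> A" using A by simp
  have m: "Suc i mod length xs < length xs" if "i < length xs" for i using that by (intro mod_less_divisor) auto
  have c: "fst (xs ! i) \<in> A" if "i < length xs" for i using that C unfolding cores_def by auto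
  have "link adj' (h ` cores xs) (map3 h (xs ! i)) (h (fst (xs ! (Suc i mod length xs))))" if i: "i < length xs" for i
  proof -
    obtain v a b where x: "xs ! i = (v, a, b)" by (cases "xs ! i")
    then have "(v, a, b) \<in> set xs" using i by (metis nth_mem)
    then have "a \<in> A" "b \<in> A" using A in_wits[of v a b xs] by auto
    moreover have "link adj (cores xs) (v, a, b) (fst (xs ! (Suc i mod length xs)))"
      using o i unfolding obs_nth x[symmetric] by blast
    moreover have "v \<in> A" using c[OF i] x by simp
    ultimately show ?thesis unfolding x map3_simp using c[OF m[OF i]] by (intro link_map3[OF h C])
  qed
  moreover have "distinct (map (\<lambda>x. h (fst x)) xs)"
  proof -
    have "distinct (map h (map fst xs))"
      using o h C unfolding obs_def distinct_map iso_on_def by (auto simp: cores_def intro: inj_on_subset)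
    then show ?thesis by (simp add: comp_def)
  qed
  moreover have "\<forall>u\<in>cores xs. \<forall>v\<in>cores xs. h u \<noteq> h v \<longrightarrow> adj' (h u) (h v)"
  proof (intro ballI impI)
    fix u v assume uv: "u \<in> cores xs" "v \<in> cores xs" "h u \<noteq> h v"
    then have "adj u v" using o unfolding obs_def by auto
    then show "adj' (h u) (h v)" using iso_onD(1)[OF h] uv C by blast
  qed
  ultimately show ?thesis using o m unfolding obs_nth cores_map3
    by (auto simp: fst_map3 comp_def)
qed

lemma ess_map3:
  assumes h: "iso_on h A adj adj'" and A: "verts_of xs \<subseteq> A" and e: "ess adj xs"
  shows "ess adj' (map (map3 h) xs)"
  unfolding ess_iff wits_map3
proof (intro ballI impI)
  fix x' y' assume "x' \<in> h ` wits xs" "y' \<in> h ` wits xs" and xy': "adj' x' y'"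
  then obtain x y where xy: "x \<in> wits xs" "y \<in> wits xs" "x' = h x" "y' = h y" by blast
  have xA: "x \<in> A" "y \<in> A" and C: "cores xs \<subseteq> A" using xy A by auto
  have "pair_ok adj xs x y" using e xy xy' iso_onD(1)[OF h xA] unfolding ess_iff by blast
  moreover have "map3 h z \<in> set (map (map3 h) xs)" if "z \<in> set xs" for z using that by simp
  ultimately show "pair_ok adj' (map (map3 h) xs) x' y'"
    unfolding pair_ok_def cores_map3 xy missed_image[OF h C xA(1)] missed_image[OF h C xA(2)]
    by (elim disjE) (blast, blast, fastforce simp: map3_def split: prod.splits)
qed

lemma shape_map:
  assumes h: "iso_on h A adj adj'" and A: "set vs \<subseteq> A" and s: "shape adj S vs"
  shows "shape adj' S (map h vs)"
proof -
  have len: "length vs = fst S" using s by (simp add: shape_def)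
  have e: "adj' (h (vs ! i)) (h (vs ! j)) \<longleftrightarrow> adj (vs ! i) (vs ! j)" "h (vs ! i) = h (vs ! j) \<longleftrightarrow> vs ! i = vs ! j"
    if "i < fst S" "j < fst S" for i j
    by (rule iso_onD[OF h]; rule subsetD[OF A]; rule nth_mem; simp add: len that)+
  have "\<forall>j<fst S. \<forall>i<j. if (i, j) \<in> set (snd S) \<or> (j, i) \<in> set (snd S)
    then h (vs ! i) \<noteq> h (vs ! j) \<and> \<not> adj' (h (vs ! i)) (h (vs ! j)) else adj' (h (vs ! i)) (h (vs ! j))"
  proof (intro allI impI)
    fix j i assume j: "j < fst S" "i < j"
    then have i: "i < fst S" by simp
    show "if (i, j) \<in> set (snd S) \<or> (j, i) \<in> set (snd S)
      then h (vs ! i) \<noteq> h (vs ! j) \<and> \<not> adj' (h (vs ! i)) (h (vs ! j)) else adj' (h (vs ! i)) (h (vs ! j))"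
      unfolding e[OF i j(1)] using conjunct2[OF s[unfolded shape_def], THEN spec, THEN mp, OF j(1), THEN spec, THEN mp, OF j(2)] .
  qed
  then show ?thesis using len unfolding shape_def by (simp add: nth_map less_trans cong: if_cong)
qed

type_synonym answer = "nat list + nat item list"

text \<open>An answer names slots of the stored enumeration instead of vertices, and
  \<open>z\<close> gives the vertex in each slot. This makes answers comparable between different
  instances.\<close>

definition sol :: "('a \<Rightarrow> 'a \<Rightarrow> bool) \<Rightarrow> (nat \<Rightarrow> 'a) \<Rightarrow> nat \<Rightarrow> answer \<Rightarrow> bool" where
  "sol adj z n D = (case D of
     Inl js \<Rightarrow> set js \<subseteq> {..<n} \<and> (\<exists>S\<in>set co_shapes. shape adj S (map z js))
   | Inr is \<Rightarrow> verts_of is \<subseteq> {..<n} \<and> obs adj (map (map3 z) is) \<and> ess adj (map (map3 z) is))"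

text \<open>All that can be learnt about \<open>n\<close> slots by comparing them and testing
  adjacency: two tables of n^2 bits.\<close>

definition pattern :: "('a \<Rightarrow> 'a \<Rightarrow> bool) \<Rightarrow> (nat \<Rightarrow> 'a) \<Rightarrow> nat \<Rightarrow> bool list" where
  "pattern adj z n = map (\<lambda>(i, j). z i = z j) (List.product [0..<n] [0..<n]) @
     map (\<lambda>(i, j). adj (z i) (z j)) (List.product [0..<n] [0..<n])"

text \<open>Sending the vertex in a slot of one instance to the vertex in the same slot of the other
  is well defined and an isomorphism, since the patterns agree. So a correct answer for one instance
  is correct for all with its pattern, and can be stored in a program.\<close>

lemma sol_pattern:
  assumes p: "pattern adj z n = pattern adj' z' n" and s: "sol adj z n D"
  shows "sol adj' z' n D"
proof -
  have e: "z i = z j \<longleftrightarrow> z' i = z' j" "adj (z i) (z j) \<longleftrightarrow> adj' (z' i) (z' j)" if "i < n" "j < n" for i j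
    using p that unfolding pattern_def by auto
  define h where "h x = z' (SOME i. i < n \<and> z i = x)" for x
  have h: "h (z i) = z' i" if "i < n" for i
  proof -
    have "(SOME j. j < n \<and> z j = z i) < n \<and> z (SOME j. j < n \<and> z j = z i) = z i"
      by (rule someI[of "\<lambda>j. j < n \<and> z j = z i" i]) (use that in simp)
    then show ?thesis unfolding h_def using e(1) that by blast
  qed
  let ?A = "z ` {..<n}"
  have 1: "iso_on h ?A adj adj'" using h e by (auto simp: iso_on_def inj_on_def)
  show ?thesis
  proof (cases D)
    case (Inl js)
    then obtain S where S: "S \<in> set co_shapes" "shape adj S (map z js)" "set js \<subseteq> {..<n}" using s by (auto simp: sol_def)
    have "shape adj' S (map h (map z js))" by (rule shape_map[OF 1 _ S(2)]) (use S in auto)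
    moreover have e: "map h (map z js) = map z' js" using S(3) h by auto
    ultimately have "shape adj' S (map z' js)" unfolding e by blast
    then show ?thesis using S Inl unfolding sol_def by auto
  next
    case (Inr xs)
    then have xs: "verts_of xs \<subseteq> {..<n}" "obs adj (map (map3 z) xs)" "ess adj (map (map3 z) xs)" using s by (auto simp: sol_def)
    have A: "verts_of (map (map3 z) xs) \<subseteq> ?A" using xs(1) by auto
    have "map3 h (map3 z x) = map3 z' x" if "x \<in> set xs" for x
    proof -
      obtain v a b where x: "x = (v, a, b)" by (cases x)
      have "v \<in> cores xs" "a \<in> wits xs" "b \<in> wits xs" using that in_wits unfolding x cores_def by force+
      then show ?thesis using xs(1) h unfolding x by auto
    qed
    then have m: "map (map3 h) (map (map3 z) xs) = map (map3 z') xs" by simp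
    show ?thesis
      using obs_map3[OF 1 A xs(2)] ess_map3[OF 1 A xs(3)] xs(1) Inr unfolding m by (simp add: sol_def)
  qed
qed

section \<open>Small enumerations in constant time, and output\<close>

text \<open>A complete decision tree with one leaf for each outcome of the tests. It is
  exponentially large in the number of tests, but these are finitely many and fixed with the
  program.\<close>

fun tree :: "test list \<Rightarrow> (bool list \<Rightarrow> com) \<Rightarrow> com" where
  "tree [] f = f []"
| "tree (b # bs) f = Branch b (tree bs (\<lambda>l. f (True # l))) (tree bs (\<lambda>l. f (False # l)))"

lemma run_tree: "run (tree bs f) s = run (f (map (\<lambda>b. eval_test b s) bs)) s"
  by (induction bs arbitrary: f) auto

lemma loopfree_tree: "(\<And>l. loopfree (f l)) \<Longrightarrow> loopfree (tree bs f)"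
  by (induction bs arbitrary: f) auto

text \<open>The items are flattened three to one: slot \<open>j\<close> is component
  \<open>j mod 3\<close> of item \<open>j div 3\<close>.\<close>

definition slot :: "nat \<Rightarrow> exp" where
  "slot j = Read ([''q'', ''w0'', ''w1''] ! (j mod 3)) ((Succ ^^ (j div 3)) Hd)"

definition value_at :: "state \<Rightarrow> nat \<Rightarrow> nat" where
  "value_at s j = s ([''q'', ''w0'', ''w1''] ! (j mod 3)) (s ''hd'' 0 + j div 3)"

lemma eval_Succ_pow: "eval_exp ((Succ ^^ i) e) s = eval_exp e s + i"
  by (induction i) auto

lemma eval_slot [simp]: "eval_exp (slot j) s = value_at s j"
  by (simp add: slot_def value_at_def eval_Succ_pow)

definition out_item :: "exp \<Rightarrow> exp \<Rightarrow> exp \<Rightarrow> exp \<Rightarrow> com" where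
  "out_item e v a b = seqs [Write ''out_q'' e v, Write ''out_w0'' e a, Write ''out_w1'' e b,
     Branch (Eq a b) (Write ''out_wlen'' e (Const 1)) (Write ''out_wlen'' e (Const 2))]"

fun out_items :: "nat \<Rightarrow> nat item list \<Rightarrow> com" where
  "out_items i [] = Skip"
| "out_items i ((v, a, b) # xs) = Seq (out_item (Const i) (slot v) (slot a) (slot b)) (out_items (Suc i) xs)"

fun out_verts :: "nat \<Rightarrow> nat list \<Rightarrow> com" where
  "out_verts i [] = Skip"
| "out_verts i (j # js) = Seq (Write ''out_v'' (Const i) (slot j)) (out_verts (Suc i) js)"

definition out_answer :: "answer \<Rightarrow> com" where
  "out_answer D = (case D of
     Inl js \<Rightarrow> Seq (Set ''out_kind'' (Const 1)) (Seq (Set ''out_n'' (Const (length js))) (out_verts 0 js))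
   | Inr is \<Rightarrow> Seq (Set ''out_k'' (Const (length is))) (out_items 0 is))"

definition out_ok :: "state \<Rightarrow> nat \<Rightarrow> nat item \<Rightarrow> bool" where
  "out_ok s i x \<longleftrightarrow> (s ''out_q'' i, s ''out_w0'' i, s ''out_w1'' i) = x \<and>
     s ''out_wlen'' i = (if s ''out_w0'' i = s ''out_w1'' i then 1 else 2)"

lemma enum_output:
  assumes "s ''out_k'' 0 = length xs" "\<And>i. i < length xs \<Longrightarrow> out_ok s i (xs ! i)"
  shows "enum_output s = enum_of xs"
proof -
  have "s ''out_q'' i = fst (xs ! i)" if "i < length xs" for i
    using assms(2)[OF that] unfolding out_ok_def by (metis fst_conv)
  then have "map (s ''out_q'') [0..<length xs] = map fst xs" by (intro nth_equalityI) simp_all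
  moreover have "map (\<lambda>i. take (s ''out_wlen'' i) [s ''out_w0'' i, s ''out_w1'' i]) [0..<length xs] =
      map (\<lambda>(v, a, b). if a = b then [a] else [a, b]) xs"
  proof (rule nth_equalityI)
    fix i assume "i < length (map (\<lambda>i. take (s ''out_wlen'' i) [s ''out_w0'' i, s ''out_w1'' i]) [0..<length xs])"
    then have i: "i < length xs" by simp
    obtain v a b where x: "xs ! i = (v, a, b)" by (cases "xs ! i")
    then show "map (\<lambda>i. take (s ''out_wlen'' i) [s ''out_w0'' i, s ''out_w1'' i]) [0..<length xs] ! i =
       map (\<lambda>(v, a, b). if a = b then [a] else [a, b]) xs ! i"
      using assms(2)[OF i] i by (simp add: out_ok_def)
  qed simp
  ultimately show ?thesis by (simp add: enum_output_def enum_of_def assms(1))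
qed

definition outs :: "string set" where
  "outs = {''out_q'', ''out_w0'', ''out_w1'', ''out_wlen'', ''out_k'', ''out_kind'', ''out_n'', ''out_v''}"

definition steady :: "state \<Rightarrow> exp \<Rightarrow> bool" where
  "steady s e \<longleftrightarrow> (\<forall>s'. (\<forall>x. x \<notin> outs \<longrightarrow> s' x = s x) \<longrightarrow> eval_exp e s' = eval_exp e s)"

lemma run_out_item:
  assumes "eval_exp e s = i" and steady: "\<forall>f\<in>{v, a, b, e}. steady s f"
  shows "out_ok (run (out_item e v a b) s) i (eval_exp v s, eval_exp a s, eval_exp b s)"
    and "j \<noteq> i \<Longrightarrow> out_ok (run (out_item e v a b) s) j y = out_ok s j y"
    and "x \<notin> {''out_q'', ''out_w0'', ''out_w1'', ''out_wlen''} \<Longrightarrow> run (out_item e v a b) s x = s x"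
proof -
  define s1 where "s1 = run (Write ''out_q'' e v) s"
  define s2 where "s2 = run (Write ''out_w0'' e a) s1"
  define s3 where "s3 = run (Write ''out_w1'' e b) s2"
  have "\<forall>x. x \<notin> outs \<longrightarrow> s1 x = s x" by (simp add: s1_def outs_def)
  moreover from this have "\<forall>x. x \<notin> outs \<longrightarrow> s2 x = s x" by (simp add: s2_def outs_def)
  moreover from this have "\<forall>x. x \<notin> outs \<longrightarrow> s3 x = s x" by (simp add: s3_def outs_def)
  ultimately have e: "eval_exp f s1 = eval_exp f s \<and> eval_exp f s2 = eval_exp f s \<and> eval_exp f s3 = eval_exp f s"
    if "f \<in> {v, a, b, e}" for f
    using bspec[OF steady that] unfolding steady_def by blast
  have e': "eval_exp a s1 = eval_exp a s" "eval_exp b s2 = eval_exp b s" "eval_exp a s3 = eval_exp a s" "eval_exp b s3 = eval_exp b s"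
    "eval_exp e s1 = i" "eval_exp e s2 = i" "eval_exp e s3 = i"
    using e[of a, THEN conjunct1] e[of b, THEN conjunct2, THEN conjunct1] e[of a, THEN conjunct2, THEN conjunct2]
      e[of b, THEN conjunct2, THEN conjunct2] e[of e] assms(1) by simp_all
  have s1: "s1 = s(''out_q'' := (s ''out_q'')(i := eval_exp v s))" by (simp add: s1_def assms(1))
  have s2: "s2 = s1(''out_w0'' := (s1 ''out_w0'')(i := eval_exp a s))" by (simp add: s2_def e')
  have s3: "s3 = s2(''out_w1'' := (s2 ''out_w1'')(i := eval_exp b s))" by (simp add: s3_def e')
  have "run (out_item e v a b) s =
      run (Branch (Eq a b) (Write ''out_wlen'' e (Const 1)) (Write ''out_wlen'' e (Const 2))) s3"
    by (simp only: out_item_def seqs.simps run.simps(3) s1_def s2_def s3_def)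
  then have r: "run (out_item e v a b) s = s3(''out_wlen'' := (s3 ''out_wlen'')(i := if eval_exp a s = eval_exp b s then 1 else 2))"
    using e' by simp
  show "out_ok (run (out_item e v a b) s) i (eval_exp v s, eval_exp a s, eval_exp b s)"
    unfolding r out_ok_def s3 s2 s1 by simp
  show "out_ok (run (out_item e v a b) s) j y = out_ok s j y" if "j \<noteq> i"
    unfolding r out_ok_def s3 s2 s1 using that by simp
  show "run (out_item e v a b) s x = s x" if "x \<notin> {''out_q'', ''out_w0'', ''out_w1'', ''out_wlen''}"
    unfolding r s3 s2 s1 using that by simp
qed

lemma value_at_frame: "(\<And>x. x \<notin> outs \<Longrightarrow> s' x = s x) \<Longrightarrow> value_at s' = value_at s"
proof (rule ext)
  fix j :: nat assume a: "\<And>x. x \<notin> outs \<Longrightarrow> s' x = s x"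
  have "j mod 3 = 0 \<or> j mod 3 = 1 \<or> j mod 3 = 2" by linarith
  moreover have "s' ''q'' = s ''q''" "s' ''w0'' = s ''w0''" "s' ''w1'' = s ''w1''" "s' ''hd'' = s ''hd''"
    by (rule a, simp add: outs_def)+
  ultimately show "value_at s' j = value_at s j" by (elim disjE) (simp_all add: value_at_def)
qed

lemma run_out_items:
  "(\<forall>p<length xs. out_ok (run (out_items i xs) s) (i + p) (map3 (value_at s) (xs ! p))) \<and>
   (\<forall>j<i. \<forall>x. out_ok (run (out_items i xs) s) j x = out_ok s j x) \<and>
   (\<forall>x. x \<notin> {''out_q'', ''out_w0'', ''out_w1'', ''out_wlen''} \<longrightarrow> run (out_items i xs) s x = s x)"
proof (induction xs arbitrary: i s)
  case (Cons y xs)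
  obtain v a b where y: "y = (v, a, b)" by (cases y)
  let ?r = "run (out_item (Const i) (slot v) (slot a) (slot b)) s"
  have "steady s (slot j)" for j
    unfolding steady_def eval_slot
  proof (intro allI impI)
    fix s' assume a: "\<forall>x. x \<notin> outs \<longrightarrow> s' x = s x"
    have "value_at s' = value_at s" by (rule value_at_frame, rule a[rule_format])
    then show "value_at s' j = value_at s j" by (rule fun_cong)
  qed
  moreover have "steady s (Const i)" unfolding steady_def by simp
  ultimately have "\<forall>f\<in>{slot v, slot a, slot b, Const i}. steady s f" by blast
  note R = run_out_item[OF eval_exp.simps(1) this, unfolded eval_slot]
  have fr: "value_at ?r = value_at s" by (rule value_at_frame, rule R(3), rule contra_subsetD[of _ outs]) (simp_all add: outs_def)
  note IH = Cons.IH[of "Suc i" ?r, unfolded fr]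
  have 1: "out_ok (run (out_items (Suc i) xs) ?r) (i + p) (map3 (value_at s) ((y # xs) ! p))" if "p < length (y # xs)" for p
  proof (cases p)
    case 0
    have "out_ok (run (out_items (Suc i) xs) ?r) i (map3 (value_at s) y)" using IH R(1) by (simp add: y del: run.simps)
    then show ?thesis by (simp add: 0)
  next
    case (Suc p')
    then show ?thesis using IH that by (simp del: run.simps)
  qed
  have 2: "out_ok (run (out_items (Suc i) xs) ?r) j x = out_ok s j x" if "j < i" for j x
    using IH[THEN conjunct2, THEN conjunct1, rule_format, OF less_SucI[OF that], of x] R(2)[of j x] that by (simp del: run.simps)
  have 3: "run (out_items (Suc i) xs) ?r x = s x" if "x \<notin> {''out_q'', ''out_w0'', ''out_w1'', ''out_wlen''}" for x
    using IH R(3)[OF that] that by metis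
  have r: "run (out_items i (y # xs)) s = run (out_items (Suc i) xs) ?r" by (simp add: y)
  show ?case unfolding r using 1 2 3 by blast
qed simp

lemma run_out_verts:
  "(\<forall>p<length js. run (out_verts i js) s ''out_v'' (i + p) = value_at s (js ! p)) \<and>
   (\<forall>j<i. run (out_verts i js) s ''out_v'' j = s ''out_v'' j) \<and>
   (\<forall>x. x \<noteq> ''out_v'' \<longrightarrow> run (out_verts i js) s x = s x)"
proof (induction js arbitrary: i s)
  case (Cons y js)
  define r where "r = run (Write ''out_v'' (Const i) (slot y)) s"
  have rx: "x \<noteq> ''out_v'' \<Longrightarrow> r x = s x" for x by (simp add: r_def)
  have fr: "value_at r = value_at s" by (rule value_at_frame) (auto simp: r_def outs_def)
  have rv: "r ''out_v'' = (s ''out_v'')(i := value_at s y)" by (simp add: r_def)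
  have run: "run (out_verts i (y # js)) s = run (out_verts (Suc i) js) r" by (simp add: r_def)
  note IH = Cons.IH[of "Suc i" r, unfolded fr]
  have "run (out_verts (Suc i) js) r ''out_v'' (i + p) = value_at s ((y # js) ! p)" if "p < length (y # js)" for p
  proof (cases p)
    case 0
    then show ?thesis using IH rv by simp
  next
    case (Suc p')
    then show ?thesis using IH that by simp
  qed
  then show ?case unfolding run using IH rv rx by simp
qed simp

lemma loopfree_out_items: "loopfree (out_items i xs)"
  by (induction i xs rule: out_items.induct) (simp_all add: out_item_def)

lemma loopfree_out_verts: "loopfree (out_verts i js)"
  by (induction i js rule: out_verts.induct) simp_all

definition atoms :: "(exp \<Rightarrow> exp \<Rightarrow> test) \<Rightarrow> nat \<Rightarrow> test list" where
  "atoms adjt n = map (\<lambda>(i, j). Eq (slot i) (slot j)) (List.product [0..<n] [0..<n]) @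
     map (\<lambda>(i, j). adjt (slot i) (slot j)) (List.product [0..<n] [0..<n])"

text \<open>The answer is chosen when the program is defined, not when it runs; it depends on the
  outcomes \<open>l\<close> of the tests alone. Outcomes for which no relation has an answer receive
  an arbitrary one.\<close>

definition leaf :: "nat \<Rightarrow> bool list \<Rightarrow> com" where
  "leaf n l = out_answer (SOME D. \<exists>adj (z :: nat \<Rightarrow> nat). pattern adj z n = l \<and> sol adj z n D)"

fun brute :: "(exp \<Rightarrow> exp \<Rightarrow> test) \<Rightarrow> nat \<Rightarrow> com" where
  "brute adjt 0 = Skip"
| "brute adjt (Suc k) = Branch (Eq Len (Const k)) (tree (atoms adjt (3 * k)) (leaf (3 * k))) (brute adjt k)"

definition out_all :: com where
  "out_all = Seq (seqs [Set ''out_k'' Len, Set ''i'' (Const 0), Set ''j'' Hd])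
     (While (Less (Var ''j'') Tl) (seqs [
        out_item (Var ''i'') (Read ''q'' (Var ''j'')) (Read ''w0'' (Var ''j'')) (Read ''w1'' (Var ''j'')),
        Inc ''i'', Inc ''j'']))"

definition solve :: "(exp \<Rightarrow> exp \<Rightarrow> test) \<Rightarrow> com" where
  "solve adjt = Seq (shrink adjt) (Branch (Less Len (Const 12)) (brute adjt 12) out_all)"

lemma loopfree_brute: "loopfree (brute adjt k)"
proof (induction k)
  case (Suc k)
  have "loopfree (leaf n l)" for n l
    by (simp add: leaf_def out_answer_def loopfree_out_items loopfree_out_verts split: sum.split)
  then show ?case using Suc loopfree_tree by simp
qed simp

lemma run_brute: "length (items s) < k \<Longrightarrow> run (brute adjt k) s =
    run (leaf (3 * length (items s)) (map (\<lambda>b. eval_test b s) (atoms adjt (3 * length (items s))))) s"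
  by (induction k) (auto simp: run_tree less_Suc_eq)

lemma run_out_answer:
  "run (out_answer (Inl js)) s ''out_kind'' 0 = 1"
  "vertices_output (run (out_answer (Inl js)) s) = value_at s ` set js"
  "run (out_answer (Inr is)) s ''out_kind'' 0 = s ''out_kind'' 0"
  "enum_output (run (out_answer (Inr is)) s) = enum_of (map (map3 (value_at s)) is)"
proof -
  let ?s1 = "run (Seq (Set ''out_kind'' (Const 1)) (Set ''out_n'' (Const (length js)))) s"
  let ?r = "run (out_verts 0 js) ?s1"
  have r: "run (out_answer (Inl js)) s = ?r" by (simp add: out_answer_def)
  have v: "value_at ?s1 = value_at s" by (rule value_at_frame) (simp add: outs_def)
  note R = run_out_verts[of js 0 ?s1, unfolded v]
  show "run (out_answer (Inl js)) s ''out_kind'' 0 = 1" unfolding r using R by simp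
  have n: "?r ''out_n'' 0 = length js" using R by simp
  have "?r ''out_v'' ` {0..<length js} = (\<lambda>p. value_at s (js ! p)) ` {0..<length js}"
    using R by (intro image_cong) simp_all
  also have "\<dots> = value_at s ` set js" by (simp add: image_image[symmetric] nth_image[of "length js" js, simplified])
  finally show "vertices_output (run (out_answer (Inl js)) s) = value_at s ` set js"
    unfolding r vertices_output_def n .
next
  let ?s1 = "run (Set ''out_k'' (Const (length is))) s"
  let ?r = "run (out_items 0 is) ?s1"
  have r: "run (out_answer (Inr is)) s = ?r" by (simp add: out_answer_def)
  have v: "value_at ?s1 = value_at s" by (rule value_at_frame) (simp add: outs_def)
  note R = run_out_items[of "is" 0 ?s1, unfolded v]
  show "run (out_answer (Inr is)) s ''out_kind'' 0 = s ''out_kind'' 0" unfolding r using R by simp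
  show "enum_output (run (out_answer (Inr is)) s) = enum_of (map (map3 (value_at s)) is)"
    unfolding r using R by (intro enum_output) auto
qed

lemma values_items: "value_at s ` {..<3 * length (items s)} = verts_of (items s)"
proof -
  let ?k = "length (items s)"
  have e: "value_at s (3 * i) = s ''q'' (s ''hd'' 0 + i)" "value_at s (Suc (3 * i)) = s ''w0'' (s ''hd'' 0 + i)"
    "value_at s (Suc (Suc (3 * i))) = s ''w1'' (s ''hd'' 0 + i)" for i
  proof -
    have "Suc (3 * i) mod 3 = 1" "Suc (3 * i) div 3 = i" "Suc (Suc (3 * i)) mod 3 = 2" "Suc (Suc (3 * i)) div 3 = i" by presburger+
    then show "value_at s (3 * i) = s ''q'' (s ''hd'' 0 + i)" "value_at s (Suc (3 * i)) = s ''w0'' (s ''hd'' 0 + i)"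
      "value_at s (Suc (Suc (3 * i))) = s ''w1'' (s ''hd'' 0 + i)"
      unfolding value_at_def by (simp_all add: numeral_2_eq_2)
  qed
  have "{..<3 * ?k} = (\<Union>i<?k. {3 * i, Suc (3 * i), Suc (Suc (3 * i))})"
  proof (intro equalityI subsetI)
    fix j assume "j \<in> {..<3 * ?k}"
    then have j: "j < 3 * ?k" by (simp del: length_block)
    have "j < 3 * K \<Longrightarrow> j div 3 < K" for K by presburger
    from this[OF j] have "j div 3 < ?k" .
    moreover have "j = 3 * (j div 3) \<or> j = Suc (3 * (j div 3)) \<or> j = Suc (Suc (3 * (j div 3)))" by presburger
    then have "j \<in> {3 * (j div 3), Suc (3 * (j div 3)), Suc (Suc (3 * (j div 3)))}" by simp
    ultimately show "j \<in> (\<Union>i<?k. {3 * i, Suc (3 * i), Suc (Suc (3 * i))})" by blast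
  qed auto
  then have "value_at s ` {..<3 * ?k} = (\<Union>i<?k. {s ''q'' (s ''hd'' 0 + i), s ''w0'' (s ''hd'' 0 + i), s ''w1'' (s ''hd'' 0 + i)})"
    by (simp only: image_UN image_insert image_empty e)
  moreover have "set (items s) = (\<lambda>i. (s ''q'' (s ''hd'' 0 + i), s ''w0'' (s ''hd'' 0 + i), s ''w1'' (s ''hd'' 0 + i))) ` {..<?k}"
  proof -
    have "set (items s) = (!) (items s) ` {..<?k}" by (metis atLeast0LessThan nth_image order_refl take_all)
    then show ?thesis by (simp add: nth_block cong: image_cong_simp)
  qed
  then have "cores (items s) = (\<lambda>i. s ''q'' (s ''hd'' 0 + i)) ` {..<?k}"
    "wits (items s) = (\<Union>i<?k. {s ''w0'' (s ''hd'' 0 + i), s ''w1'' (s ''hd'' 0 + i)})"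
    unfolding cores_def wits_def by (simp_all only: image_image fst_conv UN_extend_simps prod.case UN_simps)
  ultimately show ?thesis by auto
qed

lemma sol_exists:
  assumes "listed adj (z ` {..<n}) \<or> (\<exists>ys. obs adj ys \<and> ess adj ys \<and> verts_of ys \<subseteq> z ` {..<n})"
  shows "\<exists>D. sol adj z n D"
proof -
  define f where "f x = (SOME i. i < n \<and> z i = x)" for x
  have f: "f x < n" "z (f x) = x" if "x \<in> z ` {..<n}" for x
  proof -
    have "\<exists>i. i < n \<and> z i = x" using that by auto
    from someI_ex[OF this] show "f x < n" "z (f x) = x" by (simp_all add: f_def)
  qed
  from assms show ?thesis
  proof
    assume "listed adj (z ` {..<n})"
    then obtain S vs where S: "S \<in> set co_shapes" "set vs \<subseteq> z ` {..<n}" "shape adj S vs" unfolding listed_def by blast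
    have "z (f x) = x" if "x \<in> set vs" for x using S(2) f(2) that by blast
    then have "map z (map f vs) = vs" unfolding map_map by (intro map_idI) simp
    then have "shape adj S (map z (map f vs))" using S(3) by simp
    moreover have "set (map f vs) \<subseteq> {..<n}" using S(2) f by auto
    ultimately have "sol adj z n (Inl (map f vs))" unfolding sol_def using S(1) by (simp del: map_map) blast
    then show ?thesis ..
  next
    assume "\<exists>ys. obs adj ys \<and> ess adj ys \<and> verts_of ys \<subseteq> z ` {..<n}"
    then obtain ys where y: "obs adj ys" "ess adj ys" "verts_of ys \<subseteq> z ` {..<n}" by blast
    have "map3 z (map3 f x) = x" if "x \<in> set ys" for x
    proof -
      obtain v a b where x: "x = (v, a, b)" by (cases x)
      have "v \<in> cores ys" "a \<in> wits ys" "b \<in> wits ys"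
        using that in_wits[of v a b ys] unfolding x cores_def by force+
      then show ?thesis using y(3) f unfolding x by auto
    qed
    then have m: "map (map3 z) (map (map3 f) ys) = ys" unfolding map_map by (intro map_idI) simp
    have "verts_of (map (map3 f) ys) \<subseteq> {..<n}" using y(3) f by auto
    then have "sol adj z n (Inr (map (map3 f) ys))" unfolding sol_def using y m by (simp del: map_map)
    then show ?thesis ..
  qed
qed

definition answered :: "(nat \<Rightarrow> nat \<Rightarrow> bool) \<Rightarrow> nat set \<Rightarrow> state \<Rightarrow> bool" where
  "answered adj U s \<longleftrightarrow>
     s ''out_kind'' 0 = 0 \<and> (\<exists>ys. obs adj ys \<and> ess adj ys \<and> verts_of ys \<subseteq> U \<and> enum_output s = enum_of ys) \<or>
     s ''out_kind'' 0 = 1 \<and> (\<exists>S\<in>set co_shapes. \<exists>vs. shape adj S vs \<and> set vs \<subseteq> U \<and> vertices_output s = set vs)"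

lemma writes_shrink: "''out_kind'' \<notin> writes (shrink adjt)"
  by (simp add: shrink_def round_def search_round_def clean_up_def clean_step_def reduce_def Let_def act_defs
      retreat_def step_back_def advance_def move_def search_def search_step_def mark_def filter_order_def filter_step_def
      cut_def finish_def turn_def swap_def locate_def copy_front_def)

lemma ends_out_all:
  assumes o: "obs adj (items s)" "ess adj (items s)" "verts_of (items s) \<subseteq> U" and k: "s ''out_kind'' 0 = 0"
  shows "ends out_all s (9 * length (items s) + 4) (answered adj U)"
  unfolding out_all_def
proof (rule ends_Seq[where ?T1.0 = 3])
  let ?h = "s ''hd'' 0" and ?t = "s ''tl'' 0" and ?p = "[Set ''out_k'' Len, Set ''i'' (Const 0), Set ''j'' Hd]"
  let ?body = "seqs [out_item (Var ''i'') (Read ''q'' (Var ''j'')) (Read ''w0'' (Var ''j'')) (Read ''w1'' (Var ''j'')), Inc ''i'', Inc ''j'']"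
  let ?I = "\<lambda>s'. s' ''out_k'' 0 = length (items s) \<and> s' ''j'' 0 = ?h + s' ''i'' 0 \<and> s' ''i'' 0 \<le> ?t - ?h \<and>
     (\<forall>p<s' ''i'' 0. out_ok s' p (items s ! p))"
  show "ends (seqs ?p) s 3 (\<lambda>s'. ?I s' \<and> s' ''i'' 0 = 0)" by (rule ends_run) simp_all
  show "3 + (9 * length (items s) + 1) \<le> 9 * length (items s) + 4" by simp
  fix s1 assume s1: "?I s1 \<and> s1 ''i'' 0 = 0" and f1: "\<And>a. a \<notin> writes (seqs ?p) \<Longrightarrow> s1 a = s a"
  show "ends (While (Less (Var ''j'') Tl) ?body) s1 (9 * length (items s) + 1) (answered adj U)"
  proof (rule ends_While[where I = ?I and \<Phi> = "\<lambda>s'. 9 * (length (items s) - s' ''i'' 0)"])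
    fix s' assume I: "?I s'" and b: "eval_test (Less (Var ''j'') Tl) s'" and f': "\<And>a. a \<notin> writes ?body \<Longrightarrow> s' a = s1 a"
    have e: "s' ''q'' = s ''q''" "s' ''w0'' = s ''w0''" "s' ''w1'' = s ''w1''" "s' ''tl'' = s ''tl''"
      using f' f1 by (simp_all add: out_item_def)
    let ?i = "s' ''i'' 0"
    have i: "?i < ?t - ?h" using b I e by auto
    let ?it = "out_item (Var ''i'') (Read ''q'' (Var ''j'')) (Read ''w0'' (Var ''j'')) (Read ''w1'' (Var ''j''))"
    let ?r = "run ?it s'"
    have fr: "\<forall>f\<in>{Read ''q'' (Var ''j''), Read ''w0'' (Var ''j''), Read ''w1'' (Var ''j''), Var ''i''}. steady s' f"
      by (simp add: steady_def outs_def)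
    have ei: "eval_exp (Var ''i'') s' = ?i" by simp
    note R = run_out_item[OF ei fr]
    have r: "?r ''i'' = s' ''i''" "?r ''j'' = s' ''j''" "?r ''out_k'' = s' ''out_k''" by (rule R(3); simp)+
    have n: "out_ok ?r ?i (items s ! ?i)" using R(1) i I e by (simp add: nth_block del: run.simps)
    have n': "out_ok ?r p (items s ! p)" if "p < ?i" for p using R(2)[of p] that I by (simp del: run.simps)
    have run: "run ?body s' = (let r' = ?r(''i'' := (?r ''i'')(0 := Suc ?i)) in r'(''j'' := (r' ''j'')(0 := Suc (s' ''j'' 0))))"
      by (simp add: r Let_def)
    have ok: "out_ok (run ?body s') p x = out_ok ?r p x" for p x unfolding run by (simp add: out_ok_def Let_def)
    have k: "run ?body s' ''out_k'' = s' ''out_k''" "run ?body s' ''i'' 0 = Suc ?i" "run ?body s' ''j'' 0 = Suc (s' ''j'' 0)"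
      unfolding run by (simp_all add: r Let_def)
    have "?I (run ?body s') \<and> 8 + 1 + 9 * (length (items s) - run ?body s' ''i'' 0) \<le> 9 * (length (items s) - ?i)"
      unfolding k ok using I n n' i by (auto simp: less_Suc_eq)
    then show "\<exists>T. ends ?body s' T (\<lambda>s''. ?I s'' \<and> T + 1 + 9 * (length (items s) - s'' ''i'' 0) \<le> 9 * (length (items s) - ?i))"
      by (intro exI[of _ 8] ends_run) (simp_all add: out_item_def del: run.simps length_block)
  next
    fix s' assume I: "?I s'" and b: "\<not> eval_test (Less (Var ''j'') Tl) s'" and f': "\<And>a. a \<notin> writes ?body \<Longrightarrow> s' a = s1 a"
    have e: "s' ''tl'' = s ''tl''" "s' ''out_kind'' = s ''out_kind''" using f' f1 by (simp_all add: out_item_def)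
    have i: "s' ''i'' 0 = length (items s)" using b I e by auto
    have "enum_output s' = enum_of (items s)" using I unfolding i by (intro enum_output) auto
    then show "answered adj U s'" unfolding answered_def e using o k by blast
  qed (use s1 in auto)
qed

context ram_search
begin

text \<open>By \<open>obs_solution\<close> the instance at hand has an answer, so the choice made in
  its leaf is a proper one. By \<open>sol_pattern\<close> this choice, possibly made for another
  instance with the same pattern, is correct here.\<close>

lemma run_brute_answered:
  assumes ok: "ok s" and o: "obs adj (items s)" and V: "verts_of (items s) \<subseteq> U" and k: "s ''out_kind'' 0 = 0" "length (items s) < 12"
  shows "answered adj U (run (brute adjt 12) s)"
proof -
  let ?n = "3 * length (items s)" and ?z = "value_at s"
  have z: "?z j \<in> U" if "j < ?n" for j using values_items[of s] V that by blast
  have p: "map (\<lambda>b. eval_test b s) (atoms adjt ?n) = pattern adj ?z ?n"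
    unfolding atoms_def pattern_def map_append map_map
    by (intro arg_cong2[where f = "(@)"] map_cong) (auto simp: comp_def adjt[OF ok] z simp del: length_block)
  define D where "D = (SOME D. \<exists>adj' (z' :: nat \<Rightarrow> nat). pattern adj' z' ?n = pattern adj ?z ?n \<and> sol adj' z' ?n D)"
  have "\<exists>D. sol adj ?z ?n D"
    by (rule sol_exists) (unfold values_items, rule obs_solution[OF o])
  then have "\<exists>D. \<exists>adj' (z' :: nat \<Rightarrow> nat). pattern adj' z' ?n = pattern adj ?z ?n \<and> sol adj' z' ?n D" by blast
  from someI_ex[OF this] have "\<exists>adj' (z' :: nat \<Rightarrow> nat). pattern adj' z' ?n = pattern adj ?z ?n \<and> sol adj' z' ?n D"
    unfolding D_def .
  then have D: "sol adj ?z ?n D" using sol_pattern by blast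
  have r: "run (brute adjt 12) s = run (out_answer D) s"
    unfolding run_brute[OF k(2)] p leaf_def D_def ..
  show ?thesis
  proof (cases D)
    case (Inl js)
    then obtain S where S: "set js \<subseteq> {..<?n}" "S \<in> set co_shapes" "shape adj S (map ?z js)"
      using D unfolding sol_def by (auto simp del: length_block)
    have "set (map ?z js) \<subseteq> U" using S(1) z by (auto simp del: length_block)
    then show ?thesis unfolding r Inl answered_def run_out_answer using S(2,3) by (metis set_map)
  next
    case (Inr xs)
    then have x: "verts_of xs \<subseteq> {..<?n}" "obs adj (map (map3 ?z) xs)" "ess adj (map (map3 ?z) xs)"
      using D unfolding sol_def by (auto simp del: length_block)
    have "verts_of (map (map3 ?z) xs) \<subseteq> U" using x(1) z by (auto simp del: length_block)
    then show ?thesis unfolding r Inr answered_def run_out_answer using x(2,3) k(1) by blast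
  qed
qed

lemma ends_solve:
  assumes ok: "ok s" and o: "obs adj (items s)" and V: "verts_of (items s) \<subseteq> U" and U: "finite U"
    and w: "wits (items s) \<subseteq> set (order s)" and sorted: "sorted_wrt (\<lambda>u v. key u < key v) (order s)" and mx: "s ''mx'' 0 = S"
    and k: "s ''out_kind'' 0 = 0"
  shows "ends (solve adjt) s (shrink_cost * length (items s) * (min S (2 * length (items s)) + 1) + 6 * s ''el'' 0 + 9 * card U + cost (brute adjt 12) + 7)
    (answered adj U)"
  unfolding solve_def
proof (rule ends_Seq[OF ends_shrink[OF ok o V w sorted mx]])
  fix s1 assume s1: "solved s1" and f: "\<And>a. a \<notin> writes (shrink adjt) \<Longrightarrow> s1 a = s a"
  have k1: "s1 ''out_kind'' 0 = 0" using f[OF writes_shrink] k by simp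
  have S: "ok s1" "obs adj (items s1)" "verts_of (items s1) \<subseteq> U" "12 \<le> length (items s1) \<longrightarrow> ess adj (items s1)"
    using s1 unfolding solved_def by blast+
  have "length (items s1) = card (cores (items s1))"
    using S(2) unfolding obs_def cores_def set_map[symmetric] by (metis distinct_card length_map)
  then have l: "length (items s1) \<le> card U" using S(3) U by (metis card_mono Un_subset_iff)
  show "ends (Branch (Less Len (Const 12)) (brute adjt 12) out_all) s1 (9 * card U + cost (brute adjt 12) + 5) (answered adj U)"
  proof (rule ends_Branch)
    assume "eval_test (Less Len (Const 12)) s1"
    then have "length (items s1) < 12" by simp
    then show "ends (brute adjt 12) s1 (9 * card U + cost (brute adjt 12) + 4) (answered adj U)"
      using run_brute_answered[OF S(1-3) k1] by (intro ends_run loopfree_brute) auto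
  next
    assume "\<not> eval_test (Less Len (Const 12)) s1"
    then have "12 \<le> length (items s1)" by simp
    then have "ends out_all s1 (9 * length (items s1) + 4) (answered adj U)" using S k1 by (intro ends_out_all) auto
    then show "ends out_all s1 (9 * card U + cost (brute adjt 12) + 4) (answered adj U)"
      by (rule ends_weaken) (use l in \<open>auto simp del: length_block\<close>)
  qed simp
qed simp

end

section \<open>Graph input: an adjacency table for core and witnesses\<close>

text \<open>Identifier zero means none, and \<open>c\<close> is the next free identifier. Vertices
  outside \<open>X\<close> may carry either.\<close>

definition ids_ok :: "(nat \<Rightarrow> nat) \<Rightarrow> nat \<Rightarrow> nat set \<Rightarrow> bool" where
  "ids_ok f c X \<longleftrightarrow> (\<forall>v. f v < c) \<and> (\<forall>v\<in>X. f v \<noteq> 0) \<and> (\<forall>u v. f u = f v \<longrightarrow> f u \<noteq> 0 \<longrightarrow> u = v)"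

lemma ids_ok_upd:
  assumes i: "ids_ok f c X" and c: "c \<noteq> 0"
  shows "ids_ok (f(v := c)) (Suc c) (insert v X)"
proof -
  have l: "f w < c" for w using i unfolding ids_ok_def by blast
  have n: "f w \<noteq> c" "c \<noteq> f w" for w using l[of w] by auto
  have j: "u = w" if "f u = f w" "f u \<noteq> 0" for u w using i that unfolding ids_ok_def by blast
  have x: "f w \<noteq> 0" if "w \<in> X" for w using i that unfolding ids_ok_def by blast
  have "(f(v := c)) w < Suc c" for w using l[of w] by simp
  moreover have "(f(v := c)) w \<noteq> 0" if "w \<in> insert v X" for w using that x c by auto
  moreover have "u = w" if "(f(v := c)) u = (f(v := c)) w" "(f(v := c)) u \<noteq> 0" for u w
    using that j[of u w] n[of u] n[of w] by (cases "u = v"; cases "w = v") simp_all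
  ultimately show ?thesis unfolding ids_ok_def by blast
qed

text \<open>Completes pairs of type O1 by a copy and gives a fresh identifier to each of the three
  vertices of an item. A vertex that occurs again is simply renumbered, so all identifiers stay
  below 3k + 1.\<close>

definition prepare_step :: com where
  "prepare_step = seqs [
     Branch (Less (Read ''wlen'' (Var ''i'')) (Const 2)) (Write ''w1'' (Var ''i'') (Read ''w0'' (Var ''i''))) Skip,
     Write ''lid'' (Read ''q'' (Var ''i'')) (Var ''c''), Inc ''c'',
     Write ''lid'' (Read ''w0'' (Var ''i'')) (Var ''c''), Inc ''c'',
     Write ''lid'' (Read ''w1'' (Var ''i'')) (Var ''c''), Inc ''c'', Inc ''i'']"

definition prepare :: com where
  "prepare = Seq (seqs [Set ''tl'' (Var ''k''), Set ''i'' (Const 0), Set ''c'' (Const 1)])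
     (While (Less (Var ''i'') Tl) prepare_step)"

lemma run_prepare_step:
  fixes s :: state
  defines "i \<equiv> s ''i'' 0" and "c \<equiv> s ''c'' 0" and "r \<equiv> run prepare_step s"
  defines "w \<equiv> if s ''wlen'' i < 2 then s ''w0'' i else s ''w1'' i"
  shows "r ''i'' 0 = Suc i" "r ''c'' 0 = Suc (Suc (Suc c))" "r ''w1'' p = (if p = i then w else s ''w1'' p)"
    "r ''lid'' = (s ''lid'')(s ''q'' i := c, s ''w0'' i := Suc c, w := Suc (Suc c))"
  by (cases "s ''wlen'' i < 2"; simp add: r_def prepare_step_def i_def c_def w_def)+

lemma ends_prepare:
  fixes xs :: "nat item list"
  assumes hd: "s ''hd'' 0 = 0" and k: "s ''k'' 0 = length xs" and lid: "s ''lid'' = (\<lambda>_. 0)"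
    and input: "\<And>p. p < length xs \<Longrightarrow>
      xs ! p = (s ''q'' p, s ''w0'' p, if s ''wlen'' p < 2 then s ''w0'' p else s ''w1'' p)"
  shows "ends prepare s (11 * length xs + 4)
    (\<lambda>s'. items s' = xs \<and> s' ''c'' 0 = 3 * length xs + 1 \<and> ids_ok (s' ''lid'') (s' ''c'' 0) (verts_of xs))"
  unfolding prepare_def
proof (rule ends_Seq[where ?T1.0 = 3])
  let ?k = "length xs" and ?p = "seqs [Set ''tl'' (Var ''k''), Set ''i'' (Const 0), Set ''c'' (Const 1)]"
  let ?I = "\<lambda>s'. s' ''i'' 0 \<le> ?k \<and> s' ''c'' 0 = 3 * s' ''i'' 0 + 1 \<and>
     (\<forall>p<s' ''i'' 0. s' ''w1'' p = snd (snd (xs ! p))) \<and> (\<forall>p\<ge>s' ''i'' 0. s' ''w1'' p = s ''w1'' p) \<and>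
     ids_ok (s' ''lid'') (s' ''c'' 0) (verts_of (take (s' ''i'' 0) xs))"
  have "ids_ok (\<lambda>_. 0) (Suc 0) {}" by (simp add: ids_ok_def)
  then show "ends ?p s 3 (\<lambda>s'. ?I s' \<and> s' ''tl'' 0 = ?k \<and> s' ''i'' 0 = 0)"
    by (intro ends_run) (simp_all add: k lid cores_def wits_def)
  show "3 + (11 * ?k + 1) \<le> 11 * ?k + 4" by simp
  fix s1 assume s1: "?I s1 \<and> s1 ''tl'' 0 = ?k \<and> s1 ''i'' 0 = 0" and f1: "\<And>a. a \<notin> writes ?p \<Longrightarrow> s1 a = s a"
  show "ends (While (Less (Var ''i'') Tl) prepare_step) s1 (11 * ?k + 1)
    (\<lambda>s'. items s' = xs \<and> s' ''c'' 0 = 3 * ?k + 1 \<and> ids_ok (s' ''lid'') (s' ''c'' 0) (verts_of xs))"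
  proof (rule ends_While[where I = ?I and \<Phi> = "\<lambda>s'. 11 * (?k - s' ''i'' 0)"])
    fix s' assume I: "?I s'" and b: "eval_test (Less (Var ''i'') Tl) s'" and f': "\<And>a. a \<notin> writes prepare_step \<Longrightarrow> s' a = s1 a"
    let ?i = "s' ''i'' 0" and ?r = "run prepare_step s'"
    have e: "s' ''q'' = s ''q''" "s' ''w0'' = s ''w0''" "s' ''wlen'' = s ''wlen''" "s' ''tl'' = s1 ''tl''"
      using f' f1 by (simp_all add: prepare_step_def)
    have i: "?i < ?k" using b e s1 by simp
    have w: "s' ''w1'' ?i = s ''w1'' ?i" using I by blast
    note R = run_prepare_step[of s', unfolded e w]
    let ?w = "if s ''wlen'' ?i < 2 then s ''w0'' ?i else s ''w1'' ?i"
    have x: "xs ! ?i = (s ''q'' ?i, s ''w0'' ?i, ?w)" by (rule input[OF i])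
    have "verts_of (take (Suc ?i) xs) = insert ?w (insert (s ''w0'' ?i) (insert (s ''q'' ?i) (verts_of (take ?i xs))))"
      unfolding take_Suc_conv_app_nth[OF i] x cores_def wits_def by auto
    moreover have "ids_ok (s' ''lid'') (s' ''c'' 0) (verts_of (take ?i xs))" "s' ''c'' 0 \<noteq> 0" using I by auto
    ultimately have id: "ids_ok (?r ''lid'') (?r ''c'' 0) (verts_of (take (Suc ?i) xs))"
      unfolding R(2,4) by (simp only: ids_ok_upd Nat.nat.simps not_False_eq_True)
    have "?r ''w1'' p = snd (snd (xs ! p))" if "p < Suc ?i" for p
      using that I R(3)[of p] x by (cases "p = ?i") auto
    moreover have "?r ''w1'' p = s ''w1'' p" if "Suc ?i \<le> p" for p using that I R(3)[of p] by auto
    moreover have "?r ''c'' 0 = 3 * Suc ?i + 1" using R(2) I by simp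
    ultimately have J: "?I ?r \<and> 10 + 1 + 11 * (?k - ?r ''i'' 0) \<le> 11 * (?k - ?i)" using id i unfolding R(1) by simp
    show "\<exists>T. ends prepare_step s' T (\<lambda>s''. ?I s'' \<and> T + 1 + 11 * (?k - s'' ''i'' 0) \<le> 11 * (?k - ?i))"
      by (rule exI[of _ 10], rule ends_run, simp add: prepare_step_def, rule J, simp add: prepare_step_def)
  next
    fix s' assume I: "?I s'" and b: "\<not> eval_test (Less (Var ''i'') Tl) s'" and f': "\<And>a. a \<notin> writes prepare_step \<Longrightarrow> s' a = s1 a"
    have e: "s' ''q'' = s ''q''" "s' ''w0'' = s ''w0''" "s' ''tl'' = s1 ''tl''" "s' ''hd'' = s ''hd''"
      using f' f1 by (simp_all add: prepare_step_def)
    have i: "s' ''i'' 0 = ?k" using b e s1 I by simp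
    have "items s' = xs"
    proof (rule nth_equalityI)
      show "length (items s') = length xs" using e s1 hd by simp
      fix p assume "p < length (items s')"
      then have p: "p < ?k" using e s1 hd by simp
      have "snd (snd (xs ! p)) = s' ''w1'' p" using I p unfolding i by simp
      then show "items s' ! p = xs ! p" using input[OF p] p e s1 hd by (simp add: nth_block)
    qed
    then show "items s' = xs \<and> s' ''c'' 0 = 3 * ?k + 1 \<and> ids_ok (s' ''lid'') (s' ''c'' 0) (verts_of xs)"
      using I unfolding i take_all[OF order_refl] by blast
  qed (use s1 in auto)
qed

text \<open>The machine cannot multiply, so the multiples of the row length are found by counting.
  This takes time quadratic in k, which \<open>clique_edges\<close> allows.\<close>

definition rows :: com where
  "rows = Seq (seqs [Set ''len'' (Var ''c''), Set ''c'' (Const 0), Set ''j'' (Const 0), Set ''r'' (Const 0)])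
     (While (Less (Var ''c'') (Var ''len''))
       (Branch (Less (Var ''j'') (Var ''len'')) (seqs [Inc ''r'', Inc ''j''])
         (seqs [Inc ''c'', Write ''row'' (Var ''c'') (Var ''r''), Set ''j'' (Const 0)])))"

lemma ends_rows:
  assumes "s ''row'' 0 = 0" "s ''c'' 0 = L"
  shows "ends rows s (7 * (L * (L + 1)) + 5) (\<lambda>s'. \<forall>x\<le>L. s' ''row'' x = x * L)"
  unfolding rows_def
proof (rule ends_Seq[where ?T1.0 = 4])
  let ?p = "seqs [Set ''len'' (Var ''c''), Set ''c'' (Const 0), Set ''j'' (Const 0), Set ''r'' (Const 0)]"
  let ?body = "Branch (Less (Var ''j'') (Var ''len'')) (seqs [Inc ''r'', Inc ''j''])
     (seqs [Inc ''c'', Write ''row'' (Var ''c'') (Var ''r''), Set ''j'' (Const 0)])"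
  let ?I = "\<lambda>s'. s' ''c'' 0 \<le> L \<and> s' ''j'' 0 \<le> L \<and> s' ''r'' 0 = s' ''c'' 0 * L + s' ''j'' 0 \<and>
     (\<forall>x\<le>s' ''c'' 0. s' ''row'' x = x * L)"
  \<comment> \<open>A row takes \<open>L\<close> increments and one step to store its address;
    \<open>j\<close> of the increments are already spent.\<close>
  let ?\<Phi> = "\<lambda>s'. 7 * ((L - s' ''c'' 0) * (L + 1) - s' ''j'' 0)"
  show "ends ?p s 4 (\<lambda>s'. ?I s' \<and> s' ''len'' 0 = L \<and> s' ''c'' 0 = 0 \<and> s' ''j'' 0 = 0)"
    by (rule ends_run) (simp_all add: assms)
  show "4 + (7 * (L * (L + 1)) + 1) \<le> 7 * (L * (L + 1)) + 5" by simp
  fix s1 assume s1: "?I s1 \<and> s1 ''len'' 0 = L \<and> s1 ''c'' 0 = 0 \<and> s1 ''j'' 0 = 0"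
  show "ends (While (Less (Var ''c'') (Var ''len'')) ?body) s1 (7 * (L * (L + 1)) + 1) (\<lambda>s'. \<forall>x\<le>L. s' ''row'' x = x * L)"
  proof (rule ends_While[where I = ?I and \<Phi> = ?\<Phi>])
    fix s' assume I: "?I s'" and b: "eval_test (Less (Var ''c'') (Var ''len'')) s'" and f': "\<And>a. a \<notin> writes ?body \<Longrightarrow> s' a = s1 a"
    let ?c = "s' ''c'' 0" and ?j = "s' ''j'' 0" and ?r = "run ?body s'"
    have len: "s' ''len'' 0 = L" using f' s1 by simp
    then have c: "?c < L" using b by simp
    then obtain d where d: "L - ?c = Suc d" "L - Suc ?c = d" by (metis Suc_diff_Suc)
    have J: "?I ?r \<and> 6 + 1 + ?\<Phi> ?r \<le> ?\<Phi> s'"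
    proof (cases "?j < L")
      case True
      then have "?r ''c'' 0 = ?c" "?r ''j'' 0 = Suc ?j" "?r ''r'' 0 = Suc (s' ''r'' 0)" "?r ''row'' = s' ''row''"
        using len by simp_all
      then show ?thesis using I True d by simp
    next
      case False
      then have "?j = L" using I by simp
      then have rr: "s' ''r'' 0 = Suc ?c * L" using I by simp
      have r: "?r ''c'' 0 = Suc ?c" "?r ''j'' 0 = 0" "?r ''r'' 0 = s' ''r'' 0" "?r ''row'' = (s' ''row'')(Suc ?c := s' ''r'' 0)"
        using False len by simp_all
      have "?I ?r" unfolding r rr using I c by (auto simp: le_Suc_eq)
      moreover have "6 + 1 + ?\<Phi> ?r \<le> ?\<Phi> s'" unfolding r d \<open>?j = L\<close> by simp
      ultimately show ?thesis by blast
    qed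
    show "\<exists>T. ends ?body s' T (\<lambda>s''. ?I s'' \<and> T + 1 + ?\<Phi> s'' \<le> ?\<Phi> s')"
      by (rule exI[of _ 6], rule ends_run, simp, rule J, simp)
  next
    fix s' assume I: "?I s'" and b: "\<not> eval_test (Less (Var ''c'') (Var ''len'')) s'" and f': "\<And>a. a \<notin> writes ?body \<Longrightarrow> s' a = s1 a"
    have "s' ''len'' 0 = L" using f' s1 by simp
    then have "s' ''c'' 0 = L" using b I by simp
    then show "\<forall>x\<le>L. s' ''row'' x = x * L" using I by simp
  qed (use s1 in auto)
qed

definition fill :: com where
  "fill = Seq (seqs [Set ''i'' (Const 0), Set ''j'' (Const 0)]) (Seq
     (While (Less (Var ''i'') (Var ''n''))
       (Branch (Less (Var ''j'') (Read ''start'' (Succ (Var ''i''))))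
         (seqs [Write ''mat'' (Minus (Read ''row'' (Read ''lid'' (Var ''i''))) (Read ''lid'' (Read ''adj'' (Var ''j'')))) (Const 1),
           Inc ''j''])
         (seqs [Write ''ord'' (Var ''i'') (Var ''i''), Inc ''i''])))
     (seqs [Set ''el'' (Var ''n''), Set ''mx'' (Var ''n'')]))"

lemma concat_nth:
  assumes "u < length xss" "j < length (xss ! u)"
  shows "concat xss ! (length (concat (take u xss)) + j) = xss ! u ! j"
proof -
  have "concat xss = concat (take u xss) @ xss ! u @ concat (drop (Suc u) xss)"
    by (metis assms(1) concat.simps(2) concat_append id_take_nth_drop)
  then show ?thesis using assms(2) by (simp add: nth_append)
qed

lemma ends_fill:
  fixes adj :: "nat list list"
  assumes n: "s ''n'' 0 = length adj"
    and start: "\<And>v. v \<le> length adj \<Longrightarrow> s ''start'' v = length (concat (take v adj))"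
    and a: "\<And>e. e < length (concat adj) \<Longrightarrow> s ''adj'' e = concat adj ! e" and mat: "s ''mat'' = (\<lambda>_. 0)"
  shows "ends fill s (6 * (length adj + length (concat adj)) + 5)
    (\<lambda>s'. order s' = [0..<length adj] \<and> s' ''el'' 0 = length adj \<and> s' ''mx'' 0 = length adj \<and>
      (\<forall>x. 0 < s' ''mat'' x \<longleftrightarrow> (\<exists>u<length adj. \<exists>v\<in>set (adj ! u). x = s ''row'' (s ''lid'' u) - s ''lid'' v)))"
  unfolding fill_def
proof (rule ends_Seq[where ?T1.0 = 2])
  let ?n = "length adj" and ?M = "length (concat adj)"
  let ?st = "\<lambda>v. length (concat (take v adj))" and ?A = "\<lambda>u v. s ''row'' (s ''lid'' u) - s ''lid'' v"
  let ?p = "seqs [Set ''i'' (Const 0), Set ''j'' (Const 0)]"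
  let ?b1 = "seqs [Write ''mat'' (Minus (Read ''row'' (Read ''lid'' (Var ''i''))) (Read ''lid'' (Read ''adj'' (Var ''j'')))) (Const 1), Inc ''j'']"
  let ?b2 = "seqs [Write ''ord'' (Var ''i'') (Var ''i''), Inc ''i'']"
  let ?t = "Less (Var ''j'') (Read ''start'' (Succ (Var ''i'')))"
  let ?body = "Branch ?t ?b1 ?b2"
  define filled where "filled u e x \<longleftrightarrow> (\<exists>u'<u. \<exists>v\<in>set (adj ! u'). x = ?A u' v) \<or> (\<exists>j<e - ?st u. x = ?A u (adj ! u ! j))" for u e x
  let ?I = "\<lambda>s'. s' ''i'' 0 \<le> ?n \<and> ?st (s' ''i'' 0) \<le> s' ''j'' 0 \<and> s' ''j'' 0 \<le> ?st (Suc (s' ''i'' 0)) \<and>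
     (\<forall>v<s' ''i'' 0. s' ''ord'' v = v) \<and> (\<forall>x. 0 < s' ''mat'' x \<longleftrightarrow> filled (s' ''i'' 0) (s' ''j'' 0) x)"
  let ?\<Phi> = "\<lambda>s'. 6 * ((?n - s' ''i'' 0) + (?M - s' ''j'' 0))"
  have st: "?st (Suc u) = ?st u + length (adj ! u)" if "u < ?n" for u using that by (simp add: take_Suc_conv_app_nth)
  have stM: "?st u \<le> ?M" for u by (metis append_take_drop_id concat_append length_append le_add1)
  show "ends ?p s 2 (\<lambda>s'. ?I s' \<and> s' ''i'' 0 = 0 \<and> s' ''j'' 0 = 0)" by (rule ends_run) (simp_all add: mat filled_def)
  show "2 + (6 * (?n + ?M) + 3) \<le> 6 * (?n + ?M) + 5" by simp
  fix s1 assume s1: "?I s1 \<and> s1 ''i'' 0 = 0 \<and> s1 ''j'' 0 = 0" and f1: "\<And>a. a \<notin> writes ?p \<Longrightarrow> s1 a = s a"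
  show "ends (Seq (While (Less (Var ''i'') (Var ''n'')) ?body) (seqs [Set ''el'' (Var ''n''), Set ''mx'' (Var ''n'')])) s1 (6 * (?n + ?M) + 3)
    (\<lambda>s'. order s' = [0..<?n] \<and> s' ''el'' 0 = ?n \<and> s' ''mx'' 0 = ?n \<and>
      (\<forall>x. 0 < s' ''mat'' x \<longleftrightarrow> (\<exists>u<?n. \<exists>v\<in>set (adj ! u). x = ?A u v)))"
  proof (rule ends_Seq)
    show "ends (While (Less (Var ''i'') (Var ''n'')) ?body) s1 (6 * (?n + ?M) + 1)
      (\<lambda>s'. s' ''n'' 0 = ?n \<and> (\<forall>v<?n. s' ''ord'' v = v) \<and> (\<forall>x. 0 < s' ''mat'' x \<longleftrightarrow> (\<exists>u<?n. \<exists>v\<in>set (adj ! u). x = ?A u v)))"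
    proof (rule ends_While[where I = ?I and \<Phi> = ?\<Phi>])
      fix s' assume I: "?I s'" and b: "eval_test (Less (Var ''i'') (Var ''n'')) s'" and f': "\<And>a. a \<notin> writes ?body \<Longrightarrow> s' a = s1 a"
      let ?u = "s' ''i'' 0" and ?e = "s' ''j'' 0" and ?r = "run ?body s'"
      have e: "s' ''n'' = s ''n''" "s' ''start'' = s ''start''" "s' ''adj'' = s ''adj''" "s' ''row'' = s ''row''" "s' ''lid'' = s ''lid''"
        using f' f1 by simp_all
      have u: "?u < ?n" using b e n by simp
      have t: "eval_test ?t s' \<longleftrightarrow> ?e < ?st (Suc ?u)" using start[of "Suc ?u"] u e by simp
      have J: "?I ?r \<and> 5 + 1 + ?\<Phi> ?r \<le> ?\<Phi> s'"
      proof (cases "?e < ?st (Suc ?u)")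
        case True
        let ?j = "?e - ?st ?u"
        have j: "?j < length (adj ! ?u)" "?e = ?st ?u + ?j" using True I st[OF u] by auto
        have M: "?e < ?M" using True stM[of "Suc ?u"] by simp
        have "s ''adj'' ?e = adj ! ?u ! ?j" using a[OF M] concat_nth[OF u j(1)] j(2) by simp
        then have r: "?r ''i'' 0 = ?u" "?r ''j'' 0 = Suc ?e" "?r ''ord'' = s' ''ord''"
          "?r ''mat'' = (s' ''mat'')(?A ?u (adj ! ?u ! ?j) := 1)"
          unfolding run.simps(4) using t True e by simp_all
        have "filled ?u (Suc ?e) x \<longleftrightarrow> filled ?u ?e x \<or> x = ?A ?u (adj ! ?u ! ?j)" for x
        proof -
          have "?st ?u \<le> ?e" using I by blast
          then have "Suc ?e - ?st ?u = Suc ?j" by (rule Suc_diff_le)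
          then show ?thesis unfolding filled_def by (auto simp: less_Suc_eq)
        qed
        then have "0 < ?r ''mat'' x \<longleftrightarrow> filled (?r ''i'' 0) (?r ''j'' 0) x" for x unfolding r using I by simp
        then have "?I ?r" using I True unfolding r by simp
        moreover have "5 + 1 + ?\<Phi> ?r \<le> ?\<Phi> s'" unfolding r Suc_diff_Suc[OF M, symmetric] by simp
        ultimately show ?thesis by blast
      next
        case False
        then have j: "?e = ?st (Suc ?u)" using I by simp
        have r: "?r ''i'' 0 = Suc ?u" "?r ''j'' 0 = ?e" "?r ''ord'' = (s' ''ord'')(?u := ?u)" "?r ''mat'' = s' ''mat''"
          unfolding run.simps(4) using t False by simp_all
        have "filled (Suc ?u) ?e x \<longleftrightarrow> filled ?u ?e x" for x
        proof -
          have "?e - ?st ?u = length (adj ! ?u)" "?e - ?st (Suc ?u) = 0" using j st[OF u] by simp_all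
          moreover have "(\<exists>v\<in>set (adj ! ?u). x = ?A ?u v) \<longleftrightarrow> (\<exists>j<length (adj ! ?u). x = ?A ?u (adj ! ?u ! j))"
            by (metis in_set_conv_nth)
          moreover have "(\<exists>u'<Suc ?u. P u') \<longleftrightarrow> (\<exists>u'<?u. P u') \<or> P ?u" for P by (auto simp: less_Suc_eq)
          ultimately show ?thesis unfolding filled_def by simp
        qed
        moreover have "?e \<le> ?st (Suc (Suc ?u))"
        proof (cases "Suc ?u < ?n")
          case True
          then show ?thesis using j st[OF True] by simp
        qed (use j in simp)
        ultimately show ?thesis using I u j unfolding r by (simp add: less_Suc_eq)
      qed
      show "\<exists>T. ends ?body s' T (\<lambda>s''. ?I s'' \<and> T + 1 + ?\<Phi> s'' \<le> ?\<Phi> s')"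
        by (rule exI[of _ 5], rule ends_run, simp, rule J, simp)
    next
      fix s' assume I: "?I s'" and b: "\<not> eval_test (Less (Var ''i'') (Var ''n'')) s'" and f': "\<And>a. a \<notin> writes ?body \<Longrightarrow> s' a = s1 a"
      have nn: "s' ''n'' = s ''n''" using f' f1 by simp
      then have i: "s' ''i'' 0 = ?n" using b I n by simp
      have "s' ''j'' 0 = ?M" using I unfolding i by simp
      then have "filled ?n (s' ''j'' 0) x \<longleftrightarrow> (\<exists>u<?n. \<exists>v\<in>set (adj ! u). x = ?A u v)" for x unfolding filled_def by simp
      then show "s' ''n'' 0 = ?n \<and> (\<forall>v<?n. s' ''ord'' v = v) \<and> (\<forall>x. 0 < s' ''mat'' x \<longleftrightarrow> (\<exists>u<?n. \<exists>v\<in>set (adj ! u). x = ?A u v))"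
        using I nn n unfolding i by simp
    qed (use s1 in auto)
    fix s2 assume s2: "s2 ''n'' 0 = ?n \<and> (\<forall>v<?n. s2 ''ord'' v = v) \<and> (\<forall>x. 0 < s2 ''mat'' x \<longleftrightarrow> (\<exists>u<?n. \<exists>v\<in>set (adj ! u). x = ?A u v))"
    have "map (s2 ''ord'') [0..<?n] = [0..<?n]" by (rule map_idI) (use s2 in simp)
    then show "ends (seqs [Set ''el'' (Var ''n''), Set ''mx'' (Var ''n'')]) s2 2
      (\<lambda>s'. order s' = [0..<?n] \<and> s' ''el'' 0 = ?n \<and> s' ''mx'' 0 = ?n \<and>
        (\<forall>x. 0 < s' ''mat'' x \<longleftrightarrow> (\<exists>u<?n. \<exists>v\<in>set (adj ! u). x = ?A u v)))"
      using s2 by (intro ends_run) (simp_all add: order_def)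
  qed simp
qed

text \<open>For 0 < b < L the address is (a - 1) * L + (L - b), from which division recovers
  \<open>a\<close> and \<open>b\<close>. A missing identifier gives zero or a multiple of
  \<open>L\<close>, and so never collides with a proper address.\<close>

lemma address_inj:
  fixes a b L :: nat
  assumes "a \<noteq> 0" "b \<noteq> 0" "b < L" "b' < L" and e: "a * L - b = a' * L - b'"
  shows "a = a' \<and> b = b'"
proof -
  have dm: "(Suc x * L - y) div L = x \<and> (Suc x * L - y) mod L = L - y" if "0 < y" "y < L" for x y
  proof -
    have e: "Suc x * L - y = (L - y) + x * L" using that by simp
    have "(d + x * L) div L = x \<and> (d + x * L) mod L = d" if "d < L" for d using that by simp
    then show ?thesis unfolding e using that by (metis diff_less less_trans)
  qed
  obtain x where x: "a = Suc x" using assms(1) by (cases a) auto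
  note X = dm[of b x, OF _ assms(3), folded x]
  have m: "(a * L - b) mod L = L - b" "(a * L - b) div L = x" using X assms(2) by auto
  have ne: "0 < L - b" using assms(3) by simp
  show ?thesis
  proof (cases a')
    case 0
    have "(a * L - b) mod L = 0" unfolding e 0 by simp
    then show ?thesis using m(1) ne by linarith
  next
    case (Suc y)
    show ?thesis
    proof (cases "b' = 0")
      case True
      have "(a * L - b) mod L = 0" unfolding e True by simp
      then show ?thesis using m(1) ne by linarith
    next
      case False
      then have "(a * L - b) div L = y" "(a * L - b) mod L = L - b'"
        unfolding e Suc using dm[of b' y] assms(4) by auto
      then show ?thesis using m assms(3,4) x Suc by linarith
    qed
  qed
qed

lemma finite_edges: "simple_graph G \<Longrightarrow> finite (edges G)"
proof -
  assume "simple_graph G"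
  then have f: "finite (verts G)" and e: "\<forall>e\<in>edges G. \<exists>u\<in>verts G. \<exists>v\<in>verts G. u \<noteq> v \<and> e = {u, v}"
    unfolding simple_graph_def by simp_all
  have "edges G \<subseteq> Pow (verts G)"
  proof
    fix e assume "e \<in> edges G"
    then obtain u v where "u \<in> verts G" "v \<in> verts G" "e = {u, v}" using e by blast
    then show "e \<in> Pow (verts G)" by simp
  qed
  then show ?thesis using f by (simp add: finite_subset)
qed

text \<open>An ordered pair of adjacent vertices is determined by its edge and by which end is the
  smaller number.\<close>

lemma card_pairs_le:
  fixes G :: "nat graph"
  assumes "simple_graph G" and R: "\<And>u v. (u, v) \<in> R \<Longrightarrow> u \<noteq> v \<and> {u, v} \<in> edges G"
  shows "card R \<le> 2 * card (edges G)"
proof -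
  let ?f = "\<lambda>(u, v). ({u, v}, u < (v :: nat))"
  have "inj_on ?f R"
  proof (rule inj_onI)
    fix x y assume "x \<in> R" "y \<in> R" and e: "?f x = ?f y"
    obtain u v where x: "x = (u, v)" by (cases x)
    obtain u' v' where y: "y = (u', v')" by (cases y)
    show "x = y" using e unfolding x y by (auto simp: doubleton_eq_iff)
  qed
  moreover have "?f ` R \<subseteq> edges G \<times> UNIV" using R by auto
  moreover have "finite (edges G \<times> (UNIV :: bool set))" using finite_edges[OF assms(1)] by simp
  ultimately have "card R \<le> card (edges G \<times> (UNIV :: bool set))" by (rule card_inj_on_le)
  then show ?thesis by (simp add: card_cartesian_product)
qed

lemma length_adjacency_lists:
  assumes G: "simple_graph G" and adj: "adjacency_lists G adj"
  shows "length (concat adj) \<le> 2 * card (edges G)"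
proof -
  have "length (concat adj) = (\<Sum>v<length adj. length (adj ! v))"
    by (simp add: length_concat sum_list_sum_nth atLeast0LessThan)
  also have "\<dots> = (\<Sum>v<length adj. card (set (adj ! v)))"
    by (intro sum.cong refl distinct_card[symmetric]) (use adj in \<open>simp add: adjacency_lists_def\<close>)
  also have "\<dots> = card (SIGMA v:{..<length adj}. set (adj ! v))" by simp
  also have "\<dots> \<le> 2 * card (edges G)"
  proof (rule card_pairs_le[OF G])
    interpret adjacency "gadj G" by (rule adjacency_gadj[OF G])
    fix u v assume "(u, v) \<in> (SIGMA v:{..<length adj}. set (adj ! v))"
    then have "{v, u} \<in> edges G" using adj by (auto simp: adjacency_lists_def)
    then show "u \<noteq> v \<and> {u, v} \<in> edges G" using adj_irrefl[of u] by (auto simp: insert_commute)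
  qed
  finally show ?thesis .
qed

text \<open>This makes both the quadratic table and the search through all pairs of witnesses linear
  in the size of the graph.\<close>

lemma clique_edges:
  fixes G :: "nat graph"
  assumes G: "simple_graph G" and c: "clique G K"
  shows "card K * card K \<le> 2 * card (edges G) + card K"
proof -
  have K: "finite K" using c G unfolding clique_def simple_graph_def by (metis finite_subset)
  let ?R = "K \<times> K - (\<lambda>v. (v, v)) ` K"
  have "card ?R \<le> 2 * card (edges G)"
    by (rule card_pairs_le[OF G]) (use c in \<open>auto simp: clique_def\<close>)
  moreover have "card ?R = card K * card K - card K"
  proof -
    have "card ((\<lambda>v. (v, v)) ` K) = card K" by (intro card_image inj_onI) simp
    moreover have "card ?R = card (K \<times> K) - card ((\<lambda>v. (v, v)) ` K)" using K by (intro card_Diff_subset) auto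
    ultimately show ?thesis by (simp add: card_cartesian_product)
  qed
  ultimately show ?thesis by linarith
qed

lemma enum_input_items:
  assumes Q: "obstacle_enum_in G Q" and p: "p < length (fst Q)"
  shows "items_of Q ! p = (let s = enum_input Q s0 in
    (s ''q'' p, s ''w0'' p, if s ''wlen'' p < 2 then s ''w0'' p else s ''w1'' p))"
proof -
  have l: "length (snd Q) = length (fst Q)" using Q by (simp add: obstacle_enum_in_def Let_def)
  have "witness_enum G (set (fst Q)) (fst Q ! p) (fst Q ! ((p + 1) mod length (fst Q))) (snd Q ! p)"
    using Q p by (simp add: obstacle_enum_in_def Let_def)
  then have "(\<exists>w. snd Q ! p = [w]) \<or> (\<exists>u z. snd Q ! p = [u, z])" unfolding witness_enum_def by blast
  then show ?thesis using p l by (auto simp: items_of_def enum_input_def array_def)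
qed

definition graph_adjt :: "exp \<Rightarrow> exp \<Rightarrow> test" where
  "graph_adjt e f = Less (Const 0) (Read ''mat'' (Minus (Read ''row'' (Read ''lid'' e)) (Read ''lid'' f)))"

definition graph_program :: com where
  "graph_program = Seq prepare (Seq rows (Seq fill (solve graph_adjt)))"

definition graph_constant :: nat where
  "graph_constant = 4 * ram_search.shrink_cost graph_adjt + cost (brute graph_adjt 12) + 200"

lemma graph_algorithm:
  assumes G: "simple_graph G" and adj: "adjacency_lists G adj" and Q: "obstacle_enum_in G Q"
  shows "ends graph_program (graph_input adj Q) (graph_constant * (card (verts G) + card (edges G)))
    (answered (gadj G) (verts_of (items_of Q)))"
proof -
  let ?xs = "items_of Q" and ?n = "length adj" and ?s = "graph_input adj Q"
  let ?U = "verts_of ?xs" and ?k = "length (fst Q)"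
  define L where "L = 3 * ?k + 1"
  define ok where "ok s \<longleftrightarrow> (\<forall>a\<in>?U. \<forall>b\<in>?U. 0 < s ''mat'' (s ''row'' (s ''lid'' a) - s ''lid'' b) \<longleftrightarrow> gadj G a b)" for s :: state
  note I = obstacle_enum_items[OF G Q]
  have V: "verts G = {0..<?n}" using adj by (simp add: adjacency_lists_def)
  have U: "?U \<subseteq> {0..<?n}" using I(2) V by simp
  then have finU: "finite ?U" and cU: "card ?U \<le> ?n"
    using finite_subset card_mono[of "{0..<?n}" ?U] by auto
  have frame: "ok s'" if "ok s" "\<And>a. a \<in> adj_arrays \<Longrightarrow> s' a = s a" for s s'
  proof -
    have "s' ''mat'' = s ''mat''" "s' ''row'' = s ''row''" "s' ''lid'' = s ''lid''"
      by (rule that(2), simp add: adj_arrays_def)+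
    then show ?thesis using that(1) by (simp add: ok_def)
  qed
  interpret adjacency "gadj G" by (rule adjacency_gadj[OF G])
  \<comment> \<open>With n successors tried, every pair is reached, so any key will do; the identity
    matches the order 0, ..., n - 1.\<close>
  interpret ram_search "gadj G" graph_adjt ok ?U id ?n
    by unfold_locales (use finU cU frame in \<open>auto simp: graph_adjt_def ok_def\<close>)
  have k0: "length ?xs = ?k" by (rule I(3))
  have in_s: "?s ''hd'' 0 = 0" "?s ''k'' 0 = length ?xs" "?s ''lid'' = (\<lambda>_. 0)" "?s ''row'' 0 = 0" "?s ''mat'' = (\<lambda>_. 0)"
    "?s ''n'' 0 = ?n" "?s ''adj'' = array (concat adj)" "?s ''out_kind'' 0 = 0"
    "?s ''start'' = array (map (\<lambda>v. length (concat (take v adj))) [0..<?n + 1])"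
    using k0 by (simp_all add: graph_input_def enum_input_def array_def)
  have input: "?xs ! p = (?s ''q'' p, ?s ''w0'' p, if ?s ''wlen'' p < 2 then ?s ''w0'' p else ?s ''w1'' p)"
    if "p < length ?xs" for p
    unfolding graph_input_def by (rule enum_input_items[OF Q, of p, unfolded Let_def]) (use that k0 in simp)
  have k: "?k \<le> ?n" "3 \<le> ?k" "?k * ?k \<le> 2 * card (edges G) + ?k"
  proof -
    have q: "3 \<le> ?k" "distinct (fst Q)" "clique G (set (fst Q))" using Q by (auto simp: obstacle_enum_in_def Let_def)
    then have c: "card (set (fst Q)) = ?k" by (simp add: distinct_card)
    show "3 \<le> ?k" by (rule q(1))
    show "?k * ?k \<le> 2 * card (edges G) + ?k" using clique_edges[OF G q(3)] unfolding c .
    have "set (fst Q) \<subseteq> {0..<?n}" using q(3) V by (simp add: clique_def)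
    from card_mono[OF _ this] show "?k \<le> ?n" using c by simp
  qed
  have M: "length (concat adj) \<le> 2 * card (edges G)" by (rule length_adjacency_lists[OF G adj])
  let ?N = "?n + card (edges G)"
  let ?T4 = "shrink_cost * ?k * (min ?n (2 * ?k) + 1) + 6 * ?n + 9 * card ?U + cost (brute graph_adjt 12) + 7"
  let ?T3 = "6 * (?n + length (concat adj)) + 5 + ?T4"
  let ?T2 = "7 * (L * (L + 1)) + 5 + ?T3"
  have "ends graph_program ?s (11 * ?k + 4 + ?T2) (answered (gadj G) ?U)"
    unfolding graph_program_def
  proof (rule ends_Seq[OF ends_prepare[OF in_s(1-3) input]])
    fix s1 assume s1: "items s1 = ?xs \<and> s1 ''c'' 0 = 3 * length ?xs + 1 \<and> ids_ok (s1 ''lid'') (s1 ''c'' 0) ?U"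
      and f1: "\<And>a. a \<notin> writes prepare \<Longrightarrow> s1 a = ?s a"
    have e1: "s1 ''row'' = ?s ''row''" "s1 ''mat'' = ?s ''mat''" "s1 ''n'' = ?s ''n''" "s1 ''adj'' = ?s ''adj''"
      "s1 ''start'' = ?s ''start''" "s1 ''out_kind'' = ?s ''out_kind''"
      by (rule f1, simp add: prepare_def prepare_step_def)+
    have c1: "s1 ''c'' 0 = L" "s1 ''row'' 0 = 0" using s1 k0 e1 in_s by (simp_all add: L_def)
    show "ends (Seq rows (Seq fill (solve graph_adjt))) s1 ?T2 (answered (gadj G) ?U)"
    proof (rule ends_Seq[OF ends_rows[of s1 L, OF c1(2,1)]])
      fix s2 assume s2: "\<forall>x\<le>L. s2 ''row'' x = x * L" and f2: "\<And>a. a \<notin> writes rows \<Longrightarrow> s2 a = s1 a"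
      have e2: "s2 ''mat'' = ?s ''mat''" "s2 ''n'' = ?s ''n''" "s2 ''adj'' = ?s ''adj''" "s2 ''start'' = ?s ''start''"
        "s2 ''out_kind'' = ?s ''out_kind''" "s2 ''lid'' = s1 ''lid''"
        "s2 ''q'' = s1 ''q''" "s2 ''w0'' = s1 ''w0''" "s2 ''w1'' = s1 ''w1''" "s2 ''hd'' = s1 ''hd''" "s2 ''tl'' = s1 ''tl''"
        using e1 by (simp_all add: f2 rows_def)
      have ids: "ids_ok (s2 ''lid'') L ?U" unfolding e2 c1(1)[symmetric] using s1 by blast
      have F: "s2 ''n'' 0 = ?n" "\<And>v. v \<le> ?n \<Longrightarrow> s2 ''start'' v = length (concat (take v adj))"
        "\<And>e. e < length (concat adj) \<Longrightarrow> s2 ''adj'' e = concat adj ! e" "s2 ''mat'' = (\<lambda>_. 0)"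
        unfolding e2 in_s by (simp_all add: array_def del: upt_Suc)
      show "ends (Seq fill (solve graph_adjt)) s2 ?T3 (answered (gadj G) ?U)"
      proof (rule ends_Seq[OF ends_fill[of s2 adj, OF F]])
        fix s3 assume s3: "order s3 = [0..<?n] \<and> s3 ''el'' 0 = ?n \<and> s3 ''mx'' 0 = ?n \<and>
            (\<forall>x. 0 < s3 ''mat'' x \<longleftrightarrow> (\<exists>u<?n. \<exists>v\<in>set (adj ! u). x = s2 ''row'' (s2 ''lid'' u) - s2 ''lid'' v))"
          and f3: "\<And>a. a \<notin> writes fill \<Longrightarrow> s3 a = s2 a"
        have e3: "s3 ''lid'' = s2 ''lid''" "s3 ''row'' = s2 ''row''" "s3 ''out_kind'' = ?s ''out_kind''"
          "s3 ''q'' = s1 ''q''" "s3 ''w0'' = s1 ''w0''" "s3 ''w1'' = s1 ''w1''" "s3 ''hd'' = s1 ''hd''" "s3 ''tl'' = s1 ''tl''"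
          using e2 by (simp_all add: f3 fill_def)
        have it: "items s3 = ?xs" using s1 by (simp add: block_def e3)
        let ?l = "s2 ''lid''"
        have l: "?l u < L" for u using ids unfolding ids_ok_def by blast
        have row: "s2 ''row'' (?l u) = ?l u * L" for u using s2 l[of u] by simp
        have "0 < s3 ''mat'' (s3 ''row'' (s3 ''lid'' a) - s3 ''lid'' b) \<longleftrightarrow> gadj G a b" if ab: "a \<in> ?U" "b \<in> ?U" for a b
        proof -
          have z: "?l a \<noteq> 0" "?l b \<noteq> 0" using ids ab unfolding ids_ok_def by blast+
          \<comment> \<open>The lists of the whole graph are entered in the table, also for vertices
            without identifier. Still, the cell of \<open>a\<close> and \<open>b\<close> is written
            only on behalf of \<open>a\<close> and \<open>b\<close>.\<close>
          have inj: "a = u \<and> b = v" if "?l a * L - ?l b = ?l u * L - ?l v" for u v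
          proof -
            have "?l a = ?l u \<and> ?l b = ?l v" by (rule address_inj[OF z l l that])
            then show ?thesis using ids z unfolding ids_ok_def by blast
          qed
          have an: "a < ?n" using U ab by auto
          have "0 < s3 ''mat'' (s3 ''row'' (s3 ''lid'' a) - s3 ''lid'' b) \<longleftrightarrow>
              (\<exists>u<?n. \<exists>v\<in>set (adj ! u). ?l a * L - ?l b = ?l u * L - ?l v)"
            using s3 unfolding e3 row by blast
          also have "\<dots> \<longleftrightarrow> b \<in> set (adj ! a)" using inj an by blast
          also have "\<dots> \<longleftrightarrow> gadj G a b" using adj an by (auto simp: adjacency_lists_def insert_commute)
          finally show ?thesis .
        qed
        then have "ok s3" unfolding ok_def by blast
        then have "ends (solve graph_adjt) s3 (shrink_cost * length (items s3) * (min ?n (2 * length (items s3)) + 1) + 6 * s3 ''el'' 0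
            + 9 * card ?U + cost (brute graph_adjt 12) + 7) (answered (gadj G) ?U)"
          by (rule ends_solve) (use it I U s3 finU e3 in_s in \<open>auto simp: sorted_wrt_upt\<close>)
        then show "ends (solve graph_adjt) s3 ?T4 (answered (gadj G) ?U)" unfolding it k0 using s3 by simp
      qed (assumption | rule order_refl)+
    qed (assumption | rule order_refl)+
  qed (simp_all only: k0 order_refl)
  moreover have "11 * ?k + 4 + ?T2 \<le> graph_constant * (card (verts G) + card (edges G))"
  proof -
    \<comment> \<open>Here 2k^2 + k becomes linear, through k^2 <= 2m + k and k <= n.\<close>
    have "?k * (min ?n (2 * ?k) + 1) \<le> ?k * (2 * ?k + 1)" by (intro mult_le_mono2) simp
    also have "\<dots> \<le> 4 * ?N" using k by (simp add: algebra_simps)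
    finally have X: "shrink_cost * (?k * (min ?n (2 * ?k) + 1)) \<le> shrink_cost * (4 * ?N)" by (rule mult_le_mono2)
    have Y: "L * (L + 1) \<le> 20 * ?N" using k unfolding L_def by (simp add: algebra_simps)
    have Z: "cost (brute graph_adjt 12) \<le> cost (brute graph_adjt 12) * ?N" using k by simp
    have sum: "graph_constant * ?N = shrink_cost * (4 * ?N) + cost (brute graph_adjt 12) * ?N + 200 * ?N"
      unfolding graph_constant_def by (simp add: algebra_simps)
    have n: "card (verts G) = ?n" using V by simp
    have "11 * k + 4 + (7 * y + 5 + (6 * (n + l) + 5 + (x + 6 * n + 9 * u + b + 7))) \<le> w + z + 200 * (n + m)"
      if "x \<le> w" "y \<le> 20 * (n + m)" "b \<le> z" "k \<le> n" "3 \<le> k" "l \<le> 2 * m" "u \<le> n" for x y w z b k n l m u :: nat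
      using that by simp
    from this[OF X Y Z k(1,2) M cU] show ?thesis unfolding n sum by (simp only: mult.assoc)
  qed
  ultimately show ?thesis by (rule ends_weaken) simp
qed

section \<open>Model input: adjacency from the order of the extremes\<close>

text \<open>The loop test says that \<open>i\<close> is below 2n without computing 2n. Since the
  extremes arrive in order, the arcs are listed in \<open>ord\<close> sorted by their entering
  extremes.\<close>

definition scan :: com where
  "scan = Seq (seqs [Set ''i'' (Const 0), Set ''el'' (Const 0)]) (Seq
     (While (Less (Minus (Var ''i'') (Var ''n'')) (Var ''n''))
       (seqs [Branch (Less (Const 0) (Read ''enters'' (Var ''i'')))
           (seqs [Write ''pin'' (Read ''arc'' (Var ''i'')) (Var ''i''),
             Write ''ord'' (Var ''el'') (Read ''arc'' (Var ''i'')), Inc ''el''])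
           (Write ''pout'' (Read ''arc'' (Var ''i'')) (Var ''i'')),
         Inc ''i'']))
     (Set ''mx'' (Const 10)))"

lemma ends_scan:
  fixes xs :: "(nat \<times> bool) list"
  assumes n: "length xs = 2 * s ''n'' 0" and arc: "\<And>p. p < length xs \<Longrightarrow> s ''arc'' p = fst (xs ! p)"
    and enters: "\<And>p. p < length xs \<Longrightarrow> 0 < s ''enters'' p \<longleftrightarrow> snd (xs ! p)" and d: "distinct xs"
  shows "ends scan s (7 * length xs + 4)
    (\<lambda>s'. order s' = map fst (filter snd xs) \<and> s' ''el'' 0 = length (filter snd xs) \<and> s' ''mx'' 0 = 10 \<and>
      (\<forall>p<length xs. s' (if snd (xs ! p) then ''pin'' else ''pout'') (fst (xs ! p)) = p))"
  unfolding scan_def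
proof (rule ends_Seq[where ?T1.0 = 2])
  let ?N = "length xs" and ?p = "seqs [Set ''i'' (Const 0), Set ''el'' (Const 0)]"
  let ?br = "Branch (Less (Const 0) (Read ''enters'' (Var ''i'')))
           (seqs [Write ''pin'' (Read ''arc'' (Var ''i'')) (Var ''i''),
             Write ''ord'' (Var ''el'') (Read ''arc'' (Var ''i'')), Inc ''el''])
           (Write ''pout'' (Read ''arc'' (Var ''i'')) (Var ''i''))"
  let ?body = "seqs [?br, Inc ''i'']" and ?t = "Less (Minus (Var ''i'') (Var ''n'')) (Var ''n'')"
  let ?P = "\<lambda>s' p. s' (if snd (xs ! p) then ''pin'' else ''pout'') (fst (xs ! p)) = p"
  let ?I = "\<lambda>s'. s' ''i'' 0 \<le> ?N \<and> s' ''el'' 0 = length (filter snd (take (s' ''i'' 0) xs)) \<and>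
     order s' = map fst (filter snd (take (s' ''i'' 0) xs)) \<and> (\<forall>p<s' ''i'' 0. ?P s' p)"
  show "ends ?p s 2 (\<lambda>s'. ?I s' \<and> s' ''i'' 0 = 0)" by (rule ends_run) (simp_all add: order_def)
  show "2 + (7 * ?N + 2) \<le> 7 * ?N + 4" by simp
  fix s1 assume s1: "?I s1 \<and> s1 ''i'' 0 = 0" and f1: "\<And>a. a \<notin> writes ?p \<Longrightarrow> s1 a = s a"
  show "ends (Seq (While ?t ?body) (Set ''mx'' (Const 10))) s1 (7 * ?N + 2)
    (\<lambda>s'. order s' = map fst (filter snd xs) \<and> s' ''el'' 0 = length (filter snd xs) \<and> s' ''mx'' 0 = 10 \<and> (\<forall>p<?N. ?P s' p))"
  proof (rule ends_Seq)
    show "ends (While ?t ?body) s1 (7 * ?N + 1)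
      (\<lambda>s'. order s' = map fst (filter snd xs) \<and> s' ''el'' 0 = length (filter snd xs) \<and> (\<forall>p<?N. ?P s' p))"
    proof (rule ends_While[where I = ?I and \<Phi> = "\<lambda>s'. 7 * (?N - s' ''i'' 0)"])
      fix s' assume I: "?I s'" and b: "eval_test ?t s'" and f': "\<And>a. a \<notin> writes ?body \<Longrightarrow> s' a = s1 a"
      let ?i = "s' ''i'' 0" and ?r = "run ?body s'"
      have e: "s' ''n'' = s ''n''" "s' ''arc'' = s ''arc''" "s' ''enters'' = s ''enters''" using f' f1 by simp_all
      have i: "?i < ?N" using b n e by auto
      obtain v x where vx: "xs ! ?i = (v, x)" by (cases "xs ! ?i")
      have new: "s ''arc'' ?i = v" "0 < s ''enters'' ?i \<longleftrightarrow> x" using arc[OF i] enters[OF i] vx by simp_all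
      have tk: "take (Suc ?i) xs = take ?i xs @ [(v, x)]" using i vx by (simp add: take_Suc_conv_app_nth)
      have ri: "?r ''i'' 0 = Suc ?i" using new e by simp
      have ne: "xs ! p \<noteq> xs ! ?i" if "p < ?i" for p using d i that by (simp add: nth_eq_iff_index_eq)
      have "?I ?r"
      proof (cases x)
        case True
        then have r: "?r ''el'' 0 = Suc (s' ''el'' 0)" "?r ''ord'' = (s' ''ord'')(s' ''el'' 0 := v)"
          "?r ''pin'' = (s' ''pin'')(v := ?i)" "?r ''pout'' = s' ''pout''"
          using new e by simp_all
        have "order ?r = order s' @ [v]" unfolding order_def r by simp
        moreover have "?P ?r p" if "p < Suc ?i" for p
        proof (cases "p = ?i")
          case True
          then show ?thesis unfolding \<open>p = ?i\<close> vx using \<open>x\<close> r(3) by simp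
        next
          case False
          then have p: "p < ?i" using that by simp
          have "snd (xs ! p) \<longrightarrow> fst (xs ! p) \<noteq> v" using ne[OF p] vx True by (cases "xs ! p") auto
          moreover have "?P s' p" using I p by blast
          ultimately show ?thesis using r(3,4) by (cases "snd (xs ! p)") (simp_all del: run.simps)
        qed
        ultimately show ?thesis using I i True unfolding ri tk r by simp
      next
        case False
        then have r: "?r ''el'' = s' ''el''" "?r ''ord'' = s' ''ord''"
          "?r ''pout'' = (s' ''pout'')(v := ?i)" "?r ''pin'' = s' ''pin''"
          using new e by simp_all
        have "order ?r = order s'" unfolding order_def r ..
        moreover have "?P ?r p" if "p < Suc ?i" for p
        proof (cases "p = ?i")
          case True
          then show ?thesis unfolding \<open>p = ?i\<close> vx using \<open>\<not> x\<close> r(3) by simp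
        next
          case False
          then have p: "p < ?i" using that by simp
          have "\<not> snd (xs ! p) \<longrightarrow> fst (xs ! p) \<noteq> v" using ne[OF p] vx \<open>\<not> x\<close> by (cases "xs ! p") auto
          moreover have "?P s' p" using I p by blast
          ultimately show ?thesis using r(3,4) by (cases "snd (xs ! p)") (simp_all del: run.simps)
        qed
        ultimately show ?thesis using I i False unfolding ri tk r by simp
      qed
      moreover have "6 + 1 + 7 * (?N - ?r ''i'' 0) \<le> 7 * (?N - ?i)" unfolding ri using i by simp
      ultimately have J: "?I ?r \<and> 6 + 1 + 7 * (?N - ?r ''i'' 0) \<le> 7 * (?N - ?i)" by blast
      show "\<exists>T. ends ?body s' T (\<lambda>s''. ?I s'' \<and> T + 1 + 7 * (?N - s'' ''i'' 0) \<le> 7 * (?N - ?i))"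
        by (rule exI[of _ 6], rule ends_run, simp, rule J, simp)
    next
      fix s' assume I: "?I s'" and b: "\<not> eval_test ?t s'" and f': "\<And>a. a \<notin> writes ?body \<Longrightarrow> s' a = s1 a"
      have "s' ''n'' = s ''n''" using f' f1 by simp
      then have i: "s' ''i'' 0 = ?N" using b I n by auto
      show "order s' = map fst (filter snd xs) \<and> s' ''el'' 0 = length (filter snd xs) \<and> (\<forall>p<?N. ?P s' p)"
        using I unfolding i by simp
    qed (use s1 in auto)
    fix s2 assume s2: "order s2 = map fst (filter snd xs) \<and> s2 ''el'' 0 = length (filter snd xs) \<and> (\<forall>p<?N. ?P s2 p)"
    have "order (s2(''mx'' := f)) = order s2" for f by (simp add: order_def)
    then show "ends (Set ''mx'' (Const 10)) s2 1
      (\<lambda>s'. order s' = map fst (filter snd xs) \<and> s' ''el'' 0 = length (filter snd xs) \<and> s' ''mx'' 0 = 10 \<and> (\<forall>p<?N. ?P s' p))"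
      using s2 by (intro ends_run) auto
  qed simp
qed

lemma arc_position:
  assumes "distinct xs" "p < length xs"
  shows "xs ! p = (v, True) \<Longrightarrow> arc_start xs v = p" "xs ! p = (v, False) \<Longrightarrow> arc_end xs v = p"
  using assms unfolding arc_start_def arc_end_def by (auto intro!: the_equality simp: nth_eq_iff_index_eq[symmetric])

lemma sorted_arc_start:
  assumes d: "distinct xs"
  shows "sorted_wrt (\<lambda>u v. arc_start xs u < arc_start xs v) (map fst (filter snd xs))"
proof -
  have "sorted_wrt (\<lambda>x y. snd x \<longrightarrow> snd y \<longrightarrow> arc_start xs (fst x) < arc_start xs (fst y)) xs"
    unfolding sorted_wrt_iff_nth_less
  proof (intro allI impI)
    fix i j assume ij: "i < j" "j < length xs" and s: "snd (xs ! i)" "snd (xs ! j)"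
    have "xs ! i = (fst (xs ! i), True)" "xs ! j = (fst (xs ! j), True)" using s by (simp_all add: prod_eq_iff)
    then have "arc_start xs (fst (xs ! i)) = i" "arc_start xs (fst (xs ! j)) = j" using arc_position(1)[OF d] ij by auto
    then show "arc_start xs (fst (xs ! i)) < arc_start xs (fst (xs ! j))" using ij by simp
  qed
  from sorted_wrt_filter[OF this, of snd]
  show ?thesis unfolding sorted_wrt_map
    by (rule sorted_wrt_mono_rel[rotated]) auto
qed

definition in_arc :: "exp \<Rightarrow> exp \<Rightarrow> test" where
  "in_arc e f = (let a = Read ''pin'' e; b = Read ''pout'' e; p = Read ''pin'' f in
     Or (Conj (Le a b) (Conj (Le a p) (Le p b))) (Conj (Less b a) (Or (Le a p) (Le p b))))"

lemma eval_in_arc: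
  "s ''pin'' (eval_exp f s) < N \<Longrightarrow> eval_test (in_arc e f) s \<longleftrightarrow>
     s ''pin'' (eval_exp f s) \<in> cyc_ivl N (s ''pin'' (eval_exp e s)) (s ''pout'' (eval_exp e s))"
  by (auto simp: in_arc_def Let_def cyc_ivl_def)

text \<open>Two arcs meet exactly if one contains the entering extreme of the other
  (\<open>cyc_ivl_meet_iff\<close>). An arc meets itself, so equality has to be excluded.\<close>

definition arc_adjt :: "exp \<Rightarrow> exp \<Rightarrow> test" where
  "arc_adjt e f = Conj (Neg (Eq e f)) (Or (in_arc e f) (in_arc f e))"

lemma arc_adjt_simps: "eval_test (arc_adjt e f) s \<longleftrightarrow>
    eval_exp e s \<noteq> eval_exp f s \<and> (eval_test (in_arc e f) s \<or> eval_test (in_arc f e) s)"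
  by (simp add: arc_adjt_def)

text \<open>An interval contains every left endpoint that lies between its own left endpoint and another
  left endpoint in it.\<close>

lemma cyc_ivl_between:
  assumes "key y \<in> cyc_ivl N (key x) j" "cyclic_between key x z y" "key z < N"
  shows "key z \<in> cyc_ivl N (key x) j \<and> z \<noteq> x"
  using assms unfolding cyc_ivl_def cyclic_between_def by (auto split: if_splits)

text \<open>Of two arcs that meet, one contains the entering extreme of the other, hence also every
  entering extreme on the way there, and meets those arcs.\<close>

lemma sweepable_arcs:
  assumes N: "\<And>v. v \<in> U \<Longrightarrow> f v < N" "\<And>v. v \<in> U \<Longrightarrow> g v < N"
    and adj: "\<And>u v. u \<in> U \<Longrightarrow> v \<in> U \<Longrightarrow> adj u v \<longleftrightarrow> u \<noteq> v \<and> cyc_ivl N (f u) (g u) \<inter> cyc_ivl N (f v) (g v) \<noteq> {}"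
  shows "sweepable adj f U"
  unfolding sweepable_def
proof (intro ballI impI)
  fix x y assume xy: "x \<in> U" "y \<in> U" "adj x y"
  have sweep: "adj u w" if "u \<in> U" "v \<in> U" "w \<in> U" "f v \<in> cyc_ivl N (f u) (g u)" "cyclic_between f u w v" for u v w
  proof -
    have w: "f w \<in> cyc_ivl N (f u) (g u) \<and> w \<noteq> u" using that N by (intro cyc_ivl_between) auto
    have "cyc_ivl N (f u) (g u) \<inter> cyc_ivl N (f w) (g w) \<noteq> {}"
      using w cyc_ivl_meet_iff[of "f u" N "g u" "f w" "g w"] N that by simp
    then show ?thesis using adj[OF that(1,3)] w by auto
  qed
  have "f y \<in> cyc_ivl N (f x) (g x) \<or> f x \<in> cyc_ivl N (f y) (g y)"
    using xy adj[OF xy(1,2)] cyc_ivl_meet_iff[of "f x" N "g x" "f y" "g y"] N by simp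
  then show "(\<forall>z\<in>U. cyclic_between f x z y \<longrightarrow> adj x z) \<or> (\<forall>z\<in>U. cyclic_between f y z x \<longrightarrow> adj y z)"
    using sweep xy by metis
qed

definition model_program :: com where
  "model_program = Seq prepare (Seq scan (solve arc_adjt))"

definition model_constant :: nat where
  "model_constant = 11 * ram_search.shrink_cost arc_adjt + cost (brute arc_adjt 12) + 60"

lemma model_algorithm:
  assumes G: "simple_graph G" and V: "verts G = {0..<n}" and A: "circular_arc_model G A"
    and X: "extremes_in_order (verts G) A xs" and Q: "obstacle_enum_in G Q"
  shows "ends model_program (model_input n xs Q) (model_constant * n)
    (\<lambda>s. \<exists>ys. obs (gadj G) ys \<and> ess (gadj G) ys \<and> verts_of ys \<subseteq> verts G \<and> enum_output s = enum_of ys)"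
proof -
  let ?ys = "items_of Q" and ?s = "model_input n xs Q" and ?N = "length xs"
  let ?U = "verts_of ?ys" and ?k = "length (fst Q)"
  let ?f = "arc_start xs" and ?g = "arc_end xs"
  define ok where "ok s \<longleftrightarrow> (\<forall>v\<in>?U. s ''pin'' v = ?f v \<and> s ''pout'' v = ?g v)" for s :: state
  note I = obstacle_enum_items[OF G Q]
  have U: "?U \<subseteq> {0..<n}" using I(2) V by simp
  then have finU: "finite ?U" and cU: "card ?U \<le> n"
    using finite_subset card_mono[of "{0..<n}" ?U] by auto
  have d: "distinct xs" and sx: "set xs = {0..<n} \<times> UNIV" using X V unfolding extremes_in_order_def by auto
  have len: "?N = 2 * n" using distinct_card[OF d] unfolding sx by (simp add: card_cartesian_product)
  have at: "?f v < ?N" "xs ! ?f v = (v, True)" "?g v < ?N" "xs ! ?g v = (v, False)" if "v < n" for v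
    using the_index[OF d, of "(v, True)"] the_index[OF d, of "(v, False)"] that
    unfolding arc_start_def arc_end_def sx by auto
  have Un: "v < n" if "v \<in> ?U" for v using U that by auto
  have adj_iff: "gadj G u v \<longleftrightarrow> u \<noteq> v \<and> arc_ivl xs u \<inter> arc_ivl xs v \<noteq> {}" if "u < n" "v < n" for u v
  proof (cases "u = v")
    case True
    interpret adjacency "gadj G" by (rule adjacency_gadj[OF G])
    show ?thesis using True adj_irrefl[of v] by simp
  next
    case False
    have uv: "u \<in> verts G" "v \<in> verts G" using V that by auto
    then have "gadj G u v \<longleftrightarrow> A u \<inter> A v \<noteq> {}" using A False unfolding circular_arc_model_def by blast
    then show ?thesis using arcs_meet_iff[OF X uv] False by simp
  qed
  have adj_iff': "gadj G u v \<longleftrightarrow> u \<noteq> v \<and> (?f v \<in> cyc_ivl ?N (?f u) (?g u) \<or> ?f u \<in> cyc_ivl ?N (?f v) (?g v))"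
    if "u < n" "v < n" for u v
    unfolding adj_iff[OF that] arc_ivl_def using at that by (simp only: cyc_ivl_meet_iff)
  have frame: "ok s'" if "ok s" "\<And>a. a \<in> adj_arrays \<Longrightarrow> s' a = s a" for s s'
  proof -
    have "s' ''pin'' = s ''pin''" "s' ''pout'' = s ''pout''" by (rule that(2), simp add: adj_arrays_def)+
    then show ?thesis using that(1) by (simp add: ok_def)
  qed
  have adjt: "eval_test (arc_adjt e f) s \<longleftrightarrow> gadj G (eval_exp e s) (eval_exp f s)"
    if "ok s" "eval_exp e s \<in> ?U" "eval_exp f s \<in> ?U" for e f s
  proof -
    have p: "s ''pin'' v = ?f v" "s ''pout'' v = ?g v" if "v \<in> ?U" for v using \<open>ok s\<close> that by (auto simp: ok_def)
    have l: "s ''pin'' v < ?N" if "v \<in> ?U" for v using p(1)[OF that] at(1)[OF Un[OF that]] by simp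
    show ?thesis
      unfolding arc_adjt_simps eval_in_arc[of s f ?N e, OF l[OF that(3)]] eval_in_arc[of s e ?N f, OF l[OF that(2)]]
        p[OF that(2)] p[OF that(3)] adj_iff'[OF Un[OF that(2)] Un[OF that(3)]] ..
  qed
  have sw: "sweepable (gadj G) ?f ?U"
  proof (rule sweepable_arcs)
    show "?f v < ?N" "?g v < ?N" if "v \<in> ?U" for v using at Un[OF that] by auto
    show "gadj G u v \<longleftrightarrow> u \<noteq> v \<and> cyc_ivl ?N (?f u) (?g u) \<inter> cyc_ivl ?N (?f v) (?g v) \<noteq> {}" if "u \<in> ?U" "v \<in> ?U" for u v
      using adj_iff[OF Un[OF that(1)] Un[OF that(2)]] unfolding arc_ivl_def .
  qed
  interpret adjacency "gadj G" by (rule adjacency_gadj[OF G])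
  interpret ram_search "gadj G" arc_adjt ok ?U ?f 10
  proof unfold_locales
    show "finite ?U \<and> card ?U \<le> 10 \<or> 10 \<le> (10 :: nat) \<and> sweepable (gadj G) ?f ?U" using sw by simp
  qed (fact adjt, fact frame)
  have k0: "length ?ys = ?k" by (rule I(3))
  have k: "?k \<le> n" "3 \<le> ?k"
  proof -
    have q: "3 \<le> ?k" "distinct (fst Q)" "clique G (set (fst Q))" using Q by (auto simp: obstacle_enum_in_def Let_def)
    then have c: "card (set (fst Q)) = ?k" by (simp add: distinct_card)
    have "set (fst Q) \<subseteq> {0..<n}" using q(3) V by (simp add: clique_def)
    from card_mono[OF _ this] show "?k \<le> n" using c by simp
  qed (use Q in \<open>auto simp: obstacle_enum_in_def Let_def\<close>)
  have nl: "\<not> listed (gadj G) ?U"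
  proof -
    have N0: "0 < ?N" using k len by simp
    \<comment> \<open>\<open>gap_family\<close> speaks about a set for every argument; outside the
      graph the default interval \<open>{0}\<close> is used.\<close>
    let ?F = "\<lambda>v. if v < n then ?f v else 0" and ?H = "\<lambda>v. if v < n then ?g v else 0"
    have gf: "gap_family (\<lambda>v. cyc_ivl ?N (?F v) (?H v)) {..<?N}" by (rule cyc_ivl_gap_family) (use at N0 in auto)
    show ?thesis
    proof (rule gap_family.no_listed[OF gf])
      show "gadj G u v \<longleftrightarrow> gap_family.meet (\<lambda>v. cyc_ivl ?N (?F v) (?H v)) u v" if "u \<in> ?U" "v \<in> ?U" "u \<noteq> v" for u v
        unfolding gap_family.meet_def[OF gf] using adj_iff[OF Un[OF that(1)] Un[OF that(2)]] Un that by (simp add: arc_ivl_def)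
      show "\<not> gadj G u u" for u by (rule adj_irrefl)
    qed
  qed
  have in_s: "?s ''hd'' 0 = 0" "?s ''k'' 0 = length ?ys" "?s ''lid'' = (\<lambda>_. 0)" "?s ''n'' 0 = n" "?s ''out_kind'' 0 = 0"
    "?s ''arc'' = array (map fst xs)" "?s ''enters'' = array (map (\<lambda>x. if snd x then 1 else 0) xs)"
    using k0 by (simp_all add: model_input_def enum_input_def array_def)
  have input: "?ys ! p = (?s ''q'' p, ?s ''w0'' p, if ?s ''wlen'' p < 2 then ?s ''w0'' p else ?s ''w1'' p)"
    if "p < length ?ys" for p
    unfolding model_input_def by (rule enum_input_items[OF Q, of p, unfolded Let_def]) (use that k0 in simp)
  let ?T3 = "shrink_cost * ?k * (min 10 (2 * ?k) + 1) + 6 * n + 9 * card ?U + cost (brute arc_adjt 12) + 7"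
  let ?T2 = "7 * ?N + 4 + ?T3"
  have "ends model_program ?s (11 * ?k + 4 + ?T2) (answered (gadj G) ?U)"
    unfolding model_program_def
  proof (rule ends_Seq[OF ends_prepare[OF in_s(1-3) input]])
    fix s1 assume s1: "items s1 = ?ys \<and> s1 ''c'' 0 = 3 * length ?ys + 1 \<and> ids_ok (s1 ''lid'') (s1 ''c'' 0) ?U"
      and f1: "\<And>a. a \<notin> writes prepare \<Longrightarrow> s1 a = ?s a"
    have e1: "s1 ''n'' = ?s ''n''" "s1 ''arc'' = ?s ''arc''" "s1 ''enters'' = ?s ''enters''" "s1 ''out_kind'' = ?s ''out_kind''"
      by (rule f1, simp add: prepare_def prepare_step_def)+
    have S: "?N = 2 * s1 ''n'' 0" "\<And>p. p < ?N \<Longrightarrow> s1 ''arc'' p = fst (xs ! p)"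
      "\<And>p. p < ?N \<Longrightarrow> 0 < s1 ''enters'' p \<longleftrightarrow> snd (xs ! p)"
      unfolding e1 in_s by (simp_all add: len array_def)
    show "ends (Seq scan (solve arc_adjt)) s1 ?T2 (answered (gadj G) ?U)"
    proof (rule ends_Seq[OF ends_scan[of xs s1, OF S d]])
      fix s2 assume s2: "order s2 = map fst (filter snd xs) \<and> s2 ''el'' 0 = length (filter snd xs) \<and> s2 ''mx'' 0 = 10 \<and>
          (\<forall>p<?N. s2 (if snd (xs ! p) then ''pin'' else ''pout'') (fst (xs ! p)) = p)"
        and f2: "\<And>a. a \<notin> writes scan \<Longrightarrow> s2 a = s1 a"
      have e2: "s2 ''out_kind'' = ?s ''out_kind''" "s2 ''q'' = s1 ''q''" "s2 ''w0'' = s1 ''w0''" "s2 ''w1'' = s1 ''w1''"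
        "s2 ''hd'' = s1 ''hd''" "s2 ''tl'' = s1 ''tl''"
        using e1 by (simp_all add: f2 scan_def)
      have it: "items s2 = ?ys" using s1 by (simp add: block_def e2)
      have "s2 ''pin'' v = ?f v \<and> s2 ''pout'' v = ?g v" if "v \<in> ?U" for v
      proof -
        note a = at[OF Un[OF that]]
        have "s2 (if snd (xs ! p) then ''pin'' else ''pout'') (fst (xs ! p)) = p" if "p < ?N" for p using s2 that by blast
        from this[OF a(1)] this[OF a(3)] show ?thesis unfolding a(2,4) by simp
      qed
      then have "ok s2" unfolding ok_def by blast
      moreover have "wits ?ys \<subseteq> set (order s2)"
      proof
        fix v assume "v \<in> wits ?ys"
        then have "v < n" using Un by blast
        then have "(v, True) \<in> set xs" unfolding sx by simp
        then show "v \<in> set (order s2)" using s2 by force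
      qed
      moreover have "sorted_wrt (\<lambda>u v. ?f u < ?f v) (order s2)" using s2 sorted_arc_start[OF d] by simp
      moreover have "s2 ''el'' 0 = n"
      proof -
        have "set (filter snd xs) = {0..<n} \<times> {True}" unfolding set_filter sx by auto
        then have "card (set (filter snd xs)) = n" by (simp add: card_cartesian_product)
        then show ?thesis using s2 distinct_card[OF distinct_filter[OF d], of snd] by simp
      qed
      moreover have "s2 ''mx'' 0 = 10" "s2 ''out_kind'' 0 = 0" using s2 e2 in_s by simp_all
      moreover have "obs (gadj G) ?ys" by (rule I(1))
      ultimately have "ends (solve arc_adjt) s2 (shrink_cost * length (items s2) * (min 10 (2 * length (items s2)) + 1) + 6 * s2 ''el'' 0
          + 9 * card ?U + cost (brute arc_adjt 12) + 7) (answered (gadj G) ?U)"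
        by (intro ends_solve) (simp_all add: it finU[unfolded finite_Un])
      then show "ends (solve arc_adjt) s2 ?T3 (answered (gadj G) ?U)" unfolding it k0 \<open>s2 ''el'' 0 = n\<close> .
    qed (assumption | rule order_refl)+
  qed (simp_all only: k0 order_refl)
  moreover have "11 * ?k + 4 + ?T2 \<le> model_constant * n"
  proof -
    \<comment> \<open>With ten successors per witness the factor of the length is at most eleven,
      whence linear time in n.\<close>
    have "?k * (min 10 (2 * ?k) + 1) \<le> n * 11" using k by (intro mult_le_mono) auto
    then have X: "shrink_cost * (?k * (min 10 (2 * ?k) + 1)) \<le> shrink_cost * (n * 11)" by (rule mult_le_mono2)
    have Z: "cost (brute arc_adjt 12) \<le> cost (brute arc_adjt 12) * n" using k by simp
    have sum: "model_constant * n = shrink_cost * (n * 11) + cost (brute arc_adjt 12) * n + 60 * n"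
      unfolding model_constant_def by (simp add: algebra_simps)
    have "11 * k + 4 + (7 * (2 * n) + 4 + (x + 6 * n + 9 * u + b + 7)) \<le> w + z + 60 * n"
      if "x \<le> w" "b \<le> z" "k \<le> n" "3 \<le> k" "u \<le> n" for x w z b k n u :: nat
      using that by simp
    from this[OF X Z k cU] show ?thesis unfolding sum len by (simp only: mult.assoc)
  qed
  ultimately show ?thesis
  proof (rule ends_weaken)
    fix s assume "answered (gadj G) ?U s"
    then show "\<exists>ys. obs (gadj G) ys \<and> ess (gadj G) ys \<and> verts_of ys \<subseteq> verts G \<and> enum_output s = enum_of ys"
      using nl I(2) unfolding answered_def listed_def by (meson subset_trans)
  qed
qed

theorem theorem8:
  "(\<exists>(P :: com) (c :: nat). \<forall>(G :: nat graph) (adj :: nat list list) (Q :: nat enumeration).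
      simple_graph G \<and> adjacency_lists G adj \<and> obstacle_enum_in G Q \<longrightarrow>
      (\<exists>t s. exec P (graph_input adj Q) t s \<and>
         t \<le> c * (card (verts G) + card (edges G)) \<and>
         (if s ''out_kind'' 0 = 0
          then essential_of_induced G (enum_output s)
          else vertices_output s \<subseteq> verts G \<and>
               is_listed_graph (induced G (vertices_output s))))) \<and>
   (\<exists>(P :: com) (c :: nat). \<forall>(G :: nat graph) (n :: nat) (A :: nat \<Rightarrow> complex set)
        (xs :: (nat \<times> bool) list) (Q :: nat enumeration).
      simple_graph G \<and> verts G = {0..<n} \<and> circular_arc_model G A \<and>
      extremes_in_order (verts G) A xs \<and> obstacle_enum_in G Q \<longrightarrow>
      (\<exists>t s. exec P (model_input n xs Q) t s \<and>
         t \<le> c * n \<and>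
         essential_of_induced G (enum_output s)))"
proof (rule conjI, goal_cases)
  case 1
  show ?case
  proof (rule exI[of _ graph_program], rule exI[of _ graph_constant], intro allI impI, elim conjE)
    fix G adj Q
    assume G: "simple_graph G" and a: "adjacency_lists G adj" and Q: "obstacle_enum_in G Q"
    obtain t s where ts: "exec graph_program (graph_input adj Q) t s" "t \<le> graph_constant * (card (verts G) + card (edges G))"
      and s: "answered (gadj G) (verts_of (items_of Q)) s"
      using graph_algorithm[OF G a Q] unfolding ends_def by blast
    have U: "verts_of (items_of Q) \<subseteq> verts G" by (rule obstacle_enum_items(2)[OF G Q])
    have "if s ''out_kind'' 0 = 0 then essential_of_induced G (enum_output s)
      else vertices_output s \<subseteq> verts G \<and> is_listed_graph (induced G (vertices_output s))"
      using s unfolding answered_def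
    proof (elim disjE conjE exE bexE)
      fix ys assume k: "s ''out_kind'' 0 = 0" and ys: "obs (gadj G) ys" "ess (gadj G) ys" "verts_of ys \<subseteq> verts_of (items_of Q)"
        and out: "enum_output s = enum_of ys"
      have "verts_of ys \<subseteq> verts G" using ys(3) U by (rule subset_trans)
      then show ?thesis using essential_enum_of[OF G ys(1,2)] k out by simp
    next
      fix S vs assume k: "s ''out_kind'' 0 = 1" and S: "S \<in> set co_shapes" "shape (gadj G) S vs"
        and vs: "set vs \<subseteq> verts_of (items_of Q)" "vertices_output s = set vs"
      have "set vs \<subseteq> verts G" using vs(1) U by (rule subset_trans)
      then show ?thesis using listed_is_listed_graph[OF G S] k vs(2) by simp
    qed
    then show "\<exists>t s. exec graph_program (graph_input adj Q) t s \<and> t \<le> graph_constant * (card (verts G) + card (edges G)) \<and>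
      (if s ''out_kind'' 0 = 0 then essential_of_induced G (enum_output s)
       else vertices_output s \<subseteq> verts G \<and> is_listed_graph (induced G (vertices_output s)))"
      using ts by blast
  qed
next
  case 2
  show ?case
  proof (rule exI[of _ model_program], rule exI[of _ model_constant], intro allI impI, elim conjE)
    fix G :: "nat graph" and n A xs and Q :: "nat enumeration"
    assume M: "simple_graph G" "verts G = {0..<n}" "circular_arc_model G A" "extremes_in_order (verts G) A xs" "obstacle_enum_in G Q"
    obtain t s ys where ts: "exec model_program (model_input n xs Q) t s" "t \<le> model_constant * n"
      and ys: "obs (gadj G) ys" "ess (gadj G) ys" "verts_of ys \<subseteq> verts G" "enum_output s = enum_of ys"
      using model_algorithm[OF M] unfolding ends_def by blast
    have "essential_of_induced G (enum_output s)"
      unfolding ys(4) by (rule essential_enum_of[OF M(1) ys(1-3)])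
    then show "\<exists>t s. exec model_program (model_input n xs Q) t s \<and> t \<le> model_constant * n \<and> essential_of_induced G (enum_output s)"
      using ts by blast
  qed
qed

end
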